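(* Let $D$ be a rank 2 distribution with small growth vector $(2,3,5)$ on a 5-dimensional manifold $M$ and let $(X_1,X_2)$ be a local basis of $D$. Then for any $q\in M$ (in the domain of the basis) the restriction of the density $A=A_{X_1,X_2}$ of the fundamental form to the fiber $(D^2)^\perp(q)$ is a degree 4 homogeneous polynomial on $(D^2)^\perp(q)$.
   Context: All objects are smooth. $D^1=D$, $D^j=D^{j-1}+[D,D^{j-1}]$; the small growth vector at $q$ is $(\dim D(q),\dim D^2(q),\dots)$. $\pi:T^*M\to M$ is the projection, $\sigma=-d s$ with $s$ the tautological 1-form on $T^*M$; the Hamiltonian field $\vec G$ of a function $G$ is defined by $\sigma(\vec G,\cdot)=dG$. $(D^l)^\perp=\{(p,q)\in T^*M: p\cdot v=0\ \forall v\in D^l(q)\}$ and $(D^2)^\perp(q)=(D^2)^\perp\cap T_q^*M$ (here a 2-dimensional linear space). For $(X_1,X_2)$ put $u_1=p\cdot X_1$, $u_2=p\cdot X_2$, $u_4=p\cdot[X_1,[X_1,X_2]]$, $u_5=p\cdot[X_2,[X_1,X_2]]$. The field $\vec h=u_4\vec u_2-u_5\vec u_1$ is tangent to $(D^2)^\perp$ and spans $\ker\sigma|_{(D^2)^\perp}$ away from the zero section. $\vec e$ is the Euler field (generator of fiberwise dilations). Reduced Jacobi curve. For $\lambda\in(D^2)^\perp$ off the zero section let $\mathcal J(\lambda)=\bigl(T_\lambda(T^*_{\pi(\lambda)}M)+\ker\sigma|_{D^\perp}(\lambda)\bigr)\cap T_\lambda(D^2)^\perp$ and $W_\lambda=\bigl(\vec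 e(\lambda)^\angle\cap T_\lambda(D^2)^\perp\bigr)/\mathrm{span}(\vec h(\lambda),\vec e(\lambda))$ ($\angle$ = $\sigma$-skew-orthogonal complement), a 4-dimensional symplectic space. The parametrized reduced Jacobi curve is the curve of Lagrangian subspaces $t\mapsto \widetilde J(e^{t\vec h}\lambda)=(e^{-t\vec h})_*\mathcal J(e^{t\vec h}\lambda)/\mathrm{span}(\vec h(\lambda),\vec e(\lambda))$ in $W_\lambda$. For growth vector $(2,3,5)$ it has constant weight 4. Invariants of curves. Let $t\mapsto S_t$ be the matrix curve representing a curve $\Lambda(t)$ of half-dimensional subspaces as graphs in some coordinates. The weight of $\Lambda$ at $\tau$ is the order of zero of $t\mapsto\det(S_t-S_\tau)$ at $\tau$. If the weight is constant, equal to $k$, put $g_\Lambda(t_0,t_1)=\frac{\partial^2}{\partial t_0\partial t_1}\ln\left|\frac{\det(S_{t_0}-S_{t_1})}{(t_0-t_1)^k}\right|$, $\rho(t)=g_\Lambda(t,t)$, and define the density of the fundamental form $A(t)=\frac12\frac{\partial^2}{\partial t_0^2}g_\Lambda(t_0,t_1)\big|_{t_0=t_1=t}-\frac{3}{5k}\rho(t)^2-\frac{3}{20}\rho''(t)$. $A_{X_1,X_2}(\lambda)$ is the density at $t=0$ for the curve $t\mapsto\widetilde J(e^{t\vec h}\lambda)$. Under change of the basis $(X_1,X_2)$ it is multiplied by the 8th power of the determinant of the transition matrix (a function on $M$). The zero polynomial is regarded as homogeneous of degree 4. *)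

theory Defs
  imports "HOL-Analysis.Analysis"
begin

section \<open>Smooth maps, manifolds, distributions\<close>

text \<open>Infinite differentiability; only used on open sets.\<close>

primrec Ck_on ::
    "nat \<Rightarrow> 'a::real_normed_vector set \<Rightarrow> ('a \<Rightarrow> 'b::real_normed_vector) \<Rightarrow> bool" where
  "Ck_on 0 S f \<longleftrightarrow> continuous_on S f"
| "Ck_on (Suc k) S f \<longleftrightarrow>
     (\<forall>x\<in>S. f differentiable (at x)) \<and> (\<forall>v. Ck_on k S (\<lambda>x. frechet_derivative f (at x) v))"

definition smooth_on ::
    "'a::real_normed_vector set \<Rightarrow> ('a \<Rightarrow> 'b::real_normed_vector) \<Rightarrow> bool" where
  "smooth_on S f \<longleftrightarrow> (\<forall>k. Ck_on k S f)"

text \<open>A chart is a pair of its domain and its coordinate map. The values of the coordinate map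
  outside the domain play no role.\<close>

type_synonym ('m, 'e) chart = "'m set \<times> ('m \<Rightarrow> 'e)"

definition is_chart :: "'m topology \<Rightarrow> ('m, 'e::euclidean_space) chart \<Rightarrow> bool" where
  "is_chart T c \<longleftrightarrow>
     openin T (fst c) \<and> open (snd c ` fst c) \<and>
     homeomorphic_map (subtopology T (fst c)) (top_of_set (snd c ` fst c)) (snd c)"

definition transition ::
    "('m, 'e) chart \<Rightarrow> ('m, 'e) chart \<Rightarrow> 'e::euclidean_space \<Rightarrow> 'e" where
  "transition c c' = snd c' \<circ> inv_into (fst c) (snd c)"

text \<open>The dimension of the manifold is the dimension of the model space \<^typ>\<open>'e\<close>.\<close>

definition smooth_manifold ::
    "'m topology \<Rightarrow> ('m, 'e::euclidean_space) chart set \<Rightarrow> bool" where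
  "smooth_manifold T \<A> \<longleftrightarrow>
     Hausdorff_space T \<and> second_countable T \<and>
     (\<forall>c\<in>\<A>. is_chart T c) \<and> topspace T = (\<Union>c\<in>\<A>. fst c) \<and>
     (\<forall>c\<in>\<A>. \<forall>c'\<in>\<A>. smooth_on (snd c ` (fst c \<inter> fst c')) (transition c c'))"

text \<open>Vector fields and distributions are given by their local representatives: \<open>X c\<close> and \<open>D c\<close>
  are defined on the image of the chart \<open>c\<close>, and the representatives in two charts are related by
  the derivative of the transition map.\<close>

definition vector_field_on ::
    "'m topology \<Rightarrow> ('m, 'e::euclidean_space) chart set \<Rightarrow> 'm set \<Rightarrow>
     (('m, 'e) chart \<Rightarrow> 'e \<Rightarrow> 'e) \<Rightarrow> bool" where
  "vector_field_on T \<A> U X \<longleftrightarrow>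
     openin T U \<and>
     (\<forall>c\<in>\<A>. smooth_on (snd c ` (fst c \<inter> U)) (X c)) \<and>
     (\<forall>c\<in>\<A>. \<forall>c'\<in>\<A>. \<forall>y \<in> snd c ` (fst c \<inter> fst c' \<inter> U).
        X c' (transition c c' y) = frechet_derivative (transition c c') (at y) (X c y))"

definition distribution ::
    "('m, 'e::euclidean_space) chart set \<Rightarrow> nat \<Rightarrow> (('m, 'e) chart \<Rightarrow> 'e \<Rightarrow> 'e set) \<Rightarrow> bool" where
  "distribution \<A> r D \<longleftrightarrow>
     (\<forall>c\<in>\<A>. \<forall>y \<in> snd c ` fst c.
        subspace (D c y) \<and> dim (D c y) = r \<and>
        (\<exists>V Y. open V \<and> y \<in> V \<and> V \<subseteq> snd c ` fst c \<and> (\<forall>i<r. smooth_on V (Y i)) \<and>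
               (\<forall>z\<in>V. D c z = span ((\<lambda>i. Y i z) ` {..<r})))) \<and>
     (\<forall>c\<in>\<A>. \<forall>c'\<in>\<A>. \<forall>y \<in> snd c ` (fst c \<inter> fst c').
        D c' (transition c c' y) = frechet_derivative (transition c c') (at y) ` D c y)"

text \<open>As a rank 2 distribution has two-dimensional fibres, two spanning fields form a basis.\<close>

definition local_basis2 ::
    "'m topology \<Rightarrow> ('m, 'e::euclidean_space) chart set \<Rightarrow> (('m, 'e) chart \<Rightarrow> 'e \<Rightarrow> 'e set) \<Rightarrow>
     'm set \<Rightarrow> (('m, 'e) chart \<Rightarrow> 'e \<Rightarrow> 'e) \<Rightarrow> (('m, 'e) chart \<Rightarrow> 'e \<Rightarrow> 'e) \<Rightarrow> bool" where
  "local_basis2 T \<A> D U X1 X2 \<longleftrightarrow>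
     vector_field_on T \<A> U X1 \<and> vector_field_on T \<A> U X2 \<and>
     (\<forall>c\<in>\<A>. \<forall>y \<in> snd c ` (fst c \<inter> U). D c y = span {X1 c y, X2 c y})"

definition lie_bracket :: "('e::real_normed_vector \<Rightarrow> 'e) \<Rightarrow> ('e \<Rightarrow> 'e) \<Rightarrow> 'e \<Rightarrow> 'e" where
  "lie_bracket X Y x = frechet_derivative Y (at x) (X x) - frechet_derivative X (at x) (Y x)"

definition section_on ::
    "'e::real_normed_vector set \<Rightarrow> ('e \<Rightarrow> 'e set) \<Rightarrow> ('e \<Rightarrow> 'e) \<Rightarrow> bool" where
  "section_on V D X \<longleftrightarrow> open V \<and> smooth_on V X \<and> (\<forall>x\<in>V. X x \<in> D x)"

text \<open>The powers \<open>D\<^sup>1 = D\<close>, \<open>D\<^sup>j = D\<^sup>j\<^sup>-\<^sup>1 + [D, D\<^sup>j\<^sup>-\<^sup>1]\<close>, with brackets of germs of smooth sections;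
  the value at 0 is only a convention.\<close>

fun dist_power :: "('e::euclidean_space \<Rightarrow> 'e set) \<Rightarrow> nat \<Rightarrow> 'e \<Rightarrow> 'e set" where
  "dist_power D 0 = (\<lambda>x. {0})"
| "dist_power D (Suc 0) = D"
| "dist_power D (Suc (Suc j)) =
     (\<lambda>x. span (dist_power D (Suc j) x \<union>
       {lie_bracket X Y x | X Y. \<exists>V. x \<in> V \<and> section_on V D X \<and>
                                     section_on V (dist_power D (Suc j)) Y}))"

definition has_small_growth_vector ::
    "('e::euclidean_space \<Rightarrow> 'e set) \<Rightarrow> 'e \<Rightarrow> nat list \<Rightarrow> bool" where
  "has_small_growth_vector D x ns \<longleftrightarrow>
     (\<forall>j<length ns. dim (dist_power D (Suc j) x) = ns ! j)"


section \<open>Symplectic geometry of the cotangent bundle in canonical coordinates\<close>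

text \<open>A chart with image \<open>\<Omega>\<close> identifies the cotangent bundle over its domain with
  \<open>\<Omega> \<times> UNIV\<close>, points being \<open>\<xi> = (x, p)\<close>, and \<open>p \<bullet> v\<close> is the pairing of covectors and vectors.
  The tautological form at \<open>(x, p)\<close> sends \<open>(a, \<alpha>)\<close> to \<open>p \<bullet> a\<close>; \<open>\<sigma>\<close> is minus its differential.\<close>

definition \<sigma> :: "'e::euclidean_space \<times> 'e \<Rightarrow> 'e \<times> 'e \<Rightarrow> real" where
  "\<sigma> v w = fst v \<bullet> snd w - snd v \<bullet> fst w"

definition hamiltonian_field ::
    "('e::euclidean_space \<times> 'e \<Rightarrow> real) \<Rightarrow> 'e \<times> 'e \<Rightarrow> 'e \<times> 'e" where
  "hamiltonian_field G \<xi> = (THE v. \<forall>w. \<sigma> v w = frechet_derivative G (at \<xi>) w)"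

definition lift_function :: "('e::euclidean_space \<Rightarrow> 'e) \<Rightarrow> 'e \<times> 'e \<Rightarrow> real" where
  "lift_function X \<xi> = snd \<xi> \<bullet> X (fst \<xi>)"

definition h_field ::
    "('e::euclidean_space \<Rightarrow> 'e) \<Rightarrow> ('e \<Rightarrow> 'e) \<Rightarrow> 'e \<times> 'e \<Rightarrow> 'e \<times> 'e" where
  "h_field X1 X2 \<xi> =
     (let u1 = lift_function X1; u2 = lift_function X2;
          u4 = lift_function (lie_bracket X1 (lie_bracket X1 X2));
          u5 = lift_function (lie_bracket X2 (lie_bracket X1 X2))
      in u4 \<xi> *\<^sub>R hamiltonian_field u2 \<xi> - u5 \<xi> *\<^sub>R hamiltonian_field u1 \<xi>)"

definition euler_field :: "'e::euclidean_space \<times> 'e \<Rightarrow> 'e \<times> 'e" where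
  "euler_field \<xi> = (0, snd \<xi>)"

definition annihilator_at :: "('e::euclidean_space \<Rightarrow> 'e set) \<Rightarrow> 'e \<Rightarrow> 'e set" where
  "annihilator_at E x = {p. \<forall>v\<in>E x. p \<bullet> v = 0}"

definition annihilator ::
    "'e::euclidean_space set \<Rightarrow> ('e \<Rightarrow> 'e set) \<Rightarrow> ('e \<times> 'e) set" where
  "annihilator \<Omega> E = {(x, p). x \<in> \<Omega> \<and> p \<in> annihilator_at E x}"

text \<open>Tangent space of an embedded submanifold, as the set of velocities of smooth curves in it.\<close>

definition tangent_space :: "'a::real_normed_vector set \<Rightarrow> 'a \<Rightarrow> 'a set" where
  "tangent_space N \<xi> =
     {v. \<exists>\<gamma> \<epsilon>. 0 < \<epsilon> \<and> smooth_on {-\<epsilon><..<\<epsilon>} \<gamma> \<and> \<gamma> ` {-\<epsilon><..<\<epsilon>} \<subseteq> N \<and>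
               \<gamma> 0 = \<xi> \<and> (\<gamma> has_vector_derivative v) (at (0::real))}"

definition kernel_restricted ::
    "('e::euclidean_space \<times> 'e) set \<Rightarrow> 'e \<times> 'e \<Rightarrow> ('e \<times> 'e) set" where
  "kernel_restricted N \<xi> = {v \<in> tangent_space N \<xi>. \<forall>w \<in> tangent_space N \<xi>. \<sigma> v w = 0}"

definition vertical_space :: "('e::euclidean_space \<times> 'e) set" where
  "vertical_space = {v. fst v = 0}"

definition jacobi_space ::
    "'e::euclidean_space set \<Rightarrow> ('e \<Rightarrow> 'e set) \<Rightarrow> 'e \<times> 'e \<Rightarrow> ('e \<times> 'e) set" where
  "jacobi_space \<Omega> D \<xi> =
     {v + w | v w. v \<in> vertical_space \<and> w \<in> kernel_restricted (annihilator \<Omega> D) \<xi>}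
     \<inter> tangent_space (annihilator \<Omega> (dist_power D 2)) \<xi>"

text \<open>Time \<open>t\<close> value of the integral curve in the open set \<open>V\<close> starting at \<open>x\<close>; meaningful only
  when this curve exists up to time \<open>t\<close>.\<close>

definition flow :: "'a::real_normed_vector set \<Rightarrow> ('a \<Rightarrow> 'a) \<Rightarrow> real \<Rightarrow> 'a \<Rightarrow> 'a" where
  "flow V X t x =
     (THE y. \<exists>\<gamma>. \<gamma> 0 = x \<and> \<gamma> t = y \<and>
        (\<forall>s \<in> closed_segment 0 t. \<gamma> s \<in> V \<and>
           (\<gamma> has_vector_derivative X (\<gamma> s)) (at s within closed_segment 0 t)))"

text \<open>The subspaces \<open>(e\<^sup>-\<^sup>t\<^sup>h)\<^sub>* \<J>(e\<^sup>t\<^sup>h \<xi>)\<close> before passing to the quotient.\<close>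

definition jacobi_curve ::
    "'e::euclidean_space set \<Rightarrow> ('e \<Rightarrow> 'e set) \<Rightarrow> ('e \<Rightarrow> 'e) \<Rightarrow> ('e \<Rightarrow> 'e) \<Rightarrow> 'e \<times> 'e \<Rightarrow>
     real \<Rightarrow> ('e \<times> 'e) set" where
  "jacobi_curve \<Omega> D X1 X2 \<xi> t =
     (let \<phi> = flow (\<Omega> \<times> UNIV) (h_field X1 X2); \<mu> = \<phi> t \<xi>
      in frechet_derivative (\<phi> (- t)) (at \<mu>) ` jacobi_space \<Omega> D \<mu>)"

text \<open>The reduced space is \<open>W\<^sub>\<xi> = W_numerator / W_denominator\<close>.\<close>

definition W_numerator ::
    "'e::euclidean_space set \<Rightarrow> ('e \<Rightarrow> 'e set) \<Rightarrow> 'e \<times> 'e \<Rightarrow> ('e \<times> 'e) set" where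
  "W_numerator \<Omega> D \<xi> =
     {w. \<sigma> (euler_field \<xi>) w = 0} \<inter> tangent_space (annihilator \<Omega> (dist_power D 2)) \<xi>"

definition W_denominator ::
    "('e::euclidean_space \<Rightarrow> 'e) \<Rightarrow> ('e \<Rightarrow> 'e) \<Rightarrow> 'e \<times> 'e \<Rightarrow> ('e \<times> 'e) set" where
  "W_denominator X1 X2 \<xi> = span {h_field X1 X2 \<xi>, euler_field \<xi>}"


section \<open>Invariants of curves of half-dimensional subspaces\<close>

text \<open>Linear coordinates on a quotient \<open>E / K\<close> (split into two halves) are the same as linear
  maps on \<open>E\<close> onto the coordinate space with kernel \<open>K\<close>; we let them be defined on the ambient
  space, their values outside \<open>E\<close> being irrelevant. The image of \<open>\<Lambda> / K\<close> under the coordinates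
  is the image of \<open>\<Lambda>\<close>.\<close>

definition quotient_coordinates ::
    "'a::real_vector set \<Rightarrow> 'a set \<Rightarrow> ('a \<Rightarrow> (real^'n) \<times> (real^'n)) \<Rightarrow> bool" where
  "quotient_coordinates E K L \<longleftrightarrow> linear L \<and> L ` E = UNIV \<and> {v \<in> E. L v = 0} = K"

definition graph_of :: "real^'n^'n \<Rightarrow> ((real^'n) \<times> (real^'n)) set" where
  "graph_of S = {(x, S *v x) | x. True}"

definition zero_of_order :: "(real \<Rightarrow> real) \<Rightarrow> real \<Rightarrow> nat \<Rightarrow> bool" where
  "zero_of_order f \<tau> k \<longleftrightarrow> (\<exists>a. a \<noteq> 0 \<and> ((\<lambda>t. f t / (t - \<tau>) ^ k) \<longlongrightarrow> a) (at \<tau>))"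

definition has_weight :: "(real \<Rightarrow> real^'n^'n) \<Rightarrow> real \<Rightarrow> nat \<Rightarrow> bool" where
  "has_weight S \<tau> k \<longleftrightarrow> zero_of_order (\<lambda>t. det (S t - S \<tau>)) \<tau> k"

text \<open>The quotient \<open>det (S t0 - S t1) / (t0 - t1)\<^sup>k\<close>, extended to the diagonal by continuity.\<close>

definition det_quotient :: "nat \<Rightarrow> (real \<Rightarrow> real^'n^'n) \<Rightarrow> real \<Rightarrow> real \<Rightarrow> real" where
  "det_quotient k S t0 t1 =
     (if t0 \<noteq> t1 then det (S t0 - S t1) / (t0 - t1) ^ k
      else Lim (at t1) (\<lambda>t. det (S t - S t1) / (t - t1) ^ k))"

definition g_curve :: "nat \<Rightarrow> (real \<Rightarrow> real^'n^'n) \<Rightarrow> real \<Rightarrow> real \<Rightarrow> real" where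
  "g_curve k S t0 t1 = deriv (\<lambda>x. deriv (\<lambda>y. ln \<bar>det_quotient k S x y\<bar>) t1) t0"

definition rho_curve :: "nat \<Rightarrow> (real \<Rightarrow> real^'n^'n) \<Rightarrow> real \<Rightarrow> real" where
  "rho_curve k S t = g_curve k S t t"

definition density_of_curve :: "nat \<Rightarrow> (real \<Rightarrow> real^'n^'n) \<Rightarrow> real \<Rightarrow> real" where
  "density_of_curve k S t =
     1 / 2 * (deriv ^^ 2) (\<lambda>t0. g_curve k S t0 t) t
     - 3 / (5 * real k) * (rho_curve k S t)\<^sup>2
     - 3 / 20 * (deriv ^^ 2) (rho_curve k S) t"

text \<open>The density of the fundamental form of the reduced Jacobi curve at time 0, computed from any
  matrix curve representing it near time 0. As the reduced space is four-dimensional, the matrices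
  are \<open>2 \<times> 2\<close>.\<close>

definition fundamental_density ::
    "'e::euclidean_space set \<Rightarrow> ('e \<Rightarrow> 'e set) \<Rightarrow> ('e \<Rightarrow> 'e) \<Rightarrow> ('e \<Rightarrow> 'e) \<Rightarrow> 'e \<times> 'e \<Rightarrow> real"
  where
  "fundamental_density \<Omega> D X1 X2 \<xi> =
     (THE a. \<exists>(L :: 'e \<times> 'e \<Rightarrow> (real^2) \<times> (real^2)) S k.
        quotient_coordinates (W_numerator \<Omega> D \<xi>) (W_denominator X1 X2 \<xi>) L \<and>
        (\<forall>\<^sub>F t in nhds 0. L ` jacobi_curve \<Omega> D X1 X2 \<xi> t = graph_of (S t)) \<and>
        (\<forall>\<^sub>F \<tau> in nhds 0. has_weight S \<tau> k) \<and>
        a = density_of_curve k S 0)"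


section \<open>Homogeneous polynomials on a linear subspace\<close>

text \<open>Homogeneity of degree \<open>d\<close> of each monomial is imposed, so the zero function qualifies for
  every \<open>d\<close>.\<close>

definition homogeneous_polynomial_on ::
    "'a::euclidean_space set \<Rightarrow> nat \<Rightarrow> ('a \<Rightarrow> real) \<Rightarrow> bool" where
  "homogeneous_polynomial_on F d f \<longleftrightarrow>
     (\<exists>B coef. independent B \<and> span B = F \<and>
        (\<forall>p\<in>F. f p = (\<Sum>\<alpha> | \<alpha> \<in> B \<rightarrow>\<^sub>E {..d} \<and> sum \<alpha> B = d.
                           coef \<alpha> * (\<Prod>b\<in>B. representation B p b ^ \<alpha> b))))"

end

theory Submission
  imports Defs "HOL-Computational_Algebra.Polynomial"
begin

text \<open>On \<open>(D\<^sup>2)\<^sup>\<bottom>\<close>, where \<open>u\<^sub>5 \<noteq> 0\<close>, let \<open>E\<^sub>0\<close> be the vertical field given by the covector dual to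
  \<open>[X\<^sub>1, [X\<^sub>1, X\<^sub>2]]\<close> in the frame generated by \<open>X\<^sub>1\<close> and \<open>X\<^sub>2\<close>, and put \<open>E\<^sub>k\<^sub>+\<^sub>1 = [h, E\<^sub>k]\<close>. Modulo \<open>h\<close> and the
  Euler field, \<open>E\<^sub>0, \<dots>, E\<^sub>3\<close> is a basis of the reduced space and the reduced Jacobi curve is spanned by
  \<open>v(t) = (e\<^sup>-\<^sup>t\<^sup>h)\<^sub>* E\<^sub>0\<close> and \<open>v'(t)\<close>, so that \<open>v\<^sup>(\<^sup>k\<^sup>)(0) = E\<^sub>k\<close>. The density depends only on the coefficients
  of the \<open>E\<^sub>k\<close> in this basis, which are rational on the fibre with a power of \<open>u\<^sub>5\<close> as denominator.
  Since \<open>h\<close> is homogeneous, dilating the fibre by \<open>s\<close> rescales the time of the curve by \<open>s\<close>, and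
  the density, having four derivatives, is homogeneous of degree 4. Hence it equals
  \<open>u\<^sub>5\<^sup>4 P(u\<^sub>4 / u\<^sub>5)\<close> for some polynomial \<open>P\<close>. Exchanging \<open>X\<^sub>1\<close> and \<open>X\<^sub>2\<close> leaves \<open>h\<close> unchanged and
  exchanges \<open>u\<^sub>4\<close> and \<open>u\<^sub>5\<close> up to sign, so the density is also \<open>u\<^sub>4\<^sup>4 Q(u\<^sub>5 / u\<^sub>4)\<close>, which bounds the degree
  of \<open>P\<close> by 4.\<close>

section \<open>Calculus of smooth maps\<close>

text \<open>The density is defined through flows, a definite description over all coordinates,
  matrix curves and weights, and iterated derivatives. The proof avoids smooth dependence of all
  this on the covector: each point of the fibre is treated separately, and different points are
  compared only through the values at time 0 of derivatives, which are brackets. The choice of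
  \<open>E_0, ..., E_3\<close> as basis is a normalisation. In it \<open>v(0), ..., v'''(0)\<close>
  are the standard basis vectors, so the reduced determinant has the constant value 1/12 at the
  origin, and the division hidden in the derivative of its logarithm creates no denominators. Under
  dilation by \<open>s\<close> the coordinate of \<open>E_k\<close> along \<open>E_j\<close> has
  degree \<open>k - j\<close>. These degrees cancel in every term of a determinant, so the degree 4
  of the density comes from its four derivatives alone. On the line \<open>u_5 = 0\<close> the basis
  degenerates; this is the obstacle that makes two expressions, one for each order of the fields,
  necessary.\<close>

lemma Ck_on_cong:
  assumes "open S" "\<And>x. x \<in> S \<Longrightarrow> f x = g x" "Ck_on k S f"
  shows "Ck_on k S g"
  using assms(2,3)
proof (induction k arbitrary: f g)
  case 0
  then show ?case by (simp cong: continuous_on_cong)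
next
  case (Suc k)
  have d: "g differentiable (at x)" if "x \<in> S" for x
    using Suc.prems that \<open>open S\<close>
    by (metis Ck_on.simps(2) differentiable_def has_derivative_transform_within_open)
  have e: "frechet_derivative f (at x) v = frechet_derivative g (at x) v" if "x \<in> S" for x v
    by (metis Ck_on.simps(2) Suc.prems(1) Suc.prems(2) assms(1) frechet_derivative_transform_within_open that)
  have "Ck_on k S (\<lambda>x. frechet_derivative g (at x) v)" for v
    by (rule Suc.IH[of "\<lambda>x. frechet_derivative f (at x) v"]) (use e Suc.prems in auto)
  then show ?case using d by simp
qed

text \<open>Admits any formula for the derivative in place of the chosen
  \<open>frechet_derivative\<close>; the closure properties below are inductions on the order that
  go through it.\<close>

lemma Ck_onI:
  assumes "open S" "\<And>x. x \<in> S \<Longrightarrow> (f has_derivative f' x) (at x)" "\<And>v. Ck_on k S (\<lambda>x. f' x v)"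
  shows "Ck_on (Suc k) S f"
proof -
  have "frechet_derivative f (at x) v = f' x v" if "x \<in> S" for x v
    using assms(2)[OF that] frechet_derivative_at by metis
  moreover have "f differentiable (at x)" if "x \<in> S" for x
    using assms(2)[OF that] differentiable_def by blast
  ultimately show ?thesis
    using Ck_on_cong[OF assms(1) _ assms(3)] by simp
qed

lemma Ck_on_continuous: "Ck_on k S f \<Longrightarrow> continuous_on S f"
  by (cases k) (auto intro!: continuous_at_imp_continuous_on differentiable_imp_continuous_within)

lemma Ck_on_SucD: "Ck_on (Suc k) S f \<Longrightarrow> Ck_on k S f"
proof (induction k arbitrary: f)
  case 0
  then show ?case using Ck_on_continuous by fastforce
next
  case (Suc k)
  show ?case
    unfolding Ck_on.simps
    using Suc.prems Suc.IH by (metis Ck_on.simps(2))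
qed

lemma Ck_on_subset: "Ck_on k S f \<Longrightarrow> T \<subseteq> S \<Longrightarrow> Ck_on k T f"
  by (induction k arbitrary: f) (auto intro: continuous_on_subset)

lemma Ck_on_has_derivative:
  "Ck_on (Suc k) S f \<Longrightarrow> x \<in> S \<Longrightarrow> (f has_derivative frechet_derivative f (at x)) (at x)"
  by (simp add: frechet_derivative_works)

lemma Ck_on_const: "open S \<Longrightarrow> Ck_on k S (\<lambda>x. c)"
proof (induction k arbitrary: c)
  case (Suc k)
  show ?case by (rule Ck_onI[where f'="\<lambda>x v. 0"]) (use Suc in auto)
qed simp

lemma Ck_on_bounded_linear:
  assumes "bounded_linear L" "open S" "Ck_on k S f"
  shows "Ck_on k S (\<lambda>x. L (f x))"
  using assms(3)
proof (induction k arbitrary: f)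
  case 0
  then show ?case
    using linear_continuous_on[OF assms(1), of UNIV] by (auto intro: continuous_on_compose2)
next
  case (Suc k)
  show ?case
  proof (rule Ck_onI[OF \<open>open S\<close>])
    fix x assume "x \<in> S"
    show "((\<lambda>x. L (f x)) has_derivative (\<lambda>v. L (frechet_derivative f (at x) v))) (at x)"
      using bounded_linear.has_derivative[OF assms(1) Ck_on_has_derivative[OF Suc.prems \<open>x \<in> S\<close>]] .
  next
    show "Ck_on k S (\<lambda>x. L (frechet_derivative f (at x) v))" for v
      using Suc by auto
  qed
qed

lemma Ck_on_add:
  assumes "open S" "Ck_on k S f" "Ck_on k S g"
  shows "Ck_on k S (\<lambda>x. f x + g x)"
  using assms(2,3)
proof (induction k arbitrary: f g)
  case 0
  then show ?case by (auto intro: continuous_intros)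
next
  case (Suc k)
  show ?case
    by (rule Ck_onI[OF \<open>open S\<close>,
          where f'="\<lambda>x v. frechet_derivative f (at x) v + frechet_derivative g (at x) v"])
       (use Suc in \<open>auto intro!: has_derivative_add Ck_on_has_derivative[OF Suc.prems(1)]
           Ck_on_has_derivative[OF Suc.prems(2)]\<close>)
qed

lemma Ck_on_bilinear:
  assumes "bounded_bilinear prd" "open S" "Ck_on k S f" "Ck_on k S g"
  shows "Ck_on k S (\<lambda>x. prd (f x) (g x))"
  using assms(3,4)
proof (induction k arbitrary: f g)
  case 0
  then show ?case by (auto intro: bounded_bilinear.continuous_on[OF assms(1)])
next
  case (Suc k)
  show ?case
  proof (rule Ck_onI[OF \<open>open S\<close>])
    fix x assume "x \<in> S"
    show "((\<lambda>x. prd (f x) (g x)) has_derivative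
           (\<lambda>v. prd (f x) (frechet_derivative g (at x) v) + prd (frechet_derivative f (at x) v) (g x))) (at x)"
      by (rule bounded_bilinear.FDERIV[OF assms(1)])
         (use Ck_on_has_derivative \<open>x \<in> S\<close> Suc.prems in blast)+
  next
    show "Ck_on k S (\<lambda>x. prd (f x) (frechet_derivative g (at x) v) + prd (frechet_derivative f (at x) v) (g x))" for v
      by (rule Ck_on_add[OF \<open>open S\<close>]; rule Suc.IH) (use Suc.prems Ck_on_SucD in auto)
  qed
qed

text \<open>The derivative of \<open>1/f\<close> contains \<open>1/f\<close> itself, one order
  lower, so the induction on \<open>k\<close> closes with \<open>f\<close> fixed.\<close>

lemma Ck_on_inverse:
  fixes f :: "'a::real_normed_vector \<Rightarrow> real"
  assumes "open S" "\<And>x. x \<in> S \<Longrightarrow> f x \<noteq> 0" "Ck_on k S f"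
  shows "Ck_on k S (\<lambda>x. inverse (f x))"
  using assms(3)
proof (induction k)
  case 0
  then show ?case using assms(2) by (auto intro: continuous_intros)
next
  case (Suc k)
  show ?case
  proof (rule Ck_onI[OF \<open>open S\<close>])
    fix x assume "x \<in> S"
    show "((\<lambda>x. inverse (f x)) has_derivative
           (\<lambda>v. - (inverse (f x) * frechet_derivative f (at x) v * inverse (f x)))) (at x)"
      by (rule Deriv.has_derivative_inverse) (use Ck_on_has_derivative \<open>x \<in> S\<close> Suc.prems assms(2) in blast)+
  next
    show "Ck_on k S (\<lambda>x. - (inverse (f x) * frechet_derivative f (at x) v * inverse (f x)))" for v
      by (intro Ck_on_bounded_linear[OF bounded_linear_minus[OF bounded_linear_ident]]
            Ck_on_bilinear[OF bounded_bilinear_mult] \<open>open S\<close> Suc.IH)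
         (use Suc.prems Ck_on_SucD in auto)
  qed
qed

lemma smooth_on_cong: "open S \<Longrightarrow> (\<And>x. x \<in> S \<Longrightarrow> f x = g x) \<Longrightarrow> smooth_on S f \<Longrightarrow> smooth_on S g"
  unfolding smooth_on_def using Ck_on_cong by blast

lemma smooth_on_const: "open S \<Longrightarrow> smooth_on S (\<lambda>x. c)"
  unfolding smooth_on_def using Ck_on_const by blast

lemma smooth_on_bounded_linear:
  "bounded_linear L \<Longrightarrow> open S \<Longrightarrow> smooth_on S f \<Longrightarrow> smooth_on S (\<lambda>x. L (f x))"
  unfolding smooth_on_def using Ck_on_bounded_linear by blast

lemma smooth_on_add:
  "open S \<Longrightarrow> smooth_on S f \<Longrightarrow> smooth_on S g \<Longrightarrow> smooth_on S (\<lambda>x. f x + g x)"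
  unfolding smooth_on_def using Ck_on_add by blast

lemma smooth_on_bilinear:
  "bounded_bilinear prd \<Longrightarrow> open S \<Longrightarrow> smooth_on S f \<Longrightarrow> smooth_on S g \<Longrightarrow> smooth_on S (\<lambda>x. prd (f x) (g x))"
  unfolding smooth_on_def using Ck_on_bilinear by blast

lemma smooth_on_inverse:
  fixes f :: "'a::real_normed_vector \<Rightarrow> real"
  shows "open S \<Longrightarrow> (\<And>x. x \<in> S \<Longrightarrow> f x \<noteq> 0) \<Longrightarrow> smooth_on S f \<Longrightarrow> smooth_on S (\<lambda>x. inverse (f x))"
  unfolding smooth_on_def using Ck_on_inverse by blast

lemmas smooth_on_mult = smooth_on_bilinear[OF bounded_bilinear_mult]
lemmas smooth_on_scaleR = smooth_on_bilinear[OF bounded_bilinear_scaleR]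
lemmas smooth_on_inner = smooth_on_bilinear[OF bounded_bilinear_inner]
lemmas smooth_on_minus = smooth_on_bounded_linear[OF bounded_linear_minus[OF bounded_linear_ident]]

lemma smooth_on_diff:
  "open S \<Longrightarrow> smooth_on S f \<Longrightarrow> smooth_on S g \<Longrightarrow> smooth_on S (\<lambda>x. f x - g x)"
  using smooth_on_add[of S f "\<lambda>x. - g x"] smooth_on_minus[of S g] by simp

lemma smooth_on_divide:
  fixes f :: "'a::real_normed_vector \<Rightarrow> real"
  shows "open S \<Longrightarrow> (\<And>x. x \<in> S \<Longrightarrow> g x \<noteq> 0) \<Longrightarrow> smooth_on S f \<Longrightarrow> smooth_on S g \<Longrightarrow> smooth_on S (\<lambda>x. f x / g x)"
  unfolding divide_inverse by (intro smooth_on_mult smooth_on_inverse) auto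

lemma smooth_on_sum:
  "open S \<Longrightarrow> (\<And>i. i \<in> I \<Longrightarrow> smooth_on S (f i)) \<Longrightarrow> smooth_on S (\<lambda>x. \<Sum>i\<in>I. f i x)"
  by (induction I rule: infinite_finite_induct) (auto intro: smooth_on_const smooth_on_add)

lemma smooth_on_prod:
  fixes f :: "'i \<Rightarrow> 'a::real_normed_vector \<Rightarrow> real"
  shows "open S \<Longrightarrow> (\<And>i. i \<in> I \<Longrightarrow> smooth_on S (f i)) \<Longrightarrow> smooth_on S (\<lambda>x. \<Prod>i\<in>I. f i x)"
  by (induction I rule: infinite_finite_induct) (auto intro: smooth_on_const smooth_on_mult)

lemma smooth_on_subset: "smooth_on S f \<Longrightarrow> T \<subseteq> S \<Longrightarrow> smooth_on T f"
  unfolding smooth_on_def using Ck_on_subset by blast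

lemma smooth_on_has_derivative:
  "smooth_on S f \<Longrightarrow> x \<in> S \<Longrightarrow> (f has_derivative frechet_derivative f (at x)) (at x)"
  unfolding smooth_on_def using Ck_on_has_derivative by blast

lemma smooth_on_derivative_const:
  "smooth_on S f \<Longrightarrow> smooth_on S (\<lambda>x. frechet_derivative f (at x) v)"
  unfolding smooth_on_def by (metis Ck_on.simps(2))

lemma smooth_on_componentwise:
  fixes f :: "'a::real_normed_vector \<Rightarrow> 'b::euclidean_space"
  assumes "open S" "\<And>b. b \<in> Basis \<Longrightarrow> smooth_on S (\<lambda>x. f x \<bullet> b)"
  shows "smooth_on S f"
proof -
  have "smooth_on S (\<lambda>x. \<Sum>b\<in>Basis. (f x \<bullet> b) *\<^sub>R b)"
    using assms by (intro smooth_on_sum smooth_on_scaleR smooth_on_const) auto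
  then show ?thesis by (simp add: euclidean_representation)
qed

lemma frechet_derivative_basis:
  fixes f :: "'a::euclidean_space \<Rightarrow> 'b::real_normed_vector"
  assumes "(f has_derivative f') F"
  shows "f' v = (\<Sum>b\<in>Basis. (v \<bullet> b) *\<^sub>R f' b)"
proof -
  interpret bounded_linear f' using assms has_derivative_bounded_linear by blast
  show ?thesis
    by (subst (1) euclidean_representation[of v, symmetric]) (simp add: sum scaleR)
qed

text \<open>\<open>Ck_on\<close> controls derivatives in constant directions; a variable direction
  is expanded in the standard basis, which leaves finitely many constant ones.\<close>

lemma smooth_on_derivative:
  fixes f :: "'a::euclidean_space \<Rightarrow> 'b::real_normed_vector"
  assumes "open S" "smooth_on S f" "smooth_on S v"
  shows "smooth_on S (\<lambda>x. frechet_derivative f (at x) (v x))"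
proof (rule smooth_on_cong[OF \<open>open S\<close>])
  show "smooth_on S (\<lambda>x. \<Sum>b\<in>Basis. (v x \<bullet> b) *\<^sub>R frechet_derivative f (at x) b)"
    using assms by (intro smooth_on_sum smooth_on_scaleR smooth_on_inner smooth_on_const smooth_on_derivative_const)
  show "(\<Sum>b\<in>Basis. (v x \<bullet> b) *\<^sub>R frechet_derivative f (at x) b) = frechet_derivative f (at x) (v x)"
    if "x \<in> S" for x
    using frechet_derivative_basis[OF smooth_on_has_derivative[OF assms(2) that], of "v x"] by simp
qed

lemma smooth_on_lie_bracket:
  fixes X Y :: "'a::euclidean_space \<Rightarrow> 'a"
  assumes "open S" "smooth_on S X" "smooth_on S Y"
  shows "smooth_on S (lie_bracket X Y)"
  unfolding lie_bracket_def using assms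
  by (intro smooth_on_diff smooth_on_derivative)

text \<open>Supports the construction of curves in \<open>tangent_space_zero_set\<close>, where the
  coframe is evaluated along a straight line in the base.\<close>

lemma Ck_on_affine_line:
  fixes f :: "'a::real_normed_vector \<Rightarrow> 'b::real_normed_vector"
  assumes "open S" "open I" "\<And>t. t \<in> I \<Longrightarrow> x + t *\<^sub>R a \<in> S" "Ck_on k S f"
  shows "Ck_on k I (\<lambda>t::real. f (x + t *\<^sub>R a))"
  using assms(4)
proof (induction k arbitrary: f)
  case 0
  then show ?case
    by (auto intro!: continuous_on_compose2[of S f] continuous_intros assms(3))
next
  case (Suc k)
  show ?case
  proof (rule Ck_onI[OF \<open>open I\<close>])
    fix t assume "t \<in> I"
    have "((\<lambda>t. x + t *\<^sub>R a) has_derivative (\<lambda>v. v *\<^sub>R a)) (at t)"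
      by (auto intro!: derivative_eq_intros)
    from has_derivative_compose[OF this Ck_on_has_derivative[OF Suc.prems assms(3)[OF \<open>t \<in> I\<close>]]]
    have "((\<lambda>t. f (x + t *\<^sub>R a)) has_derivative
        (\<lambda>v. frechet_derivative f (at (x + t *\<^sub>R a)) (v *\<^sub>R a))) (at t)" .
    then show "((\<lambda>t. f (x + t *\<^sub>R a)) has_derivative
        (\<lambda>v. v *\<^sub>R frechet_derivative f (at (x + t *\<^sub>R a)) a)) (at t)"
      using linear_cmul[OF has_derivative_linear[OF Ck_on_has_derivative[OF Suc.prems assms(3)[OF \<open>t \<in> I\<close>]]]]
      by simp
  next
    show "Ck_on k I (\<lambda>t. v *\<^sub>R frechet_derivative f (at (x + t *\<^sub>R a)) a)" for v
      by (rule Ck_on_bounded_linear[OF bounded_linear_scaleR_right \<open>open I\<close>]) (use Suc in auto)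
  qed
qed

lemma smooth_on_affine_line:
  assumes "open S" "open I" "\<And>t. t \<in> I \<Longrightarrow> x + t *\<^sub>R a \<in> S" "smooth_on S f"
  shows "smooth_on I (\<lambda>t::real. f (x + t *\<^sub>R a))"
  using Ck_on_affine_line[OF assms(1-3)] assms(4) unfolding smooth_on_def by blast

text \<open>The second difference of \<open>f\<close> over the parallelogram with sides
  \<open>r v\<close> and \<open>r w\<close> does not see the order of the sides. Two applications of
  the mean value theorem turn it into \<open>r r\<close> times a mixed derivative at a nearby point,
  for either order, and continuity compares both with the values at \<open>x\<close>.\<close>

lemma Clairaut:
  fixes f :: "'a::real_normed_vector \<Rightarrow> real"
  assumes "open S" "x \<in> S" "Ck_on 2 S f"
  shows "frechet_derivative (\<lambda>y. frechet_derivative f (at y) v) (at x) w =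
         frechet_derivative (\<lambda>y. frechet_derivative f (at y) w) (at x) v"
proof -
  let ?D = "\<lambda>v y. frechet_derivative f (at y) v"
  let ?DD = "\<lambda>v w y. frechet_derivative (?D v) (at y) w"
  have df: "(f has_derivative frechet_derivative f (at y)) (at y)" if "y \<in> S" for y
    using assms(3) that by (simp add: numeral_2_eq_2 frechet_derivative_works)
  have ddf: "(?D v has_derivative frechet_derivative (?D v) (at y)) (at y)" if "y \<in> S" for y v
    using assms(3) that by (simp add: numeral_2_eq_2 frechet_derivative_works)
  have cont: "continuous_on S (?DD v w)" for v w
    using assms(3) by (simp add: numeral_2_eq_2)
  have line: "((\<lambda>s. g (y + s *\<^sub>R u)) has_real_derivative g' u) (at s)"
    if "(g has_derivative g') (at (y + s *\<^sub>R u))" for g :: "'a \<Rightarrow> real" and g' y u s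
  proof -
    have "((\<lambda>s. y + s *\<^sub>R u) has_derivative (\<lambda>r. r *\<^sub>R u)) (at s)"
      by (auto intro!: derivative_eq_intros)
    from has_derivative_compose[OF this that]
    have "((\<lambda>s. g (y + s *\<^sub>R u)) has_derivative (\<lambda>r. g' (r *\<^sub>R u))) (at s)" .
    moreover have "(\<lambda>r. g' (r *\<^sub>R u)) = (*) (g' u)"
      using has_derivative_bounded_linear[OF that]
      by (auto simp: linear_simps bounded_linear.linear linear_cmul)
    ultimately show ?thesis by (simp add: has_field_derivative_def)
  qed
  \<comment> \<open>The mean value theorem is applied along \<open>u\<close> to the difference of
    two parallel edges, and then along \<open>v\<close> to the derivative at the point
    found.\<close>
  have key: "\<exists>a b. \<bar>a\<bar> \<le> r \<and> \<bar>b\<bar> \<le> r \<and>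
      f (x + r *\<^sub>R u + r *\<^sub>R v) - f (x + r *\<^sub>R u) - f (x + r *\<^sub>R v) + f x = r * r * ?DD u v (x + a *\<^sub>R u + b *\<^sub>R v)"
    if r: "r > 0" and sub: "\<And>a b. \<bar>a\<bar> \<le> r \<Longrightarrow> \<bar>b\<bar> \<le> r \<Longrightarrow> x + a *\<^sub>R u + b *\<^sub>R v \<in> S" for r u v
  proof -
    let ?g = "\<lambda>s. f ((x + r *\<^sub>R v) + s *\<^sub>R u) - f (x + s *\<^sub>R u)"
    have in1: "(x + r *\<^sub>R v) + s *\<^sub>R u \<in> S" "x + s *\<^sub>R u \<in> S" if "0 \<le> s" "s \<le> r" for s
      using sub[of s r] sub[of s 0] that r by (auto simp: algebra_simps)
    have "\<exists>z>0. z < r \<and> ?g r - ?g 0 = (r - 0) * (?D u ((x + r *\<^sub>R v) + z *\<^sub>R u) - ?D u (x + z *\<^sub>R u))"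
      by (rule MVT2[OF r]) (intro DERIV_diff line df in1; simp)
    then obtain a where a: "0 < a" "a < r"
      "?g r - ?g 0 = r * (?D u ((x + r *\<^sub>R v) + a *\<^sub>R u) - ?D u (x + a *\<^sub>R u))" by auto
    let ?k = "\<lambda>s. ?D u ((x + a *\<^sub>R u) + s *\<^sub>R v)"
    have "\<exists>z>0. z < r \<and> ?k r - ?k 0 = (r - 0) * ?DD u v ((x + a *\<^sub>R u) + z *\<^sub>R v)"
      by (rule MVT2[OF r]) (rule line[OF ddf], use sub a in auto)
    then obtain b where b: "0 < b" "b < r" "?k r - ?k 0 = r * ?DD u v ((x + a *\<^sub>R u) + b *\<^sub>R v)" by auto
    have "f (x + r *\<^sub>R u + r *\<^sub>R v) - f (x + r *\<^sub>R u) - f (x + r *\<^sub>R v) + f x = ?g r - ?g 0"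
      by (simp add: algebra_simps)
    also have "\<dots> = r * (?k r - ?k 0)" using a(3) by (simp add: algebra_simps)
    finally show ?thesis using a b by (intro exI[of _ a] exI[of _ b]) (auto simp: algebra_simps)
  qed
  have "\<bar>?DD v w x - ?DD w v x\<bar> \<le> e" if e: "e > 0" for e
  proof -
    have c1: "isCont (?DD v w) x" "isCont (?DD w v) x"
      using cont assms continuous_on_eq_continuous_at by blast+
    obtain d1 where d1: "d1 > 0" "\<And>y. dist y x < d1 \<Longrightarrow> dist (?DD v w y) (?DD v w x) < e/2"
      using c1(1) e unfolding continuous_at_eps_delta by (meson half_gt_zero)
    obtain d2 where d2: "d2 > 0" "\<And>y. dist y x < d2 \<Longrightarrow> dist (?DD w v y) (?DD w v x) < e/2"
      using c1(2) e unfolding continuous_at_eps_delta by (meson half_gt_zero)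
    obtain d3 where d3: "d3 > 0" "\<And>y. dist y x < d3 \<Longrightarrow> y \<in> S"
      using assms(1,2) unfolding open_dist by blast
    define d where "d = min d1 (min d2 d3)"
    \<comment> \<open>Small enough that the whole parallelogram lies within \<open>d\<close> of
      \<open>x\<close>, whichever side comes first; the added 1 keeps the denominator positive when
      both vectors vanish.\<close>
    define r where "r = d / (2 * (norm v + norm w + 1))"
    have d: "d > 0" using d1 d2 d3 by (simp add: d_def)
    have pos: "norm v + norm w + 1 > 0" by (simp add: add_nonneg_pos)
    have r: "r > 0" using d pos by (simp add: r_def)
    have rr: "r * (norm v + norm w) < d"
    proof -
      have "r * (norm v + norm w) \<le> r * (norm v + norm w + 1)" using r by simp
      also have "\<dots> = d / 2" using pos unfolding r_def by (simp add: field_simps)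
      finally show ?thesis using d by simp
    qed
    have close: "dist (x + a *\<^sub>R u1 + b *\<^sub>R u2) x < d"
      if "\<bar>a\<bar> \<le> r" "\<bar>b\<bar> \<le> r" "norm u1 + norm u2 = norm v + norm w" for a b u1 u2
    proof -
      have "norm (a *\<^sub>R u1 + b *\<^sub>R u2) \<le> \<bar>a\<bar> * norm u1 + \<bar>b\<bar> * norm u2"
        by (metis norm_scaleR norm_triangle_ineq)
      also have "\<dots> \<le> r * norm u1 + r * norm u2"
        using that by (intro add_mono mult_right_mono) auto
      also have "\<dots> < d" using rr that by (simp add: distrib_left[symmetric])
      finally show ?thesis by (simp add: dist_norm add.assoc)
    qed
    obtain a b where 1: "\<bar>a\<bar> \<le> r" "\<bar>b\<bar> \<le> r"
      "f (x + r *\<^sub>R v + r *\<^sub>R w) - f (x + r *\<^sub>R v) - f (x + r *\<^sub>R w) + f x = r * r * ?DD v w (x + a *\<^sub>R v + b *\<^sub>R w)"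
      using key[OF r, of v w] close[of _ _ v w] d3 by (fastforce simp: d_def)
    obtain a' b' where 2: "\<bar>a'\<bar> \<le> r" "\<bar>b'\<bar> \<le> r"
      "f (x + r *\<^sub>R w + r *\<^sub>R v) - f (x + r *\<^sub>R w) - f (x + r *\<^sub>R v) + f x = r * r * ?DD w v (x + a' *\<^sub>R w + b' *\<^sub>R v)"
      using key[OF r, of w v] close[of _ _ w v] d3 by (fastforce simp: d_def)
    have "r * r * ?DD v w (x + a *\<^sub>R v + b *\<^sub>R w) = r * r * ?DD w v (x + a' *\<^sub>R w + b' *\<^sub>R v)"
      using 1(3) 2(3) by (simp add: algebra_simps)
    then have eq: "?DD v w (x + a *\<^sub>R v + b *\<^sub>R w) = ?DD w v (x + a' *\<^sub>R w + b' *\<^sub>R v)"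
      using r by simp
    have "dist (?DD v w (x + a *\<^sub>R v + b *\<^sub>R w)) (?DD v w x) < e/2"
      using close[of a b v w] 1 by (intro d1(2)) (auto simp: d_def)
    moreover have "dist (?DD w v (x + a' *\<^sub>R w + b' *\<^sub>R v)) (?DD w v x) < e/2"
      using close[of a' b' w v] 2 by (intro d2(2)) (auto simp: d_def)
    moreover have "\<bar>p - q\<bar> \<le> e" if "\<bar>p' - p\<bar> < e/2" "\<bar>q' - q\<bar> < e/2" "p' = q'" for p q p' q' :: real
      using that by linarith
    ultimately show ?thesis using eq unfolding dist_real_def by blast
  qed
  then have "\<bar>?DD v w x - ?DD w v x\<bar> \<le> 0" by (meson dense_ge)
  then show ?thesis by simp
qed

lemma smooth_on_Clairaut:
  fixes f :: "'a::real_normed_vector \<Rightarrow> real"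
  assumes "open S" "x \<in> S" "smooth_on S f"
  shows "frechet_derivative (\<lambda>y. frechet_derivative f (at y) v) (at x) w =
         frechet_derivative (\<lambda>y. frechet_derivative f (at y) w) (at x) v"
  using Clairaut assms unfolding smooth_on_def by blast

section \<open>Local flows\<close>

text \<open>The derivative is continuous direction by direction. Compactness of the ball bounds it
  in each basis direction, the sum of these bounds dominates the operator norm, and convexity of the
  ball gives the Lipschitz estimate.\<close>

lemma Ck_on_1_Lipschitz_cball:
  fixes f :: "'a::euclidean_space \<Rightarrow> 'b::real_normed_vector"
  assumes "Ck_on 1 S f" "cball c r \<subseteq> S"
  obtains L where "L \<ge> 0" "\<And>x y. x \<in> cball c r \<Longrightarrow> y \<in> cball c r \<Longrightarrow> norm (f x - f y) \<le> L * norm (x - y)"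
proof -
  have df: "(f has_derivative frechet_derivative f (at x)) (at x)" if "x \<in> cball c r" for x
    using assms that by (auto simp: frechet_derivative_works)
  have "\<exists>M. \<forall>x\<in>cball c r. norm (frechet_derivative f (at x) b) \<le> M" for b
  proof -
    have "continuous_on (cball c r) (\<lambda>x. frechet_derivative f (at x) b)"
      using assms by (auto intro: continuous_on_subset)
    then have "bounded ((\<lambda>x. frechet_derivative f (at x) b) ` cball c r)"
      by (intro compact_imp_bounded compact_continuous_image) auto
    then show ?thesis by (auto simp: bounded_iff)
  qed
  then obtain M where M: "\<And>b x. x \<in> cball c r \<Longrightarrow> norm (frechet_derivative f (at x) b) \<le> M b"
    by metis
  define L where "L = (\<Sum>b\<in>Basis. \<bar>M b\<bar>)"
  have on: "onorm (frechet_derivative f (at x)) \<le> L" if x: "x \<in> cball c r" for x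
  proof (rule onorm_le)
    fix v
    have "norm (frechet_derivative f (at x) v) \<le> (\<Sum>b\<in>Basis. \<bar>v \<bullet> b\<bar> * norm (frechet_derivative f (at x) b))"
      by (subst frechet_derivative_basis[OF df[OF x]], rule order_trans[OF norm_sum]) simp
    also have "\<dots> \<le> (\<Sum>b\<in>Basis. norm v * \<bar>M b\<bar>)"
      by (intro sum_mono mult_mono order_trans[OF M[OF x] abs_ge_self]) (auto simp: Basis_le_norm)
    finally show "norm (frechet_derivative f (at x) v) \<le> L * norm v"
      by (simp add: L_def sum_distrib_left mult.commute)
  qed
  show ?thesis
  proof
    show "L \<ge> 0" by (simp add: L_def sum_nonneg)
    show "norm (f x - f y) \<le> L * norm (x - y)" if "x \<in> cball c r" "y \<in> cball c r" for x y
      by (rule differentiable_bound[OF convex_cball _ on that])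
         (use df has_derivative_at_withinI in blast)+
  qed
qed

lemma vector_derivative_bound:
  fixes g :: "real \<Rightarrow> 'b::real_normed_vector"
  assumes "convex S" "\<And>t. t \<in> S \<Longrightarrow> (g has_vector_derivative g' t) (at t within S)"
    and "\<And>t. t \<in> S \<Longrightarrow> norm (g' t) \<le> B" "a \<in> S" "b \<in> S"
  shows "norm (g a - g b) \<le> B * \<bar>a - b\<bar>"
proof -
  have "norm (g a - g b) \<le> B * norm (a - b)"
  proof (rule differentiable_bound[OF assms(1) _ _ assms(4,5)])
    show "(g has_derivative (\<lambda>h. h *\<^sub>R g' t)) (at t within S)" if "t \<in> S" for t
      using assms(2)[OF that] by (simp add: has_vector_derivative_def)
    show "onorm (\<lambda>h. h *\<^sub>R g' t) \<le> B" if "t \<in> S" for t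
      by (rule onorm_le) (use assms(3)[OF that] in \<open>simp add: mult.commute[of B] mult_left_mono\<close>)
  qed
  then show ?thesis by simp
qed

text \<open>The starting point \<open>y\<close> ranges over the half ball:
  \<open>\<tau> M \<le> r / 2\<close> keeps every iterate in the full ball, so one time
  \<open>\<tau>\<close> serves all nearby starting points. The condition
  \<open>\<tau> L \<le> 1 / 2\<close> yields the contraction factor 1/2.\<close>

lemma Picard:
  fixes F :: "'b::banach \<Rightarrow> 'b"
  assumes Lip: "\<And>x y. x \<in> cball c r \<Longrightarrow> y \<in> cball c r \<Longrightarrow> norm (F x - F y) \<le> L * norm (x - y)"
    and M: "\<And>x. x \<in> cball c r \<Longrightarrow> norm (F x) \<le> M"
    and pos: "r > 0" "L \<ge> 0" "M \<ge> 0" "\<tau> > 0" "\<tau> * M \<le> r / 2" "\<tau> * L \<le> 1 / 2"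
    and y: "y \<in> cball c (r / 2)"
  obtains \<gamma> where "\<gamma> 0 = y" "\<And>t. t \<in> {-\<tau>..\<tau>} \<Longrightarrow> \<gamma> t \<in> cball c r"
    "\<And>t. t \<in> {-\<tau>..\<tau>} \<Longrightarrow> (\<gamma> has_vector_derivative F (\<gamma> t)) (at t within {-\<tau>..\<tau>})"
proof -
  let ?I = "{-\<tau>..\<tau>}"
  define K :: "(real \<Rightarrow>\<^sub>C 'b) set" where "K = PiC UNIV (\<lambda>_. cball c r)"
  have memK: "\<phi> \<in> K \<longleftrightarrow> (\<forall>t. apply_bcontfun \<phi> t \<in> cball c r)" for \<phi>
    by (auto simp: K_def mem_PiC_iff)
  have "complete K" unfolding K_def
    by (intro closed_PiC complete_eq_closed[THEN iffD2]) auto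
  have Fcont: "continuous_on (cball c r) F"
  proof (rule continuous_onI)
    fix x e assume x: "x \<in> cball c r" and e: "(e::real) > 0"
    show "\<exists>d>0. \<forall>x'\<in>cball c r. dist x' x < d \<longrightarrow> dist (F x') (F x) \<le> e"
    proof (intro exI conjI ballI impI)
      show "e / (L + 1) > 0" using e pos by simp
      fix x' assume x': "x' \<in> cball c r" "dist x' x < e / (L + 1)"
      have "dist (F x') (F x) \<le> L * dist x' x" using Lip[OF x'(1) x] by (simp add: dist_norm)
      also have "\<dots> \<le> (L + 1) * dist x' x" by (simp add: mult_right_mono)
      also have "\<dots> \<le> e" using x'(2) pos by (simp add: field_simps)
      finally show "dist (F x') (F x) \<le> e" .
    qed
  qed
  have "\<exists>g. \<forall>t\<in>?I. (g has_vector_derivative F (apply_bcontfun \<phi> t)) (at t within ?I)" if "\<phi> \<in> K" for \<phi>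
  proof -
    have "continuous_on ?I (\<lambda>t. F (apply_bcontfun \<phi> t))"
      by (rule continuous_on_compose2[OF Fcont])
         (use that memK in \<open>auto intro: continuous_on_subset[OF continuous_on_apply_bcontfun]\<close>)
    then show ?thesis by (meson antiderivative_continuous)
  qed
  then obtain g where g: "\<And>\<phi> t. \<phi> \<in> K \<Longrightarrow> t \<in> ?I \<Longrightarrow> (g \<phi> has_vector_derivative F (apply_bcontfun \<phi> t)) (at t within ?I)"
    by metis
  \<comment> \<open>The fixed point is sought among bounded continuous functions on the whole line,
    a complete space; clamping the time to the interval extends the local integral to such a
    function.\<close>
  define cl where "cl t = max (-\<tau>) (min \<tau> t)" for t
  have cl: "cl t \<in> ?I" "\<bar>cl t\<bar> \<le> \<tau>" for t using pos by (auto simp: cl_def)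
  have 0: "0 \<in> ?I" using pos by auto
  define \<psi> where "\<psi> \<phi> t = y + (g \<phi> (cl t) - g \<phi> 0)" for \<phi> t
  have near: "norm (g \<phi> t - g \<phi> 0) \<le> r / 2" if "\<phi> \<in> K" "t \<in> ?I" for \<phi> t
  proof -
    have "norm (g \<phi> t - g \<phi> 0) \<le> M * \<bar>t - 0\<bar>"
      by (rule vector_derivative_bound[OF _ g[OF that(1)] _ that(2) 0]) (use M memK that in auto)
    also have "\<dots> \<le> M * \<tau>" using that pos by (intro mult_left_mono) auto
    finally show ?thesis using pos by (simp add: mult.commute)
  qed
  have in_ball: "\<psi> \<phi> t \<in> cball c r" if "\<phi> \<in> K" for \<phi> t
  proof -
    have "norm (\<psi> \<phi> t - c) \<le> norm (y - c) + norm (g \<phi> (cl t) - g \<phi> 0)"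
      unfolding \<psi>_def by (metis add_diff_eq add.commute norm_triangle_ineq add_diff_cancel_left' diff_add_eq)
    also have "\<dots> \<le> r / 2 + r / 2"
      using y near[OF that cl(1)] by (intro add_mono) (auto simp: dist_norm norm_minus_commute)
    finally show ?thesis by (simp add: dist_norm norm_minus_commute)
  qed
  have bc: "\<psi> \<phi> \<in> bcontfun" if "\<phi> \<in> K" for \<phi>
  proof (rule bcontfun_normI)
    have "continuous_on ?I (g \<phi>)"
      using g[OF that] has_vector_derivative_continuous continuous_on_eq_continuous_within by blast
    then have "continuous_on UNIV (\<lambda>t. g \<phi> (cl t))"
      by (rule continuous_on_compose2) (use cl in \<open>auto simp: cl_def intro!: continuous_intros\<close>)
    then show "continuous_on UNIV (\<psi> \<phi>)" unfolding \<psi>_def by (intro continuous_intros)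
    show "norm (\<psi> \<phi> t) \<le> norm c + r" for t
      using in_ball[OF that, of t] norm_triangle_sub[of "\<psi> \<phi> t" c] by (simp add: dist_norm norm_minus_commute)
  qed
  define P where "P \<phi> = Bcontfun (\<psi> \<phi>)" for \<phi>
  have P: "apply_bcontfun (P \<phi>) = \<psi> \<phi>" if "\<phi> \<in> K" for \<phi>
    using bc[OF that] by (simp add: P_def Bcontfun_inverse)
  have contr: "dist (P \<phi>1) (P \<phi>2) \<le> 1/2 * dist \<phi>1 \<phi>2" if K: "\<phi>1 \<in> K" "\<phi>2 \<in> K" for \<phi>1 \<phi>2
  proof (rule dist_bound)
    fix t
    let ?h = "\<lambda>t. g \<phi>1 t - g \<phi>2 t"
    have "norm (?h (cl t) - ?h 0) \<le> (L * dist \<phi>1 \<phi>2) * \<bar>cl t - 0\<bar>"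
    proof (rule vector_derivative_bound[OF _ _ _ cl(1) 0])
      show "(?h has_vector_derivative F (apply_bcontfun \<phi>1 s) - F (apply_bcontfun \<phi>2 s)) (at s within ?I)" if "s \<in> ?I" for s
        using g[OF K(1) that] g[OF K(2) that] by (rule has_vector_derivative_diff)
      show "norm (F (apply_bcontfun \<phi>1 s) - F (apply_bcontfun \<phi>2 s)) \<le> L * dist \<phi>1 \<phi>2" if "s \<in> ?I" for s
      proof -
        have "norm (F (apply_bcontfun \<phi>1 s) - F (apply_bcontfun \<phi>2 s)) \<le> L * dist (apply_bcontfun \<phi>1 s) (apply_bcontfun \<phi>2 s)"
          unfolding dist_norm by (rule Lip) (use K memK in auto)
        also have "\<dots> \<le> L * dist \<phi>1 \<phi>2" using pos by (intro mult_left_mono dist_bounded)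
        finally show ?thesis .
      qed
    qed auto
    also have "\<dots> \<le> (L * dist \<phi>1 \<phi>2) * \<tau>"
      using cl pos by (intro mult_left_mono) auto
    also have "\<dots> = (\<tau> * L) * dist \<phi>1 \<phi>2" by simp
    also have "\<dots> \<le> 1/2 * dist \<phi>1 \<phi>2" using pos by (intro mult_right_mono) auto
    finally show "dist (apply_bcontfun (P \<phi>1) t) (apply_bcontfun (P \<phi>2) t) \<le> 1/2 * dist \<phi>1 \<phi>2"
      using K by (simp add: P \<psi>_def dist_norm algebra_simps)
  qed
  have "const_bcontfun c \<in> K" using pos by (simp add: memK)
  then have "K \<noteq> {}" by blast
  have "\<exists>!\<phi>\<in>K. P \<phi> = \<phi>"
    by (rule Banach_fix[OF \<open>complete K\<close> \<open>K \<noteq> {}\<close>, of "1/2"]) (use contr in_ball P memK in auto)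
  then obtain \<phi> where \<phi>: "\<phi> \<in> K" "P \<phi> = \<phi>" by blast
  have eq: "apply_bcontfun \<phi> t = \<psi> \<phi> t" for t using P \<phi> by metis
  have cl_id: "cl t = t" if "t \<in> ?I" for t using that by (auto simp: cl_def)
  show ?thesis
  proof
    show "apply_bcontfun \<phi> 0 = y" using cl_id[OF 0] by (simp add: eq \<psi>_def)
    show "apply_bcontfun \<phi> t \<in> cball c r" for t using \<phi> memK by blast
    show "(apply_bcontfun \<phi> has_vector_derivative F (apply_bcontfun \<phi> t)) (at t within ?I)" if "t \<in> ?I" for t
    proof (rule has_vector_derivative_transform[OF that])
      show "((\<lambda>t. y + (g \<phi> t - g \<phi> 0)) has_vector_derivative F (apply_bcontfun \<phi> t)) (at t within ?I)"
        using g[OF \<phi>(1) that] by (auto intro!: derivative_eq_intros)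
    qed (simp add: eq \<psi>_def cl_id)
  qed
qed

text \<open>The bound on \<open>d'\<close> is two-sided, so time may run in either direction:
  multiplied by \<open>exp (- K t)\<close> the function \<open>d\<close> cannot increase, multiplied
  by \<open>exp (K t)\<close> it cannot decrease.\<close>

lemma Gronwall:
  fixes d d' :: "real \<Rightarrow> real"
  assumes "convex S" "a \<in> S" "b \<in> S"
    and der: "\<And>t. t \<in> S \<Longrightarrow> (d has_vector_derivative d' t) (at t within S)"
    and le: "\<And>t. t \<in> S \<Longrightarrow> \<bar>d' t\<bar> \<le> K * d t"
  shows "d b \<le> d a * exp (K * \<bar>b - a\<bar>)"
proof -
  have sub: "{min a b..max a b} \<subseteq> S"
    using assms(1-3) by (metis closed_segment_eq_real_ivl closed_segment_subset max.commute max_def min.commute min_def)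
  have dex: "((\<lambda>t. d t * exp (c * t)) has_derivative (\<lambda>h. h * ((d' t + c * d t) * exp (c * t)))) (at t within T)"
    if "t \<in> S" "T \<subseteq> S" for t T c
  proof -
    have "(d has_derivative (\<lambda>h. h * d' t)) (at t within T)"
      using has_vector_derivative_within_subset[OF der[OF that(1)] that(2)]
      by (simp add: has_vector_derivative_def)
    then show ?thesis by (auto intro!: derivative_eq_intros simp: algebra_simps)
  qed
  show ?thesis
  proof (cases "a \<le> b")
    case True
    have "\<exists>t\<in>{a..b}. d b * exp (-K * b) - d a * exp (-K * a) = (b - a) * ((d' t + -K * d t) * exp (-K * t))"
      by (rule mvt_very_simple[OF True]) (use sub True in \<open>intro dex, auto\<close>)
    then obtain t where t: "t \<in> {a..b}"
      "d b * exp (-K * b) - d a * exp (-K * a) = (b - a) * ((d' t + -K * d t) * exp (-K * t))" by blast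
    have "d' t - K * d t \<le> 0" using le[of t] t sub True by fastforce
    then have "(b - a) * ((d' t + -K * d t) * exp (-K * t)) \<le> 0"
      using True by (intro mult_nonneg_nonpos mult_nonpos_nonneg) auto
    then have "d b * exp (-K * b) \<le> d a * exp (-K * a)" using t by simp
    then have "d b * exp (-K * b) * exp (K * b) \<le> d a * exp (-K * a) * exp (K * b)"
      by (intro mult_right_mono) auto
    then show ?thesis using True by (simp add: mult.assoc exp_add[symmetric] algebra_simps)
  next
    case False
    have "\<exists>t\<in>{b..a}. d a * exp (K * a) - d b * exp (K * b) = (a - b) * ((d' t + K * d t) * exp (K * t))"
      by (rule mvt_very_simple, use False in simp, rule dex) (use sub False in auto)
    then obtain t where t: "t \<in> {b..a}"
      "d a * exp (K * a) - d b * exp (K * b) = (a - b) * ((d' t + K * d t) * exp (K * t))" by blast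
    have "d' t + K * d t \<ge> 0" using le[of t] t sub False by fastforce
    then have "(a - b) * ((d' t + K * d t) * exp (K * t)) \<ge> 0"
      using False by (intro mult_nonneg_nonneg) auto
    then have "d b * exp (K * b) \<le> d a * exp (K * a)" using t by simp
    then have "d b * exp (K * b) * exp (- K * b) \<le> d a * exp (K * a) * exp (- K * b)"
      by (intro mult_right_mono) auto
    then show ?thesis using False by (simp add: mult.assoc exp_add[symmetric] algebra_simps)
  qed
qed

text \<open>The squared distance is used because it is differentiable also where the solutions meet;
  by Cauchy-Schwarz its derivative is at most \<open>2 L\<close> times itself.\<close>

lemma solutions_Gronwall:
  fixes X :: "'a::real_inner \<Rightarrow> 'a"
  assumes Lip: "\<And>x y. x \<in> B \<Longrightarrow> y \<in> B \<Longrightarrow> norm (X x - X y) \<le> L * norm (x - y)"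
    and "convex S" "a \<in> S" "b \<in> S"
    and "\<And>t. t \<in> S \<Longrightarrow> \<gamma>1 t \<in> B \<and> (\<gamma>1 has_vector_derivative X (\<gamma>1 t)) (at t within S)"
    and "\<And>t. t \<in> S \<Longrightarrow> \<gamma>2 t \<in> B \<and> (\<gamma>2 has_vector_derivative X (\<gamma>2 t)) (at t within S)"
  shows "(norm (\<gamma>1 b - \<gamma>2 b))\<^sup>2 \<le> (norm (\<gamma>1 a - \<gamma>2 a))\<^sup>2 * exp (2 * L * \<bar>b - a\<bar>)"
proof -
  define w where "w t = \<gamma>1 t - \<gamma>2 t" for t
  define d where "d t = w t \<bullet> w t" for t
  have "d b \<le> d a * exp ((2 * L) * \<bar>b - a\<bar>)"
  proof (rule Gronwall[OF assms(2-4)])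
    fix t assume t: "t \<in> S"
    have "(w has_vector_derivative X (\<gamma>1 t) - X (\<gamma>2 t)) (at t within S)"
      unfolding w_def using assms(5,6)[OF t] by (auto intro: has_vector_derivative_diff)
    from bounded_bilinear.has_vector_derivative[OF bounded_bilinear_inner this this]
    show "(d has_vector_derivative 2 * (w t \<bullet> (X (\<gamma>1 t) - X (\<gamma>2 t)))) (at t within S)"
      by (simp add: d_def[abs_def] inner_commute)
    have "\<bar>w t \<bullet> (X (\<gamma>1 t) - X (\<gamma>2 t))\<bar> \<le> norm (w t) * norm (X (\<gamma>1 t) - X (\<gamma>2 t))"
      by (rule Cauchy_Schwarz_ineq2)
    also have "\<dots> \<le> norm (w t) * (L * norm (w t))"
      using Lip assms(5,6)[OF t] by (intro mult_left_mono) (auto simp: w_def)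
    also have "\<dots> = L * d t" by (simp add: d_def power2_norm_eq_inner[symmetric] power2_eq_square)
    finally show "\<bar>2 * (w t \<bullet> (X (\<gamma>1 t) - X (\<gamma>2 t)))\<bar> \<le> 2 * L * d t" by simp
  qed
  then show ?thesis by (simp add: d_def w_def power2_norm_eq_inner)
qed

text \<open>Lipschitz bounds are available only locally, so the preceding estimate gives agreement
  near each common time. The set of common times is thus open and closed in a connected set.\<close>

lemma solutions_unique:
  fixes X :: "'a::euclidean_space \<Rightarrow> 'a"
  assumes V: "open V" "Ck_on 1 V X" and S: "convex S" "a \<in> S" "b \<in> S"
    and s1: "\<And>t. t \<in> S \<Longrightarrow> \<gamma>1 t \<in> V \<and> (\<gamma>1 has_vector_derivative X (\<gamma>1 t)) (at t within S)"
    and s2: "\<And>t. t \<in> S \<Longrightarrow> \<gamma>2 t \<in> V \<and> (\<gamma>2 has_vector_derivative X (\<gamma>2 t)) (at t within S)"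
    and "\<gamma>1 a = \<gamma>2 a"
  shows "\<gamma>1 b = \<gamma>2 b"
proof -
  let ?E = "{t \<in> S. \<gamma>1 t = \<gamma>2 t}"
  have c: "continuous_on S \<gamma>1" "continuous_on S \<gamma>2"
    using s1 s2 has_vector_derivative_continuous continuous_on_eq_continuous_within by blast+
  have "closedin (top_of_set S) {t \<in> S. \<gamma>1 t - \<gamma>2 t = 0}"
    using continuous_closedin_preimage_constant[of S "\<lambda>t. \<gamma>1 t - \<gamma>2 t" 0] c by (auto intro: continuous_intros)
  then have clo: "closedin (top_of_set S) ?E" by simp
  have "\<exists>e>0. \<forall>t\<in>S. dist t s < e \<longrightarrow> t \<in> ?E" if s: "s \<in> ?E" for s
  proof -
    have "\<gamma>1 s \<in> V" using s s1 by blast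
    then obtain r where r: "r > 0" "cball (\<gamma>1 s) r \<subseteq> V" using V open_contains_cball by blast
    obtain L where L: "\<And>x y. x \<in> cball (\<gamma>1 s) r \<Longrightarrow> y \<in> cball (\<gamma>1 s) r \<Longrightarrow> norm (X x - X y) \<le> L * norm (x - y)"
      using Ck_on_1_Lipschitz_cball[OF V(2) r(2)] by blast
    obtain e1 where e1: "e1 > 0" "\<And>t. t \<in> S \<Longrightarrow> dist t s < e1 \<Longrightarrow> dist (\<gamma>1 t) (\<gamma>1 s) < r"
      using c(1) s r(1) unfolding continuous_on_iff by blast
    obtain e2 where e2: "e2 > 0" "\<And>t. t \<in> S \<Longrightarrow> dist t s < e2 \<Longrightarrow> dist (\<gamma>2 t) (\<gamma>2 s) < r"
      using c(2) s r(1) unfolding continuous_on_iff by blast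
    define e where "e = min e1 e2"
    let ?S = "S \<inter> ball s e"
    have "t \<in> ?E" if t: "t \<in> S" "dist t s < e" for t
    proof -
      have "(norm (\<gamma>1 t - \<gamma>2 t))\<^sup>2 \<le> (norm (\<gamma>1 s - \<gamma>2 s))\<^sup>2 * exp (2 * L * \<bar>t - s\<bar>)"
      proof (rule solutions_Gronwall[OF L, where S="?S"])
        show "convex ?S" by (intro convex_Int S convex_ball)
        show "s \<in> ?S" "t \<in> ?S" using s t e1 e2 by (auto simp: e_def dist_commute)
        fix u assume u: "u \<in> ?S"
        show "\<gamma>1 u \<in> cball (\<gamma>1 s) r \<and> (\<gamma>1 has_vector_derivative X (\<gamma>1 u)) (at u within ?S)"
          using u e1(2)[of u] s1[of u] by (auto simp: e_def dist_commute intro: has_vector_derivative_within_subset)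
        show "\<gamma>2 u \<in> cball (\<gamma>1 s) r \<and> (\<gamma>2 has_vector_derivative X (\<gamma>2 u)) (at u within ?S)"
          using u e2(2)[of u] s2[of u] s by (auto simp: e_def dist_commute intro: has_vector_derivative_within_subset)
      qed auto
      then show ?thesis using s t by simp
    qed
    then show ?thesis using e1 e2 by (intro exI[of _ e]) (auto simp: e_def)
  qed
  then have ope: "openin (top_of_set S) ?E" unfolding openin_euclidean_subtopology_iff by blast
  have "connected S" using S(1) by (rule convex_connected)
  with clo ope have "?E = {} \<or> ?E = S" unfolding connected_clopen by blast
  then show ?thesis using assms by blast
qed

text \<open>Evaluates the definite description in \<open>flow\<close> from one exhibited integral
  curve.\<close>

lemma flow_eqI:
  fixes X :: "'a::euclidean_space \<Rightarrow> 'a"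
  assumes V: "open V" "Ck_on 1 V X" and "\<gamma> 0 = x"
    and s: "\<And>s. s \<in> closed_segment 0 t \<Longrightarrow> \<gamma> s \<in> V \<and> (\<gamma> has_vector_derivative X (\<gamma> s)) (at s within closed_segment 0 t)"
  shows "flow V X t x = \<gamma> t"
  unfolding flow_def
proof (rule the_equality)
  show "\<exists>\<gamma>'. \<gamma>' 0 = x \<and> \<gamma>' t = \<gamma> t \<and> (\<forall>s\<in>closed_segment 0 t. \<gamma>' s \<in> V \<and> (\<gamma>' has_vector_derivative X (\<gamma>' s)) (at s within closed_segment 0 t))"
    using assms by blast
next
  fix y assume "\<exists>\<gamma>'. \<gamma>' 0 = x \<and> \<gamma>' t = y \<and> (\<forall>s\<in>closed_segment 0 t. \<gamma>' s \<in> V \<and> (\<gamma>' has_vector_derivative X (\<gamma>' s)) (at s within closed_segment 0 t))"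
  then obtain \<gamma>' where g: "\<gamma>' 0 = x" "\<gamma>' t = y"
    "\<And>s. s \<in> closed_segment 0 t \<Longrightarrow> \<gamma>' s \<in> V \<and> (\<gamma>' has_vector_derivative X (\<gamma>' s)) (at s within closed_segment 0 t)" by blast
  have "\<gamma>' t = \<gamma> t"
    by (rule solutions_unique[OF V convex_closed_segment _ _ g(3) s, of 0]) (use g assms in auto)
  then show "y = \<gamma> t" using g by simp
qed


text \<open>The orbit and the differential \<open>A t\<close> of the backward flow are solved for
  together, as one autonomous system for the pair, so a single existence argument covers both. That
  \<open>A t\<close> is this differential is a separate estimate: for the orbit through a point
  \<open>y\<close> near \<open>\<gamma> t\<close>, its difference from \<open>\<gamma>\<close>,
  transported by \<open>A\<close>, moves only by a term quadratic in the distance of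
  \<open>y\<close> from \<open>\<gamma> t\<close>. Two orders of differentiability make the
  derivative of \<open>X\<close> Lipschitz, on which both parts rest.\<close>

lemma flow_and_derivative:
  fixes X :: "'a::euclidean_space \<Rightarrow> 'a"
  assumes V: "open V" "Ck_on 2 V X" and \<xi>: "\<xi> \<in> V"
  obtains T \<gamma> A where "T > 0" "\<gamma> 0 = \<xi>" "A 0 = id_blinfun"
    "\<And>t. \<bar>t\<bar> < T \<Longrightarrow> \<gamma> t \<in> V"
    "\<And>t. \<bar>t\<bar> < T \<Longrightarrow> (\<gamma> has_vector_derivative X (\<gamma> t)) (at t)"
    "\<And>t. \<bar>t\<bar> < T \<Longrightarrow> (A has_vector_derivative - (A t o\<^sub>L Blinfun (frechet_derivative X (at (\<gamma> t))))) (at t)"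
    "\<And>t. \<bar>t\<bar> < T \<Longrightarrow> flow V X t \<xi> = \<gamma> t"
    "\<And>t. \<bar>t\<bar> < T \<Longrightarrow> frechet_derivative (flow V X (- t)) (at (\<gamma> t)) = blinfun_apply (A t)"
proof -
  define X' where "X' x = Blinfun (frechet_derivative X (at x))" for x
  have V1: "Ck_on 1 V X" using V(2) Ck_on_SucD by (metis Suc_1)
  have dX: "(X has_derivative frechet_derivative X (at x)) (at x)" if "x \<in> V" for x
    using V(2) that Ck_on_has_derivative by (metis Suc_1)
  have X'_apply: "blinfun_apply (X' x) = frechet_derivative X (at x)" if "x \<in> V" for x
    unfolding X'_def using has_derivative_bounded_linear[OF dX[OF that]] by (rule bounded_linear_Blinfun_apply)
  obtain r where r: "r > 0" "cball \<xi> r \<subseteq> V" using V \<xi> open_contains_cball by blast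
  obtain L where L: "L \<ge> 0" "\<And>x y. x \<in> cball \<xi> r \<Longrightarrow> y \<in> cball \<xi> r \<Longrightarrow> norm (X x - X y) \<le> L * norm (x - y)"
    using Ck_on_1_Lipschitz_cball[OF V1 r(2)] by blast
  have "\<exists>l\<ge>0. \<forall>x\<in>cball \<xi> r. \<forall>y\<in>cball \<xi> r.
      norm (frechet_derivative X (at x) b - frechet_derivative X (at y) b) \<le> l * norm (x - y)" for b
  proof -
    have "Ck_on 1 V (\<lambda>x. frechet_derivative X (at x) b)" using V(2) by (metis Ck_on.simps(2) Suc_1)
    from Ck_on_1_Lipschitz_cball[OF this r(2)] show ?thesis by metis
  qed
  then obtain l where l: "\<And>b. l b \<ge> 0" "\<And>b x y. x \<in> cball \<xi> r \<Longrightarrow> y \<in> cball \<xi> r \<Longrightarrow>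
      norm (frechet_derivative X (at x) b - frechet_derivative X (at y) b) \<le> l b * norm (x - y)"
    by metis
  define L' where "L' = (\<Sum>b\<in>Basis. l b)"
  have L'0: "L' \<ge> 0" using l by (simp add: L'_def sum_nonneg)
  have L': "norm (X' x - X' y) \<le> L' * norm (x - y)" if "x \<in> cball \<xi> r" "y \<in> cball \<xi> r" for x y
  proof -
    have "norm (X' x - X' y) \<le> (\<Sum>b\<in>Basis. norm (blinfun_apply (X' x - X' y) b))"
      by (rule norm_blinfun_euclidean_le)
    also have "\<dots> \<le> (\<Sum>b\<in>Basis. l b * norm (x - y))"
      using that r l(2) by (intro sum_mono) (auto simp: blinfun.diff_left X'_apply subset_eq)
    finally show ?thesis by (simp add: L'_def sum_distrib_right)
  qed
  define M where "M = norm (X \<xi>) + L * r"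
  have M: "norm (X x) \<le> M" if "x \<in> cball \<xi> r" for x
  proof -
    have "norm (X x) \<le> norm (X \<xi>) + norm (X x - X \<xi>)" by (metis norm_triangle_sub)
    also have "\<dots> \<le> norm (X \<xi>) + L * norm (x - \<xi>)" using L(2)[OF that, of \<xi>] r by simp
    also have "\<dots> \<le> M" unfolding M_def using that L(1) r
      by (intro add_left_mono mult_left_mono) (auto simp: dist_norm norm_minus_commute)
    finally show ?thesis .
  qed
  have M0: "M \<ge> 0" using L r by (simp add: M_def)
  define N where "N = norm (X' \<xi>) + L' * r"
  have N: "norm (X' x) \<le> N" if "x \<in> cball \<xi> r" for x
  proof -
    have "norm (X' x) \<le> norm (X' \<xi>) + norm (X' x - X' \<xi>)" by (metis norm_triangle_sub)
    also have "\<dots> \<le> norm (X' \<xi>) + L' * norm (x - \<xi>)" using L'[OF that, of \<xi>] r by simp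
    also have "\<dots> \<le> N" unfolding N_def using that L'0 r
      by (intro add_left_mono mult_left_mono) (auto simp: dist_norm norm_minus_commute)
    finally show ?thesis .
  qed
  have N0: "N \<ge> 0" using L'0 r by (simp add: N_def)
  define F where "F z = (X (fst z), - (snd z o\<^sub>L X' (fst z)))" for z :: "'a \<times> ('a \<Rightarrow>\<^sub>L 'a)"
  let ?c = "(\<xi>, id_blinfun) :: 'a \<times> ('a \<Rightarrow>\<^sub>L 'a)"
  have cb: "fst z \<in> cball \<xi> r" "norm (snd z) \<le> 1 + r" if "z \<in> cball ?c r" for z
  proof -
    show "fst z \<in> cball \<xi> r" using that dist_fst_le[of ?c z] by auto
    have "norm (snd z) \<le> norm (id_blinfun :: 'a \<Rightarrow>\<^sub>L 'a) + norm (snd z - id_blinfun)" by (metis norm_triangle_sub)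
    also have "norm (snd z - id_blinfun) \<le> r"
      using that dist_snd_le[of ?c z] by (auto simp: dist_norm norm_minus_commute)
    finally show "norm (snd z) \<le> 1 + r"
      using norm_blinfun_id_le[where 'a='a] by linarith
  qed
  have FL: "norm (F z - F z') \<le> (L + N + (1 + r) * L') * norm (z - z')"
    if z: "z \<in> cball ?c r" "z' \<in> cball ?c r" for z z'
  proof -
    have n1: "norm (fst z - fst z') \<le> norm (z - z')" using dist_fst_le[of z z'] by (simp add: dist_norm)
    have n2: "norm (snd z - snd z') \<le> norm (z - z')" using dist_snd_le[of z z'] by (simp add: dist_norm)
    have "norm (F z - F z') \<le> norm (X (fst z) - X (fst z')) + norm ((snd z' o\<^sub>L X' (fst z')) - (snd z o\<^sub>L X' (fst z)))"
      unfolding F_def by (simp add: norm_Pair_le)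
    also have "(snd z' o\<^sub>L X' (fst z')) - (snd z o\<^sub>L X' (fst z)) =
        ((snd z' - snd z) o\<^sub>L X' (fst z')) + (snd z o\<^sub>L (X' (fst z') - X' (fst z)))"
      by (rule blinfun_eqI) (simp add: blinfun.bilinear_simps)
    also have "norm \<dots> \<le> norm (snd z' - snd z) * norm (X' (fst z')) + norm (snd z) * norm (X' (fst z') - X' (fst z))"
      by (intro order_trans[OF norm_triangle_ineq] add_mono norm_blinfun_compose)
    also have "\<dots> \<le> norm (z - z') * N + (1 + r) * (L' * norm (z - z'))"
    proof (intro add_mono mult_mono)
      show "norm (X' (fst z') - X' (fst z)) \<le> L' * norm (z - z')"
        using L'[OF cb(1)[OF z(2)] cb(1)[OF z(1)]] n1 L'0
        by (auto simp: norm_minus_commute intro: order_trans mult_left_mono)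
    qed (use n2 N cb z N0 r in \<open>auto simp: norm_minus_commute\<close>)
    also have "norm (X (fst z) - X (fst z')) \<le> L * norm (z - z')"
      using L(2)[OF cb(1)[OF z(1)] cb(1)[OF z(2)]] n1 L(1) by (meson order_trans mult_left_mono)
    finally show ?thesis by (simp add: algebra_simps)
  qed
  have FM: "norm (F z) \<le> M + (1 + r) * N" if z: "z \<in> cball ?c r" for z
  proof -
    have "norm (F z) \<le> norm (X (fst z)) + norm (snd z o\<^sub>L X' (fst z))"
      unfolding F_def using norm_Pair_le[of "X (fst z)" "- (snd z o\<^sub>L X' (fst z))"] by simp
    also have "\<dots> \<le> norm (X (fst z)) + norm (snd z) * norm (X' (fst z))"
      by (intro add_left_mono norm_blinfun_compose)
    also have "\<dots> \<le> M + (1 + r) * N"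
      using M N cb[OF z] r by (intro add_mono mult_mono) auto
    finally show ?thesis .
  qed
  define LL where "LL = L + N + (1 + r) * L'"
  define MM where "MM = M + (1 + r) * N"
  have LLMM: "LL \<ge> L" "MM \<ge> M" "LL \<ge> 0" "MM \<ge> 0" using L N0 L'0 M0 r by (auto simp: LL_def MM_def)
  \<comment> \<open>The two entries give the ball condition and the contraction condition of
    \<open>Picard\<close>; adding 1 avoids division by zero.\<close>
  define \<tau> where "\<tau> = min (r / 2 / (MM + 1)) (1 / 2 / (LL + 1))"
  have \<tau>: "\<tau> > 0" "\<tau> * MM \<le> r / 2" "\<tau> * LL \<le> 1 / 2"
  proof -
    show "\<tau> > 0" using r LLMM by (simp add: \<tau>_def)
    have "\<tau> * MM \<le> r / 2 / (MM + 1) * MM" using LLMM by (intro mult_right_mono) (auto simp: \<tau>_def)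
    also have "\<dots> \<le> r / 2" using LLMM r by (simp add: field_simps)
    finally show "\<tau> * MM \<le> r / 2" .
    have "\<tau> * LL \<le> 1 / 2 / (LL + 1) * LL" using LLMM by (intro mult_right_mono) (auto simp: \<tau>_def)
    also have "\<dots> \<le> 1 / 2" using LLMM by (simp add: field_simps)
    finally show "\<tau> * LL \<le> 1 / 2" .
  qed
  have \<tau>': "\<tau> * M \<le> r / 2" "\<tau> * L \<le> 1 / 2"
    by (rule order_trans[OF mult_left_mono[OF LLMM(2)] \<tau>(2)], use \<tau>(1) in simp)
       (rule order_trans[OF mult_left_mono[OF LLMM(1)] \<tau>(3)], use \<tau>(1) in simp)
  let ?I = "{-\<tau>..\<tau>}"
  obtain z where z: "z 0 = ?c" "\<And>t. t \<in> ?I \<Longrightarrow> z t \<in> cball ?c r"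
    "\<And>t. t \<in> ?I \<Longrightarrow> (z has_vector_derivative F (z t)) (at t within ?I)"
    by (rule Picard[of ?c r F LL MM \<tau> ?c]) (use FL FM r \<tau> LLMM in \<open>auto simp: LL_def MM_def\<close>)
  define \<gamma> where "\<gamma> t = fst (z t)" for t
  define A where "A t = snd (z t)" for t
  have \<gamma>w: "(\<gamma> has_vector_derivative X (\<gamma> t)) (at t within ?I)" if "t \<in> ?I" for t
    unfolding \<gamma>_def using bounded_linear.has_vector_derivative[OF bounded_linear_fst z(3)[OF that]]
    by (simp add: F_def)
  have Aw: "(A has_vector_derivative - (A t o\<^sub>L X' (\<gamma> t))) (at t within ?I)" if "t \<in> ?I" for t
    unfolding \<gamma>_def A_def using bounded_linear.has_vector_derivative[OF bounded_linear_snd z(3)[OF that]]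
    by (simp add: F_def)
  have \<gamma>in: "\<gamma> t \<in> cball \<xi> r" "norm (A t) \<le> 1 + r" if "t \<in> ?I" for t
    using cb z(2)[OF that] by (auto simp: \<gamma>_def A_def)
  have 0: "\<gamma> 0 = \<xi>" "A 0 = id_blinfun" using z by (auto simp: \<gamma>_def A_def)
  have "continuous (at 0 within ?I) \<gamma>" by (rule has_vector_derivative_continuous[OF \<gamma>w]) (use \<tau>(1) in auto)
  \<comment> \<open>Keeps \<open>\<gamma> t\<close> in the open half ball, so that all points close
    to it are admissible starting points for the common time \<open>\<tau>\<close>.\<close>
  then obtain T1 where T1: "T1 > 0" "\<And>t. t \<in> ?I \<Longrightarrow> dist t 0 < T1 \<Longrightarrow> dist (\<gamma> t) (\<gamma> 0) < r / 2"
    using r(1) unfolding continuous_within_eps_delta by (meson half_gt_zero)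
  define T where "T = min T1 \<tau>"
  have T: "T > 0" "\<And>t. \<bar>t\<bar> < T \<Longrightarrow> t \<in> interior ?I" "\<And>t. \<bar>t\<bar> < T \<Longrightarrow> t \<in> ?I"
    using T1 \<tau> by (auto simp: T_def)
  have near: "dist \<xi> (\<gamma> t) < r / 2" if "\<bar>t\<bar> < T" for t
    using T1(2)[of t] T(3)[OF that] that 0 by (simp add: T_def dist_commute)
  have \<gamma>': "(\<gamma> has_vector_derivative X (\<gamma> t)) (at t)" if "\<bar>t\<bar> < T" for t
    using \<gamma>w[OF T(3)[OF that]] at_within_interior[OF T(2)[OF that]] by simp
  have A': "(A has_vector_derivative - (A t o\<^sub>L X' (\<gamma> t))) (at t)" if "\<bar>t\<bar> < T" for t
    using Aw[OF T(3)[OF that]] at_within_interior[OF T(2)[OF that]] by simp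
  have seg: "\<bar>s\<bar> < T" if "s \<in> closed_segment 0 t" "\<bar>t\<bar> < T" for s t
    using that by (auto simp: closed_segment_eq_real_ivl split: if_splits)
  have fl: "flow V X t \<xi> = \<gamma> t" if "\<bar>t\<bar> < T" for t
  proof (rule flow_eqI[where \<gamma>=\<gamma>, OF V(1) V1 0(1)])
    fix s assume "s \<in> closed_segment 0 t"
    then have s: "\<bar>s\<bar> < T" using seg that by blast
    then show "\<gamma> s \<in> V \<and> (\<gamma> has_vector_derivative X (\<gamma> s)) (at s within closed_segment 0 t)"
      using \<gamma>'[OF s] \<gamma>in(1)[OF T(3)[OF s]] r(2) by (auto intro: has_vector_derivative_at_within)
  qed
  have der: "(flow V X (- t) has_derivative blinfun_apply (A t)) (at (\<gamma> t))" if t: "\<bar>t\<bar> < T" for t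
  proof -
    \<comment> \<open>The bound on \<open>A\<close>, times the Taylor constant of \<open>X\<close>
      with Gronwall's factor, times the length of the time interval.\<close>
    define C where "C = (1 + r) * (L' * exp (2 * L * \<tau>)) * \<tau>"
    have est: "norm (flow V X (- t) y - \<xi> - A t (y - \<gamma> t)) \<le> C * (norm (y - \<gamma> t))\<^sup>2" if y: "y \<in> cball \<xi> (r / 2)" for y
    proof -
      obtain x where x: "x 0 = y" "\<And>s. s \<in> ?I \<Longrightarrow> x s \<in> cball \<xi> r"
        "\<And>s. s \<in> ?I \<Longrightarrow> (x has_vector_derivative X (x s)) (at s within ?I)"
        by (rule Picard[of \<xi> r X L M \<tau> y]) (use L M r \<tau> \<tau>' M0 y in auto)
      let ?S = "closed_segment 0 (- t)"
      have S: "\<bar>s\<bar> \<le> \<bar>t\<bar>" "\<bar>t + s\<bar> < T" "\<bar>s\<bar> < T" "s \<in> ?I" if "s \<in> ?S" for s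
      proof -
        show "\<bar>s\<bar> \<le> \<bar>t\<bar>" "\<bar>t + s\<bar> < T" using that t by (auto simp: closed_segment_eq_real_ivl split: if_splits)
        with t show "\<bar>s\<bar> < T" by simp
        with T show "s \<in> ?I" by blast
      qed
      have SI: "?S \<subseteq> ?I" using S by blast
      have xS: "(x has_vector_derivative X (x s)) (at s within ?S)" if "s \<in> ?S" for s
        using x(3)[OF S(4)[OF that]] SI by (rule has_vector_derivative_within_subset)
      have flx: "flow V X (- t) y = x (- t)"
        by (rule flow_eqI[where \<gamma>=x, OF V(1) V1 x(1)]) (use xS x(2) S(4) r(2) in blast)
      define \<beta> where "\<beta> s = \<gamma> (t + s)" for s
      define B where "B s = A (t + s)" for s
      have sh: "((\<lambda>s. f (t + s)) has_vector_derivative f') (at s within ?S)"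
        if "(f has_vector_derivative f') (at (t + s))" for f :: "real \<Rightarrow> 'c::real_normed_vector" and f' s
      proof -
        have "((\<lambda>s. t + s) has_vector_derivative 1) (at s)"
          by (auto intro!: derivative_eq_intros)
        from vector_diff_chain_at[OF this that] show ?thesis
          by (simp add: o_def has_vector_derivative_at_within)
      qed
      have \<beta>S: "(\<beta> has_vector_derivative X (\<beta> s)) (at s within ?S)" if "s \<in> ?S" for s
        unfolding \<beta>_def by (rule sh[OF \<gamma>'[OF S(2)[OF that]]])
      have BS: "(B has_vector_derivative - (B s o\<^sub>L X' (\<beta> s))) (at s within ?S)" if "s \<in> ?S" for s
        unfolding \<beta>_def B_def by (rule sh[OF A'[OF S(2)[OF that]]])
      have \<beta>in: "\<beta> s \<in> cball \<xi> r" "norm (B s) \<le> 1 + r" if "s \<in> ?S" for s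
        unfolding \<beta>_def B_def using \<gamma>in T(3) S(2)[OF that] by auto
      define d where "d = norm (y - \<gamma> t)"
      have close: "(norm (x s - \<beta> s))\<^sup>2 \<le> d\<^sup>2 * exp (2 * L * \<tau>)" if s: "s \<in> ?S" for s
      proof -
        have "(norm (x s - \<beta> s))\<^sup>2 \<le> (norm (x 0 - \<beta> 0))\<^sup>2 * exp (2 * L * \<bar>s - 0\<bar>)"
          by (rule solutions_Gronwall[OF L(2), where B="cball \<xi> r" and S="?S" and ?\<gamma>1.0=x and ?\<gamma>2.0=\<beta>]) (use xS \<beta>S x(2) S(4) \<beta>in s in auto)
        also have "\<dots> \<le> d\<^sup>2 * exp (2 * L * \<tau>)"
          using S(4)[OF s] L(1) x(1) by (intro mult_mono) (auto simp: d_def \<beta>_def mult_left_mono)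
        finally show ?thesis .
      qed
      \<comment> \<open>Taylor remainder of \<open>X\<close> at \<open>b\<close>, from the Lipschitz
        constant \<open>L'\<close> of its derivative.\<close>
      have quad: "norm (X a - X b - X' b (a - b)) \<le> L' * (norm (a - b))\<^sup>2"
        if ab: "a \<in> cball \<xi> r" "b \<in> cball \<xi> r" for a b
      proof -
        have sub: "closed_segment a b \<subseteq> cball \<xi> r" using ab by (simp add: closed_segment_subset)
        have "norm ((X a - X' b a) - (X b - X' b b)) \<le> (L' * norm (a - b)) * norm (a - b)"
        proof (rule differentiable_bound[of "closed_segment a b" _ "\<lambda>u. blinfun_apply (X' u - X' b)"])
          fix u assume u: "u \<in> closed_segment a b"
          then have uV: "u \<in> V" "u \<in> cball \<xi> r" using sub r by blast+
          show "((\<lambda>u. X u - blinfun_apply (X' b) u) has_derivative blinfun_apply (X' u - X' b)) (at u within closed_segment a b)"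
            using has_derivative_at_withinI[OF dX[OF uV(1)]] uV
            by (auto intro!: derivative_eq_intros simp: blinfun.diff_left X'_apply)
          have "norm (u - b) \<le> norm (a - b)" using u segment_bound(2)[of u a b] by (simp add: norm_minus_commute)
          then have "norm (X' u - X' b) \<le> L' * norm (a - b)"
            using L'[OF uV(2) ab(2)] L'0 by (meson mult_left_mono order_trans)
          then show "onorm (blinfun_apply (X' u - X' b)) \<le> L' * norm (a - b)" by (simp add: norm_blinfun.rep_eq)
        qed auto
        then show ?thesis by (simp add: blinfun.diff_right power2_eq_square algebra_simps)
      qed
      \<comment> \<open>Interpolates between \<open>A t (y - \<gamma> t)\<close> at time 0 and the
        displacement of the endpoint from \<open>\<xi>\<close> at time \<open>- t\<close>. The
        equation for \<open>A\<close> cancels the linear part of its derivative and leaves the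
        Taylor remainder.\<close>
      define w where "w s = B s (x s - \<beta> s)" for s
      define w' where "w' s = B s (X (x s) - X (\<beta> s) - X' (\<beta> s) (x s - \<beta> s))" for s
      have wd: "(w has_vector_derivative w' s) (at s within ?S)" if "s \<in> ?S" for s
      proof -
        have "((\<lambda>s. x s - \<beta> s) has_vector_derivative X (x s) - X (\<beta> s)) (at s within ?S)"
          using xS[OF that] \<beta>S[OF that] by (rule has_vector_derivative_diff)
        from bounded_bilinear.has_vector_derivative[OF bounded_bilinear_blinfun_apply BS[OF that] this]
        show ?thesis
          by (simp add: w_def[abs_def] w'_def blinfun.bilinear_simps algebra_simps)
      qed
      have wb: "norm (w' s) \<le> (1 + r) * (L' * exp (2 * L * \<tau>)) * d\<^sup>2" if s: "s \<in> ?S" for s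
      proof -
        have "norm (w' s) \<le> norm (B s) * norm (X (x s) - X (\<beta> s) - X' (\<beta> s) (x s - \<beta> s))"
          unfolding w'_def by (rule norm_blinfun)
        also have "\<dots> \<le> (1 + r) * (L' * (norm (x s - \<beta> s))\<^sup>2)"
          using \<beta>in[OF s] quad[OF x(2)[OF S(4)[OF s]] \<beta>in(1)[OF s]] r by (intro mult_mono) auto
        also have "\<dots> \<le> (1 + r) * (L' * (d\<^sup>2 * exp (2 * L * \<tau>)))"
          using close[OF s] r L'0 by (intro mult_left_mono) auto
        finally show ?thesis by (simp add: mult_ac)
      qed
      have "norm (w (- t) - w 0) \<le> ((1 + r) * (L' * exp (2 * L * \<tau>)) * d\<^sup>2) * \<bar>- t - 0\<bar>"
        by (rule vector_derivative_bound[OF _ wd wb]) auto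
      also have "\<dots> \<le> ((1 + r) * (L' * exp (2 * L * \<tau>)) * d\<^sup>2) * \<tau>"
        using t r L'0 by (intro mult_left_mono) (auto simp: T_def)
      finally have "norm (w (- t) - w 0) \<le> C * d\<^sup>2" by (simp add: C_def mult_ac)
      moreover have "w (- t) = flow V X (- t) y - \<xi>" "w 0 = A t (y - \<gamma> t)"
        by (simp_all add: w_def B_def \<beta>_def 0 flx x(1))
      ultimately show ?thesis by (simp add: d_def)
    qed
    have base: "flow V X (- t) (\<gamma> t) = \<xi>"
      using est[of "\<gamma> t"] near[OF t] by (simp add: blinfun.zero_right)
    show ?thesis
    proof (rule has_derivativeI_sandwich[where s=UNIV and H="\<lambda>y. C * norm (y - \<gamma> t)"])
      show "r / 2 - dist \<xi> (\<gamma> t) > 0" using near[OF t] by simp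
      show "bounded_linear (blinfun_apply (A t))" by (rule blinfun.bounded_linear_right)
      show "((\<lambda>y. C * norm (y - \<gamma> t)) \<longlongrightarrow> 0) (at (\<gamma> t))"
        by (auto intro!: tendsto_eq_intros)
      fix y assume y: "y \<noteq> \<gamma> t" "dist y (\<gamma> t) < r / 2 - dist \<xi> (\<gamma> t)"
      have "dist \<xi> y \<le> dist \<xi> (\<gamma> t) + dist y (\<gamma> t)" by (metis dist_commute dist_triangle)
      then have "y \<in> cball \<xi> (r / 2)" using y by simp
      from est[OF this] have "norm (flow V X (- t) y - \<xi> - A t (y - \<gamma> t)) / norm (y - \<gamma> t)
          \<le> C * (norm (y - \<gamma> t))\<^sup>2 / norm (y - \<gamma> t)"
        by (intro divide_right_mono) auto
      then show "norm (flow V X (- t) y - flow V X (- t) (\<gamma> t) - A t (y - \<gamma> t)) / norm (y - \<gamma> t)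
          \<le> C * norm (y - \<gamma> t)"
        using y by (simp add: base power2_eq_square)
    qed
  qed
  show ?thesis
  proof
    show "T > 0" "\<gamma> 0 = \<xi>" "A 0 = id_blinfun" by fact+
    show "\<gamma> t \<in> V" if "\<bar>t\<bar> < T" for t using \<gamma>in(1)[OF T(3)[OF that]] r by blast
    show "frechet_derivative (flow V X (- t)) (at (\<gamma> t)) = blinfun_apply (A t)" if "\<bar>t\<bar> < T" for t
      using frechet_derivative_at[OF der[OF that]] by simp
    show "(A has_vector_derivative - (A t o\<^sub>L Blinfun (frechet_derivative X (at (\<gamma> t))))) (at t)" if "\<bar>t\<bar> < T" for t
      using A'[OF that] by (simp add: X'_def)
  qed (use \<gamma>' fl in auto)
qed

text \<open>Here \<open>A t\<close> stands for the differential of \<open>e\<^sup>-\<^sup>t\<^sup>X\<close> at \<open>\<gamma> t\<close>.\<close>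

lemma pullback_has_derivative_lie_bracket:
  fixes X Y :: "'a::euclidean_space \<Rightarrow> 'a"
  assumes "(\<gamma> has_vector_derivative X (\<gamma> t)) (at t)"
    and "(A has_vector_derivative - (A t o\<^sub>L Blinfun (frechet_derivative X (at (\<gamma> t))))) (at t)"
    and "X differentiable (at (\<gamma> t))" "Y differentiable (at (\<gamma> t))"
  shows "((\<lambda>t. blinfun_apply (A t) (Y (\<gamma> t))) has_vector_derivative blinfun_apply (A t) (lie_bracket X Y (\<gamma> t))) (at t)"
proof -
  have bl: "bounded_linear (frechet_derivative X (at (\<gamma> t)))"
    using assms(3) frechet_derivative_works has_derivative_bounded_linear by blast
  have "(Y has_derivative frechet_derivative Y (at (\<gamma> t))) (at (\<gamma> t))"
    using assms(4) frechet_derivative_works by blast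
  from vector_derivative_diff_chain_within[OF assms(1), of Y "frechet_derivative Y (at (\<gamma> t))"] this
  have "((\<lambda>t. Y (\<gamma> t)) has_vector_derivative frechet_derivative Y (at (\<gamma> t)) (X (\<gamma> t))) (at t)"
    by (simp add: o_def has_derivative_at_withinI)
  from bounded_bilinear.has_vector_derivative[OF bounded_bilinear_blinfun_apply assms(2) this]
  show ?thesis
    by (simp add: lie_bracket_def blinfun.bilinear_simps bounded_linear_Blinfun_apply[OF bl])
qed

section \<open>Jets of graded families of functions of two variables\<close>

text \<open>The parameter \<open>s\<close> will be the speed of a curve, so a \<open>k\<close>-th order derivative raises the degree by \<open>k\<close>.\<close>

definition graded :: "int \<Rightarrow> (real \<times> real \<Rightarrow> real) \<Rightarrow> bool" where
  "graded d f \<longleftrightarrow> (\<exists>P. \<forall>s z. s \<noteq> 0 \<longrightarrow> f (s, z) = s powi d * poly P z)"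

lemma graded_add: "graded d f \<Longrightarrow> graded d g \<Longrightarrow> graded d (\<lambda>i. f i + g i)"
  unfolding graded_def by (metis distrib_left poly_add)

lemma graded_mult: "graded d f \<Longrightarrow> graded e g \<Longrightarrow> graded (d + e) (\<lambda>i. f i * g i)"
proof -
  assume "graded d f" "graded e g"
  then obtain P Q where "\<And>s z. s \<noteq> 0 \<Longrightarrow> f (s, z) = s powi d * poly P z"
    "\<And>s z. s \<noteq> 0 \<Longrightarrow> g (s, z) = s powi e * poly Q z"
    unfolding graded_def by blast
  then have "f (s, z) * g (s, z) = s powi (d + e) * poly (P * Q) z" if "s \<noteq> 0" for s z
    using that by (simp add: power_int_add)
  then show ?thesis unfolding graded_def by blast
qed

lemma graded_const: "graded 0 (\<lambda>i. c)"
  unfolding graded_def by (rule exI[of _ "[:c:]"]) simp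

lemma graded_zero: "graded d (\<lambda>i. 0)"
  unfolding graded_def by (rule exI[of _ 0]) simp

lemma graded_cmult: "graded d f \<Longrightarrow> graded d (\<lambda>i. c * f i)"
  using graded_mult[OF graded_const] by simp

lemma graded_uminus: "graded d f \<Longrightarrow> graded d (\<lambda>i. - f i)"
  using graded_cmult[of d f "-1"] by simp

lemma graded_diff: "graded d f \<Longrightarrow> graded d g \<Longrightarrow> graded d (\<lambda>i. f i - g i)"
  using graded_add[OF _ graded_uminus] by force

text \<open>Total derivatives on a neighbourhood, since the partials are differentiated again and
  also restricted to the diagonal.\<close>

definition has_partials :: "(real \<times> real \<Rightarrow> real) \<Rightarrow> (real \<times> real \<Rightarrow> real) \<Rightarrow> (real \<times> real \<Rightarrow> real) \<Rightarrow> bool" where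
  "has_partials F F0 F1 \<longleftrightarrow>
     (\<forall>\<^sub>F x in nhds (0, 0). (F has_derivative (\<lambda>h. fst h * F0 x + snd h * F1 x)) (at x))"

lemma has_partials_const: "has_partials (\<lambda>x. c) (\<lambda>x. 0) (\<lambda>x. 0)"
  unfolding has_partials_def by simp

lemma has_partials_add:
  "has_partials F F0 F1 \<Longrightarrow> has_partials G G0 G1 \<Longrightarrow>
   has_partials (\<lambda>x. F x + G x) (\<lambda>x. F0 x + G0 x) (\<lambda>x. F1 x + G1 x)"
  unfolding has_partials_def
  by (erule (1) eventually_elim2) (auto intro!: derivative_eq_intros simp: algebra_simps)

lemma has_partials_mult:
  "has_partials F F0 F1 \<Longrightarrow> has_partials G G0 G1 \<Longrightarrow>
   has_partials (\<lambda>x. F x * G x) (\<lambda>x. F0 x * G x + F x * G0 x) (\<lambda>x. F1 x * G x + F x * G1 x)"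
  unfolding has_partials_def
  by (erule (1) eventually_elim2) (auto intro!: derivative_eq_intros simp: algebra_simps)

lemma has_partials_isCont: "has_partials F F0 F1 \<Longrightarrow> isCont F (0, 0)"
  unfolding has_partials_def using eventually_nhds_x_imp_x has_derivative_continuous by blast

lemma isCont_eventually_nonzero:
  fixes F :: "'a::t2_space \<Rightarrow> real"
  assumes "isCont F a" "F a \<noteq> 0"
  shows "\<forall>\<^sub>F x in nhds a. F x \<noteq> 0"
  using tendsto_imp_eventually_ne[OF assms[unfolded isCont_def]] assms(2)
  by (auto simp: eventually_nhds_conv_at)

lemma has_partials_inverse:
  assumes "has_partials F F0 F1" "F (0, 0) \<noteq> 0"
  shows "has_partials (\<lambda>x. inverse (F x)) (\<lambda>x. - (F0 x * (inverse (F x) * inverse (F x))))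
           (\<lambda>x. - (F1 x * (inverse (F x) * inverse (F x))))"
  using assms(1) isCont_eventually_nonzero[OF has_partials_isCont[OF assms(1)] assms(2)]
  unfolding has_partials_def
proof eventually_elim
  case (elim x)
  show ?case
    by (rule has_derivative_eq_rhs[OF Deriv.has_derivative_inverse[OF elim(2,1)]]) (simp add: fun_eq_iff distrib_left distrib_right mult_ac)
qed

text \<open>Gradedness concerns the values at the origin, whereas the partials exist on a
  neighbourhood that may depend on the parameter. Curves belonging to different parameters can
  therefore be chosen independently of each other.\<close>

primrec jet :: "nat \<Rightarrow> int \<Rightarrow> (real \<times> real \<Rightarrow> real \<times> real \<Rightarrow> real) \<Rightarrow> bool" where
  "jet 0 d F \<longleftrightarrow> graded d (\<lambda>i. F i (0, 0))"
| "jet (Suc n) d F \<longleftrightarrow> graded d (\<lambda>i. F i (0, 0)) \<and>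
     (\<exists>F0 F1. (\<forall>s z. s \<noteq> 0 \<longrightarrow> has_partials (F (s, z)) (F0 (s, z)) (F1 (s, z))) \<and>
              jet n (d + 1) F0 \<and> jet n (d + 1) F1)"

lemma jet_SucI:
  assumes "graded d (\<lambda>i. F i (0, 0))" "\<And>s z. s \<noteq> 0 \<Longrightarrow> has_partials (F (s, z)) (F0 (s, z)) (F1 (s, z))"
    "jet n (d + 1) F0" "jet n (d + 1) F1"
  shows "jet (Suc n) d F"
  unfolding jet.simps by (intro conjI exI[of _ F0] exI[of _ F1] allI impI) (rule assms; assumption)+

lemma jet_SucE:
  assumes "jet (Suc n) d F"
  obtains F0 F1 where "\<And>s z. s \<noteq> 0 \<Longrightarrow> has_partials (F (s, z)) (F0 (s, z)) (F1 (s, z))"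
    "jet n (d + 1) F0" "jet n (d + 1) F1"
  using assms unfolding jet.simps by blast

lemma jet_value: "jet n d F \<Longrightarrow> graded d (\<lambda>i. F i (0, 0))"
  by (cases n) auto

lemma jet_SucD: "jet (Suc n) d F \<Longrightarrow> jet n d F"
proof (induction n arbitrary: d F)
  case (Suc n)
  from jet_SucE[OF Suc.prems] obtain F0 F1
    where F: "\<And>s z. s \<noteq> 0 \<Longrightarrow> has_partials (F (s, z)) (F0 (s, z)) (F1 (s, z))"
      "jet (Suc n) (d + 1) F0" "jet (Suc n) (d + 1) F1" by metis
  show ?case
    by (rule jet_SucI[OF jet_value[OF Suc.prems] F(1) Suc.IH[OF F(2)] Suc.IH[OF F(3)]])
qed simp

lemma jet_zero: "jet n d (\<lambda>i x. 0)"
proof (induction n arbitrary: d)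
  case (Suc n)
  then show ?case
    by (intro jet_SucI[where ?F0.0="\<lambda>i x. 0" and ?F1.0="\<lambda>i x. 0"] graded_zero has_partials_const)
qed (simp add: graded_zero)

lemma jet_const: "graded d c \<Longrightarrow> jet n d (\<lambda>i x. c i)"
  using jet_SucI[where ?F0.0="\<lambda>i x. 0" and ?F1.0="\<lambda>i x. 0", OF _ has_partials_const jet_zero jet_zero]
  by (cases n) (simp_all del: jet.simps(2))

lemma jet_add: "jet n d F \<Longrightarrow> jet n d G \<Longrightarrow> jet n d (\<lambda>i x. F i x + G i x)"
proof (induction n arbitrary: d F G)
  case 0
  then show ?case by (simp add: graded_add)
next
  case (Suc n)
  obtain F0 F1 where F: "\<And>s z. s \<noteq> 0 \<Longrightarrow> has_partials (F (s, z)) (F0 (s, z)) (F1 (s, z))"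
    "jet n (d + 1) F0" "jet n (d + 1) F1" using jet_SucE[OF Suc.prems(1)] by blast
  obtain G0 G1 where G: "\<And>s z. s \<noteq> 0 \<Longrightarrow> has_partials (G (s, z)) (G0 (s, z)) (G1 (s, z))"
    "jet n (d + 1) G0" "jet n (d + 1) G1" using jet_SucE[OF Suc.prems(2)] by blast
  have "graded d (\<lambda>i. F i (0, 0) + G i (0, 0))"
    by (rule graded_add[OF jet_value[OF Suc.prems(1)] jet_value[OF Suc.prems(2)]])
  then show ?case
    by (rule jet_SucI[OF _ has_partials_add[OF F(1) G(1)] Suc.IH[OF F(2) G(2)] Suc.IH[OF F(3) G(3)]])
qed

lemma jet_mult: "jet n d F \<Longrightarrow> jet n e G \<Longrightarrow> jet n (d + e) (\<lambda>i x. F i x * G i x)"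
proof (induction n arbitrary: d e F G)
  case 0
  then show ?case by (simp add: graded_mult)
next
  case (Suc n)
  obtain F0 F1 where F: "\<And>s z. s \<noteq> 0 \<Longrightarrow> has_partials (F (s, z)) (F0 (s, z)) (F1 (s, z))"
    "jet n (d + 1) F0" "jet n (d + 1) F1" using jet_SucE[OF Suc.prems(1)] by blast
  obtain G0 G1 where G: "\<And>s z. s \<noteq> 0 \<Longrightarrow> has_partials (G (s, z)) (G0 (s, z)) (G1 (s, z))"
    "jet n (e + 1) G0" "jet n (e + 1) G1" using jet_SucE[OF Suc.prems(2)] by blast
  have jF: "jet n d F" and jG: "jet n e G" using Suc.prems jet_SucD by blast+
  have 0: "jet n (d + e + 1) (\<lambda>i x. F0 i x * G i x + F i x * G0 i x)"
    using jet_add[OF Suc.IH[OF F(2) jG], of "\<lambda>i x. F i x * G0 i x"] Suc.IH[OF jF G(2)]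
    by (simp add: ac_simps)
  have 1: "jet n (d + e + 1) (\<lambda>i x. F1 i x * G i x + F i x * G1 i x)"
    using jet_add[OF Suc.IH[OF F(3) jG], of "\<lambda>i x. F i x * G1 i x"] Suc.IH[OF jF G(3)]
    by (simp add: ac_simps)
  have 2: "graded (d + e) (\<lambda>i. F i (0, 0) * G i (0, 0))"
    by (rule graded_mult[OF jet_value[OF Suc.prems(1)] jet_value[OF Suc.prems(2)]])
  show ?case
    by (rule jet_SucI[OF 2 has_partials_mult[OF F(1) G(1)] 0 1])
qed

lemma jet_cmult: "jet n d F \<Longrightarrow> jet n d (\<lambda>i x. c * F i x)"
  using jet_mult[of n 0 "\<lambda>i x. c" d F] jet_const[OF graded_const] by simp

lemma jet_uminus: "jet n d F \<Longrightarrow> jet n d (\<lambda>i x. - F i x)"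
  using jet_cmult[of n d F "-1"] by simp

lemma jet_sum: "(\<And>j. j \<in> J \<Longrightarrow> jet n d (F j)) \<Longrightarrow> jet n d (\<lambda>i x. \<Sum>j\<in>J. F j i x)"
  by (induction J rule: infinite_finite_induct) (auto intro: jet_zero jet_add)

lemma jet_prod: "(\<And>j. j \<in> J \<Longrightarrow> jet n (d j) (F j)) \<Longrightarrow> jet n (\<Sum>j\<in>J. d j) (\<lambda>i x. \<Prod>j\<in>J. F j i x)"
  by (induction J rule: infinite_finite_induct) (auto intro: jet_const graded_const jet_mult)

text \<open>The reciprocal of a polynomial in \<open>z\<close> is in general not a polynomial, so
  gradedness of the reciprocal value at the origin is assumed. The derivatives then follow, because
  each partial of the inverse is a partial of \<open>F\<close> times a power of the inverse.\<close>

lemma jet_inverse: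
  assumes "\<And>s z. s \<noteq> 0 \<Longrightarrow> F (s, z) (0, 0) \<noteq> 0" "graded (- d) (\<lambda>i. inverse (F i (0, 0)))" "jet n d F"
  shows "jet n (- d) (\<lambda>i x. inverse (F i x))"
  using assms(3)
proof (induction n)
  case 0
  then show ?case using assms by simp
next
  case (Suc n)
  obtain F0 F1 where F: "\<And>s z. s \<noteq> 0 \<Longrightarrow> has_partials (F (s, z)) (F0 (s, z)) (F1 (s, z))"
    "jet n (d + 1) F0" "jet n (d + 1) F1" using jet_SucE[OF Suc.prems(1)] by blast
  have I: "jet n (- d) (\<lambda>i x. inverse (F i x))" using Suc jet_SucD by blast
  have J: "jet n (- d + 1) (\<lambda>i x. - (K i x * (inverse (F i x) * inverse (F i x))))"
    if "jet n (d + 1) K" for K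
    using jet_uminus[OF jet_mult[OF that jet_mult[OF I I]]] by simp
  show ?case
    by (rule jet_SucI[OF assms(2) has_partials_inverse[OF F(1) assms(1)] J[OF F(2)] J[OF F(3)]])
qed

section \<open>Curves given with all their derivatives, and their integral averages\<close>

definition tower :: "(nat \<Rightarrow> real \<Rightarrow> 'a::real_normed_vector) \<Rightarrow> bool" where
  "tower w \<longleftrightarrow> (\<exists>e>0. \<forall>k t. \<bar>t\<bar> < e \<longrightarrow> (w k has_vector_derivative w (Suc k) t) (at t))"

lemma eventually_nhds_origin:
  "(\<forall>\<^sub>F x in nhds (0::real, 0::real). P x) \<longleftrightarrow> (\<exists>e>0. \<forall>x y. \<bar>x\<bar> < e \<longrightarrow> \<bar>y\<bar> < e \<longrightarrow> P (x, y))"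
proof
  assume "\<forall>\<^sub>F x in nhds (0::real, 0::real). P x"
  then obtain e where e: "e > 0" "\<And>x. dist x (0, 0) < e \<Longrightarrow> P x"
    unfolding eventually_nhds_metric by blast
  have "P (x, y)" if "\<bar>x\<bar> < e / 2" "\<bar>y\<bar> < e / 2" for x y
  proof (rule e(2))
    have "dist (x, y) (0, 0) \<le> \<bar>x\<bar> + \<bar>y\<bar>"
      by (simp add: dist_Pair_Pair sqrt_sum_squares_le_sum_abs)
    then show "dist (x, y) (0, 0) < e" using that by simp
  qed
  then show "\<exists>e>0. \<forall>x y. \<bar>x\<bar> < e \<longrightarrow> \<bar>y\<bar> < e \<longrightarrow> P (x, y)"
    using e(1) by (intro exI[of _ "e/2"]) auto
next
  assume "\<exists>e>0. \<forall>x y. \<bar>x\<bar> < e \<longrightarrow> \<bar>y\<bar> < e \<longrightarrow> P (x, y)"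
  then obtain e where e: "e > 0" "\<And>x y. \<bar>x\<bar> < e \<Longrightarrow> \<bar>y\<bar> < e \<Longrightarrow> P (x, y)" by blast
  show "\<forall>\<^sub>F x in nhds (0::real, 0::real). P x"
    unfolding eventually_nhds_metric
  proof (intro exI conjI allI impI)
    fix x :: "real \<times> real" assume "dist x (0, 0) < e"
    then have "\<bar>fst x\<bar> < e" "\<bar>snd x\<bar> < e"
      using dist_fst_le[of x "(0,0)"] dist_snd_le[of x "(0,0)"] by (auto simp: dist_real_def)
    then show "P x" using e(2)[of "fst x" "snd x"] by simp
  qed (rule e(1))
qed

lemma segment_bound_abs:
  fixes x y \<tau> e :: real
  assumes "\<bar>x\<bar> < e" "\<bar>y\<bar> < e" "0 \<le> \<tau>" "\<tau> \<le> 1"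
  shows "\<bar>x + \<tau> * (y - x)\<bar> < e"
proof -
  have "x + \<tau> * (y - x) = (1 - \<tau>) * x + \<tau> * y" by (simp add: algebra_simps)
  moreover have "\<dots> \<in> {-e<..<e}"
    using convexD[of "{-e<..<e}" x y "1 - \<tau>" \<tau>] assms by (simp add: abs_less_iff)
  ultimately show ?thesis by (simp add: abs_less_iff)
qed

text \<open>Differentiation under the integral sign on a square around the origin; the chain rule
  contributes \<open>1 - \<tau>\<close> for the first endpoint and \<open>\<tau>\<close> for the
  second. Integral averages, unlike difference quotients, remain differentiable across the diagonal
  without a separate argument.\<close>

lemma tower_integral_has_partials:
  fixes w :: "nat \<Rightarrow> real \<Rightarrow> real"
  assumes "tower w" and q: "continuous_on {0..1} q"
  shows "has_partials (\<lambda>x. integral {0..1} (\<lambda>\<tau>. q \<tau> * w k (fst x + \<tau> * (snd x - fst x))))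
           (\<lambda>x. integral {0..1} (\<lambda>\<tau>. (q \<tau> * (1 - \<tau>)) * w (Suc k) (fst x + \<tau> * (snd x - fst x))))
           (\<lambda>x. integral {0..1} (\<lambda>\<tau>. (q \<tau> * \<tau>) * w (Suc k) (fst x + \<tau> * (snd x - fst x))))"
proof -
  obtain e where e: "e > 0" "\<And>k t. \<bar>t\<bar> < e \<Longrightarrow> (w k has_vector_derivative w (Suc k) t) (at t)"
    using assms(1) unfolding tower_def by blast
  let ?U = "ball (0::real) e \<times> ball (0::real) e"
  have wc: "continuous_on (ball 0 e) (w k)" for k
    using e(2) by (intro continuous_at_imp_continuous_on ballI has_vector_derivative_continuous) (auto simp: dist_real_def)
  have inb: "fst x + \<tau> * (snd x - fst x) \<in> ball 0 e" if "x \<in> ?U" "\<tau> \<in> {0..1}" for x \<tau>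
    using segment_bound_abs[of "fst x" e "snd x" \<tau>] that by (auto simp: dist_real_def)
  have cw: "continuous_on (?U \<times> {0..1}) (\<lambda>y. w k (fst (fst y) + snd y * (snd (fst y) - fst (fst y))))" for k
    by (rule continuous_on_compose2[OF wc]) (use inb in \<open>fastforce intro!: continuous_intros\<close>)+
  have cq: "continuous_on (?U \<times> {0..1}) (\<lambda>y. q (snd y))"
    by (rule continuous_on_compose2[OF q]) (auto intro!: continuous_intros)
  have cws: "continuous_on {0..1} (\<lambda>\<tau>. w k (fst x + \<tau> * (snd x - fst x)))" if "x \<in> ?U" for x k
    by (rule continuous_on_compose2[OF wc]) (use inb[OF that] in \<open>auto intro!: continuous_intros\<close>)
  have "((\<lambda>x. integral {0..1} (\<lambda>\<tau>. q \<tau> * w k (fst x + \<tau> * (snd x - fst x)))) has_derivative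
      (\<lambda>h. fst h * integral {0..1} (\<lambda>\<tau>. (q \<tau> * (1 - \<tau>)) * w (Suc k) (fst x + \<tau> * (snd x - fst x))) +
           snd h * integral {0..1} (\<lambda>\<tau>. (q \<tau> * \<tau>) * w (Suc k) (fst x + \<tau> * (snd x - fst x))))) (at x)"
    if x: "x \<in> ?U" for x
  proof -
    let ?a = "\<lambda>x \<tau>. (q \<tau> * (1 - \<tau>)) * w (Suc k) (fst x + \<tau> * (snd x - fst x))"
    let ?b = "\<lambda>x \<tau>. (q \<tau> * \<tau>) * w (Suc k) (fst x + \<tau> * (snd x - fst x))"
    let ?fx = "\<lambda>x \<tau>. ?a x \<tau> *\<^sub>R (fst_blinfun :: (real \<times> real) \<Rightarrow>\<^sub>L real) + ?b x \<tau> *\<^sub>R snd_blinfun"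
    have D: "((\<lambda>x. integral (cbox 0 1) (\<lambda>\<tau>. q \<tau> * w k (fst x + \<tau> * (snd x - fst x)))) has_derivative
      blinfun_apply (integral (cbox 0 1) (?fx x))) (at x within ?U)"
    proof (rule leibniz_rule)
      fix y \<tau> assume y: "y \<in> ?U" and \<tau>: "\<tau> \<in> cbox (0::real) 1"
      have "(w k has_derivative (\<lambda>h. h * w (Suc k) (fst y + \<tau> * (snd y - fst y)))) (at (fst y + \<tau> * (snd y - fst y)))"
        using e(2) inb[OF y, of \<tau>] \<tau> by (simp add: has_vector_derivative_def dist_real_def)
      moreover have "((\<lambda>y. fst y + \<tau> * (snd y - fst y)) has_derivative (\<lambda>h. fst h + \<tau> * (snd h - fst h))) (at y within ?U)"
        by (auto intro!: derivative_eq_intros)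
      ultimately have "((\<lambda>y. w k (fst y + \<tau> * (snd y - fst y))) has_derivative
          (\<lambda>h. (fst h + \<tau> * (snd h - fst h)) * w (Suc k) (fst y + \<tau> * (snd y - fst y)))) (at y within ?U)"
        by (rule has_derivative_compose[rotated])
      from has_derivative_mult_right[OF this, of "q \<tau>"]
      show "((\<lambda>x. q \<tau> * w k (fst x + \<tau> * (snd x - fst x))) has_derivative blinfun_apply (?fx y \<tau>)) (at y within ?U)"
        by (rule has_derivative_eq_rhs) (auto simp: blinfun.bilinear_simps algebra_simps)
    next
      show "(\<lambda>\<tau>. q \<tau> * w k (fst y + \<tau> * (snd y - fst y))) integrable_on cbox 0 1" if "y \<in> ?U" for y
        using cws[OF that, of k] q by (intro integrable_continuous) (auto intro!: continuous_intros)
      show "continuous_on (?U \<times> cbox 0 1) (\<lambda>(x, \<tau>). ?fx x \<tau>)"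
        using cw[of "Suc k"] cq by (auto simp: split_beta intro!: continuous_intros)
      show "convex ?U" by (intro convex_Times convex_ball)
    qed (rule x)
    have "(?a x has_integral integral {0..1} (?a x)) {0..1}" "(?b x has_integral integral {0..1} (?b x)) {0..1}"
      using cws[OF x, of "Suc k"] q
      by (auto intro!: integrable_integral integrable_continuous_real continuous_intros)
    then have "(?fx x has_integral integral {0..1} (?a x) *\<^sub>R fst_blinfun + integral {0..1} (?b x) *\<^sub>R snd_blinfun) {0..1}"
      by (intro has_integral_add has_integral_scaleR_left)
    then have I: "integral (cbox 0 1) (?fx x) = integral {0..1} (?a x) *\<^sub>R fst_blinfun + integral {0..1} (?b x) *\<^sub>R snd_blinfun"
      by (simp add: integral_unique)
    have "(at x within ?U) = at x" using x by (intro at_within_open open_Times open_ball)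
    then have "((\<lambda>x. integral {0..1} (\<lambda>\<tau>. q \<tau> * w k (fst x + \<tau> * (snd x - fst x)))) has_derivative
        blinfun_apply (integral {0..1} (?a x) *\<^sub>R fst_blinfun + integral {0..1} (?b x) *\<^sub>R snd_blinfun)) (at x)"
      using D I by (simp add: cbox_interval)
    then show ?thesis
      by (rule has_derivative_eq_rhs) (simp add: fun_eq_iff blinfun.bilinear_simps mult.commute)
  qed
  then show ?thesis
    unfolding has_partials_def eventually_nhds_origin using e(1) by (intro exI[of _ e]) (auto simp: dist_real_def)
qed

text \<open>The weight \<open>q\<close> is arbitrary so that the family is closed under partial
  derivatives, which multiply \<open>q\<close> by \<open>1 - \<tau>\<close> or \<open>\<tau>\<close>
  and raise \<open>k\<close>. At the origin the curve is evaluated at time 0 throughout, so the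
  value is a fixed multiple of \<open>w i k 0\<close>.\<close>

lemma jet_integral:
  fixes w :: "real \<times> real \<Rightarrow> nat \<Rightarrow> real \<Rightarrow> real"
  assumes "\<And>s z. s \<noteq> 0 \<Longrightarrow> tower (w (s, z))" "\<And>k. graded (d + int k) (\<lambda>i. w i k 0)"
    and "continuous_on {0..1} q"
  shows "jet n (d + int k) (\<lambda>i x. integral {0..1} (\<lambda>\<tau>. q \<tau> * w i k (fst x + \<tau> * (snd x - fst x))))"
  using assms(3)
proof (induction n arbitrary: q k)
  case 0
  then show ?case using graded_cmult[OF assms(2), where c="integral {0..1} q"] by simp
next
  case (Suc n)
  have 1: "graded (d + int k) (\<lambda>i. integral {0..1} (\<lambda>\<tau>. q \<tau> * w i k (fst (0::real,0::real) + \<tau> * (snd (0::real,0::real) - fst (0::real,0::real)))))"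
    using graded_cmult[OF assms(2), where c="integral {0..1} q"] by simp
  have 2: "jet n (d + int k + 1) (\<lambda>i x. integral {0..1} (\<lambda>\<tau>. (q \<tau> * (1 - \<tau>)) * w i (Suc k) (fst x + \<tau> * (snd x - fst x))))"
    using Suc.IH[of "\<lambda>\<tau>. q \<tau> * (1 - \<tau>)" "Suc k"] continuous_on_mult[OF Suc.prems, of "\<lambda>\<tau>. (1 - \<tau>)"]
    by (simp add: ac_simps continuous_intros)
  have 3: "jet n (d + int k + 1) (\<lambda>i x. integral {0..1} (\<lambda>\<tau>. (q \<tau> * \<tau>) * w i (Suc k) (fst x + \<tau> * (snd x - fst x))))"
    using Suc.IH[of "\<lambda>\<tau>. q \<tau> * \<tau>" "Suc k"] continuous_on_mult[OF Suc.prems, of "\<lambda>\<tau>. \<tau>"]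
    by (simp add: ac_simps continuous_intros)
  show ?case
    by (rule jet_SucI[OF 1 tower_integral_has_partials[OF assms(1) Suc.prems] 2 3])
qed

lemma jet_fst:
  fixes w :: "real \<times> real \<Rightarrow> nat \<Rightarrow> real \<Rightarrow> real"
  assumes "\<And>s z. s \<noteq> 0 \<Longrightarrow> tower (w (s, z))" "\<And>k. graded (d + int k) (\<lambda>i. w i k 0)"
  shows "jet n (d + int k) (\<lambda>i x. w i k (fst x))"
proof (induction n arbitrary: k)
  case 0
  then show ?case using assms(2) by simp
next
  case (Suc n)
  have "has_partials (\<lambda>x. w (s, z) k (fst x)) (\<lambda>x. w (s, z) (Suc k) (fst x)) (\<lambda>x. 0)" if s: "s \<noteq> 0" for s z
  proof -
    obtain e where e: "e > 0" "\<And>k t. \<bar>t\<bar> < e \<Longrightarrow> (w (s, z) k has_vector_derivative w (s, z) (Suc k) t) (at t)"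
      using assms(1)[OF s] unfolding tower_def by blast
    have "((\<lambda>x. w (s, z) k (fst x)) has_derivative (\<lambda>h. fst h * w (s, z) (Suc k) (fst x))) (at x)"
      if "\<bar>fst x\<bar> < e" for x :: "real \<times> real"
    proof -
      have "(w (s, z) k has_derivative (\<lambda>h. h * w (s, z) (Suc k) (fst x))) (at (fst x))"
        using e(2)[OF that] by (simp add: has_vector_derivative_def)
      from has_derivative_compose[OF bounded_linear_imp_has_derivative[OF bounded_linear_fst] this]
      show ?thesis .
    qed
    then show ?thesis unfolding has_partials_def eventually_nhds_origin using e(1) by auto
  qed
  then show ?case
    using assms(2)[of k] Suc.IH[of "Suc k"] jet_zero[of n "d + int k + 1"]
    by (intro jet_SucI[where ?F0.0="\<lambda>i x. w i (Suc k) (fst x)" and ?F1.0="\<lambda>i x. 0"]) (simp_all add: ac_simps)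
qed

text \<open>An entry in row \<open>a\<close> and column \<open>b\<close> has degree
  \<open>r a - r b\<close>. Along any permutation these degrees sum to zero, so every term of the
  Leibniz formula has degree 0.\<close>

lemma jet_det:
  fixes A :: "real \<times> real \<Rightarrow> real \<times> real \<Rightarrow> real^'n^'n"
  assumes "\<And>a b. jet n (r a - r b) (\<lambda>i x. A i x $ a $ b)"
  shows "jet n 0 (\<lambda>i x. det (A i x))"
  unfolding det_def
proof (intro jet_sum jet_cmult)
  fix p assume "p \<in> {p. p permutes (UNIV :: 'n set)}"
  then have "(\<Sum>a\<in>UNIV. r (p a)) = sum r UNIV"
    using sum.permute[of p UNIV r] by (simp add: o_def)
  then have "(\<Sum>a\<in>UNIV. r a - r (p a)) = 0" by (simp add: sum_subtractf)
  then show "jet n 0 (\<lambda>i x. \<Prod>a\<in>UNIV. A i x $ a $ p a)"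
    using jet_prod[of UNIV n "\<lambda>a. r a - r (p a)" "\<lambda>a i x. A i x $ a $ p a"] assms by simp
qed

section \<open>The density of the fundamental form of a curve of planes\<close>

definition vec4 :: "(real^2) \<times> (real^2) \<Rightarrow> real^4" where
  "vec4 v = (\<chi> i. if i = 1 then fst v $ 1 else if i = 2 then fst v $ 2 else if i = 3 then snd v $ 1 else snd v $ 2)"

definition vec4_inv :: "real^4 \<Rightarrow> (real^2) \<times> (real^2)" where
  "vec4_inv u = (vector [u $ 1, u $ 2], vector [u $ 3, u $ 4])"

lemma vec4_nth [simp]:
  "vec4 v $ 1 = fst v $ 1" "vec4 v $ 2 = fst v $ 2" "vec4 v $ 3 = snd v $ 1" "vec4 v $ 4 = snd v $ 2"
  by (simp_all add: vec4_def)

lemma vec4_vec4_inv [simp]: "vec4 (vec4_inv u) = u"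
  by (simp add: vec_eq_iff forall_4 vec4_inv_def)

lemma vec4_inv_vec4 [simp]: "vec4_inv (vec4 v) = v"
  by (cases v) (simp add: vec_eq_iff forall_2 vec4_inv_def)

lemma linear_vec4: "linear vec4"
  by (rule linearI) (simp_all add: vec_eq_iff forall_4)

lemma linear_vec4_inv: "linear vec4_inv"
  by (rule linearI) (simp_all add: vec4_inv_def vec_eq_iff forall_2)

definition vol :: "real^4 \<Rightarrow> real^4 \<Rightarrow> real^4 \<Rightarrow> real^4 \<Rightarrow> real" where
  "vol a b c d = det (\<chi> i. if i = 1 then a else if i = 2 then b else if i = 3 then c else d)"

definition area :: "real^2 \<Rightarrow> real^2 \<Rightarrow> real" where
  "area x y = x $ 1 * y $ 2 - x $ 2 * y $ 1"

text \<open>Laplace expansion along the first two rows, with complementary two-by-two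
  minors.\<close>

lemma det_4:
  "det (A::'a::comm_ring_1^4^4) =
     (A$1$1 * A$2$2 - A$1$2 * A$2$1) * (A$3$3 * A$4$4 - A$3$4 * A$4$3)
   - (A$1$1 * A$2$3 - A$1$3 * A$2$1) * (A$3$2 * A$4$4 - A$3$4 * A$4$2)
   + (A$1$1 * A$2$4 - A$1$4 * A$2$1) * (A$3$2 * A$4$3 - A$3$3 * A$4$2)
   + (A$1$2 * A$2$3 - A$1$3 * A$2$2) * (A$3$1 * A$4$4 - A$3$4 * A$4$1)
   - (A$1$2 * A$2$4 - A$1$4 * A$2$2) * (A$3$1 * A$4$3 - A$3$3 * A$4$1)
   + (A$1$3 * A$2$4 - A$1$4 * A$2$3) * (A$3$1 * A$4$2 - A$3$2 * A$4$1)"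
proof -
  have f1: "finite {2::4, 3, 4}" "1 \<notin> {2::4, 3, 4}" by auto
  have f2: "finite {3::4, 4}" "2 \<notin> {3::4, 4}" by auto
  have f3: "finite {4::4}" "3 \<notin> {4::4}" by auto
  show ?thesis
    unfolding det_def UNIV_4
    unfolding sum_over_permutations_insert[OF f1]
    unfolding sum_over_permutations_insert[OF f2]
    unfolding sum_over_permutations_insert[OF f3]
    unfolding permutes_sing
    by (simp add: sign_swap_id permutation_swap_id permutation_compose sign_compose sign_id swap_id_eq algebra_simps)
qed

lemma vol_expand:
  "vol a b c d =
     (a$1 * b$2 - a$2 * b$1) * (c$3 * d$4 - c$4 * d$3)
   - (a$1 * b$3 - a$3 * b$1) * (c$2 * d$4 - c$4 * d$2)
   + (a$1 * b$4 - a$4 * b$1) * (c$2 * d$3 - c$3 * d$2)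
   + (a$2 * b$3 - a$3 * b$2) * (c$1 * d$4 - c$4 * d$1)
   - (a$2 * b$4 - a$4 * b$2) * (c$1 * d$3 - c$3 * d$1)
   + (a$3 * b$4 - a$4 * b$3) * (c$1 * d$2 - c$2 * d$1)"
  unfolding vol_def det_4 by simp

text \<open>Subtracting \<open>S\<close> applied to the upper half from the lower half is a
  coordinate change of determinant 1. It kills the lower halves of \<open>a\<close> and
  \<open>b\<close>, and the determinant becomes block triangular.\<close>

lemma vol_graph:
  assumes "snd a = S *v fst a" "snd b = S *v fst b"
  shows "vol (vec4 a) (vec4 b) (vec4 c) (vec4 d) =
     area (fst a) (fst b) * area (snd c - S *v fst c) (snd d - S *v fst d)"
proof -
  have s: "snd a $ i = S $ i $ 1 * fst a $ 1 + S $ i $ 2 * fst a $ 2"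
    "snd b $ i = S $ i $ 1 * fst b $ 1 + S $ i $ 2 * fst b $ 2" for i
    using assms by (simp_all add: matrix_vector_mult_def sum_2)
  show ?thesis
    unfolding vol_expand area_def vec4_nth s
    by (simp add: matrix_vector_mult_def sum_2) algebra
qed

text \<open>Replaces the determinant of a difference of matrices by the volume of vectors spanning
  the two planes. The two areas account for the choice of these vectors; the order of
  \<open>S\<close> and \<open>S'\<close> does not affect the sign because the matrices are
  two-by-two.\<close>

lemma vol_graphs:
  assumes "snd a = S *v fst a" "snd b = S *v fst b" "snd c = S' *v fst c" "snd d = S' *v fst d"
  shows "vol (vec4 a) (vec4 b) (vec4 c) (vec4 d) = area (fst a) (fst b) * area (fst c) (fst d) * det (S - S')"
proof -
  have "area (snd c - S *v fst c) (snd d - S *v fst d) = area (fst c) (fst d) * det (S - S')"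
    unfolding area_def assms(3,4) det_2 by (simp add: matrix_vector_mult_def sum_2) algebra
  then show ?thesis using vol_graph[OF assms(1,2)] by simp
qed

text \<open>The source of the weight 4: modulo \<open>a\<close> and \<open>b\<close> the third
  vector is \<open>s\<^sup>2 r\<close>, and modulo \<open>b\<close> and \<open>r\<close> the fourth
  is \<open>s\<^sup>2 q\<close>.\<close>

lemma vol_Taylor:
  "vol a b (a + s *\<^sub>R b + s\<^sup>2 *\<^sub>R r) (b + (2 * s) *\<^sub>R r + s\<^sup>2 *\<^sub>R q) = s ^ 4 * vol a b r q"
proof -
  have 1: "vol a b (a + s *\<^sub>R b + t *\<^sub>R r) d = t * vol a b r d" for t d
    unfolding vol_expand vector_add_component vector_scaleR_component real_scaleR_def by algebra
  have 2: "vol a b r (b + p *\<^sub>R r + t *\<^sub>R q) = t * vol a b r q" for p t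
    unfolding vol_expand vector_add_component vector_scaleR_component real_scaleR_def by algebra
  show ?thesis unfolding 1 2 by algebra
qed

text \<open>The factor is the determinant of \<open>M\<close> in the coordinates
  \<open>vec4\<close>; surjectivity keeps it from vanishing.\<close>

lemma vol_linear:
  assumes "linear M" "surj M"
  obtains \<delta> where "\<delta> \<noteq> 0"
    "\<And>a b c d. vol (vec4 (M a)) (vec4 (M b)) (vec4 (M c)) (vec4 (M d)) = \<delta> * vol (vec4 a) (vec4 b) (vec4 c) (vec4 d)"
proof -
  define N :: "real^4^4" where "N = (\<chi> i j. vec4 (M (vec4_inv (axis i 1))) $ j)"
  have Ma: "vec4 (M a) $ j = (\<Sum>i\<in>UNIV. vec4 a $ i * N $ i $ j)" for a j
  proof -
    have lin: "linear (\<lambda>u. vec4 (M (vec4_inv u)))"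
      using linear_compose[OF linear_compose[OF linear_vec4_inv assms(1)] linear_vec4] by (simp add: o_def)
    have e: "vec4 a = (\<Sum>i\<in>UNIV. vec4 a $ i *\<^sub>R axis i 1)"
      using basis_expansion[of "vec4 a"] by (simp add: scalar_mult_eq_scaleR)
    have l: "vec4 (M (vec4_inv (\<Sum>i\<in>UNIV. c i *\<^sub>R axis i 1))) = (\<Sum>i\<in>UNIV. c i *\<^sub>R vec4 (M (vec4_inv (axis i 1))))"
      for c :: "4 \<Rightarrow> real"
      by (simp add: linear_sum[OF lin] linear_cmul[OF lin])
    have "vec4 (M (vec4_inv (vec4 a))) = (\<Sum>i\<in>UNIV. vec4 a $ i *\<^sub>R vec4 (M (vec4_inv (axis i 1))))"
      using l[of "\<lambda>i. vec4 a $ i"] unfolding e[symmetric] .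
    then show ?thesis by (simp add: N_def)
  qed
  have eq: "vol (vec4 (M a)) (vec4 (M b)) (vec4 (M c)) (vec4 (M d)) = det N * vol (vec4 a) (vec4 b) (vec4 c) (vec4 d)" for a b c d
  proof -
    have "(\<chi> i. if i = 1 then vec4 (M a) else if i = 2 then vec4 (M b) else if i = 3 then vec4 (M c) else vec4 (M d)) =
      ((\<chi> i. if i = 1 then vec4 a else if i = 2 then vec4 b else if i = 3 then vec4 c else vec4 d) :: real^4^4) ** N"
      by (simp add: vec_eq_iff matrix_matrix_mult_def Ma)
    then show ?thesis unfolding vol_def by (simp add: det_mul)
  qed
  have "det N \<noteq> 0"
  proof
    assume "det N = 0"
    have "vol (axis 1 1) (axis 2 1) (axis 3 1) (axis 4 1) = 0"
      using eq[of "inv M (vec4_inv (axis 1 1))" "inv M (vec4_inv (axis 2 1))" "inv M (vec4_inv (axis 3 1))" "inv M (vec4_inv (axis 4 1))"]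
      unfolding surj_f_inv_f[OF assms(2)] vec4_vec4_inv \<open>det N = 0\<close> by simp
    then show False by (simp add: vol_expand axis_def)
  qed
  then show ?thesis using eq that by blast
qed

text \<open>By Taylor's formula with integral remainder, this is the determinant of the planes of the
  curve at two times divided by the 4th power of the time difference.\<close>

definition curve_det :: "(nat \<Rightarrow> real \<Rightarrow> (real^2) \<times> (real^2)) \<Rightarrow> real \<times> real \<Rightarrow> real" where
  "curve_det v x = vol (vec4 (v 0 (fst x))) (vec4 (v 1 (fst x)))
     (\<chi> j. integral {0..1} (\<lambda>\<tau>. (1 - \<tau>) * vec4 (v 2 (fst x + \<tau> * (snd x - fst x))) $ j))
     (\<chi> j. integral {0..1} (\<lambda>\<tau>. (\<tau> - \<tau>\<^sup>2) * vec4 (v 3 (fst x + \<tau> * (snd x - fst x))) $ j))"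

lemma tower_component:
  assumes "tower v"
  shows "tower (\<lambda>k t. vec4 (v k t) $ j)"
proof -
  have "bounded_linear (\<lambda>v. vec4 v $ j)"
    using bounded_linear_compose[OF bounded_linear_vec_nth linear_conv_bounded_linear[THEN iffD1, OF linear_vec4]] .
  note has_vector_derivative = bounded_linear.has_vector_derivative[OF this]
  obtain e where "e > 0" "\<And>k t. \<bar>t\<bar> < e \<Longrightarrow> (v k has_vector_derivative v (Suc k) t) (at t)"
    using assms unfolding tower_def by blast
  then show ?thesis
    unfolding tower_def by (intro exI[of _ e] conjI allI impI has_vector_derivative) auto
qed

text \<open>The second formula is the expansion of \<open>w 1\<close> in which the first order term
  is expressed through the remainder of the first formula. This is the shape that
  \<open>vol_Taylor\<close> expects: the same vector \<open>r\<close> must occur in both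
  expansions.\<close>

lemma tower_Taylor:
  fixes w :: "nat \<Rightarrow> real \<Rightarrow> real"
  assumes "\<And>k t. \<bar>t\<bar> < e \<Longrightarrow> (w k has_vector_derivative w (Suc k) t) (at t)" "\<bar>x\<bar> < e" "\<bar>y\<bar> < e"
  shows "w 0 y = w 0 x + (y - x) * w 1 x + (y - x)\<^sup>2 * integral {0..1} (\<lambda>\<tau>. (1 - \<tau>) * w 2 (x + \<tau> * (y - x)))"
    and "(y - x) * (w 1 y - w 1 x) = 2 * (w 0 y - w 0 x - (y - x) * w 1 x) +
           (y - x) ^ 3 * integral {0..1} (\<lambda>\<tau>. (\<tau> - \<tau>\<^sup>2) * w 3 (x + \<tau> * (y - x)))"
proof -
  define s where "s = y - x"
  have xs: "x + s = y" by (simp add: s_def)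
  have dw: "((\<lambda>\<tau>. w k (x + \<tau> * s)) has_real_derivative s * w (Suc k) (x + \<tau> * s)) (at \<tau> within {0..1})"
    if "\<tau> \<in> {0..1}" for k \<tau>
  proof -
    have "(w k has_real_derivative w (Suc k) (x + \<tau> * s)) (at (x + \<tau> * s))"
      using assms(1) segment_bound_abs[of x e y \<tau>] assms(2,3) that
      by (simp add: s_def has_real_derivative_iff_has_vector_derivative)
    moreover have "((\<lambda>\<tau>. x + \<tau> * s) has_real_derivative s) (at \<tau> within {0..1})"
      by (auto intro!: derivative_eq_intros)
    ultimately have "((\<lambda>\<tau>. w k (x + \<tau> * s)) has_real_derivative w (Suc k) (x + \<tau> * s) * s) (at \<tau> within {0..1})"
      by (rule DERIV_chain2)
    then show ?thesis by (simp add: mult.commute)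
  qed
  have "((\<lambda>\<tau>. s\<^sup>2 * ((1 - \<tau>) * w 2 (x + \<tau> * s))) has_integral
      (\<lambda>\<tau>. w 0 (x + \<tau> * s) + (1 - \<tau>) * s * w 1 (x + \<tau> * s)) 1 - (\<lambda>\<tau>. w 0 (x + \<tau> * s) + (1 - \<tau>) * s * w 1 (x + \<tau> * s)) 0) {0..1}"
  proof (rule fundamental_theorem_of_calculus)
    fix \<tau> :: real assume t: "\<tau> \<in> {0..1}"
    have "((\<lambda>\<tau>. w 0 (x + \<tau> * s) + (1 - \<tau>) * s * w 1 (x + \<tau> * s)) has_real_derivative
       s * w (Suc 0) (x + \<tau> * s) + ((- 1) * s * w 1 (x + \<tau> * s) + (1 - \<tau>) * s * (s * w (Suc 1) (x + \<tau> * s)))) (at \<tau> within {0..1})"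
      by (rule derivative_eq_intros dw[OF t] refl)+ (simp add: algebra_simps)
    then show "((\<lambda>\<tau>. w 0 (x + \<tau> * s) + (1 - \<tau>) * s * w 1 (x + \<tau> * s)) has_vector_derivative
       s\<^sup>2 * ((1 - \<tau>) * w 2 (x + \<tau> * s))) (at \<tau> within {0..1})"
      by (simp add: has_real_derivative_iff_has_vector_derivative[symmetric] power2_eq_square numeral_2_eq_2 algebra_simps)
  qed simp
  from integral_unique[OF this, unfolded integral_mult_right]
  have 1: "s\<^sup>2 * integral {0..1} (\<lambda>\<tau>. (1 - \<tau>) * w 2 (x + \<tau> * s)) = w 0 y - w 0 x - s * w 1 x"
    by (simp add: xs)
  then show "w 0 y = w 0 x + (y - x) * w 1 x + (y - x)\<^sup>2 * integral {0..1} (\<lambda>\<tau>. (1 - \<tau>) * w 2 (x + \<tau> * (y - x)))"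
    by (simp add: s_def)
  \<comment> \<open>An antiderivative found by integrating by parts; the kernel
    \<open>\<tau> - \<tau>\<^sup>2\<close> vanishes at both ends, so no boundary value of
    \<open>w 2\<close> survives.\<close>
  let ?H = "\<lambda>\<tau>. s\<^sup>2 * (\<tau> - \<tau>\<^sup>2) * w 2 (x + \<tau> * s) - s * (1 - 2 * \<tau>) * w 1 (x + \<tau> * s) - 2 * w 0 (x + \<tau> * s)"
  have "((\<lambda>\<tau>. s ^ 3 * ((\<tau> - \<tau>\<^sup>2) * w 3 (x + \<tau> * s))) has_integral ?H 1 - ?H 0) {0..1}"
  proof (rule fundamental_theorem_of_calculus)
    fix \<tau> :: real assume t: "\<tau> \<in> {0..1}"
    have "(?H has_real_derivative
       s\<^sup>2 * (1 - 2 * \<tau>) * w 2 (x + \<tau> * s) + s\<^sup>2 * (\<tau> - \<tau>\<^sup>2) * (s * w (Suc 2) (x + \<tau> * s))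
       - (- 2 * s * w 1 (x + \<tau> * s) + s * (1 - 2 * \<tau>) * (s * w (Suc 1) (x + \<tau> * s)))
       - 2 * (s * w (Suc 0) (x + \<tau> * s))) (at \<tau> within {0..1})"
      by (rule derivative_eq_intros dw[OF t] refl)+ (simp add: algebra_simps)
    moreover have "s\<^sup>2 * (1 - 2 * \<tau>) * w 2 (x + \<tau> * s) + s\<^sup>2 * (\<tau> - \<tau>\<^sup>2) * (s * w (Suc 2) (x + \<tau> * s))
       - (- 2 * s * w 1 (x + \<tau> * s) + s * (1 - 2 * \<tau>) * (s * w (Suc 1) (x + \<tau> * s)))
       - 2 * (s * w (Suc 0) (x + \<tau> * s)) = s ^ 3 * ((\<tau> - \<tau>\<^sup>2) * w 3 (x + \<tau> * s))"
      by (simp add: power3_eq_cube power2_eq_square numeral_2_eq_2 numeral_3_eq_3 algebra_simps)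
    ultimately show "(?H has_vector_derivative s ^ 3 * ((\<tau> - \<tau>\<^sup>2) * w 3 (x + \<tau> * s))) (at \<tau> within {0..1})"
      by (simp add: has_real_derivative_iff_has_vector_derivative[symmetric])
  qed simp
  from integral_unique[OF this, unfolded integral_mult_right]
  have "s ^ 3 * integral {0..1} (\<lambda>\<tau>. (\<tau> - \<tau>\<^sup>2) * w 3 (x + \<tau> * s)) = s * w 1 x - 2 * w 0 y + s * w 1 y + 2 * w 0 x"
    by (simp add: xs)
  then show "(y - x) * (w 1 y - w 1 x) = 2 * (w 0 y - w 0 x - (y - x) * w 1 x) +
           (y - x) ^ 3 * integral {0..1} (\<lambda>\<tau>. (\<tau> - \<tau>\<^sup>2) * w 3 (x + \<tau> * (y - x)))"
    unfolding s_def[symmetric] by (simp add: right_diff_distrib)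
qed

lemma vol_curve:
  assumes e: "\<And>k t. \<bar>t\<bar> < e \<Longrightarrow> (v k has_vector_derivative v (Suc k) t) (at t)" and xy: "\<bar>x\<bar> < e" "\<bar>y\<bar> < e"
  shows "vol (vec4 (v 0 x)) (vec4 (v 1 x)) (vec4 (v 0 y)) (vec4 (v 1 y)) = (y - x) ^ 4 * curve_det v (x, y)"
proof (cases "y = x")
  case True
  moreover have "vol a b a b = 0" for a b unfolding vol_expand by algebra
  ultimately show ?thesis by simp
next
  case False
  define s where "s = y - x"
  have s: "s \<noteq> 0" using False by (simp add: s_def)
  define r where "r = (\<chi> j. integral {0..1} (\<lambda>\<tau>. (1 - \<tau>) * vec4 (v 2 (x + \<tau> * (y - x))) $ j))"
  define q where "q = (\<chi> j. integral {0..1} (\<lambda>\<tau>. (\<tau> - \<tau>\<^sup>2) * vec4 (v 3 (x + \<tau> * (y - x))) $ j))"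
  have bl: "bounded_linear (\<lambda>v. vec4 v $ j)" for j
    using bounded_linear_compose[OF bounded_linear_vec_nth linear_conv_bounded_linear[THEN iffD1, OF linear_vec4]] .
  have T: "((\<lambda>t. vec4 (v k t) $ j) has_vector_derivative vec4 (v (Suc k) t) $ j) (at t)" if "\<bar>t\<bar> < e" for k t j
    using bounded_linear.has_vector_derivative[OF bl e[OF that]] .
  have t1: "vec4 (v 0 y) $ j = vec4 (v 0 x) $ j + s * vec4 (v 1 x) $ j + s\<^sup>2 * r $ j" for j
    using tower_Taylor(1)[where w="\<lambda>k t. vec4 (v k t) $ j", OF T xy] by (simp only: r_def s_def vec_lambda_beta)
  have "s * (vec4 (v 1 y) $ j - vec4 (v 1 x) $ j) =
      2 * (vec4 (v 0 y) $ j - vec4 (v 0 x) $ j - s * vec4 (v 1 x) $ j) + s ^ 3 * q $ j" for j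
    using tower_Taylor(2)[where w="\<lambda>k t. vec4 (v k t) $ j", OF T xy] by (simp only: q_def s_def vec_lambda_beta)
  then have "s * vec4 (v 1 y) $ j = s * (vec4 (v 1 x) $ j + (2 * s) * r $ j + s\<^sup>2 * q $ j)" for j
    unfolding t1 by (simp add: power2_eq_square power3_eq_cube algebra_simps)
  then have t2: "vec4 (v 1 y) $ j = vec4 (v 1 x) $ j + (2 * s) * r $ j + s\<^sup>2 * q $ j" for j
    using s mult_left_cancel by blast
  have 0: "vec4 (v 0 y) = vec4 (v 0 x) + s *\<^sub>R vec4 (v 1 x) + s\<^sup>2 *\<^sub>R r"
    unfolding vec_eq_iff using t1 by simp
  have 1: "vec4 (v 1 y) = vec4 (v 1 x) + (2 * s) *\<^sub>R r + s\<^sup>2 *\<^sub>R q"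
    unfolding vec_eq_iff using t2 by simp
  show ?thesis
    unfolding 0 1 vol_Taylor by (simp only: curve_det_def s_def r_def q_def fst_conv snd_conv)
qed

text \<open>The index of the basis field among \<open>E 0\<close>, ..., \<open>E 3\<close> to which
  the coordinate belongs; it is subtracted from the order of a derivative to give its
  degree.\<close>

definition weight4 :: "4 \<Rightarrow> int" where
  "weight4 j = (if j = 1 then 0 else if j = 2 then 1 else if j = 3 then 2 else 3)"

text \<open>Row \<open>a\<close> of the determinant is made of derivatives of order
  \<open>weight4 a\<close>, so its entry in column \<open>b\<close> has degree
  \<open>weight4 a - weight4 b\<close>, the pattern of \<open>jet_det\<close>.\<close>

lemma jet_curve_det:
  assumes "\<And>s z. s \<noteq> 0 \<Longrightarrow> tower (v (s, z))"
    and "\<And>k j. graded (int k - weight4 j) (\<lambda>i. vec4 (v i k 0) $ j)"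
  shows "jet n 0 (\<lambda>i. curve_det (v i))"
proof -
  note T = tower_component[OF assms(1)]
  have G: "graded (- weight4 j + int k) (\<lambda>i. vec4 (v i k 0) $ j)" for k j
    using assms(2)[of k j] by simp
  have 1: "jet n (int k - weight4 j) (\<lambda>i x. vec4 (v i k (fst x)) $ j)" for j k
    using jet_fst[where w="\<lambda>i k t. vec4 (v i k t) $ j", OF T G] by simp
  have 2: "jet n (int k - weight4 j) (\<lambda>i x. integral {0..1} (\<lambda>\<tau>. q \<tau> * vec4 (v i k (fst x + \<tau> * (snd x - fst x))) $ j))"
    if "continuous_on {0..1} q" for j k q
    using jet_integral[where w="\<lambda>i k t. vec4 (v i k t) $ j", OF T G that] by simp
  have c: "continuous_on {0..1} (\<lambda>\<tau>::real. 1 - \<tau>)" "continuous_on {0..1} (\<lambda>\<tau>::real. \<tau> - \<tau>\<^sup>2)"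
    by (intro continuous_intros)+
  let ?A = "\<lambda>i x. (\<chi> a. if a = 1 then vec4 (v i 0 (fst x)) else if a = 2 then vec4 (v i 1 (fst x))
     else if a = 3 then (\<chi> j. integral {0..1} (\<lambda>\<tau>. (1 - \<tau>) * vec4 (v i 2 (fst x + \<tau> * (snd x - fst x))) $ j))
     else (\<chi> j. integral {0..1} (\<lambda>\<tau>. (\<tau> - \<tau>\<^sup>2) * vec4 (v i 3 (fst x + \<tau> * (snd x - fst x))) $ j))) :: real^4^4"
  have "\<forall>a. jet n (weight4 a - weight4 b) (\<lambda>i x. ?A i x $ a $ b)" for b
    unfolding forall_4
    using 1[of 0 b] 1[of 1 b] 2[OF c(1), of 2 b] 2[OF c(2), of 3 b] by (simp add: weight4_def)
  then have "jet n 0 (\<lambda>i x. det (?A i x))"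
    by (intro jet_det[where r=weight4]) blast
  then show ?thesis unfolding curve_det_def[abs_def] vol_def .
qed

text \<open>On the diagonal the averages become multiples by the integrals of the kernels, 1/2 for
  \<open>1 - \<tau>\<close> and 1/6 for \<open>\<tau> - \<tau>\<^sup>2\<close>; hence 12.\<close>

lemma curve_det_origin:
  "curve_det v (0, 0) = vol (vec4 (v 0 0)) (vec4 (v 1 0)) (vec4 (v 2 0)) (vec4 (v 3 0)) / 12"
proof -
  have "((\<lambda>\<tau>::real. 1 - \<tau>) has_integral (\<lambda>\<tau>. \<tau> - \<tau>\<^sup>2 / 2) 1 - (\<lambda>\<tau>. \<tau> - \<tau>\<^sup>2 / 2) 0) {0..1}"
    by (rule fundamental_theorem_of_calculus)
       (auto intro!: derivative_eq_intros simp: has_real_derivative_iff_has_vector_derivative[symmetric])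
  from integral_unique[OF this] have 1: "integral {0..1} (\<lambda>\<tau>::real. 1 - \<tau>) = 1 / 2" by simp
  have "((\<lambda>\<tau>::real. \<tau> - \<tau>\<^sup>2) has_integral (\<lambda>\<tau>. \<tau>\<^sup>2 / 2 - \<tau> ^ 3 / 3) 1 - (\<lambda>\<tau>. \<tau>\<^sup>2 / 2 - \<tau> ^ 3 / 3) 0) {0..1}"
    by (rule fundamental_theorem_of_calculus)
       (auto intro!: derivative_eq_intros simp: has_real_derivative_iff_has_vector_derivative[symmetric])
  from integral_unique[OF this] have 2: "integral {0..1} (\<lambda>\<tau>::real. \<tau> - \<tau>\<^sup>2) = 1 / 6" by simp
  have 3: "(\<chi> j. integral {0..1} (\<lambda>\<tau>. (1 - \<tau>) * vec4 (v 2 0) $ j)) = (1/2) *\<^sub>R vec4 (v 2 0)"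
    "(\<chi> j. integral {0..1} (\<lambda>\<tau>. (\<tau> - \<tau>\<^sup>2) * vec4 (v 3 0) $ j)) = (1/6) *\<^sub>R vec4 (v 3 0)"
    using 1 2 by (simp_all add: vec_eq_iff)
  have 4: "vol a b (p *\<^sub>R c) (q *\<^sub>R d) = p * q * vol a b c d" for a b c d p q
    unfolding vol_expand by (simp add: algebra_simps)
  show ?thesis
    by (simp only: curve_det_def fst_conv snd_conv diff_self mult_zero_right add_0_right 3 4)
qed

section \<open>From matrix curves to spanning vectors\<close>

definition represents ::
    "(real \<Rightarrow> real^2^2) \<Rightarrow> ((real^2) \<times> (real^2) \<Rightarrow> (real^2) \<times> (real^2)) \<Rightarrow>
     (nat \<Rightarrow> real \<Rightarrow> (real^2) \<times> (real^2)) \<Rightarrow> bool" where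
  "represents S M v \<longleftrightarrow> (\<forall>\<^sub>F t in nhds 0. graph_of (S t) = M ` span {v 0 t, v 1 t})"

lemma eventually_nhds_0_abs:
  "(\<forall>\<^sub>F t in nhds (0::real). P t) \<longleftrightarrow> (\<exists>e>0. \<forall>t. \<bar>t\<bar> < e \<longrightarrow> P t)"
  unfolding eventually_nhds_metric by (simp add: dist_real_def)

lemma area_has_derivative:
  fixes f g :: "real \<Rightarrow> real^2"
  assumes "(f has_vector_derivative f') (at t)" "(g has_vector_derivative g') (at t)"
  shows "((\<lambda>t. area (f t) (g t)) has_real_derivative area f' (g t) + area (f t) g') (at t)"
proof -
  have c: "((\<lambda>t. h t $ i) has_real_derivative h' $ i) (at t)"
    if "(h has_vector_derivative h') (at t)" for h :: "real \<Rightarrow> real^2" and h' i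
    unfolding has_real_derivative_iff_has_vector_derivative
    by (rule bounded_linear.has_vector_derivative[OF bounded_linear_vec_nth that])
  show ?thesis
    unfolding area_def by (rule derivative_eq_intros c assms refl)+ (simp add: algebra_simps)
qed

text \<open>Here \<open>\<delta>\<close> is the determinant of the coordinate change
  \<open>M\<close>, and \<open>m\<close> is the area spanned by the upper halves of the two spanning
  vectors after \<open>M\<close>, a function of a single time.\<close>

lemma represents_det:
  assumes "tower v" "curve_det v (0, 0) \<noteq> 0" "isCont (curve_det v) (0, 0)" "linear M" "surj M" "represents S M v"
  shows "\<exists>e \<delta> m m'. e > 0 \<and> \<delta> \<noteq> 0 \<and>
    (\<forall>t. \<bar>t\<bar> < e \<longrightarrow> m t \<noteq> 0 \<and> (m has_real_derivative m' t) (at t)) \<and>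
    (\<forall>x y. \<bar>x\<bar> < e \<longrightarrow> \<bar>y\<bar> < e \<longrightarrow>
       curve_det v (x, y) \<noteq> 0 \<and> det (S x - S y) = \<delta> * (x - y) ^ 4 * curve_det v (x, y) / (m x * m y))"
proof -
  obtain e1 where e1: "e1 > 0" "\<And>k t. \<bar>t\<bar> < e1 \<Longrightarrow> (v k has_vector_derivative v (Suc k) t) (at t)"
    using assms(1) unfolding tower_def by blast
  obtain e2 where e2: "e2 > 0" "\<And>x y. \<bar>x\<bar> < e2 \<Longrightarrow> \<bar>y\<bar> < e2 \<Longrightarrow> curve_det v (x, y) \<noteq> 0"
    using isCont_eventually_nonzero[OF assms(3,2)] unfolding eventually_nhds_origin by blast
  obtain e3 where e3: "e3 > 0" "\<And>t. \<bar>t\<bar> < e3 \<Longrightarrow> graph_of (S t) = M ` span {v 0 t, v 1 t}"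
    using assms(6) unfolding represents_def eventually_nhds_0_abs by blast
  obtain \<delta> where \<delta>: "\<delta> \<noteq> 0"
    "\<And>a b c d. vol (vec4 (M a)) (vec4 (M b)) (vec4 (M c)) (vec4 (M d)) = \<delta> * vol (vec4 a) (vec4 b) (vec4 c) (vec4 d)"
    using vol_linear[OF assms(4,5)] by blast
  define e where "e = min e1 (min e2 e3)"
  define m where "m t = area (fst (M (v 0 t))) (fst (M (v 1 t)))" for t
  define m' where "m' t = area (fst (M (v 1 t))) (fst (M (v 1 t))) + area (fst (M (v 0 t))) (fst (M (v 2 t)))" for t
  have S: "snd (M (v k t)) = S t *v fst (M (v k t))" if "\<bar>t\<bar> < e" "k = 0 \<or> k = 1" for k t
  proof -
    have "M (v k t) \<in> graph_of (S t)"
      using e3(2)[of t] that by (auto simp: e_def intro!: imageI span_base)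
    then show ?thesis by (auto simp: graph_of_def)
  qed
  have key: "m x * m y * det (S x - S y) = \<delta> * ((y - x) ^ 4 * curve_det v (x, y))" if "\<bar>x\<bar> < e" "\<bar>y\<bar> < e" for x y
    using vol_graphs[OF S[OF that(1), of 0] S[OF that(1), of 1] S[OF that(2), of 0] S[OF that(2), of 1]]
      \<delta>(2) vol_curve[of e1 v x y, OF e1(2)] that by (simp add: m_def e_def)
  have m: "m t \<noteq> 0" if t: "\<bar>t\<bar> < e" for t
  proof
    assume "m t = 0"
    \<comment> \<open>Some second time in the interval: if \<open>m t\<close> vanished, the identity
      for \<open>t\<close> and \<open>t'\<close> would force \<open>curve_det\<close> to vanish
      there.\<close>
    define t' where "t' = (if t > 0 then t / 2 else (t + e) / 2)"
    have "e > 0" using e1 e2 e3 by (simp add: e_def)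
    then have t': "\<bar>t'\<bar> < e" "t' \<noteq> t" using t by (auto simp: t'_def)
    have "\<delta> * ((t' - t) ^ 4 * curve_det v (t, t')) \<noteq> 0"
      using \<delta>(1) t' e2(2)[of t t'] t by (simp add: e_def)
    with key[OF t t'(1)] \<open>m t = 0\<close> show False by simp
  qed
  show ?thesis
  proof (rule exI[of _ e], rule exI[of _ \<delta>], rule exI[of _ m], rule exI[of _ m'], intro conjI allI impI)
    show "e > 0" using e1 e2 e3 by (simp add: e_def)
    show "\<delta> \<noteq> 0" by fact
    show "m t \<noteq> 0" if "\<bar>t\<bar> < e" for t using m that .
    show "curve_det v (x, y) \<noteq> 0" if "\<bar>x\<bar> < e" "\<bar>y\<bar> < e" for x y
      using e2(2) that by (simp add: e_def)
    show "det (S x - S y) = \<delta> * (x - y) ^ 4 * curve_det v (x, y) / (m x * m y)" if "\<bar>x\<bar> < e" "\<bar>y\<bar> < e" for x y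
    proof -
      have "(y - x) ^ 4 = (x - y) ^ 4" by algebra
      then show ?thesis using key[OF that] m[OF that(1)] m[OF that(2)] by (simp add: field_simps)
    qed
    show "(m has_real_derivative m' t) (at t)" if "\<bar>t\<bar> < e" for t
    proof -
      have bl: "bounded_linear (\<lambda>u. fst (M u))"
        using bounded_linear_compose[OF bounded_linear_fst linear_conv_bounded_linear[THEN iffD1, OF assms(4)]] .
      have "((\<lambda>t. fst (M (v k t))) has_vector_derivative fst (M (v (Suc k) t))) (at t)" for k
        by (rule bounded_linear.has_vector_derivative[OF bl]) (use e1(2) that in \<open>simp add: e_def\<close>)
      from area_has_derivative[OF this[of 0] this[of 1]] show ?thesis
        by (simp add: m_def[abs_def] m'_def numeral_2_eq_2)
    qed
  qed
qed

lemma zero_of_order_unique: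
  assumes "zero_of_order f \<tau> j" "zero_of_order f \<tau> k"
  shows "j = k"
proof -
  have False if "j < k" "zero_of_order f \<tau> j" "zero_of_order f \<tau> k" for j k
  proof -
    obtain a b where a: "a \<noteq> 0" "((\<lambda>t. f t / (t - \<tau>) ^ j) \<longlongrightarrow> a) (at \<tau>)"
      and b: "((\<lambda>t. f t / (t - \<tau>) ^ k) \<longlongrightarrow> b) (at \<tau>)"
      using \<open>zero_of_order f \<tau> j\<close> \<open>zero_of_order f \<tau> k\<close> unfolding zero_of_order_def by blast
    have "((\<lambda>t. (t - \<tau>) ^ (k - j)) \<longlongrightarrow> (\<tau> - \<tau>) ^ (k - j)) (at \<tau>)"
      by (intro tendsto_intros)
    then have "((\<lambda>t. f t / (t - \<tau>) ^ k * (t - \<tau>) ^ (k - j)) \<longlongrightarrow> b * 0) (at \<tau>)"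
      using b \<open>j < k\<close> by (intro tendsto_mult) (auto simp: power_0_left)
    moreover have "\<forall>\<^sub>F t in at \<tau>. f t / (t - \<tau>) ^ k * (t - \<tau>) ^ (k - j) = f t / (t - \<tau>) ^ j"
      using eventually_neq_at_within[of \<tau>]
    proof eventually_elim
      case (elim t)
      have "(t - \<tau>) ^ k = (t - \<tau>) ^ j * (t - \<tau>) ^ (k - j)"
        using \<open>j < k\<close> by (simp add: power_add[symmetric])
      then show ?case using elim by simp
    qed
    ultimately have "((\<lambda>t. f t / (t - \<tau>) ^ j) \<longlongrightarrow> 0) (at \<tau>)"
      using tendsto_cong by fastforce
    then show False using a tendsto_unique[of "at \<tau>"] by force
  qed
  then show ?thesis using assms by (metis linorder_neqE_nat)
qed

lemma has_partials_near:
  "has_partials F F0 F1 \<Longrightarrow> \<exists>e>0. \<forall>x y. \<bar>x\<bar> < e \<longrightarrow> \<bar>y\<bar> < e \<longrightarrow>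
     (F has_derivative (\<lambda>h. fst h * F0 (x, y) + snd h * F1 (x, y))) (at (x, y))"
  unfolding has_partials_def eventually_nhds_origin .

lemma partial_derivatives:
  fixes F :: "real \<times> real \<Rightarrow> real"
  assumes "(F has_derivative (\<lambda>h. fst h * a + snd h * b)) (at (x, y))"
  shows "((\<lambda>x. F (x, y)) has_real_derivative a) (at x)"
    and "((\<lambda>y. F (x, y)) has_real_derivative b) (at y)"
    and "x = y \<Longrightarrow> ((\<lambda>t. F (t, t)) has_real_derivative a + b) (at x)"
proof -
  have c: "((\<lambda>x. (x, y)) has_derivative (\<lambda>h. (h, 0))) (at x)" "((\<lambda>y. (x, y)) has_derivative (\<lambda>h. (0, h))) (at y)"
     "((\<lambda>x. (x, x)) has_derivative (\<lambda>h. (h, h))) (at x)"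
    by (auto intro!: derivative_eq_intros)
  show "((\<lambda>x. F (x, y)) has_real_derivative a) (at x)"
    unfolding has_field_derivative_def
    by (rule has_derivative_eq_rhs[OF has_derivative_compose[OF c(1) assms]]) (simp add: fun_eq_iff)
  show "((\<lambda>y. F (x, y)) has_real_derivative b) (at y)"
    unfolding has_field_derivative_def
    by (rule has_derivative_eq_rhs[OF has_derivative_compose[OF c(2) assms]]) (simp add: fun_eq_iff)
  show "((\<lambda>t. F (t, t)) has_real_derivative a + b) (at x)" if "x = y"
    unfolding has_field_derivative_def
    by (rule has_derivative_eq_rhs[OF has_derivative_compose[OF c(3), of F "\<lambda>h. fst h * a + snd h * b"]])
       (use assms that in \<open>auto simp: fun_eq_iff algebra_simps\<close>)
qed

text \<open>Division by the fourth power leaves \<open>\<delta>\<close> times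
  \<open>curve_det\<close> over the two areas, which is continuous and nonzero on the
  diagonal.\<close>

lemma has_weight_represents:
  assumes "tower v" "curve_det v (0, 0) \<noteq> 0" "has_partials (curve_det v) G0 G1" "linear M" "surj M" "represents S M v"
  shows "\<forall>\<^sub>F \<tau> in nhds 0. has_weight S \<tau> 4"
proof -
  obtain e1 \<delta> m m' where r0: "e1 > 0" "\<delta> \<noteq> 0"
    "\<forall>t. \<bar>t\<bar> < e1 \<longrightarrow> m t \<noteq> 0 \<and> (m has_real_derivative m' t) (at t)"
    "\<forall>x y. \<bar>x\<bar> < e1 \<longrightarrow> \<bar>y\<bar> < e1 \<longrightarrow>
       curve_det v (x, y) \<noteq> 0 \<and> det (S x - S y) = \<delta> * (x - y) ^ 4 * curve_det v (x, y) / (m x * m y)"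
    using represents_det[OF assms(1,2) has_partials_isCont[OF assms(3)] assms(4-6)] by (elim exE conjE) (rule that)
  then have r: "e1 > 0" "\<delta> \<noteq> 0"
    "\<And>t. \<bar>t\<bar> < e1 \<Longrightarrow> m t \<noteq> 0"
    "\<And>t. \<bar>t\<bar> < e1 \<Longrightarrow> (m has_real_derivative m' t) (at t)"
    "\<And>x y. \<bar>x\<bar> < e1 \<Longrightarrow> \<bar>y\<bar> < e1 \<Longrightarrow> curve_det v (x, y) \<noteq> 0"
    "\<And>x y. \<bar>x\<bar> < e1 \<Longrightarrow> \<bar>y\<bar> < e1 \<Longrightarrow> det (S x - S y) = \<delta> * (x - y) ^ 4 * curve_det v (x, y) / (m x * m y)"
    by blast+
  obtain e2 where e2: "e2 > 0"
    "\<And>x y. \<bar>x\<bar> < e2 \<Longrightarrow> \<bar>y\<bar> < e2 \<Longrightarrow> (curve_det v has_derivative (\<lambda>h. fst h * G0 (x, y) + snd h * G1 (x, y))) (at (x, y))"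
    using has_partials_near[OF assms(3)] by blast
  define e where "e = min e1 e2"
  have "has_weight S \<tau> 4" if \<tau>: "\<bar>\<tau>\<bar> < e" for \<tau>
    unfolding has_weight_def zero_of_order_def
  proof (intro exI conjI)
    let ?f = "\<lambda>t. \<delta> * curve_det v (t, \<tau>) / (m t * m \<tau>)"
    show "?f \<tau> \<noteq> 0" using r \<tau> by (auto simp: e_def)
    have "isCont (\<lambda>t. curve_det v (t, \<tau>)) \<tau>"
      using partial_derivatives(1)[OF e2(2)[of \<tau> \<tau>]] \<tau> by (auto simp: e_def intro: DERIV_isCont)
    moreover have "isCont m \<tau>" using r(4)[of \<tau>] \<tau> by (auto simp: e_def intro: DERIV_isCont)
    ultimately have "isCont ?f \<tau>" using r(3)[of \<tau>] \<tau> by (auto simp: e_def intro!: continuous_intros)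
    then have "(?f \<longlongrightarrow> ?f \<tau>) (at \<tau>)" by (simp add: isCont_def)
    moreover have "\<forall>\<^sub>F t in at \<tau>. ?f t = det (S t - S \<tau>) / (t - \<tau>) ^ 4"
    proof -
      have "\<forall>\<^sub>F t in nhds \<tau>. \<bar>t\<bar> < e"
        using eventually_nhds_in_open[of "ball 0 e" \<tau>] \<tau> by (simp add: dist_real_def)
      then have "\<forall>\<^sub>F t in at \<tau>. \<bar>t\<bar> < e" by (simp add: eventually_at_filter eventually_mono)
      then show ?thesis using eventually_neq_at_within[of \<tau>]
      proof eventually_elim
        case (elim t)
        then show ?case using r(6)[of t \<tau>] \<tau> by (simp add: e_def)
      qed
    qed
    ultimately show "((\<lambda>t. det (S t - S \<tau>) / (t - \<tau>) ^ 4) \<longlongrightarrow> ?f \<tau>) (at \<tau>)"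
      by (rule Lim_transform_eventually)
  qed
  then show ?thesis
    unfolding eventually_nhds_0_abs using r(1) e2(1) by (intro exI[of _ e]) (auto simp: e_def)
qed

lemma DERIV_transform_eventually:
  assumes "(f has_real_derivative d) (at x)" "\<forall>\<^sub>F s in nhds x. f s = g s"
  shows "(g has_real_derivative d) (at x)"
  using assms(1) DERIV_cong_ev[OF refl assms(2) refl] by blast

text \<open>Near \<open>t\<close> the sign of \<open>f\<close> is constant, so the absolute value is
  \<open>sgn (f t)\<close> times \<open>f\<close>, and the sign cancels in the logarithmic
  derivative.\<close>

lemma DERIV_ln_abs:
  assumes "(f has_real_derivative f') (at t)" "f t \<noteq> 0"
  shows "((\<lambda>t. ln \<bar>f t\<bar>) has_real_derivative f' / f t) (at t)"
proof -
  have sg: "\<forall>\<^sub>F s in nhds t. sgn (f s) = sgn (f t)"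
  proof -
    have "(f \<longlongrightarrow> f t) (nhds t)"
      using DERIV_isCont[OF assms(1)] by (simp add: isCont_def tendsto_at_iff_tendsto_nhds)
    then have "\<forall>\<^sub>F s in nhds t. if f t > 0 then f s > 0 else f s < 0"
      using assms(2) order_tendstoD[of f "f t" "nhds t" 0] by (cases "f t > 0") auto
    then show ?thesis by eventually_elim (use assms(2) in \<open>auto split: if_splits\<close>)
  qed
  have d: "((\<lambda>s. ln (sgn (f t) * f s)) has_real_derivative (1 / (sgn (f t) * f t)) * (sgn (f t) * f')) (at t)"
    by (rule DERIV_chain2[OF DERIV_ln_divide])
       (use assms in \<open>auto simp: sgn_if intro!: derivative_eq_intros\<close>)
  have e: "(1 / (sgn (f t) * f t)) * (sgn (f t) * f') = f' / f t"
    using assms(2) by (auto simp: sgn_if)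
  have "\<forall>\<^sub>F s in nhds t. ln (sgn (f t) * f s) = ln \<bar>f s\<bar>"
    using sg by eventually_elim (simp add: abs_sgn mult.commute)
  with d show ?thesis unfolding e by (rule DERIV_transform_eventually)
qed

text \<open>The factors \<open>m x\<close> and \<open>m y\<close> by which \<open>det (S x - S y)\<close> differs from \<^const>\<open>curve_det\<close> disappear
  in the mixed derivative of the logarithm; this makes the density independent of coordinates.\<close>

lemma density_of_curve_represents:
  assumes v: "tower v" "curve_det v (0, 0) \<noteq> 0" and M: "linear M" "surj M" and S: "represents S M v"
    and w: "\<forall>\<^sub>F \<tau> in nhds 0. has_weight S \<tau> k"
    and G: "has_partials (curve_det v) G0 G1"
    and H: "has_partials (\<lambda>x. G1 x * inverse (curve_det v x)) \<Phi> H1"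
    and \<Phi>: "has_partials \<Phi> \<Phi>0 \<Phi>1" "has_partials \<Phi>0 \<Phi>00 \<Phi>01" "has_partials \<Phi>1 \<Phi>10 \<Phi>11"
  shows "density_of_curve k S 0 = 1 / 2 * \<Phi>00 (0, 0) - 3 / 20 * (\<Phi> (0, 0))\<^sup>2
           - 3 / 20 * (\<Phi>00 (0, 0) + \<Phi>01 (0, 0) + (\<Phi>10 (0, 0) + \<Phi>11 (0, 0)))"
proof -
  have "\<forall>\<^sub>F \<tau> in nhds 0. has_weight S \<tau> 4" by (rule has_weight_represents[OF v G M S])
  \<comment> \<open>The weight is given only existentially; the order of a zero is unique, so it
    must be the computed one.\<close>
  then have k: "k = 4"
    using w zero_of_order_unique eventually_nhds_x_imp_x unfolding has_weight_def by blast
  let ?D = "curve_det v"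
  obtain e1 \<delta> m m' where r0: "e1 > 0" "\<delta> \<noteq> 0"
    "\<forall>t. \<bar>t\<bar> < e1 \<longrightarrow> m t \<noteq> 0 \<and> (m has_real_derivative m' t) (at t)"
    "\<forall>x y. \<bar>x\<bar> < e1 \<longrightarrow> \<bar>y\<bar> < e1 \<longrightarrow>
       ?D (x, y) \<noteq> 0 \<and> det (S x - S y) = \<delta> * (x - y) ^ 4 * ?D (x, y) / (m x * m y)"
    using represents_det[OF v has_partials_isCont[OF G] M S] by (elim exE conjE) (rule that)
  then have r: "e1 > 0" "\<delta> \<noteq> 0"
    "\<And>t. \<bar>t\<bar> < e1 \<Longrightarrow> m t \<noteq> 0"
    "\<And>t. \<bar>t\<bar> < e1 \<Longrightarrow> (m has_real_derivative m' t) (at t)"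
    "\<And>x y. \<bar>x\<bar> < e1 \<Longrightarrow> \<bar>y\<bar> < e1 \<Longrightarrow> ?D (x, y) \<noteq> 0"
    "\<And>x y. \<bar>x\<bar> < e1 \<Longrightarrow> \<bar>y\<bar> < e1 \<Longrightarrow> det (S x - S y) = \<delta> * (x - y) ^ 4 * ?D (x, y) / (m x * m y)"
    by blast+
  obtain e2 where e2: "e2 > 0"
    "\<And>x y. \<bar>x\<bar> < e2 \<Longrightarrow> \<bar>y\<bar> < e2 \<Longrightarrow> (?D has_derivative (\<lambda>h. fst h * G0 (x, y) + snd h * G1 (x, y))) (at (x, y))"
    using has_partials_near[OF G] by blast
  obtain e3 where e3: "e3 > 0"
    "\<And>x y. \<bar>x\<bar> < e3 \<Longrightarrow> \<bar>y\<bar> < e3 \<Longrightarrow> ((\<lambda>x. G1 x * inverse (?D x)) has_derivative (\<lambda>h. fst h * \<Phi> (x, y) + snd h * H1 (x, y))) (at (x, y))"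
    using has_partials_near[OF H] by blast
  obtain e4 where e4: "e4 > 0"
    "\<And>x y. \<bar>x\<bar> < e4 \<Longrightarrow> \<bar>y\<bar> < e4 \<Longrightarrow> (\<Phi> has_derivative (\<lambda>h. fst h * \<Phi>0 (x, y) + snd h * \<Phi>1 (x, y))) (at (x, y))"
    using has_partials_near[OF \<Phi>(1)] by blast
  obtain e5 where e5: "e5 > 0"
    "\<And>x y. \<bar>x\<bar> < e5 \<Longrightarrow> \<bar>y\<bar> < e5 \<Longrightarrow> (\<Phi>0 has_derivative (\<lambda>h. fst h * \<Phi>00 (x, y) + snd h * \<Phi>01 (x, y))) (at (x, y))"
    using has_partials_near[OF \<Phi>(2)] by blast
  obtain e6 where e6: "e6 > 0"
    "\<And>x y. \<bar>x\<bar> < e6 \<Longrightarrow> \<bar>y\<bar> < e6 \<Longrightarrow> (\<Phi>1 has_derivative (\<lambda>h. fst h * \<Phi>10 (x, y) + snd h * \<Phi>11 (x, y))) (at (x, y))"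
    using has_partials_near[OF \<Phi>(3)] by blast
  define e where "e = min e1 (min e2 (min e3 (min e4 (min e5 e6))))"
  have e: "e > 0" using r(1) e2(1) e3(1) e4(1) e5(1) e6(1) by (simp add: e_def)
  have le: "\<bar>x\<bar> < e1" "\<bar>x\<bar> < e2" "\<bar>x\<bar> < e3" "\<bar>x\<bar> < e4" "\<bar>x\<bar> < e5" "\<bar>x\<bar> < e6" if "\<bar>x\<bar> < e" for x
    using that by (simp_all add: e_def)
  have ev: "\<forall>\<^sub>F s in nhds t. \<bar>s\<bar> < e" if "\<bar>t\<bar> < e" for t
    using eventually_nhds_in_open[of "ball 0 e" t] that by (simp add: dist_real_def)
  have dq: "det_quotient 4 S x y = \<delta> * ?D (x, y) / (m x * m y)" if "\<bar>x\<bar> < e" "\<bar>y\<bar> < e" for x y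
  proof (cases "x = y")
    case False
    then show ?thesis unfolding det_quotient_def using r(6)[OF le(1)[OF that(1)] le(1)[OF that(2)]] by simp
  next
    case True
    let ?f = "\<lambda>t. \<delta> * ?D (t, y) / (m t * m y)"
    have "isCont (\<lambda>t. ?D (t, y)) y"
      using partial_derivatives(1)[OF e2(2)[OF le(2)[OF that(2)] le(2)[OF that(2)]]] by (rule DERIV_isCont)
    moreover have "isCont m y" using r(4)[OF le(1)[OF that(2)]] by (rule DERIV_isCont)
    ultimately have "isCont ?f y" using r(3)[OF le(1)[OF that(2)]] by (auto intro!: continuous_intros)
    then have "(?f \<longlongrightarrow> ?f y) (at y)" by (simp add: isCont_def)
    moreover have "\<forall>\<^sub>F t in at y. ?f t = det (S t - S y) / (t - y) ^ 4"
    proof -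
      have "\<forall>\<^sub>F t in at y. \<bar>t\<bar> < e" using ev[OF that(2)] by (simp add: eventually_at_filter eventually_mono)
      then show ?thesis using eventually_neq_at_within[of y]
      proof eventually_elim
        case (elim t)
        then show ?case using r(6)[OF le(1)[OF elim(1)] le(1)[OF that(2)]] by simp
      qed
    qed
    ultimately have "((\<lambda>t. det (S t - S y) / (t - y) ^ 4) \<longlongrightarrow> ?f y) (at y)"
      by (rule Lim_transform_eventually)
    then have "Lim (at y) (\<lambda>t. det (S t - S y) / (t - y) ^ 4) = ?f y"
      by (intro tendsto_Lim) auto
    then show ?thesis using True by (simp add: det_quotient_def)
  qed
  have inner: "deriv (\<lambda>y. ln \<bar>det_quotient 4 S x y\<bar>) y = G1 (x, y) * inverse (?D (x, y)) - m' y / m y"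
    if x: "\<bar>x\<bar> < e" and y: "\<bar>y\<bar> < e" for x y
  proof -
    have "((\<lambda>y. ln \<bar>?D (x, y)\<bar>) has_real_derivative G1 (x, y) / ?D (x, y)) (at y)"
      using partial_derivatives(2)[OF e2(2)[OF le(2)[OF x] le(2)[OF y]]] r(5)[OF le(1)[OF x] le(1)[OF y]]
      by (rule DERIV_ln_abs)
    moreover have "((\<lambda>y. ln \<bar>m y\<bar>) has_real_derivative m' y / m y) (at y)"
      using r(4)[OF le(1)[OF y]] r(3)[OF le(1)[OF y]] by (rule DERIV_ln_abs)
    ultimately have "((\<lambda>y. ln \<bar>\<delta>\<bar> - ln \<bar>m x\<bar> + (ln \<bar>?D (x, y)\<bar> - ln \<bar>m y\<bar>)) has_real_derivative
        0 + (G1 (x, y) / ?D (x, y) - m' y / m y)) (at y)"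
      by (intro DERIV_add DERIV_diff DERIV_const)
    moreover have "\<forall>\<^sub>F y in nhds y. ln \<bar>\<delta>\<bar> - ln \<bar>m x\<bar> + (ln \<bar>?D (x, y)\<bar> - ln \<bar>m y\<bar>) = ln \<bar>det_quotient 4 S x y\<bar>"
      using ev[OF y]
    proof eventually_elim
      case (elim y)
      then show ?case
        using dq[OF x elim] r(2) r(3)[OF le(1)[OF x]] r(3)[OF le(1)[OF elim]] r(5)[OF le(1)[OF x] le(1)[OF elim]]
        by (simp add: abs_mult ln_mult ln_div)
    qed
    ultimately have "((\<lambda>y. ln \<bar>det_quotient 4 S x y\<bar>) has_real_derivative
        0 + (G1 (x, y) / ?D (x, y) - m' y / m y)) (at y)"
      by (rule DERIV_transform_eventually)
    then show ?thesis by (simp add: DERIV_imp_deriv divide_inverse)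
  qed
  have g: "g_curve 4 S x y = \<Phi> (x, y)" if x: "\<bar>x\<bar> < e" and y: "\<bar>y\<bar> < e" for x y
  proof -
    have "((\<lambda>x. G1 (x, y) * inverse (?D (x, y)) - m' y / m y) has_real_derivative \<Phi> (x, y) - 0) (at x)"
      by (intro DERIV_diff DERIV_const partial_derivatives(1)[OF e3(2)[OF le(3)[OF x] le(3)[OF y]]])
    moreover have "\<forall>\<^sub>F x in nhds x. G1 (x, y) * inverse (?D (x, y)) - m' y / m y = deriv (\<lambda>y. ln \<bar>det_quotient 4 S x y\<bar>) y"
      using ev[OF x] by eventually_elim (simp add: inner[OF _ y])
    ultimately have "((\<lambda>x. deriv (\<lambda>y. ln \<bar>det_quotient 4 S x y\<bar>) y) has_real_derivative \<Phi> (x, y) - 0) (at x)"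
      by (rule DERIV_transform_eventually)
    then show ?thesis unfolding g_curve_def by (simp add: DERIV_imp_deriv)
  qed
  have deriv_near: "deriv f x = f' x"
    if "\<And>s. \<bar>s\<bar> < e \<Longrightarrow> f s = h s" "\<And>s. \<bar>s\<bar> < e \<Longrightarrow> (h has_real_derivative f' s) (at s)" "\<bar>x\<bar> < e"
    for f h f' :: "real \<Rightarrow> real" and x
  proof -
    have "\<forall>\<^sub>F s in nhds x. h s = f s" using ev[OF that(3)] by eventually_elim (simp add: that(1))
    then have "(f has_real_derivative f' x) (at x)"
      by (rule DERIV_transform_eventually[OF that(2)[OF that(3)]])
    then show ?thesis by (rule DERIV_imp_deriv)
  qed
  have z: "\<bar>0::real\<bar> < e" using e by simp
  have a1: "deriv (\<lambda>x. g_curve 4 S x 0) x = \<Phi>0 (x, 0)" if "\<bar>x\<bar> < e" for x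
    by (rule deriv_near[OF g[OF _ z] partial_derivatives(1)[OF e4(2)[OF le(4) le(4)[OF z]]] that])
  have a2: "deriv (deriv (\<lambda>x. g_curve 4 S x 0)) 0 = \<Phi>00 (0, 0)"
    by (rule deriv_near[OF a1 partial_derivatives(1)[OF e5(2)[OF le(5) le(5)[OF z]]] z])
  have b1: "deriv (rho_curve 4 S) x = \<Phi>0 (x, x) + \<Phi>1 (x, x)" if "\<bar>x\<bar> < e" for x
    by (rule deriv_near[OF _ partial_derivatives(3)[OF e4(2)[OF le(4) le(4)] refl] that])
       (simp_all add: rho_curve_def g)
  have b2: "deriv (deriv (rho_curve 4 S)) 0 = (\<lambda>x. \<Phi>00 (x, x) + \<Phi>01 (x, x) + (\<Phi>10 (x, x) + \<Phi>11 (x, x))) 0"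
    by (rule deriv_near[OF b1 DERIV_add[OF partial_derivatives(3)[OF e5(2)[OF le(5) le(5)] refl]
            partial_derivatives(3)[OF e6(2)[OF le(6) le(6)] refl]] z])
  \<comment> \<open>For weight 4 the coefficient \<open>3 / (5 k)\<close> of the squared term
    becomes 3/20.\<close>
  show ?thesis
    unfolding k density_of_curve_def using a2 b2 g[OF z z]
    by (simp add: rho_curve_def[of 4 S 0] numeral_2_eq_2)
qed

lemma in_span_pair: "p \<in> span {u, w} \<longleftrightarrow> (\<exists>a b. p = a *\<^sub>R u + b *\<^sub>R w)"
  for p :: "'a::real_vector"
  by (simp add: span_breakdown_eq algebra_simps)

text \<open>Supplies the existence half of the definite description. A plane is a graph when the
  upper halves of its spanning vectors are independent, and this persists near time 0.\<close>

lemma represents_exists: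
  assumes "tower v" "area (fst (v 0 0)) (fst (v 1 0)) \<noteq> 0"
  shows "\<exists>S. represents S id v"
proof -
  define m where "m t = area (fst (v 0 t)) (fst (v 1 t))" for t
  obtain e where e: "e > 0" "\<And>k t. \<bar>t\<bar> < e \<Longrightarrow> (v k has_vector_derivative v (Suc k) t) (at t)"
    using assms(1) unfolding tower_def by blast
  have "((\<lambda>t. fst (v k t)) has_vector_derivative fst (v (Suc k) 0)) (at 0)" for k
    using bounded_linear.has_vector_derivative[OF bounded_linear_fst e(2)[of 0 k]] e(1) by simp
  from DERIV_isCont[OF area_has_derivative[OF this[of 0] this[of 1]]]
  have "isCont m 0" by (simp add: m_def[abs_def])
  from isCont_eventually_nonzero[OF this] have m: "\<forall>\<^sub>F t in nhds 0. m t \<noteq> 0"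
    using assms(2) by (simp add: m_def)
  \<comment> \<open>The matrix of lower halves times the inverse of the matrix of upper halves,
    written out by Cramer's rule.\<close>
  define S :: "real \<Rightarrow> real^2^2" where
    "S t = (\<chi> i j. if j = 1
       then (snd (v 0 t) $ i * fst (v 1 t) $ 2 - snd (v 1 t) $ i * fst (v 0 t) $ 2) / m t
       else (snd (v 1 t) $ i * fst (v 0 t) $ 1 - snd (v 0 t) $ i * fst (v 1 t) $ 1) / m t)" for t
  have "graph_of (S t) = id ` span {v 0 t, v 1 t}" if "m t \<noteq> 0" for t
  proof -
    obtain x y x' y' where v: "v 0 t = (x, y)" "v 1 t = (x', y')" by (metis surj_pair)
    note v = v v(2)[unfolded One_nat_def]
    have mt: "m t = x $ 1 * x' $ 2 - x $ 2 * x' $ 1" unfolding m_def v area_def by simp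
    have Sx: "S t *v x = y"
      using that by (simp add: vec_eq_iff matrix_vector_mult_def sum_2 S_def v field_simps) (simp add: mt algebra_simps)
    have Sx': "S t *v x' = y'"
      using that by (simp add: vec_eq_iff matrix_vector_mult_def sum_2 S_def v field_simps) (simp add: mt algebra_simps)
    have sp: "span {(x, y), (x', y')} = {a *\<^sub>R (x, y) + b *\<^sub>R (x', y') | a b. True}"
      by (auto simp only: in_span_pair set_eq_iff mem_Collect_eq)
    show ?thesis
    proof (intro equalityI subsetI)
      fix p assume "p \<in> graph_of (S t)"
      then obtain u where p: "p = (u, S t *v u)" by (auto simp: graph_of_def)
      define a where "a = area u x' / m t"
      define b where "b = area x u / m t"
      have u: "u = a *\<^sub>R x + b *\<^sub>R x'"
        using that by (simp add: vec_eq_iff forall_2 a_def b_def area_def field_simps) (simp add: mt algebra_simps)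
      have "S t *v (a *\<^sub>R x + b *\<^sub>R x') = a *\<^sub>R y + b *\<^sub>R y'"
        using Sx Sx' by (simp add: matrix_vector_right_distrib matrix_vector_mult_scaleR)
      then have "p = a *\<^sub>R (x, y) + b *\<^sub>R (x', y')"
        unfolding p u[symmetric] by (simp flip: u)
      then show "p \<in> id ` span {v 0 t, v 1 t}" unfolding v sp by auto
    next
      fix p assume "p \<in> id ` span {v 0 t, v 1 t}"
      then obtain a b where "p = a *\<^sub>R (x, y) + b *\<^sub>R (x', y')" unfolding v sp by auto
      moreover have "S t *v (a *\<^sub>R x + b *\<^sub>R x') = a *\<^sub>R y + b *\<^sub>R y'"
        using Sx Sx' by (simp add: matrix_vector_right_distrib matrix_vector_mult_scaleR)
      ultimately show "p \<in> graph_of (S t)" unfolding graph_of_def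
        by (auto intro!: exI[of _ "a *\<^sub>R x + b *\<^sub>R x'"])
    qed
  qed
  then have "represents S id v" unfolding represents_def using m by (auto elim: eventually_mono)
  then show ?thesis by blast
qed

section \<open>The frame of a (2,3,5)-distribution\<close>

lemma exhaust_5:
  fixes x :: 5
  shows "x = 1 \<or> x = 2 \<or> x = 3 \<or> x = 4 \<or> x = 5"
proof (induct x)
  case (of_int z)
  then have "z = 0 \<or> z = 1 \<or> z = 2 \<or> z = 3 \<or> z = 4" by (simp, arith)
  then show ?case by auto
qed

lemma UNIV_5: "UNIV = {1, 2, 3, 4, 5::5}"
  using exhaust_5 by auto

lemma sum_5: "sum f (UNIV::5 set) = f 1 + f 2 + f 3 + f 4 + f 5"
  unfolding UNIV_5 by (simp add: ac_simps)

lemma smooth_on_det: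
  fixes A :: "'a::real_normed_vector \<Rightarrow> real^'n^'n"
  assumes "open S" "\<And>i j. smooth_on S (\<lambda>x. A x $ i $ j)"
  shows "smooth_on S (\<lambda>x. det (A x))"
  unfolding det_def using assms by (intro smooth_on_sum smooth_on_mult smooth_on_prod smooth_on_const) auto

lemma matrix_inv_inverse:
  assumes "det (A :: real^'n^'n) \<noteq> 0"
  shows "A ** matrix_inv A = mat 1" "matrix_inv A ** A = mat 1"
proof -
  have "\<exists>B. A ** B = mat 1 \<and> B ** A = mat 1"
    using assms invertible_det_nz[of A] unfolding invertible_def by blast
  from someI_ex[OF this] show "A ** matrix_inv A = mat 1" "matrix_inv A ** A = mat 1"
    unfolding matrix_inv_def by blast+
qed

lemma smooth_on_matrix_inv:
  fixes A :: "'a::real_normed_vector \<Rightarrow> real^'n^'n"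
  assumes "open S" "\<And>i j. smooth_on S (\<lambda>x. A x $ i $ j)" "\<And>x. x \<in> S \<Longrightarrow> det (A x) \<noteq> 0"
  shows "smooth_on S (\<lambda>x. matrix_inv (A x) $ i $ j)"
proof (rule smooth_on_cong[OF assms(1)])
  \<comment> \<open>Column \<open>i\<close> is replaced by the unit vector \<open>j\<close>, as in
    Cramer's rule for column \<open>j\<close> of the inverse.\<close>
  let ?C = "\<lambda>x. (\<chi> r s. if s = i then (axis j 1 :: real^'n) $ r else A x $ r $ s) :: real^'n^'n"
  have "smooth_on S (\<lambda>x. ?C x $ r $ s)" for r s
    using assms(2)[of r s] smooth_on_const[OF assms(1)] by (cases "s = i") auto
  then show "smooth_on S (\<lambda>x. det (?C x) / det (A x))"
    using assms by (intro smooth_on_divide smooth_on_det) auto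
  fix x assume x: "x \<in> S"
  have "A x ** matrix_inv (A x) = mat 1"
    by (rule matrix_inv_inverse(1)[OF assms(3)[OF x]])
  then have "A x *v column j (matrix_inv (A x)) = axis j 1"
    by (metis matrix_vector_mul_assoc matrix_vector_mul_lid matrix_vector_mult_basis)
  then have "column j (matrix_inv (A x)) = (\<chi> k. det (\<chi> r s. if s = k then axis j 1 $ r else A x $ r $ s) / det (A x))"
    using cramer[OF assms(3)[OF x]] by blast
  then show "det (?C x) / det (A x) = matrix_inv (A x) $ i $ j"
    by (simp add: vec_eq_iff column_def)
qed

section \<open>Derivatives and brackets of sections of a distribution\<close>

lemma indexed_independent:
  fixes Y :: "'n::finite \<Rightarrow> 'b::euclidean_space"
  assumes "dim (span (range Y)) = CARD('n)"
  shows "(\<Sum>i\<in>UNIV. a i *\<^sub>R Y i) = 0 \<Longrightarrow> a j = 0"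
proof -
  assume 0: "(\<Sum>i\<in>UNIV. a i *\<^sub>R Y i) = 0"
  have d: "dim (range Y) = CARD('n)" using assms by simp
  have ind: "independent (range Y)"
    by (rule card_le_dim_spanning[of _ "range Y"]) (use d in \<open>auto simp: span_superset intro: card_image_le\<close>)
  then have "card (range Y) = CARD('n)" using d dim_eq_card_independent by metis
  then have inj: "inj Y" by (simp add: eq_card_imp_inj_on)
  have "(\<Sum>y\<in>range Y. a (inv Y y) *\<^sub>R y) = 0"
    using 0 by (simp add: sum.reindex[OF inj] inv_f_f[OF inj])
  from independentD[OF ind _ _ this, of "Y j"] show "a j = 0"
    by (simp add: inv_f_f[OF inj])
qed

text \<open>Only continuity of the spanning fields enters: a section vanishing at \<open>x\<close> has coefficients
  of order \<open>O(|y - x|)\<close>, so its component along a covector annihilating the fibre at \<open>x\<close> is \<open>o(|y - x|)\<close>.\<close>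

lemma vanishing_section_derivative:
  fixes Y :: "'n::finite \<Rightarrow> 'a::real_normed_vector \<Rightarrow> 'b::euclidean_space"
  assumes S: "open S" "x \<in> S" and Y: "\<And>i. isCont (Y i) x" and W: "(W has_derivative W') (at x)"
    and mem: "\<And>y. y \<in> S \<Longrightarrow> W y \<in> span (range (\<lambda>i. Y i y))"
    and dim: "dim (span (range (\<lambda>i. Y i x))) = CARD('n)" and 0: "W x = 0"
  shows "W' v \<in> span (range (\<lambda>i. Y i x))"
proof -
  let ?P = "span (range (\<lambda>i. Y i x))"
  let ?f = "\<lambda>y (a::real^'n). \<Sum>i\<in>UNIV. a $ i *\<^sub>R Y i y"
  have lin: "linear (?f y)" for y
    by (rule linearI) (simp_all add: scaleR_left_distrib sum.distrib scaleR_sum_right)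
  have inj: "inj (?f x)"
    unfolding linear_injective_0[OF lin]
  proof (intro allI impI)
    fix a :: "real^'n" assume a: "?f x a = 0"
    have "a $ j = 0" for j by (rule indexed_independent[OF dim a])
    then show "a = 0" by (simp add: vec_eq_iff)
  qed
  obtain B where B: "B > 0" "\<And>a. B * norm a \<le> norm (?f x a)"
    by (rule linear_inj_bounded_below_pos[OF lin inj]) (rule that)
  have ortho: "p \<bullet> W' v = 0" if p: "\<And>i. p \<bullet> Y i x = 0" for p
  proof -
    let ?N = "CARD('n)"
    obtain K where K: "K > 0" "\<And>v. norm (W' v) \<le> norm v * K"
      using bounded_linear.pos_bounded[OF has_derivative_bounded_linear[OF W]] by blast
    have "((\<lambda>y. p \<bullet> W y) has_derivative (\<lambda>v. 0)) (at x)"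
      unfolding has_derivative_within_alt
    proof (intro conjI bounded_linear_zero allI impI)
      fix e :: real assume e: "e > 0"
      \<comment> \<open>The first entry lets half of the injectivity constant \<open>B\<close>
        survive at nearby points; the second makes the final estimate come out as \<open>e\<close>
        times the distance.\<close>
      define \<epsilon> where "\<epsilon> = min (B / (2 * ?N)) (e * B / (2 * (K + 1) * ?N * (norm p + 1)))"
      have \<epsilon>: "\<epsilon> > 0" using e B K by (simp add: \<epsilon>_def add_nonneg_pos)
      have "\<forall>i. \<exists>d>0. \<forall>y. norm (y - x) < d \<longrightarrow> norm (Y i y - Y i x) < \<epsilon>"
        using Y \<epsilon> unfolding continuous_at_eps_delta by (auto simp: dist_norm)
      then obtain d where d: "\<And>i. d i > 0" "\<And>i y. norm (y - x) < d i \<Longrightarrow> norm (Y i y - Y i x) < \<epsilon>"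
        by metis
      obtain d1 where d1: "d1 > 0" "\<And>y. norm (y - x) < d1 \<Longrightarrow> norm (W y - W x - W' (y - x)) \<le> 1 * norm (y - x)"
        using W unfolding has_derivative_within_alt by (auto dest!: spec[of _ "1::real"])
      obtain d2 where d2: "d2 > 0" "\<And>y. norm (y - x) < d2 \<Longrightarrow> y \<in> S"
        using S unfolding open_dist by (auto simp: dist_norm)
      define dd where "dd = min d1 (min d2 (Min (range d)))"
      have dd: "dd > 0" "dd \<le> d1" "dd \<le> d2" "\<And>i. dd \<le> d i"
        using d(1) d1 d2 by (auto simp: dd_def min_le_iff_disj)
      show "\<exists>d>0. \<forall>y\<in>UNIV. norm (y - x) < d \<longrightarrow> norm (p \<bullet> W y - p \<bullet> W x - 0) \<le> e * norm (y - x)"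
      proof (intro exI conjI ballI impI)
        fix y assume y: "norm (y - x) < dd"
        have "W y \<in> span (range (\<lambda>i. Y i y))" using mem d2 dd y by auto
        also have "span (range (\<lambda>i. Y i y)) = range (?f y)"
        proof
          show "span (range (\<lambda>i. Y i y)) \<subseteq> range (?f y)"
          proof (rule span_minimal)
            show "range (\<lambda>i. Y i y) \<subseteq> range (?f y)"
            proof safe
              fix i
              have "Y i y = ?f y (axis i 1)" by (simp add: axis_def if_distrib[of "\<lambda>c. c *\<^sub>R _"] cong: if_cong)
              then show "Y i y \<in> range (?f y)" by blast
            qed
            show "subspace (range (?f y))" using linear_subspace_image[OF lin subspace_UNIV] .
          qed
          show "range (?f y) \<subseteq> span (range (\<lambda>i. Y i y))"
            by (intro image_subsetI span_sum span_scale span_base rangeI)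
        qed
        finally obtain a where a: "W y = ?f y a" by blast
        have diff: "norm (Y i y - Y i x) \<le> \<epsilon>" for i using d(2)[of y i] y dd(4)[of i] by simp
        have "?f x a = W y + (\<Sum>i\<in>UNIV. a $ i *\<^sub>R (Y i x - Y i y))"
          unfolding a by (simp add: scaleR_diff_right sum_subtractf)
        then have "norm (?f x a) \<le> norm (W y) + norm (\<Sum>i\<in>UNIV. a $ i *\<^sub>R (Y i x - Y i y))"
          using norm_triangle_ineq[of "W y" "\<Sum>i\<in>UNIV. a $ i *\<^sub>R (Y i x - Y i y)"] by simp
        also have "norm (\<Sum>i\<in>UNIV. a $ i *\<^sub>R (Y i x - Y i y)) \<le> (\<Sum>i\<in>(UNIV::'n set). norm a * \<epsilon>)"
        proof (rule sum_norm_le)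
          fix i
          have "norm (Y i x - Y i y) \<le> \<epsilon>" using diff[of i] by (simp add: norm_minus_commute)
          then show "norm (a $ i *\<^sub>R (Y i x - Y i y)) \<le> norm a * \<epsilon>"
            unfolding norm_scaleR by (intro mult_mono component_le_norm_cart) auto
        qed
        also have "\<dots> = norm a * (?N * \<epsilon>)" by simp
        also have "\<dots> \<le> norm a * (B / 2)"
        proof (rule mult_left_mono)
          have "?N * \<epsilon> \<le> ?N * (B / (2 * ?N))" by (intro mult_left_mono) (simp_all add: \<epsilon>_def)
          then show "?N * \<epsilon> \<le> B / 2" by simp
        qed simp
        finally have "B * norm a \<le> norm (W y) + norm a * (B / 2)" using B(2)[of a] by linarith
        then have na: "norm a \<le> 2 / B * norm (W y)" using B(1) by (simp add: field_simps)
        have "norm (W y) \<le> norm (W y - W x - W' (y - x)) + norm (W' (y - x))"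
          using norm_triangle_ineq[of "W y - W x - W' (y - x)" "W' (y - x)"] 0 by simp
        also have "\<dots> \<le> 1 * norm (y - x) + norm (y - x) * K"
          using d1(2)[of y] y dd by (intro add_mono K) auto
        finally have nW: "norm (W y) \<le> (K + 1) * norm (y - x)" by (simp add: algebra_simps)
        have "\<bar>p \<bullet> W y\<bar> = \<bar>\<Sum>i\<in>UNIV. a $ i * (p \<bullet> (Y i y - Y i x))\<bar>"
          unfolding a by (simp add: inner_sum_right p inner_diff_right)
        also have "\<dots> \<le> (\<Sum>i\<in>(UNIV::'n set). norm a * (norm p * \<epsilon>))"
          unfolding real_norm_def[symmetric]
        proof (rule sum_norm_le)
          fix i
          have "\<bar>p \<bullet> (Y i y - Y i x)\<bar> \<le> norm p * \<epsilon>"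
            by (rule order_trans[OF Cauchy_Schwarz_ineq2 mult_left_mono[OF diff]]) simp
          then show "norm (a $ i * (p \<bullet> (Y i y - Y i x))) \<le> norm a * (norm p * \<epsilon>)"
            unfolding real_norm_def abs_mult by (intro mult_mono component_le_norm_cart) auto
        qed
        also have "\<dots> = norm a * (?N * norm p * \<epsilon>)" by simp
        also have "\<dots> \<le> (2 / B * ((K + 1) * norm (y - x))) * (?N * (norm p + 1) * \<epsilon>)"
        proof (intro mult_mono)
          show "norm a \<le> 2 / B * ((K + 1) * norm (y - x))"
            by (rule order_trans[OF na mult_left_mono[OF nW]]) (use B(1) in simp)
        qed (use \<epsilon> B K in auto)
        also have "\<dots> \<le> (2 / B * ((K + 1) * norm (y - x))) * (?N * (norm p + 1) * (e * B / (2 * (K + 1) * ?N * (norm p + 1))))"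
          using B K by (intro mult_left_mono) (auto simp: \<epsilon>_def)
        also have "\<dots> = e * norm (y - x)"
        proof -
          have "norm p + 1 \<noteq> 0" "K + 1 \<noteq> 0" "real ?N \<noteq> 0" "B \<noteq> 0"
            using K(1) B(1) norm_ge_zero[of p] by (linarith | simp)+
          then show ?thesis by (simp add: divide_simps)
        qed
        finally show "norm (p \<bullet> W y - p \<bullet> W x - 0) \<le> e * norm (y - x)" using 0 by simp
      qed (rule dd(1))
    qed
    moreover have "((\<lambda>y. p \<bullet> W y) has_derivative (\<lambda>v. p \<bullet> W' v)) (at x)"
      using W by (auto intro!: derivative_eq_intros)
    ultimately have "(\<lambda>v. 0) = (\<lambda>v. p \<bullet> W' v)" by (rule has_derivative_unique)
    then show ?thesis by (rule fun_cong[symmetric])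
  qed
  \<comment> \<open>Orthogonality to everything orthogonal to the fibre means membership in the
    fibre, a subspace being its own double orthogonal complement.\<close>
  have "W' v \<in> orthogonal_comp (orthogonal_comp ?P)"
    unfolding orthogonal_comp_def orthogonal_def
    using ortho by (auto simp: inner_commute span_base)
  then show ?thesis by (simp add: orthogonal_comp_self)
qed

text \<open>Subtracting the combination with coefficients frozen at \<open>x\<close> gives a section
  that vanishes at \<open>x\<close>.\<close>

lemma section_derivative:
  fixes Y :: "'n::finite \<Rightarrow> 'a::real_normed_vector \<Rightarrow> 'b::euclidean_space"
  assumes "open S" "x \<in> S" and Y: "\<And>i. (Y i has_derivative Y' i) (at x)" and W: "(W has_derivative W') (at x)"
    and mem: "\<And>y. y \<in> S \<Longrightarrow> W y \<in> span (range (\<lambda>i. Y i y))"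
    and dim: "dim (span (range (\<lambda>i. Y i x))) = CARD('n)" and c: "W x = (\<Sum>i\<in>UNIV. c i *\<^sub>R Y i x)"
  shows "W' v - (\<Sum>i\<in>UNIV. c i *\<^sub>R Y' i v) \<in> span (range (\<lambda>i. Y i x))"
proof (rule vanishing_section_derivative[where Y=Y and x=x and S=S, OF assms(1,2) _ _ _ dim])
  show "isCont (Y i) x" for i using Y has_derivative_continuous by blast
  show "((\<lambda>y. W y - (\<Sum>i\<in>UNIV. c i *\<^sub>R Y i y)) has_derivative (\<lambda>v. W' v - (\<Sum>i\<in>UNIV. c i *\<^sub>R Y' i v))) (at x)"
    using W Y by (intro has_derivative_diff has_derivative_sum has_derivative_scaleR_right)
  show "W y - (\<Sum>i\<in>UNIV. c i *\<^sub>R Y i y) \<in> span (range (\<lambda>i. Y i y))" if "y \<in> S" for y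
    by (intro span_diff[OF mem[OF that]] span_sum span_scale span_base rangeI)
qed (use c in simp)

lemma in_span_range:
  fixes Y :: "'n::finite \<Rightarrow> 'b::real_vector"
  assumes "w \<in> span (range Y)"
  obtains c where "w = (\<Sum>i\<in>UNIV. c i *\<^sub>R Y i)"
proof -
  have "span (range Y) \<subseteq> {\<Sum>i\<in>UNIV. c i *\<^sub>R Y i | c. True}"
  proof (rule span_minimal)
    have "\<exists>c. Y i = (\<Sum>j\<in>UNIV. c j *\<^sub>R Y j)" for i
      by (rule exI[of _ "\<lambda>j. if j = i then 1 else 0"])
         (simp add: if_distrib[of "\<lambda>c. c *\<^sub>R _"] cong: if_cong)
    then show "range Y \<subseteq> {\<Sum>i\<in>UNIV. c i *\<^sub>R Y i | c. True}" by auto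
    show "subspace {\<Sum>i\<in>UNIV. c i *\<^sub>R Y i | c. True}"
    proof (rule subspaceI; clarsimp)
      show "\<exists>c. (\<Sum>i\<in>UNIV. c i *\<^sub>R Y i) = 0" by (rule exI[of _ "\<lambda>_. 0"]) simp
      show "\<exists>c. (\<Sum>i\<in>UNIV. a i *\<^sub>R Y i) + (\<Sum>i\<in>UNIV. b i *\<^sub>R Y i) = (\<Sum>i\<in>UNIV. c i *\<^sub>R Y i)" for a b
        by (rule exI[of _ "\<lambda>i. a i + b i"]) (simp add: scaleR_left_distrib sum.distrib)
      show "\<exists>c. k *\<^sub>R (\<Sum>i\<in>UNIV. a i *\<^sub>R Y i) = (\<Sum>i\<in>UNIV. c i *\<^sub>R Y i)" for k a
        by (rule exI[of _ "\<lambda>i. k * a i"]) (simp add: scaleR_sum_right)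
    qed
  qed
  then show ?thesis using assms that by blast
qed

lemma bracket_of_sections:
  fixes Y :: "'n::finite \<Rightarrow> 'a::euclidean_space \<Rightarrow> 'a" and Z :: "'k::finite \<Rightarrow> 'a \<Rightarrow> 'a"
  assumes S: "open S" "x \<in> S" "smooth_on S V" "smooth_on S W"
    and sm: "\<And>i. smooth_on S (Y i)" "\<And>j. smooth_on S (Z j)"
    and mem: "\<And>y. y \<in> S \<Longrightarrow> V y \<in> span (range (\<lambda>i. Y i y))" "\<And>y. y \<in> S \<Longrightarrow> W y \<in> span (range (\<lambda>j. Z j y))"
    and dim: "dim (span (range (\<lambda>i. Y i x))) = CARD('n)" "dim (span (range (\<lambda>j. Z j x))) = CARD('k)"
    and P: "subspace P" "\<And>i. Y i x \<in> P" "\<And>j. Z j x \<in> P" "\<And>i j. lie_bracket (Y i) (Z j) x \<in> P"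
  shows "lie_bracket V W x \<in> P"
proof -
  let ?d = "\<lambda>f. frechet_derivative f (at x)"
  obtain a where a: "V x = (\<Sum>i\<in>UNIV. a i *\<^sub>R Y i x)" using in_span_range[OF mem(1)[OF S(2)]] .
  obtain b where b: "W x = (\<Sum>j\<in>UNIV. b j *\<^sub>R Z j x)" using in_span_range[OF mem(2)[OF S(2)]] .
  note D = smooth_on_has_derivative[OF _ S(2)]
  have lY: "linear (?d (Y i))" and lZ: "linear (?d (Z j))" for i j
    using D[OF sm(1)] D[OF sm(2)] has_derivative_linear by blast+
  have "?d V (W x) - (\<Sum>i\<in>UNIV. a i *\<^sub>R ?d (Y i) (W x)) \<in> span (range (\<lambda>i. Y i x))"
    by (rule section_derivative[OF S(1,2) D[OF sm(1)] D[OF S(3)] mem(1) dim(1) a])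
  then have 1: "?d V (W x) - (\<Sum>i\<in>UNIV. a i *\<^sub>R ?d (Y i) (W x)) \<in> P"
    using P span_minimal[of "range (\<lambda>i. Y i x)" P] by blast
  have "?d W (V x) - (\<Sum>j\<in>UNIV. b j *\<^sub>R ?d (Z j) (V x)) \<in> span (range (\<lambda>j. Z j x))"
    by (rule section_derivative[OF S(1,2) D[OF sm(2)] D[OF S(4)] mem(2) dim(2) b])
  then have 2: "?d W (V x) - (\<Sum>j\<in>UNIV. b j *\<^sub>R ?d (Z j) (V x)) \<in> P"
    using P span_minimal[of "range (\<lambda>j. Z j x)" P] by blast
  have "(\<Sum>j\<in>UNIV. b j *\<^sub>R ?d (Z j) (V x)) - (\<Sum>i\<in>UNIV. a i *\<^sub>R ?d (Y i) (W x)) =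
      (\<Sum>i\<in>UNIV. \<Sum>j\<in>UNIV. (a i * b j) *\<^sub>R lie_bracket (Y i) (Z j) x)"
  proof -
    have "(\<Sum>j\<in>UNIV. b j *\<^sub>R ?d (Z j) (V x)) = (\<Sum>j\<in>UNIV. \<Sum>i\<in>UNIV. (a i * b j) *\<^sub>R ?d (Z j) (Y i x))"
      unfolding a by (simp add: linear_sum[OF lZ] linear_cmul[OF lZ] scaleR_sum_right mult.commute)
    moreover have "(\<Sum>i\<in>UNIV. a i *\<^sub>R ?d (Y i) (W x)) = (\<Sum>i\<in>UNIV. \<Sum>j\<in>UNIV. (a i * b j) *\<^sub>R ?d (Y i) (Z j x))"
      unfolding b by (simp add: linear_sum[OF lY] linear_cmul[OF lY] scaleR_sum_right)
    ultimately show ?thesis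
      using sum.swap[of "\<lambda>j i. (a i * b j) *\<^sub>R ?d (Z j) (Y i x)" UNIV UNIV]
      by (simp add: lie_bracket_def scaleR_diff_right sum_subtractf)
  qed
  then have 3: "(\<Sum>j\<in>UNIV. b j *\<^sub>R ?d (Z j) (V x)) - (\<Sum>i\<in>UNIV. a i *\<^sub>R ?d (Y i) (W x)) \<in> P"
    using P by (auto intro!: subspace_sum subspace_scale)
  have e: "lie_bracket V W x = (?d W (V x) - (\<Sum>j\<in>UNIV. b j *\<^sub>R ?d (Z j) (V x)))
      - (?d V (W x) - (\<Sum>i\<in>UNIV. a i *\<^sub>R ?d (Y i) (W x)))
      + ((\<Sum>j\<in>UNIV. b j *\<^sub>R ?d (Z j) (V x)) - (\<Sum>i\<in>UNIV. a i *\<^sub>R ?d (Y i) (W x)))"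
    by (simp add: lie_bracket_def)
  show ?thesis unfolding e by (intro subspace_add[OF P(1)] subspace_diff[OF P(1)] 1 2 3)
qed


lemma range_two: "range (\<lambda>i::2. f i) = {f 1, f 2}"
  by (simp add: UNIV_2)

lemma range_three: "range (\<lambda>i::3. f i) = {f 1, f 2, f 3}"
  by (simp add: UNIV_3)

lemma lie_bracket_self: "lie_bracket X X x = 0"
  by (simp add: lie_bracket_def)

lemma lie_bracket_swap: "lie_bracket X Y x = - lie_bracket Y X x"
  by (simp add: lie_bracket_def)

text \<open>The situation in one chart over the domain of the basis; the claim is local
  there.\<close>

locale cartan_frame =
  fixes \<Omega> :: "(real^5) set" and X1 X2 :: "real^5 \<Rightarrow> real^5" and D :: "real^5 \<Rightarrow> (real^5) set"
  assumes open_\<Omega>: "open \<Omega>"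
    and smooth_X1: "smooth_on \<Omega> X1" and smooth_X2: "smooth_on \<Omega> X2"
    and D_eq: "x \<in> \<Omega> \<Longrightarrow> D x = span {X1 x, X2 x}"
    and growth: "x \<in> \<Omega> \<Longrightarrow> has_small_growth_vector D x [2, 3, 5]"
begin

definition "X3 = lie_bracket X1 X2"
definition "X4 = lie_bracket X1 X3"
definition "X5 = lie_bracket X2 X3"

lemma smooth_X3: "smooth_on \<Omega> X3"
  unfolding X3_def by (rule smooth_on_lie_bracket[OF open_\<Omega> smooth_X1 smooth_X2])

lemma smooth_X4: "smooth_on \<Omega> X4"
  unfolding X4_def by (rule smooth_on_lie_bracket[OF open_\<Omega> smooth_X1 smooth_X3])

lemma smooth_X5: "smooth_on \<Omega> X5"
  unfolding X5_def by (rule smooth_on_lie_bracket[OF open_\<Omega> smooth_X2 smooth_X3])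

lemma dim_powers:
  assumes "x \<in> \<Omega>"
  shows "dim (D x) = 2" "dim (dist_power D (Suc (Suc 0)) x) = 3" "dim (dist_power D (Suc (Suc (Suc 0))) x) = 5"
proof -
  have "\<forall>j<3. dim (dist_power D (Suc j) x) = [2, 3, 5] ! j"
    using growth[OF assms] by (simp add: has_small_growth_vector_def)
  from this[rule_format, of 0] this[rule_format, of 1] this[rule_format, of 2]
  show "dim (D x) = 2" "dim (dist_power D (Suc (Suc 0)) x) = 3" "dim (dist_power D (Suc (Suc (Suc 0))) x) = 5"
    by (simp_all add: numeral_2_eq_2 del: dist_power.simps(3))
qed

definition "fields2 i = (if i = (1::2) then X1 else X2)"
definition "fields3 i = (if i = (1::3) then X1 else if i = 2 then X2 else X3)"

lemma smooth_fields: "smooth_on \<Omega> (fields2 i)" "smooth_on \<Omega> (fields3 j)"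
  using smooth_X1 smooth_X2 smooth_X3 by (auto simp: fields2_def fields3_def)

lemma range_fields2: "range (\<lambda>i. fields2 i y) = {X1 y, X2 y}"
  by (simp add: range_two fields2_def)

lemma range_fields3: "range (\<lambda>i. fields3 i y) = {X1 y, X2 y, X3 y}"
  by (simp add: range_three fields3_def)

text \<open>The definition admits brackets of arbitrary local sections;
  \<open>bracket_of_sections\<close> reduces them to the single bracket of the basis fields.\<close>

lemma dist_power_2:
  assumes x: "x \<in> \<Omega>"
  shows "dist_power D 2 x = span {X1 x, X2 x, X3 x}"
proof -
  let ?B = "{lie_bracket X Y x | X Y. \<exists>V. x \<in> V \<and> section_on V D X \<and> section_on V D Y}"
  let ?P = "span {X1 x, X2 x, X3 x}"
  have e: "dist_power D 2 x = span (D x \<union> ?B)" by (simp add: numeral_2_eq_2)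
  have "?B \<subseteq> ?P"
  proof clarify
    fix V W S assume S: "x \<in> S" "section_on S D V" "section_on S D W"
    let ?S = "S \<inter> \<Omega>"
    have dim: "dim (span (range (\<lambda>i. fields2 i x))) = CARD(2)"
      using dim_powers(1)[OF x] D_eq[OF x] by (simp add: range_fields2)
    have br: "lie_bracket (fields2 i) (fields2 j) x \<in> ?P" for i j
    proof -
      have "lie_bracket X2 X1 x = - X3 x" using lie_bracket_swap by (simp add: X3_def)
      then show ?thesis
        by (cases "i = 1"; cases "j = 1")
           (auto simp: fields2_def lie_bracket_self X3_def[symmetric] span_zero intro: span_base span_neg)
    qed
    show "lie_bracket V W x \<in> ?P"
    proof (rule bracket_of_sections[where S="?S" and Y=fields2 and Z=fields2, OF _ _ _ _ _ _ _ _ dim dim])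
      show "open ?S" "x \<in> ?S" using S x open_\<Omega> by (auto simp: section_on_def)
      show "smooth_on ?S V" "smooth_on ?S W" using S by (auto simp: section_on_def intro: smooth_on_subset)
      show "smooth_on ?S (fields2 i)" for i using smooth_fields by (auto intro: smooth_on_subset)
      then show "smooth_on ?S (fields2 i)" for i .
      show "V y \<in> span (range (\<lambda>i. fields2 i y))" "W y \<in> span (range (\<lambda>i. fields2 i y))" if "y \<in> ?S" for y
        using S that D_eq[of y] by (auto simp: section_on_def range_fields2)
      show "fields2 i x \<in> ?P" for i by (auto simp: fields2_def intro: span_base)
      then show "fields2 i x \<in> ?P" for i .
    qed (use br in auto)
  qed
  moreover have "D x \<subseteq> ?P" unfolding D_eq[OF x] by (rule span_mono) auto
  ultimately have 1: "dist_power D 2 x \<subseteq> ?P" unfolding e by (intro span_minimal) auto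
  have "section_on \<Omega> D X1" "section_on \<Omega> D X2"
    using open_\<Omega> smooth_X1 smooth_X2 D_eq by (auto simp: section_on_def intro: span_base)
  then have "X3 x \<in> ?B" using x unfolding X3_def by blast
  moreover have "X1 x \<in> D x" "X2 x \<in> D x" unfolding D_eq[OF x] by (auto intro: span_base)
  ultimately have 2: "?P \<subseteq> dist_power D 2 x"
    unfolding e by (intro span_mono) auto
  show ?thesis using 1 2 by blast
qed

text \<open>The same reduction puts the third power of \<open>D\<close> inside the span; that the
  span is everything is the 5 of the growth vector.\<close>

lemma span_frame:
  assumes x: "x \<in> \<Omega>"
  shows "span {X1 x, X2 x, X3 x, X4 x, X5 x} = UNIV"
proof -
  let ?B = "{lie_bracket X Y x | X Y. \<exists>V. x \<in> V \<and> section_on V D X \<and> section_on V (dist_power D (Suc (Suc 0))) Y}"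
  let ?P = "span {X1 x, X2 x, X3 x, X4 x, X5 x}"
  have e: "dist_power D (Suc (Suc (Suc 0))) x = span (dist_power D (Suc (Suc 0)) x \<union> ?B)"
    by (simp del: dist_power.simps(3) add: dist_power.simps(3)[of D "Suc 0"])
  have D2: "dist_power D (Suc (Suc 0)) y = span {X1 y, X2 y, X3 y}" if "y \<in> \<Omega>" for y
    using dist_power_2[OF that] by (simp only: numeral_2_eq_2)
  have "?B \<subseteq> ?P"
  proof clarify
    fix V W S assume S: "x \<in> S" "section_on S D V" "section_on S (dist_power D (Suc (Suc 0))) W"
    let ?S = "S \<inter> \<Omega>"
    have dim: "dim (span (range (\<lambda>i. fields2 i x))) = CARD(2)"
      using dim_powers(1)[OF x] D_eq[OF x] by (simp add: range_fields2)
    have dim': "dim (span (range (\<lambda>i. fields3 i x))) = CARD(3)"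
      using dim_powers(2)[OF x] D2[OF x] by (simp add: range_fields3 del: dist_power.simps)
    have br: "lie_bracket (fields2 i) (fields3 j) x \<in> ?P" for i j
    proof -
      have "lie_bracket X2 X1 x = - X3 x" using lie_bracket_swap by (simp add: X3_def)
      then show ?thesis
        by (cases "i = 1"; cases "j = 1"; cases "j = 2")
           (auto simp: fields2_def fields3_def lie_bracket_self X3_def[symmetric] X4_def[symmetric] X5_def[symmetric]
             span_zero intro: span_base span_neg)
    qed
    show "lie_bracket V W x \<in> ?P"
    proof (rule bracket_of_sections[where S="?S" and Y=fields2 and Z=fields3, OF _ _ _ _ _ _ _ _ dim dim'])
      show "open ?S" "x \<in> ?S" using S x open_\<Omega> by (auto simp: section_on_def)
      show "smooth_on ?S V" "smooth_on ?S W" using S by (auto simp: section_on_def intro: smooth_on_subset)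
      show "smooth_on ?S (fields2 i)" "smooth_on ?S (fields3 j)" for i j
        using smooth_fields by (auto intro: smooth_on_subset)
      show "V y \<in> span (range (\<lambda>i. fields2 i y))" "W y \<in> span (range (\<lambda>i. fields3 i y))" if "y \<in> ?S" for y
        using S that D_eq[of y] D2[of y]
        by (auto simp: section_on_def range_fields2 range_fields3 simp del: dist_power.simps)
      show "fields2 i x \<in> ?P" "fields3 j x \<in> ?P" for i j by (auto simp: fields2_def fields3_def intro: span_base)
    qed (use br in auto)
  qed
  moreover have "dist_power D (Suc (Suc 0)) x \<subseteq> ?P" unfolding D2[OF x] by (rule span_mono) auto
  ultimately have "dist_power D (Suc (Suc (Suc 0))) x \<subseteq> ?P" unfolding e by (intro span_minimal) auto
  then have "5 \<le> dim ?P" using dim_powers(3)[OF x] by (metis dim_subset)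
  then have "dim ?P = DIM(real^5)" using dim_subset_UNIV[of ?P] by simp
  then show ?thesis using dim_eq_full[of ?P] by (simp add: span_span)
qed

definition "frame j = (if j = (1::5) then X1 else if j = 2 then X2 else if j = 3 then X3 else if j = 4 then X4 else X5)"

text \<open>The dual basis, as rows of the inverse of the matrix whose columns are the frame; in
  this form its smoothness follows from Cramer's rule.\<close>

definition "coframe j x = (\<chi> i. matrix_inv (\<chi> r s. frame s x $ r :: real^5^5) $ j $ i)"

lemma smooth_frame: "smooth_on \<Omega> (frame j)"
  using smooth_X1 smooth_X2 smooth_X3 smooth_X4 smooth_X5 by (auto simp: frame_def)

lemma frame_det:
  assumes x: "x \<in> \<Omega>"
  shows "det (\<chi> r s. frame s x $ r :: real^5^5) \<noteq> 0"
proof -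
  let ?F = "(\<chi> r s. frame s x $ r) :: real^5^5"
  have "column j ?F = frame j x" for j by (simp add: column_def vec_eq_iff)
  then have "columns ?F = range (\<lambda>j. frame j x)" unfolding columns_def by auto
  also have "\<dots> = {X1 x, X2 x, X3 x, X4 x, X5 x}" unfolding UNIV_5 by (simp add: frame_def)
  finally have "span (columns ?F) = UNIV" using span_frame[OF x] by simp
  then obtain B where "?F ** B = mat 1" using matrix_right_invertible_span_columns[of ?F] by (auto simp: span_vec_eq)
  then have "invertible ?F" unfolding invertible_def using matrix_left_right_inverse by blast
  then show ?thesis using invertible_det_nz by blast
qed

lemma smooth_coframe: "smooth_on \<Omega> (coframe j)"
proof (rule smooth_on_componentwise[OF open_\<Omega>])
  fix b :: "real^5" assume "b \<in> Basis"
  then obtain i where b: "b = axis i 1" by (auto simp: Basis_vec_def)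
  have "smooth_on \<Omega> (\<lambda>x. matrix_inv (\<chi> r s. frame s x $ r :: real^5^5) $ j $ i)"
  proof (rule smooth_on_matrix_inv[OF open_\<Omega> _ frame_det])
    show "smooth_on \<Omega> (\<lambda>x. (\<chi> r s. frame s x $ r :: real^5^5) $ r $ s)" for r s
      using smooth_on_bounded_linear[OF bounded_linear_vec_nth open_\<Omega> smooth_frame[of s], of r] by simp
  qed
  then show "smooth_on \<Omega> (\<lambda>x. coframe j x \<bullet> b)"
    by (simp add: b coframe_def inner_axis)
qed

lemma coframe_frame:
  assumes "x \<in> \<Omega>"
  shows "coframe i x \<bullet> frame j x = (if i = j then 1 else 0)"
proof -
  let ?F = "(\<chi> r s. frame s x $ r) :: real^5^5"
  have "(matrix_inv ?F ** ?F) $ i $ j = mat 1 $ i $ j"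
    using matrix_inv_inverse(2)[OF frame_det[OF assms]] by simp
  then show ?thesis
    by (simp add: matrix_matrix_mult_def mat_def coframe_def inner_vec_def)
qed

lemma frame_expansion:
  assumes "x \<in> \<Omega>"
  shows "v = (\<Sum>j\<in>UNIV. (coframe j x \<bullet> v) *\<^sub>R frame j x)"
proof -
  let ?F = "(\<chi> r s. frame s x $ r) :: real^5^5"
  have "v = (?F ** matrix_inv ?F) *v v"
    using matrix_inv_inverse(1)[OF frame_det[OF assms]] by simp
  also have "\<dots> = ?F *v (\<chi> j. coframe j x \<bullet> v)"
    unfolding matrix_vector_mul_assoc[symmetric]
    by (simp add: matrix_vector_mult_def coframe_def inner_vec_def)
  also have "\<dots> = (\<Sum>j\<in>UNIV. (coframe j x \<bullet> v) *\<^sub>R frame j x)"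
    by (simp add: matrix_vector_mult_def vec_eq_iff mult.commute)
  finally show ?thesis .
qed

end

section \<open>Fibrewise polynomial functions on the cotangent bundle\<close>

lemma derivative_along_field:
  fixes u :: "'a::euclidean_space \<Rightarrow> real" and Y :: "'a \<Rightarrow> 'a"
  assumes S: "open S" "x \<in> S" "smooth_on S u" "smooth_on S Y"
  shows "frechet_derivative (\<lambda>y. frechet_derivative u (at y) (Y y)) (at x) w =
    frechet_derivative u (at x) (frechet_derivative Y (at x) w) +
    frechet_derivative (\<lambda>y. frechet_derivative u (at y) w) (at x) (Y x)"
proof -
  let ?D = "\<lambda>b y. frechet_derivative u (at y) b"
  have du: "(u has_derivative frechet_derivative u (at y)) (at y)" if "y \<in> S" for y
    by (rule smooth_on_has_derivative[OF S(3) that])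
  have ddu: "(?D b has_derivative frechet_derivative (?D b) (at x)) (at x)" for b
    by (rule smooth_on_has_derivative[OF smooth_on_derivative_const[OF S(3)] S(2)])
  have dY: "(Y has_derivative frechet_derivative Y (at x)) (at x)"
    by (rule smooth_on_has_derivative[OF S(4,2)])
  have "((\<lambda>y. \<Sum>b\<in>Basis. (Y y \<bullet> b) * ?D b y) has_derivative
      (\<lambda>w. \<Sum>b\<in>Basis. (Y x \<bullet> b) * frechet_derivative (?D b) (at x) w + (frechet_derivative Y (at x) w \<bullet> b) * ?D b x)) (at x)"
    by (intro has_derivative_sum has_derivative_mult ddu has_derivative_inner_left dY)
  then have "((\<lambda>y. ?D (Y y) y) has_derivative
      (\<lambda>w. \<Sum>b\<in>Basis. (Y x \<bullet> b) * frechet_derivative (?D b) (at x) w + (frechet_derivative Y (at x) w \<bullet> b) * ?D b x)) (at x)"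
    by (rule has_derivative_transform_within_open[OF _ S(1,2)])
       (use frechet_derivative_basis[OF du] in simp)
  from frechet_derivative_at[OF this, symmetric]
  have "frechet_derivative (\<lambda>y. ?D (Y y) y) (at x) w =
     (\<Sum>b\<in>Basis. (Y x \<bullet> b) * frechet_derivative (?D b) (at x) w) + (\<Sum>b\<in>Basis. (frechet_derivative Y (at x) w \<bullet> b) * ?D b x)"
    by (simp add: sum.distrib)
  also have "(\<Sum>b\<in>Basis. (frechet_derivative Y (at x) w \<bullet> b) * ?D b x) = ?D (frechet_derivative Y (at x) w) x"
    using frechet_derivative_basis[OF du[OF S(2)], of "frechet_derivative Y (at x) w"] by simp
  also have "(\<Sum>b\<in>Basis. (Y x \<bullet> b) * frechet_derivative (?D b) (at x) w) =
      (\<Sum>b\<in>Basis. (Y x \<bullet> b) * frechet_derivative (?D w) (at x) b)"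
    by (intro sum.cong refl arg_cong2[where f="(*)"] smooth_on_Clairaut[OF S(1-3)])
  also have "\<dots> = frechet_derivative (?D w) (at x) (Y x)"
    using frechet_derivative_basis[OF ddu[of w], of "Y x"] by simp
  finally show ?thesis by simp
qed

text \<open>The second derivatives of \<open>u\<close> cancel by symmetry and leave the bracket.
  This converts the tangency of a bracket into statements about functions.\<close>

lemma lie_bracket_commutator:
  fixes u :: "'a::euclidean_space \<Rightarrow> real"
  assumes S: "open S" "x \<in> S" "smooth_on S u" "smooth_on S X" "smooth_on S Y"
  shows "frechet_derivative u (at x) (lie_bracket X Y x) =
     frechet_derivative (\<lambda>y. frechet_derivative u (at y) (Y y)) (at x) (X x) -
     frechet_derivative (\<lambda>y. frechet_derivative u (at y) (X y)) (at x) (Y x)"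
proof -
  have du: "linear (frechet_derivative u (at x))"
    using smooth_on_has_derivative[OF S(3,2)] has_derivative_linear by blast
  have C: "frechet_derivative (\<lambda>y. frechet_derivative u (at y) (X x)) (at x) (Y x) =
    frechet_derivative (\<lambda>y. frechet_derivative u (at y) (Y x)) (at x) (X x)"
    by (rule smooth_on_Clairaut[OF S(1-3)])
  show ?thesis
    unfolding derivative_along_field[OF S(1-3) S(5)] derivative_along_field[OF S(1-4)] lie_bracket_def linear_diff[OF du] C
    by simp
qed

lemma tangent_space_derivative_zero:
  fixes f :: "'a::real_normed_vector \<Rightarrow> 'b::real_normed_vector"
  assumes "v \<in> tangent_space N x" "(f has_derivative f') (at x)" "\<And>y. y \<in> N \<Longrightarrow> f y = 0"
  shows "f' v = 0"
proof -
  obtain \<gamma> e where g: "0 < e" "\<gamma> ` {-e<..<e} \<subseteq> N" "\<gamma> 0 = x" "(\<gamma> has_vector_derivative v) (at (0::real))"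
    using assms(1) unfolding tangent_space_def by blast
  have "((\<lambda>t. f (\<gamma> t)) has_derivative (\<lambda>h. f' (h *\<^sub>R v))) (at 0)"
    using has_derivative_compose[of \<gamma> "\<lambda>h. h *\<^sub>R v" 0 UNIV f f'] g(3,4) assms(2)
    by (simp add: has_vector_derivative_def)
  moreover have "((\<lambda>t. f (\<gamma> t)) has_derivative (\<lambda>h. 0)) (at 0)"
  proof (rule has_derivative_transform_within_open[where s="{-e<..<e}"])
    show "((\<lambda>t. 0) has_derivative (\<lambda>h. 0)) (at (0::real))" by simp
    show "0 = f (\<gamma> t)" if "t \<in> {-e<..<e}" for t using assms(3)[of "\<gamma> t"] g(2) that by (simp add: image_subset_iff)
  qed (use g(1) in auto)
  ultimately have "(\<lambda>h. f' (h *\<^sub>R v)) = (\<lambda>h. 0)" by (rule has_derivative_unique)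
  from fun_cong[OF this, of 1] show ?thesis by simp
qed

text \<open>Polynomials in the momenta with coefficients smooth on the base. The inductive form
  gives closure under differentiation and restriction to lines by induction.\<close>

inductive_set fpoly_raw :: "'e::euclidean_space set \<Rightarrow> ('e \<times> 'e \<Rightarrow> real) set" for \<Omega> where
  base: "smooth_on \<Omega> a \<Longrightarrow> (\<lambda>\<xi>. a (fst \<xi>)) \<in> fpoly_raw \<Omega>"
| momentum: "(\<lambda>\<xi>. snd \<xi> \<bullet> b) \<in> fpoly_raw \<Omega>"
| add: "f \<in> fpoly_raw \<Omega> \<Longrightarrow> g \<in> fpoly_raw \<Omega> \<Longrightarrow> (\<lambda>\<xi>. f \<xi> + g \<xi>) \<in> fpoly_raw \<Omega>"
| mult: "f \<in> fpoly_raw \<Omega> \<Longrightarrow> g \<in> fpoly_raw \<Omega> \<Longrightarrow> (\<lambda>\<xi>. f \<xi> * g \<xi>) \<in> fpoly_raw \<Omega>"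

text \<open>Agreement is asked over \<open>\<Omega>\<close> only, because the coefficients and their
  derivatives are meaningful only there.\<close>

definition fpoly :: "'e::euclidean_space set \<Rightarrow> ('e \<times> 'e \<Rightarrow> real) \<Rightarrow> bool" where
  "fpoly \<Omega> f \<longleftrightarrow> (\<exists>g\<in>fpoly_raw \<Omega>. \<forall>\<xi>\<in>\<Omega> \<times> UNIV. f \<xi> = g \<xi>)"

lemma fpoly_cong: "(\<And>\<xi>. \<xi> \<in> \<Omega> \<times> UNIV \<Longrightarrow> f \<xi> = g \<xi>) \<Longrightarrow> fpoly \<Omega> f \<Longrightarrow> fpoly \<Omega> g"
  unfolding fpoly_def by auto

lemma fpoly_base: "smooth_on \<Omega> a \<Longrightarrow> fpoly \<Omega> (\<lambda>\<xi>. a (fst \<xi>))"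
  unfolding fpoly_def by (intro bexI[of _ "\<lambda>\<xi>. a (fst \<xi>)"] fpoly_raw.base) auto

lemma fpoly_momentum: "fpoly \<Omega> (\<lambda>\<xi>. snd \<xi> \<bullet> b)"
  unfolding fpoly_def by (intro bexI[of _ "\<lambda>\<xi>. snd \<xi> \<bullet> b"] fpoly_raw.momentum) simp

lemma fpoly_add:
  assumes "fpoly \<Omega> f" "fpoly \<Omega> g"
  shows "fpoly \<Omega> (\<lambda>\<xi>. f \<xi> + g \<xi>)"
proof -
  from assms obtain f' g' where "f' \<in> fpoly_raw \<Omega>" "g' \<in> fpoly_raw \<Omega>"
    "\<forall>\<xi>\<in>\<Omega> \<times> UNIV. f \<xi> = f' \<xi>" "\<forall>\<xi>\<in>\<Omega> \<times> UNIV. g \<xi> = g' \<xi>" unfolding fpoly_def by auto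
  then show ?thesis unfolding fpoly_def by (intro bexI[of _ "\<lambda>\<xi>. f' \<xi> + g' \<xi>"] fpoly_raw.add) auto
qed

lemma fpoly_mult:
  assumes "fpoly \<Omega> f" "fpoly \<Omega> g"
  shows "fpoly \<Omega> (\<lambda>\<xi>. f \<xi> * g \<xi>)"
proof -
  from assms obtain f' g' where "f' \<in> fpoly_raw \<Omega>" "g' \<in> fpoly_raw \<Omega>"
    "\<forall>\<xi>\<in>\<Omega> \<times> UNIV. f \<xi> = f' \<xi>" "\<forall>\<xi>\<in>\<Omega> \<times> UNIV. g \<xi> = g' \<xi>" unfolding fpoly_def by auto
  then show ?thesis unfolding fpoly_def by (intro bexI[of _ "\<lambda>\<xi>. f' \<xi> * g' \<xi>"] fpoly_raw.mult) auto
qed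

lemma fpoly_const: "open \<Omega> \<Longrightarrow> fpoly \<Omega> (\<lambda>\<xi>. c)"
  using fpoly_base[of \<Omega> "\<lambda>x. c"] smooth_on_const[of \<Omega> c] by simp

lemma fpoly_minus: "open \<Omega> \<Longrightarrow> fpoly \<Omega> f \<Longrightarrow> fpoly \<Omega> (\<lambda>\<xi>. - f \<xi>)"
  using fpoly_mult[OF fpoly_const[of \<Omega> "-1"], of f] by simp

lemma fpoly_diff: "open \<Omega> \<Longrightarrow> fpoly \<Omega> f \<Longrightarrow> fpoly \<Omega> g \<Longrightarrow> fpoly \<Omega> (\<lambda>\<xi>. f \<xi> - g \<xi>)"
  using fpoly_add[OF _ fpoly_minus, of \<Omega> f g] by simp

lemma fpoly_sum: "open \<Omega> \<Longrightarrow> (\<And>i. i \<in> I \<Longrightarrow> fpoly \<Omega> (f i)) \<Longrightarrow> fpoly \<Omega> (\<lambda>\<xi>. \<Sum>i\<in>I. f i \<xi>)"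
  by (induction I rule: infinite_finite_induct) (auto intro: fpoly_const fpoly_add)

lemma fpoly_raw_derivative:
  assumes "open \<Omega>" "f \<in> fpoly_raw \<Omega>"
  shows "\<exists>f'. (\<forall>\<xi>\<in>\<Omega> \<times> UNIV. (f has_derivative f' \<xi>) (at \<xi>)) \<and> (\<forall>w. (\<lambda>\<xi>. f' \<xi> w) \<in> fpoly_raw \<Omega>)"
  using assms(2)
proof induction
  case (base a)
  have "((\<lambda>\<xi>. a (fst \<xi>)) has_derivative (\<lambda>w. frechet_derivative a (at (fst \<xi>)) (fst w))) (at \<xi>)" if "\<xi> \<in> \<Omega> \<times> UNIV" for \<xi> :: "'a \<times> 'a"
    by (rule has_derivative_compose[OF bounded_linear_imp_has_derivative[OF bounded_linear_fst]])
       (use smooth_on_has_derivative[OF base] that in auto)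
  moreover have "(\<lambda>\<xi>. frechet_derivative a (at (fst \<xi>)) (fst w)) \<in> fpoly_raw \<Omega>" for w :: "'a \<times> 'a"
    by (rule fpoly_raw.base[OF smooth_on_derivative_const[OF base]])
  ultimately show ?case
    by (intro exI[of _ "\<lambda>\<xi> w. frechet_derivative a (at (fst \<xi>)) (fst w)"]) blast
next
  case (momentum b)
  have "((\<lambda>\<xi>. snd \<xi> \<bullet> b) has_derivative (\<lambda>w. snd w \<bullet> b)) (at \<xi>)" for \<xi> :: "'a \<times> 'a"
    by (auto intro!: derivative_eq_intros)
  moreover have "(\<lambda>\<xi>. snd w \<bullet> b) \<in> fpoly_raw \<Omega>" for w :: "'a \<times> 'a"
    by (rule fpoly_raw.base[of \<Omega> "\<lambda>x. snd w \<bullet> b", OF smooth_on_const[OF assms(1)]])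
  ultimately show ?case by (intro exI[of _ "\<lambda>\<xi> w. snd w \<bullet> b"]) blast
next
  case (add f g)
  then obtain f' g' where "\<forall>\<xi>\<in>\<Omega> \<times> UNIV. (f has_derivative f' \<xi>) (at \<xi>)" "\<forall>w. (\<lambda>\<xi>. f' \<xi> w) \<in> fpoly_raw \<Omega>"
    "\<forall>\<xi>\<in>\<Omega> \<times> UNIV. (g has_derivative g' \<xi>) (at \<xi>)" "\<forall>w. (\<lambda>\<xi>. g' \<xi> w) \<in> fpoly_raw \<Omega>" by blast
  then show ?case
    by (intro exI[of _ "\<lambda>\<xi> w. f' \<xi> w + g' \<xi> w"]) (simp add: has_derivative_add fpoly_raw.add)
next
  case (mult f g)
  then obtain f' g' where d: "\<forall>\<xi>\<in>\<Omega> \<times> UNIV. (f has_derivative f' \<xi>) (at \<xi>)" "\<forall>w. (\<lambda>\<xi>. f' \<xi> w) \<in> fpoly_raw \<Omega>"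
    "\<forall>\<xi>\<in>\<Omega> \<times> UNIV. (g has_derivative g' \<xi>) (at \<xi>)" "\<forall>w. (\<lambda>\<xi>. g' \<xi> w) \<in> fpoly_raw \<Omega>" by blast
  have "(\<lambda>\<xi>. f \<xi> * g' \<xi> w + f' \<xi> w * g \<xi>) \<in> fpoly_raw \<Omega>" for w
    by (intro fpoly_raw.add fpoly_raw.mult mult.hyps d(2)[rule_format] d(4)[rule_format])
  then show ?case using d
    by (intro exI[of _ "\<lambda>\<xi> w. f \<xi> * g' \<xi> w + f' \<xi> w * g \<xi>"]) (simp add: has_derivative_mult)
qed

lemma open_times_UNIV: "open \<Omega> \<Longrightarrow> open (\<Omega> \<times> UNIV)"
  by (simp add: open_Times)

lemma fpoly_derivative:
  assumes "open \<Omega>" "fpoly \<Omega> f"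
  shows "\<xi> \<in> \<Omega> \<times> UNIV \<Longrightarrow> (f has_derivative frechet_derivative f (at \<xi>)) (at \<xi>)"
    and "fpoly \<Omega> (\<lambda>\<xi>. frechet_derivative f (at \<xi>) w)"
proof -
  obtain g where g: "g \<in> fpoly_raw \<Omega>" "\<And>\<xi>. \<xi> \<in> \<Omega> \<times> UNIV \<Longrightarrow> f \<xi> = g \<xi>"
    using assms(2) unfolding fpoly_def by blast
  obtain g' where g': "\<forall>\<xi>\<in>\<Omega> \<times> UNIV. (g has_derivative g' \<xi>) (at \<xi>)" "\<And>w. (\<lambda>\<xi>. g' \<xi> w) \<in> fpoly_raw \<Omega>"
    using fpoly_raw_derivative[OF assms(1) g(1)] by blast
  have d: "(f has_derivative g' \<xi>) (at \<xi>)" if "\<xi> \<in> \<Omega> \<times> UNIV" for \<xi>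
    by (rule has_derivative_transform_within_open[OF _ open_times_UNIV[OF assms(1)] that])
       (use g' g(2) that in auto)
  have eq: "frechet_derivative f (at \<xi>) = g' \<xi>" if "\<xi> \<in> \<Omega> \<times> UNIV" for \<xi>
    using frechet_derivative_at[OF d[OF that]] by simp
  show "(f has_derivative frechet_derivative f (at \<xi>)) (at \<xi>)" if "\<xi> \<in> \<Omega> \<times> UNIV" for \<xi>
    using d[OF that] eq[OF that] by simp
  show "fpoly \<Omega> (\<lambda>\<xi>. frechet_derivative f (at \<xi>) w)" for w
    unfolding fpoly_def using g'(2) eq by (intro bexI[of _ "\<lambda>\<xi>. g' \<xi> w"]) auto
qed

lemma fpoly_Ck_on: "open \<Omega> \<Longrightarrow> fpoly \<Omega> f \<Longrightarrow> Ck_on k (\<Omega> \<times> UNIV) f"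
proof (induction k arbitrary: f)
  case 0
  then show ?case
    using fpoly_derivative(1) by (auto intro!: continuous_at_imp_continuous_on has_derivative_continuous)
next
  case (Suc k)
  show ?case
    by (rule Ck_onI[OF open_times_UNIV[OF Suc.prems(1)] fpoly_derivative(1)[OF Suc.prems]])
       (auto intro!: Suc.IH[OF Suc.prems(1)] fpoly_derivative(2)[OF Suc.prems])
qed

lemma fpoly_smooth_on: "open \<Omega> \<Longrightarrow> fpoly \<Omega> f \<Longrightarrow> smooth_on (\<Omega> \<times> UNIV) f"
  unfolding smooth_on_def using fpoly_Ck_on by blast

definition poly_fun :: "(real \<Rightarrow> real) \<Rightarrow> bool" where
  "poly_fun f \<longleftrightarrow> (\<exists>P. \<forall>z. f z = poly P z)"

lemma poly_fun_const: "poly_fun (\<lambda>z. c)"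
  unfolding poly_fun_def by (rule exI[of _ "[:c:]"]) simp

lemma poly_fun_ident: "poly_fun (\<lambda>z. z)"
  unfolding poly_fun_def by (rule exI[of _ "[:0, 1:]"]) simp

lemma poly_fun_add: "poly_fun f \<Longrightarrow> poly_fun g \<Longrightarrow> poly_fun (\<lambda>z. f z + g z)"
  unfolding poly_fun_def by (elim exE, rule_tac x="P + Pa" in exI) simp

lemma poly_fun_mult: "poly_fun f \<Longrightarrow> poly_fun g \<Longrightarrow> poly_fun (\<lambda>z. f z * g z)"
  unfolding poly_fun_def by (elim exE, rule_tac x="P * Pa" in exI) simp

text \<open>Where polynomial dependence on \<open>z\<close> originates: along a line in one fibre
  the coefficients from the base are constants.\<close>

lemma fpoly_restrict_line:
  assumes "fpoly \<Omega> f" "x \<in> \<Omega>"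
  shows "poly_fun (\<lambda>z. f (x, p + z *\<^sub>R r))"
proof -
  obtain g where g: "g \<in> fpoly_raw \<Omega>" "\<And>\<xi>. \<xi> \<in> \<Omega> \<times> UNIV \<Longrightarrow> f \<xi> = g \<xi>"
    using assms(1) unfolding fpoly_def by blast
  from g(1) have "poly_fun (\<lambda>z. g (x, p + z *\<^sub>R r))"
  proof induction
    case (momentum b)
    have "poly_fun (\<lambda>z. p \<bullet> b + z * (r \<bullet> b))"
      by (intro poly_fun_add poly_fun_mult poly_fun_const poly_fun_ident)
    then show ?case by (simp add: inner_add_left)
    next
    case (base a)
    show ?case using poly_fun_const by simp
  next
    case (add f g)
    show ?case by (rule poly_fun_add[OF add.IH])
  next
    case (mult f g)
    show ?case by (rule poly_fun_mult[OF mult.IH])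
  qed
  then show ?thesis using g(2) assms(2) by simp
qed

definition vpoly :: "'e::euclidean_space set \<Rightarrow> ('e \<times> 'e \<Rightarrow> 'b::euclidean_space) \<Rightarrow> bool" where
  "vpoly \<Omega> F \<longleftrightarrow> (\<forall>b\<in>Basis. fpoly \<Omega> (\<lambda>\<xi>. F \<xi> \<bullet> b))"

lemma fpoly_inner:
  assumes "open \<Omega>" "vpoly \<Omega> F" "vpoly \<Omega> G"
  shows "fpoly \<Omega> (\<lambda>\<xi>. F \<xi> \<bullet> G \<xi>)"
proof (rule fpoly_cong)
  show "fpoly \<Omega> (\<lambda>\<xi>. \<Sum>b\<in>Basis. (F \<xi> \<bullet> b) * (G \<xi> \<bullet> b))"
    using assms by (intro fpoly_sum fpoly_mult) (auto simp: vpoly_def)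
qed (rule euclidean_inner[symmetric])

lemma vpoly_base:
  assumes "open \<Omega>" "smooth_on \<Omega> a"
  shows "vpoly \<Omega> (\<lambda>\<xi>. a (fst \<xi>))"
  unfolding vpoly_def
  by (intro ballI fpoly_base[of \<Omega> "\<lambda>x. a x \<bullet> _"] smooth_on_inner smooth_on_const assms)

lemma vpoly_momentum: "vpoly \<Omega> snd"
  unfolding vpoly_def by (auto intro: fpoly_momentum)

lemma vpoly_scaleR: "open \<Omega> \<Longrightarrow> fpoly \<Omega> f \<Longrightarrow> vpoly \<Omega> F \<Longrightarrow> vpoly \<Omega> (\<lambda>\<xi>. f \<xi> *\<^sub>R F \<xi>)"
  unfolding vpoly_def by (auto intro: fpoly_mult)

lemma vpoly_add: "vpoly \<Omega> F \<Longrightarrow> vpoly \<Omega> G \<Longrightarrow> vpoly \<Omega> (\<lambda>\<xi>. F \<xi> + G \<xi>)"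
  unfolding vpoly_def by (auto simp: inner_add_left intro: fpoly_add)

lemma vpoly_diff: "open \<Omega> \<Longrightarrow> vpoly \<Omega> F \<Longrightarrow> vpoly \<Omega> G \<Longrightarrow> vpoly \<Omega> (\<lambda>\<xi>. F \<xi> - G \<xi>)"
  unfolding vpoly_def by (auto simp: inner_diff_left intro: fpoly_diff)

lemma vpoly_const: "open \<Omega> \<Longrightarrow> vpoly \<Omega> (\<lambda>\<xi>. c)"
  unfolding vpoly_def by (auto intro: fpoly_const)

lemma vpoly_sum: "open \<Omega> \<Longrightarrow> (\<And>i. i \<in> I \<Longrightarrow> vpoly \<Omega> (F i)) \<Longrightarrow> vpoly \<Omega> (\<lambda>\<xi>. \<Sum>i\<in>I. F i \<xi>)"
  by (induction I rule: infinite_finite_induct) (auto intro: vpoly_const vpoly_add)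

lemma vpoly_Pair: "open \<Omega> \<Longrightarrow> vpoly \<Omega> F \<Longrightarrow> vpoly \<Omega> G \<Longrightarrow> vpoly \<Omega> (\<lambda>\<xi>. (F \<xi>, G \<xi>))"
  unfolding vpoly_def by (auto simp: Basis_prod_def)

lemma vpoly_fst:
  assumes "open \<Omega>" "vpoly \<Omega> F"
  shows "vpoly \<Omega> (\<lambda>\<xi>. fst (F \<xi>))"
  unfolding vpoly_def
proof
  fix b :: 'b assume "b \<in> Basis"
  then have "(b, 0 :: 'c) \<in> Basis" by (simp add: Basis_prod_def)
  then have "fpoly \<Omega> (\<lambda>\<xi>. F \<xi> \<bullet> (b, 0))" using assms(2) unfolding vpoly_def by blast
  then show "fpoly \<Omega> (\<lambda>\<xi>. fst (F \<xi>) \<bullet> b)" by (simp add: inner_prod_def)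
qed

lemma vpoly_smooth_on: "open \<Omega> \<Longrightarrow> vpoly \<Omega> F \<Longrightarrow> smooth_on (\<Omega> \<times> UNIV) F"
  unfolding vpoly_def by (rule smooth_on_componentwise[OF open_times_UNIV]) (auto intro: fpoly_smooth_on)

lemma vpoly_has_derivative:
  "open \<Omega> \<Longrightarrow> vpoly \<Omega> F \<Longrightarrow> \<xi> \<in> \<Omega> \<times> UNIV \<Longrightarrow> (F has_derivative frechet_derivative F (at \<xi>)) (at \<xi>)"
  by (rule smooth_on_has_derivative[OF vpoly_smooth_on])

lemma fpoly_directional:
  assumes "open \<Omega>" "fpoly \<Omega> f" "vpoly \<Omega> V"
  shows "fpoly \<Omega> (\<lambda>\<xi>. frechet_derivative f (at \<xi>) (V \<xi>))"
proof (rule fpoly_cong)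
  show "fpoly \<Omega> (\<lambda>\<xi>. \<Sum>b\<in>Basis. (V \<xi> \<bullet> b) * frechet_derivative f (at \<xi>) b)"
    using assms by (intro fpoly_sum fpoly_mult fpoly_derivative(2)) (auto simp: vpoly_def)
  show "(\<Sum>b\<in>Basis. (V \<xi> \<bullet> b) * frechet_derivative f (at \<xi>) b) = frechet_derivative f (at \<xi>) (V \<xi>)"
    if "\<xi> \<in> \<Omega> \<times> UNIV" for \<xi>
    using frechet_derivative_basis[OF fpoly_derivative(1)[OF assms(1,2) that], of "V \<xi>"] by simp
qed

lemma vpoly_directional:
  assumes "open \<Omega>" "vpoly \<Omega> F" "vpoly \<Omega> V"
  shows "vpoly \<Omega> (\<lambda>\<xi>. frechet_derivative F (at \<xi>) (V \<xi>))"
  unfolding vpoly_def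
proof
  fix b :: 'b assume b: "b \<in> Basis"
  show "fpoly \<Omega> (\<lambda>\<xi>. frechet_derivative F (at \<xi>) (V \<xi>) \<bullet> b)"
  proof (rule fpoly_cong)
    show "fpoly \<Omega> (\<lambda>\<xi>. frechet_derivative (\<lambda>\<xi>. F \<xi> \<bullet> b) (at \<xi>) (V \<xi>))"
      using assms b by (intro fpoly_directional) (auto simp: vpoly_def)
    fix \<xi> :: "'a \<times> 'a" assume "\<xi> \<in> \<Omega> \<times> UNIV"
    from has_derivative_inner_left[OF vpoly_has_derivative[OF assms(1,2) this], of b]
    show "frechet_derivative (\<lambda>\<xi>. F \<xi> \<bullet> b) (at \<xi>) (V \<xi>) = frechet_derivative F (at \<xi>) (V \<xi>) \<bullet> b"
      by (simp flip: frechet_derivative_at)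
  qed
qed

lemma vpoly_lie_bracket:
  "open \<Omega> \<Longrightarrow> vpoly \<Omega> X \<Longrightarrow> vpoly \<Omega> Y \<Longrightarrow> vpoly \<Omega> (lie_bracket X Y)"
  unfolding lie_bracket_def by (intro vpoly_diff vpoly_directional)

section \<open>Hamiltonian lifts and tangent spaces\<close>

abbreviation dlift :: "('e::euclidean_space \<Rightarrow> 'e) \<Rightarrow> 'e \<times> 'e \<Rightarrow> 'e \<times> 'e \<Rightarrow> real" where
  "dlift X \<xi> w \<equiv> frechet_derivative (lift_function X) (at \<xi>) w"

text \<open>The Hamiltonian field of \<open>lift_function X\<close> in closed form: on covectors it
  acts by minus the transposed derivative of \<open>X\<close>.\<close>

definition ham_lift :: "('e::euclidean_space \<Rightarrow> 'e) \<Rightarrow> 'e \<times> 'e \<Rightarrow> 'e \<times> 'e" where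
  "ham_lift X \<xi> = (X (fst \<xi>), - (\<Sum>b\<in>Basis. (snd \<xi> \<bullet> frechet_derivative X (at (fst \<xi>)) b) *\<^sub>R b))"

lemma lift_has_derivative:
  assumes "smooth_on \<Omega> X" "fst \<xi> \<in> \<Omega>"
  shows "(lift_function X has_derivative
    (\<lambda>w. snd w \<bullet> X (fst \<xi>) + snd \<xi> \<bullet> frechet_derivative X (at (fst \<xi>)) (fst w))) (at \<xi>)"
proof -
  have "((\<lambda>\<xi>. X (fst \<xi>)) has_derivative (\<lambda>w. frechet_derivative X (at (fst \<xi>)) (fst w))) (at \<xi>)"
    by (rule has_derivative_compose[OF bounded_linear_imp_has_derivative[OF bounded_linear_fst] smooth_on_has_derivative[OF assms]])
  from has_derivative_inner[OF bounded_linear_imp_has_derivative[OF bounded_linear_snd] this]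
  show ?thesis unfolding lift_function_def[abs_def]
    by (rule has_derivative_eq_rhs) (simp add: fun_eq_iff)
qed

lemma dlift_eq:
  assumes "smooth_on \<Omega> X" "fst \<xi> \<in> \<Omega>"
  shows "dlift X \<xi> w = snd w \<bullet> X (fst \<xi>) + snd \<xi> \<bullet> frechet_derivative X (at (fst \<xi>)) (fst w)"
  using frechet_derivative_at[OF lift_has_derivative[OF assms]] by (metis (no_types, lifting))

lemma dlift_linear:
  assumes "smooth_on \<Omega> X" "fst \<xi> \<in> \<Omega>"
  shows "linear (dlift X \<xi>)"
  using frechet_derivative_at[OF lift_has_derivative[OF assms]] has_derivative_linear[OF lift_has_derivative[OF assms]]
  by simp

lemma fpoly_lift: "open \<Omega> \<Longrightarrow> smooth_on \<Omega> X \<Longrightarrow> fpoly \<Omega> (lift_function X)"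
  unfolding lift_function_def[abs_def] by (intro fpoly_inner vpoly_momentum vpoly_base)

lemma vpoly_ham_lift:
  assumes "open \<Omega>" "smooth_on \<Omega> X"
  shows "vpoly \<Omega> (ham_lift X)"
proof -
  have "vpoly \<Omega> (\<lambda>\<xi>. \<Sum>b\<in>Basis. (snd \<xi> \<bullet> frechet_derivative X (at (fst \<xi>)) b) *\<^sub>R b)"
    by (intro vpoly_sum vpoly_scaleR vpoly_const fpoly_inner vpoly_momentum assms(1)
        vpoly_base[OF assms(1) smooth_on_derivative_const[OF assms(2)]])
  from vpoly_diff[OF assms(1) vpoly_const[OF assms(1), of 0] this]
  have "vpoly \<Omega> (\<lambda>\<xi>. - (\<Sum>b\<in>Basis. (snd \<xi> \<bullet> frechet_derivative X (at (fst \<xi>)) b) *\<^sub>R b))" by simp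
  from vpoly_Pair[OF assms(1) vpoly_base[OF assms] this] show ?thesis
    unfolding ham_lift_def[abs_def] .
qed

lemma inner_transpose:
  fixes p v :: "'e::euclidean_space"
  assumes "linear f"
  shows "(\<Sum>b\<in>Basis. (p \<bullet> f b) *\<^sub>R b) \<bullet> v = p \<bullet> f v"
proof -
  have "p \<bullet> f v = p \<bullet> f (\<Sum>b\<in>Basis. (v \<bullet> b) *\<^sub>R b)" by (simp add: euclidean_representation)
  also have "\<dots> = (\<Sum>b\<in>Basis. (v \<bullet> b) * (p \<bullet> f b))"
    by (simp add: linear_sum[OF assms] linear_cmul[OF assms] inner_sum_right)
  finally show ?thesis by (subst inner_sum_left) (simp add: inner_commute mult.commute)
qed

lemma sigma_ham_lift:
  assumes "smooth_on \<Omega> X" "fst \<xi> \<in> \<Omega>"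
  shows "\<sigma> (ham_lift X \<xi>) w = dlift X \<xi> w"
  using inner_transpose[OF has_derivative_linear[OF smooth_on_has_derivative[OF assms]], of "snd \<xi>" "fst w"]
  unfolding dlift_eq[OF assms] \<sigma>_def ham_lift_def by (simp add: inner_commute)

lemma hamiltonian_field_lift:
  assumes "smooth_on \<Omega> X" "fst \<xi> \<in> \<Omega>"
  shows "hamiltonian_field (lift_function X) \<xi> = ham_lift X \<xi>"
  unfolding hamiltonian_field_def
proof (rule the_equality)
  show "\<forall>w. \<sigma> (ham_lift X \<xi>) w = dlift X \<xi> w" using sigma_ham_lift[OF assms] by blast
  fix v assume v: "\<forall>w. \<sigma> v w = dlift X \<xi> w"
  have eq: "\<sigma> v w = \<sigma> (ham_lift X \<xi>) w" for w by (simp only: v[rule_format] sigma_ham_lift[OF assms])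
  have "fst v \<bullet> a = fst (ham_lift X \<xi>) \<bullet> a" for a using eq[of "(0, a)"] by (simp add: \<sigma>_def)
  moreover have "snd v \<bullet> a = snd (ham_lift X \<xi>) \<bullet> a" for a using eq[of "(a, 0)"] by (simp add: \<sigma>_def)
  ultimately show "v = ham_lift X \<xi>" using vector_eq_rdot by (metis prod_eqI)
qed

text \<open>The Poisson bracket of two functions linear in the momentum is the lift of the Lie
  bracket; the order of the fields here fixes the signs below.\<close>

lemma dlift_ham_lift:
  assumes "smooth_on \<Omega> X" "smooth_on \<Omega> Y" "fst \<xi> \<in> \<Omega>"
  shows "dlift X \<xi> (ham_lift Y \<xi>) = lift_function (lie_bracket Y X) \<xi>"
  using inner_transpose[OF has_derivative_linear[OF smooth_on_has_derivative[OF assms(2,3)]], of "snd \<xi>" "X (fst \<xi>)"]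
  unfolding dlift_eq[OF assms(1,3)] by (simp add: ham_lift_def lift_function_def lie_bracket_def inner_diff_right)

lemma smooth_on_ident: "open S \<Longrightarrow> smooth_on S (\<lambda>x. x)"
  unfolding smooth_on_def
proof
  fix k assume S: "open S"
  show "Ck_on k S (\<lambda>x. x)"
  proof (cases k)
    case (Suc n)
    have "Ck_on (Suc n) S (\<lambda>x. x)"
      by (rule Ck_onI[OF S, where f'="\<lambda>x v. v"]) (auto intro: Ck_on_const S)
    then show ?thesis using Suc by simp
  qed simp
qed

lemma smooth_on_Pair:
  assumes "open S" "smooth_on S f" "smooth_on S g"
  shows "smooth_on S (\<lambda>x. (f x, g x))"
proof -
  have 1: "bounded_linear (\<lambda>x::'b. (x, 0::'c))" by (intro bounded_linear_Pair bounded_linear_ident bounded_linear_zero)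
  have 2: "bounded_linear (\<lambda>x::'c. (0::'b, x))" by (intro bounded_linear_Pair bounded_linear_ident bounded_linear_zero)
  from smooth_on_add[OF assms(1) smooth_on_bounded_linear[OF 1 assms(1,2)] smooth_on_bounded_linear[OF 2 assms(1,3)]]
  show ?thesis by simp
qed

context cartan_frame
begin

definition "zero_set I = {\<xi>. fst \<xi> \<in> \<Omega> \<and> (\<forall>i\<in>I. lift_function (frame i) \<xi> = 0)}"

lemma frame_simps [simp]:
  "frame 1 = X1" "frame 2 = X2" "frame 3 = X3" "frame 4 = X4" "frame 5 = X5"
  by (simp_all add: frame_def)

lemma coframe_expansion:
  assumes "x \<in> \<Omega>"
  shows "p = (\<Sum>j\<in>UNIV. (p \<bullet> frame j x) *\<^sub>R coframe j x)"
proof -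
  have "v \<bullet> p = v \<bullet> (\<Sum>j\<in>UNIV. (p \<bullet> frame j x) *\<^sub>R coframe j x)" for v
  proof -
    have "p \<bullet> v = p \<bullet> (\<Sum>j\<in>UNIV. (coframe j x \<bullet> v) *\<^sub>R frame j x)"
      using frame_expansion[OF assms, of v] by simp
    then show ?thesis by (simp add: inner_sum_right inner_commute mult.commute)
  qed
  then show ?thesis using vector_eq_ldot by blast
qed

lemma frame_inner_eqI:
  assumes "x \<in> \<Omega>" "\<And>j. p \<bullet> frame j x = r \<bullet> frame j x"
  shows "p = r"
  using coframe_expansion[OF assms(1), of p] coframe_expansion[OF assms(1), of r] assms(2) by simp

text \<open>The lifts of the five frame fields are linear coordinates on every fibre. A vector
  satisfying the linearised equations is therefore the velocity of an explicit curve: straight in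
  the base, with the five lifts prescribed as affine functions of time.\<close>

lemma tangent_space_zero_set:
  assumes "\<xi> \<in> zero_set I"
  shows "tangent_space (zero_set I) \<xi> = {w. \<forall>i\<in>I. dlift (frame i) \<xi> w = 0}"
proof (intro equalityI subsetI)
  fix w assume w: "w \<in> tangent_space (zero_set I) \<xi>"
  have x: "fst \<xi> \<in> \<Omega>" using assms by (simp add: zero_set_def)
  have "dlift (frame i) \<xi> w = 0" if "i \<in> I" for i
  proof (rule tangent_space_derivative_zero[OF w])
    show "(lift_function (frame i) has_derivative frechet_derivative (lift_function (frame i)) (at \<xi>)) (at \<xi>)"
      using lift_has_derivative[OF smooth_frame x] by (auto simp: frechet_derivative_works[symmetric] differentiable_def)
  qed (use that in \<open>auto simp: zero_set_def\<close>)
  then show "w \<in> {w. \<forall>i\<in>I. dlift (frame i) \<xi> w = 0}" by blast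
next
  fix w assume "w \<in> {w. \<forall>i\<in>I. dlift (frame i) \<xi> w = 0}"
  then have w: "\<And>i. i \<in> I \<Longrightarrow> dlift (frame i) \<xi> w = 0" by blast
  obtain x p where \<xi>: "\<xi> = (x, p)" by fastforce
  obtain a \<alpha> where wa: "w = (a, \<alpha>)" by fastforce
  have x: "x \<in> \<Omega>" and u0: "\<And>i. i \<in> I \<Longrightarrow> p \<bullet> frame i x = 0"
    using assms \<xi> by (auto simp: zero_set_def lift_function_def)
  obtain r where r: "r > 0" "ball x r \<subseteq> \<Omega>" using open_\<Omega> x openE by blast
  define e where "e = r / (norm a + 1)"
  have na: "norm a + 1 > 0" by (simp add: add_nonneg_pos)
  have e: "e > 0" using r na by (simp add: e_def)
  let ?I = "{-e<..<e}"
  have line: "x + t *\<^sub>R a \<in> \<Omega>" if "t \<in> ?I" for t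
  proof -
    have "norm (t *\<^sub>R a) = \<bar>t\<bar> * norm a" by simp
    also have "\<dots> \<le> \<bar>t\<bar> * (norm a + 1)" by (intro mult_left_mono) auto
    also have "\<dots> < e * (norm a + 1)" using that na by (intro mult_strict_right_mono) auto
    also have "\<dots> = r" using na by (simp add: e_def)
    finally show ?thesis using r(2) by (auto simp: dist_norm)
  qed
  \<comment> \<open>The prescribed lifts; for indices in \<open>I\<close> both the constant and the
    slope vanish, so the curve stays in the zero set.\<close>
  define c where "c j t = p \<bullet> frame j x + t * dlift (frame j) \<xi> w" for j and t :: real
  define \<gamma> where "\<gamma> t = (x + t *\<^sub>R a, \<Sum>j\<in>UNIV. c j t *\<^sub>R coframe j (x + t *\<^sub>R a))" for t
  have I: "open ?I" by simp
  have sm: "smooth_on ?I \<gamma>"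
    unfolding \<gamma>_def[abs_def] c_def
    by (intro smooth_on_Pair smooth_on_add smooth_on_const smooth_on_scaleR smooth_on_mult smooth_on_ident smooth_on_sum I
        smooth_on_affine_line[OF open_\<Omega> I line smooth_coframe])
  have lift_\<gamma>: "lift_function (frame i) (\<gamma> t) = c i t" if "t \<in> ?I" for i t
    by (simp add: lift_function_def \<gamma>_def inner_sum_left coframe_frame[OF line[OF that]] if_distrib cong: if_cong)
  have "\<gamma> 0 = \<xi>"
    using coframe_expansion[OF x, of p] by (simp add: \<gamma>_def c_def \<xi>)
  have 0: "(0::real) \<in> ?I" using e by simp
  have "\<gamma> differentiable (at 0)"
    using smooth_on_has_derivative[OF sm 0] differentiableI by blast
  then obtain v where v: "(\<gamma> has_vector_derivative v) (at 0)"
    by (auto simp: vector_derivative_works)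
  \<comment> \<open>The velocity is identified by its base part and its effect on the five lifts,
    which together determine it.\<close>
  have "v = w"
  proof -
    have "((\<lambda>t. fst (\<gamma> t)) has_vector_derivative fst v) (at 0)"
      by (rule bounded_linear.has_vector_derivative[OF bounded_linear_fst v])
    moreover have "((\<lambda>t. fst (\<gamma> t)) has_vector_derivative a) (at 0)"
      unfolding \<gamma>_def by (auto intro!: derivative_eq_intros)
    ultimately have fv: "fst v = a" using vector_derivative_unique_at by blast
    have e: "dlift (frame j) \<xi> v = dlift (frame j) \<xi> w" for j
    proof -
      have d: "(lift_function (frame j) has_derivative dlift (frame j) \<xi>) (at (\<gamma> 0))"
        using lift_has_derivative[OF smooth_frame, of \<xi> j] x \<xi> \<open>\<gamma> 0 = \<xi>\<close>
        by (auto simp: frechet_derivative_works[symmetric] differentiable_def)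
      have "((\<lambda>t. lift_function (frame j) (\<gamma> t)) has_derivative (\<lambda>h. dlift (frame j) \<xi> (h *\<^sub>R v))) (at 0)"
        using has_derivative_compose[OF v[unfolded has_vector_derivative_def] d] .
      moreover have "((\<lambda>t. lift_function (frame j) (\<gamma> t)) has_derivative (\<lambda>h. h * dlift (frame j) \<xi> w)) (at 0)"
      proof (rule has_derivative_transform_within_open[OF _ I 0])
        show "((\<lambda>t. c j t) has_derivative (\<lambda>h. h * dlift (frame j) \<xi> w)) (at 0)"
          unfolding c_def by (auto intro!: derivative_eq_intros)
      qed (simp add: lift_\<gamma>)
      ultimately have "(\<lambda>h. dlift (frame j) \<xi> (h *\<^sub>R v)) = (\<lambda>h. h * dlift (frame j) \<xi> w)"
        by (rule has_derivative_unique)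
      from fun_cong[OF this, of 1] show ?thesis by simp
    qed
    have "snd v \<bullet> frame j x = \<alpha> \<bullet> frame j x" for j
      using e[of j] dlift_eq[OF smooth_frame, of \<xi> j v] dlift_eq[OF smooth_frame, of \<xi> j w] x
      by (simp add: \<xi> wa fv)
    then have "snd v = \<alpha>" by (rule frame_inner_eqI[OF x])
    then show ?thesis using fv by (simp add: wa prod_eq_iff)
  qed
  moreover have "\<gamma> ` ?I \<subseteq> zero_set I"
    using lift_\<gamma> line w u0 by (auto simp: zero_set_def c_def \<gamma>_def)
  ultimately show "w \<in> tangent_space (zero_set I) \<xi>"
    unfolding tangent_space_def using e sm v \<open>\<gamma> 0 = \<xi>\<close> by blast
qed

lemma annihilator_span: "(\<forall>v\<in>span S. p \<bullet> v = 0) \<longleftrightarrow> (\<forall>v\<in>S. p \<bullet> v = 0)"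
proof
  assume "\<forall>v\<in>S. p \<bullet> v = 0"
  then have "S \<subseteq> {v. p \<bullet> v = 0}" by blast
  moreover have "subspace {v. p \<bullet> v = 0}" by (rule subspace_hyperplane)
  ultimately show "\<forall>v\<in>span S. p \<bullet> v = 0" using span_minimal by blast
qed (auto intro: span_base)

lemma annihilator_D: "annihilator \<Omega> D = zero_set {1, 2}"
proof (rule set_eqI)
  show "\<xi> \<in> annihilator \<Omega> D \<longleftrightarrow> \<xi> \<in> zero_set {1, 2}" for \<xi>
    by (cases \<xi>; cases "fst \<xi> \<in> \<Omega>")
       (simp_all add: annihilator_def annihilator_at_def zero_set_def lift_function_def D_eq annihilator_span)
qed

lemma annihilator_D2: "annihilator \<Omega> (dist_power D 2) = zero_set {1, 2, 3}"
proof (rule set_eqI)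
  show "\<xi> \<in> annihilator \<Omega> (dist_power D 2) \<longleftrightarrow> \<xi> \<in> zero_set {1, 2, 3}" for \<xi>
    by (cases \<xi>; cases "fst \<xi> \<in> \<Omega>")
       (simp_all add: annihilator_def annihilator_at_def zero_set_def lift_function_def dist_power_2 annihilator_span)
qed

definition "N = zero_set {1, 2, 3}"

lemma N_iff: "\<xi> \<in> N \<longleftrightarrow> fst \<xi> \<in> \<Omega> \<and> lift_function X1 \<xi> = 0 \<and> lift_function X2 \<xi> = 0 \<and> lift_function X3 \<xi> = 0"
  by (auto simp: N_def zero_set_def)

lemma tangent_N:
  "\<xi> \<in> N \<Longrightarrow> tangent_space N \<xi> = {w. dlift X1 \<xi> w = 0 \<and> dlift X2 \<xi> w = 0 \<and> dlift X3 \<xi> w = 0}"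
  unfolding N_def by (simp add: tangent_space_zero_set)

lemma coframe_X:
  assumes "x \<in> \<Omega>"
  shows "coframe i x \<bullet> X1 x = (if i = 1 then 1 else 0)" "coframe i x \<bullet> X2 x = (if i = 2 then 1 else 0)"
    "coframe i x \<bullet> X3 x = (if i = 3 then 1 else 0)" "coframe i x \<bullet> X4 x = (if i = 4 then 1 else 0)"
    "coframe i x \<bullet> X5 x = (if i = 5 then 1 else 0)"
  using coframe_frame[OF assms, of i 1] coframe_frame[OF assms, of i 2] coframe_frame[OF assms, of i 3]
    coframe_frame[OF assms, of i 4] coframe_frame[OF assms, of i 5] by simp_all

text \<open>Over \<open>N\<close> the Hamiltonian fields of \<open>u_1\<close> and
  \<open>u_2\<close> lie in the kernel of \<open>\<sigma>\<close> on the annihilator of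
  \<open>D\<close>, their mutual bracket \<open>u_3\<close> being zero there. Conversely a kernel
  vector is orthogonal to the vertical vectors given by the last three coframe covectors, which
  confines its base part to \<open>D\<close>.\<close>

lemma jacobi_space_eq:
  assumes "\<xi> \<in> N"
  shows "jacobi_space \<Omega> D \<xi> = {w \<in> tangent_space N \<xi>. \<forall>j\<in>{3, 4, 5}. coframe j (fst \<xi>) \<bullet> fst w = 0}"
proof -
  have x: "fst \<xi> \<in> \<Omega>" using assms by (simp add: N_iff)
  have "\<xi> \<in> zero_set {1, 2}" using assms by (auto simp: N_def zero_set_def)
  then have T1: "tangent_space (annihilator \<Omega> D) \<xi> = {w. dlift X1 \<xi> w = 0 \<and> dlift X2 \<xi> w = 0}"
    unfolding annihilator_D by (simp add: tangent_space_zero_set)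
  have T2: "tangent_space (annihilator \<Omega> (dist_power D 2)) \<xi> = tangent_space N \<xi>"
    by (simp add: annihilator_D2 N_def)
  note dX = dlift_eq[OF _ x]
  note lin = dlift_linear[OF _ x]
  have l0: "linear (frechet_derivative X1 (at (fst \<xi>)))" "linear (frechet_derivative X2 (at (fst \<xi>)))"
    using smooth_on_has_derivative[OF _ x] smooth_X1 smooth_X2 has_derivative_linear by blast+
  show ?thesis
  proof (intro equalityI subsetI)
    fix w assume "w \<in> jacobi_space \<Omega> D \<xi>"
    then obtain v k where w: "w = v + k" "v \<in> vertical_space" "k \<in> kernel_restricted (annihilator \<Omega> D) \<xi>" "w \<in> tangent_space N \<xi>"
      unfolding jacobi_space_def T2 by blast
    have "coframe j (fst \<xi>) \<bullet> fst w = 0" if "j \<in> {3, 4, 5}" for j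
    proof -
      have "(0, coframe j (fst \<xi>)) \<in> tangent_space (annihilator \<Omega> D) \<xi>"
        unfolding T1 using that by (auto simp: dX[OF smooth_X1] dX[OF smooth_X2] coframe_X[OF x] linear_0[OF l0(1)] linear_0[OF l0(2)])
      then have "\<sigma> k (0, coframe j (fst \<xi>)) = 0" using w(3) by (auto simp: kernel_restricted_def)
      then show ?thesis using w(1,2) by (simp add: \<sigma>_def vertical_space_def inner_commute)
    qed
    then show "w \<in> {w \<in> tangent_space N \<xi>. \<forall>j\<in>{3, 4, 5}. coframe j (fst \<xi>) \<bullet> fst w = 0}"
      using w(4) by blast
  next
    fix w assume "w \<in> {w \<in> tangent_space N \<xi>. \<forall>j\<in>{3, 4, 5}. coframe j (fst \<xi>) \<bullet> fst w = 0}"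
    then have w: "w \<in> tangent_space N \<xi>" "coframe 3 (fst \<xi>) \<bullet> fst w = 0" "coframe 4 (fst \<xi>) \<bullet> fst w = 0" "coframe 5 (fst \<xi>) \<bullet> fst w = 0"
      by auto
    define c1 where "c1 = coframe 1 (fst \<xi>) \<bullet> fst w"
    define c2 where "c2 = coframe 2 (fst \<xi>) \<bullet> fst w"
    define k where "k = c1 *\<^sub>R ham_lift X1 \<xi> + c2 *\<^sub>R ham_lift X2 \<xi>"
    have fw: "fst w = c1 *\<^sub>R X1 (fst \<xi>) + c2 *\<^sub>R X2 (fst \<xi>)"
      using frame_expansion[OF x, of "fst w"] w by (simp add: sum_5 c1_def c2_def)
    have sk: "\<sigma> k v = c1 * dlift X1 \<xi> v + c2 * dlift X2 \<xi> v" for v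
      using sigma_ham_lift[OF smooth_X1 x, of v] sigma_ham_lift[OF smooth_X2 x, of v]
      unfolding k_def \<sigma>_def by (simp add: inner_add_left algebra_simps)
    \<comment> \<open>The Poisson brackets of \<open>u_1\<close> and \<open>u_2\<close> among
      themselves; the condition \<open>u_3 = 0\<close> enters here.\<close>
    have br: "lift_function (lie_bracket X1 X2) \<xi> = 0" "lift_function (lie_bracket X2 X1) \<xi> = 0"
      "lift_function (lie_bracket X1 X1) \<xi> = 0" "lift_function (lie_bracket X2 X2) \<xi> = 0"
      using assms lie_bracket_swap[of X2 X1 "fst \<xi>"]
      by (simp_all add: N_iff lift_function_def X3_def lie_bracket_self)
    have "dlift X1 \<xi> k = 0" "dlift X2 \<xi> k = 0"
      unfolding k_def using br
      by (simp_all add: linear_add[OF lin[OF smooth_X1]] linear_add[OF lin[OF smooth_X2]]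
          linear_cmul[OF lin[OF smooth_X1]] linear_cmul[OF lin[OF smooth_X2]]
          dlift_ham_lift[OF smooth_X1 smooth_X1 x] dlift_ham_lift[OF smooth_X1 smooth_X2 x]
          dlift_ham_lift[OF smooth_X2 smooth_X1 x] dlift_ham_lift[OF smooth_X2 smooth_X2 x])
    then have "k \<in> kernel_restricted (annihilator \<Omega> D) \<xi>"
      unfolding kernel_restricted_def T1 by (simp add: sk)
    moreover have "w - k \<in> vertical_space"
      using fw by (simp add: vertical_space_def k_def ham_lift_def)
    ultimately have "w \<in> {v + w | v w. v \<in> vertical_space \<and> w \<in> kernel_restricted (annihilator \<Omega> D) \<xi>}"
      by (intro CollectI exI[of _ "w - k"] exI[of _ k]) simp
    then show "w \<in> jacobi_space \<Omega> D \<xi>"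
      unfolding jacobi_space_def T2 using w(1) by blast
  qed
qed

lemma W_numerator_eq:
  "W_numerator \<Omega> D \<xi> = {w \<in> tangent_space N \<xi>. snd \<xi> \<bullet> fst w = 0}"
  by (auto simp: W_numerator_def annihilator_D2 N_def \<sigma>_def euler_field_def)

end

section \<open>The characteristic field and its iterated brackets\<close>

definition dilate :: "real \<Rightarrow> 'e::euclidean_space \<times> 'e \<Rightarrow> 'e \<times> 'e" where
  "dilate s \<xi> = (fst \<xi>, s *\<^sub>R snd \<xi>)"

lemma linear_dilate: "linear (dilate s)"
  by (rule linearI) (simp_all add: dilate_def algebra_simps)

lemma bounded_linear_dilate: "bounded_linear (dilate s)"
  using linear_dilate by (simp add: linear_conv_bounded_linear)

lemma derivative_homogeneous:
  assumes hom: "\<And>\<eta>. \<eta> \<in> \<Omega> \<times> UNIV \<Longrightarrow> Y (dilate s \<eta>) = c *\<^sub>R dilate s (Y \<eta>)"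
    and "open \<Omega>" "vpoly \<Omega> Y" "\<xi> \<in> \<Omega> \<times> UNIV"
  shows "frechet_derivative Y (at (dilate s \<xi>)) (dilate s w) = c *\<^sub>R dilate s (frechet_derivative Y (at \<xi>) w)"
proof -
  have s\<xi>: "dilate s \<xi> \<in> \<Omega> \<times> UNIV" using assms(4) by (auto simp: dilate_def)
  have "((\<lambda>\<eta>. Y (dilate s \<eta>)) has_derivative (\<lambda>w. frechet_derivative Y (at (dilate s \<xi>)) (dilate s w))) (at \<xi>)"
    by (rule has_derivative_compose[OF bounded_linear_imp_has_derivative[OF bounded_linear_dilate] vpoly_has_derivative[OF assms(2,3) s\<xi>]])
  moreover have "((\<lambda>\<eta>. Y (dilate s \<eta>)) has_derivative (\<lambda>w. c *\<^sub>R dilate s (frechet_derivative Y (at \<xi>) w))) (at \<xi>)"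
  proof (rule has_derivative_transform_within_open[OF _ open_times_UNIV[OF assms(2)] assms(4)])
    show "((\<lambda>\<eta>. c *\<^sub>R dilate s (Y \<eta>)) has_derivative (\<lambda>w. c *\<^sub>R dilate s (frechet_derivative Y (at \<xi>) w))) (at \<xi>)"
      by (intro has_derivative_scaleR_right bounded_linear.has_derivative[OF bounded_linear_dilate]
          vpoly_has_derivative[OF assms(2-4)])
  qed (simp add: hom)
  ultimately have "(\<lambda>w. frechet_derivative Y (at (dilate s \<xi>)) (dilate s w)) = (\<lambda>w. c *\<^sub>R dilate s (frechet_derivative Y (at \<xi>) w))"
    by (rule has_derivative_unique)
  then show ?thesis by (rule fun_cong)
qed

text \<open>A linear isomorphism carries brackets to brackets, so the two scaling factors simply
  multiply; the computation covers \<open>s = 0\<close> as well.\<close>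

lemma lie_bracket_homogeneous:
  assumes "\<And>\<eta>. \<eta> \<in> \<Omega> \<times> UNIV \<Longrightarrow> X (dilate s \<eta>) = b *\<^sub>R dilate s (X \<eta>)"
    and "\<And>\<eta>. \<eta> \<in> \<Omega> \<times> UNIV \<Longrightarrow> Y (dilate s \<eta>) = c *\<^sub>R dilate s (Y \<eta>)"
    and "open \<Omega>" "vpoly \<Omega> X" "vpoly \<Omega> Y" "\<xi> \<in> \<Omega> \<times> UNIV"
  shows "lie_bracket X Y (dilate s \<xi>) = (b * c) *\<^sub>R dilate s (lie_bracket X Y \<xi>)"
proof -
  have s\<xi>: "dilate s \<xi> \<in> \<Omega> \<times> UNIV" using assms(6) by (auto simp: dilate_def)
  have l: "linear (frechet_derivative X (at (dilate s \<xi>)))" "linear (frechet_derivative Y (at (dilate s \<xi>)))"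
    using vpoly_has_derivative[OF assms(3) _ s\<xi>] assms(4,5) has_derivative_linear by blast+
  have dX: "frechet_derivative X (at (dilate s \<xi>)) (dilate s w) = b *\<^sub>R dilate s (frechet_derivative X (at \<xi>) w)" for w
    by (rule derivative_homogeneous[OF _ assms(3,4,6)]) (rule assms(1))
  have dY: "frechet_derivative Y (at (dilate s \<xi>)) (dilate s w) = c *\<^sub>R dilate s (frechet_derivative Y (at \<xi>) w)" for w
    by (rule derivative_homogeneous[OF _ assms(3,5,6)]) (rule assms(2))
  show ?thesis
    unfolding lie_bracket_def assms(1)[OF assms(6)] assms(2)[OF assms(6)] linear_cmul[OF l(1)] linear_cmul[OF l(2)]
      dX dY linear_diff[OF linear_dilate]
    by (simp add: scaleR_diff_right mult.commute)
qed

context cartan_frame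
begin

definition h :: "(real^5) \<times> (real^5) \<Rightarrow> (real^5) \<times> (real^5)" where
  "h \<xi> = lift_function X4 \<xi> *\<^sub>R ham_lift X2 \<xi> - lift_function X5 \<xi> *\<^sub>R ham_lift X1 \<xi>"

primrec E :: "nat \<Rightarrow> (real^5) \<times> (real^5) \<Rightarrow> (real^5) \<times> (real^5)" where
  "E 0 = (\<lambda>\<xi>. (0, coframe 4 (fst \<xi>)))"
| "E (Suc k) = lie_bracket h (E k)"

lemma h_field_eq: "fst \<xi> \<in> \<Omega> \<Longrightarrow> h_field X1 X2 \<xi> = h \<xi>"
  unfolding h_field_def Let_def h_def X3_def[symmetric] X4_def[symmetric] X5_def[symmetric]
  by (simp add: hamiltonian_field_lift[OF smooth_X1] hamiltonian_field_lift[OF smooth_X2])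

lemma vpoly_h: "vpoly \<Omega> h"
  unfolding h_def[abs_def]
  by (intro vpoly_diff vpoly_scaleR fpoly_lift vpoly_ham_lift open_\<Omega> smooth_X1 smooth_X2 smooth_X4 smooth_X5)

lemma vpoly_E: "vpoly \<Omega> (E k)"
proof (induction k)
  case 0
  show ?case by (simp add: vpoly_Pair[OF open_\<Omega> vpoly_const[OF open_\<Omega>] vpoly_base[OF open_\<Omega> smooth_coframe]])
next
  case (Suc k)
  then show ?case by (simp add: vpoly_lie_bracket[OF open_\<Omega> vpoly_h])
qed

lemma fst_h: "fst (h \<xi>) = lift_function X4 \<xi> *\<^sub>R X2 (fst \<xi>) - lift_function X5 \<xi> *\<^sub>R X1 (fst \<xi>)"
  by (simp add: h_def ham_lift_def)

lemma dlift_h: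
  assumes "smooth_on \<Omega> X" "fst \<xi> \<in> \<Omega>"
  shows "dlift X \<xi> (h \<xi>) = lift_function X4 \<xi> * lift_function (lie_bracket X2 X) \<xi> - lift_function X5 \<xi> * lift_function (lie_bracket X1 X) \<xi>"
  unfolding h_def linear_diff[OF dlift_linear[OF assms]] linear_cmul[OF dlift_linear[OF assms]]
    dlift_ham_lift[OF assms(1) smooth_X1 assms(2)] dlift_ham_lift[OF assms(1) smooth_X2 assms(2)] by simp

text \<open>Stated on the whole bundle and not only on \<open>N\<close>, because
  \<open>bracket_tangent\<close> differentiates these identities.\<close>

lemma dlift_X_h:
  assumes "fst \<xi> \<in> \<Omega>"
  shows "dlift X1 \<xi> (h \<xi>) = - (lift_function X4 \<xi> * lift_function X3 \<xi>)"
    and "dlift X2 \<xi> (h \<xi>) = - (lift_function X5 \<xi> * lift_function X3 \<xi>)"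
    and "dlift X3 \<xi> (h \<xi>) = 0"
proof -
  have "lie_bracket X2 X1 (fst \<xi>) = - X3 (fst \<xi>)" using lie_bracket_swap[of X2 X1] by (simp add: X3_def)
  then show "dlift X1 \<xi> (h \<xi>) = - (lift_function X4 \<xi> * lift_function X3 \<xi>)"
    "dlift X2 \<xi> (h \<xi>) = - (lift_function X5 \<xi> * lift_function X3 \<xi>)" "dlift X3 \<xi> (h \<xi>) = 0"
    unfolding dlift_h[OF smooth_X1 assms] dlift_h[OF smooth_X2 assms] dlift_h[OF smooth_X3 assms]
    by (simp_all add: lift_function_def lie_bracket_self X3_def[symmetric] X4_def[symmetric] X5_def[symmetric])
qed

lemma h_tangent: "\<xi> \<in> N \<Longrightarrow> h \<xi> \<in> tangent_space N \<xi>"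
  by (simp add: tangent_N dlift_X_h N_iff)

lemma lift_has_dlift:
  assumes "smooth_on \<Omega> X" "fst \<xi> \<in> \<Omega>"
  shows "(lift_function X has_derivative dlift X \<xi>) (at \<xi>)"
  using lift_has_derivative[OF assms] by (auto simp: frechet_derivative_works[symmetric] differentiable_def)

lemma sigma_h:
  assumes "fst \<xi> \<in> \<Omega>"
  shows "fst (h \<xi>) \<bullet> snd w - snd (h \<xi>) \<bullet> fst w = lift_function X4 \<xi> * dlift X2 \<xi> w - lift_function X5 \<xi> * dlift X1 \<xi> w"
  using sigma_ham_lift[OF smooth_X1 assms, of w] sigma_ham_lift[OF smooth_X2 assms, of w]
  unfolding h_def \<sigma>_def by (simp add: inner_diff_left algebra_simps)

lemma fst_frechet:
  assumes "vpoly \<Omega> Y" "\<xi> \<in> \<Omega> \<times> UNIV" "((\<lambda>\<eta>. fst (Y \<eta>)) has_derivative G) (at \<xi>)"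
  shows "fst (frechet_derivative Y (at \<xi>) w) = G w"
  using has_derivative_unique[OF has_derivative_fst[OF vpoly_has_derivative[OF open_\<Omega> assms(1,2)]] assms(3)]
  by (rule fun_cong)

text \<open>\<open>Y\<close> need be tangent to \<open>N\<close> only along \<open>N\<close>. For
  each of the three lifts \<open>u\<close> the commutator formula leaves two terms:
  \<open>Y u\<close> vanishes on \<open>N\<close> and is differentiated along the tangent field
  \<open>h\<close>, while \<open>h u\<close> is zero or a multiple of \<open>u_3\<close>, so its
  derivative along \<open>Y\<close> vanishes on \<open>N\<close>. The condition on the pairing with
  the covector is handled by the tautological form.\<close>

lemma bracket_tangent:
  assumes Y: "vpoly \<Omega> Y" "\<And>\<xi>. \<xi> \<in> N \<Longrightarrow> Y \<xi> \<in> W_numerator \<Omega> D \<xi>" and \<xi>: "\<xi> \<in> N"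
  shows "lie_bracket h Y \<xi> \<in> W_numerator \<Omega> D \<xi>"
proof -
  have x: "fst \<xi> \<in> \<Omega>" and S: "\<xi> \<in> \<Omega> \<times> UNIV" and u: "lift_function X1 \<xi> = 0" "lift_function X2 \<xi> = 0" "lift_function X3 \<xi> = 0"
    using \<xi> by (auto simp: N_iff mem_Times_iff)
  have YT: "dlift X1 \<eta> (Y \<eta>) = 0" "dlift X2 \<eta> (Y \<eta>) = 0" "dlift X3 \<eta> (Y \<eta>) = 0" "snd \<eta> \<bullet> fst (Y \<eta>) = 0" if "\<eta> \<in> N" for \<eta>
    using Y(2)[OF that] tangent_N[OF that] by (auto simp: W_numerator_eq)
  note op = open_times_UNIV[OF open_\<Omega>]
  have main: "dlift X \<xi> (lie_bracket h Y \<xi>) = 0"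
    if X: "smooth_on \<Omega> X" and z: "\<And>\<eta>. \<eta> \<in> N \<Longrightarrow> dlift X \<eta> (Y \<eta>) = 0"
      and G: "\<And>\<eta>. \<eta> \<in> \<Omega> \<times> UNIV \<Longrightarrow> g \<eta> = dlift X \<eta> (h \<eta>)" "(g has_derivative g') (at \<xi>)" "g' (Y \<xi>) = 0" for X g g'
  proof -
    have "frechet_derivative (\<lambda>\<eta>. dlift X \<eta> (Y \<eta>)) (at \<xi>) (h \<xi>) = 0"
      by (rule tangent_space_derivative_zero[OF h_tangent[OF \<xi>]
            fpoly_derivative(1)[OF open_\<Omega> fpoly_directional[OF open_\<Omega> fpoly_lift[OF open_\<Omega> X] Y(1)] S] z])
    moreover have "frechet_derivative (\<lambda>\<eta>. dlift X \<eta> (h \<eta>)) (at \<xi>) = g'"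
      using frechet_derivative_at[OF has_derivative_transform_within_open[OF G(2) op S G(1)]] by simp
    ultimately show ?thesis
      using lie_bracket_commutator[OF op S fpoly_smooth_on[OF open_\<Omega> fpoly_lift[OF open_\<Omega> X]]
          vpoly_smooth_on[OF open_\<Omega> vpoly_h] vpoly_smooth_on[OF open_\<Omega> Y(1)]] G(3) by simp
  qed
  note d = lift_has_dlift[OF _ x]
  have 1: "dlift X1 \<xi> (lie_bracket h Y \<xi>) = 0"
    by (rule main[OF smooth_X1 YT(1) _ has_derivative_minus[OF has_derivative_mult[OF d[OF smooth_X4] d[OF smooth_X3]]]])
       (use YT[OF \<xi>] u in \<open>auto simp: dlift_X_h\<close>)
  have 2: "dlift X2 \<xi> (lie_bracket h Y \<xi>) = 0"
    by (rule main[OF smooth_X2 YT(2) _ has_derivative_minus[OF has_derivative_mult[OF d[OF smooth_X5] d[OF smooth_X3]]]])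
       (use YT[OF \<xi>] u in \<open>auto simp: dlift_X_h\<close>)
  have 3: "dlift X3 \<xi> (lie_bracket h Y \<xi>) = 0"
    by (rule main[OF smooth_X3 YT(3) _ has_derivative_const[of 0]]) (auto simp: dlift_X_h)
  have inner_d: "((\<lambda>\<eta>. snd \<eta> \<bullet> fst (F \<eta>)) has_derivative
      (\<lambda>w. snd \<xi> \<bullet> fst (frechet_derivative F (at \<xi>) w) + snd w \<bullet> fst (F \<xi>))) (at \<xi>)" if "vpoly \<Omega> F" for F
    by (rule has_derivative_inner[OF bounded_linear_imp_has_derivative[OF bounded_linear_snd]
          has_derivative_fst[OF vpoly_has_derivative[OF open_\<Omega> that S]]])
  \<comment> \<open>The tautological form on the bracket is assembled from three facts: the
    derivative along \<open>h\<close> of its value on \<open>Y\<close>, the derivative along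
    \<open>Y\<close> of its value on \<open>h\<close>, and the vanishing of \<open>\<sigma>\<close>
    on \<open>h\<close> and \<open>Y\<close>.\<close>
  have a: "snd \<xi> \<bullet> fst (frechet_derivative Y (at \<xi>) (h \<xi>)) + snd (h \<xi>) \<bullet> fst (Y \<xi>) = 0"
    by (rule tangent_space_derivative_zero[OF h_tangent[OF \<xi>] inner_d[OF Y(1)] YT(4)])
  have "((\<lambda>\<eta>. lift_function X4 \<eta> * lift_function X2 \<eta> - lift_function X5 \<eta> * lift_function X1 \<eta>) has_derivative
     (\<lambda>w. (lift_function X4 \<xi> * dlift X2 \<xi> w + dlift X4 \<xi> w * lift_function X2 \<xi>) -
          (lift_function X5 \<xi> * dlift X1 \<xi> w + dlift X5 \<xi> w * lift_function X1 \<xi>))) (at \<xi>)"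
    by (intro has_derivative_diff has_derivative_mult d smooth_X1 smooth_X2 smooth_X4 smooth_X5)
  moreover have "(\<lambda>\<eta>. lift_function X4 \<eta> * lift_function X2 \<eta> - lift_function X5 \<eta> * lift_function X1 \<eta>) = (\<lambda>\<eta>. snd \<eta> \<bullet> fst (h \<eta>))"
    by (simp add: fun_eq_iff fst_h inner_diff_right lift_function_def)
  ultimately have "(\<lambda>w. snd \<xi> \<bullet> fst (frechet_derivative h (at \<xi>) w) + snd w \<bullet> fst (h \<xi>)) =
     (\<lambda>w. (lift_function X4 \<xi> * dlift X2 \<xi> w + dlift X4 \<xi> w * lift_function X2 \<xi>) -
          (lift_function X5 \<xi> * dlift X1 \<xi> w + dlift X5 \<xi> w * lift_function X1 \<xi>))"
    using has_derivative_unique[OF inner_d[OF vpoly_h]] by simp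
  from fun_cong[OF this, of "Y \<xi>"]
  have b: "snd \<xi> \<bullet> fst (frechet_derivative h (at \<xi>) (Y \<xi>)) + snd (Y \<xi>) \<bullet> fst (h \<xi>) = 0"
    using YT[OF \<xi>] u by simp
  have c: "fst (h \<xi>) \<bullet> snd (Y \<xi>) - snd (h \<xi>) \<bullet> fst (Y \<xi>) = 0"
    unfolding sigma_h[OF x] using YT[OF \<xi>] by simp
  have "snd \<xi> \<bullet> fst (lie_bracket h Y \<xi>) = 0"
    using a b c by (simp add: lie_bracket_def inner_diff_right inner_commute)
  then show ?thesis using 1 2 3 by (simp add: W_numerator_eq tangent_N[OF \<xi>])
qed

lemma coframe_4_lifts:
  assumes "fst \<xi> \<in> \<Omega>"
  shows "dlift X1 \<xi> (E 0 \<xi>) = 0" "dlift X2 \<xi> (E 0 \<xi>) = 0" "dlift X3 \<xi> (E 0 \<xi>) = 0"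
    "dlift X4 \<xi> (E 0 \<xi>) = 1" "dlift X5 \<xi> (E 0 \<xi>) = 0"
proof -
  have l: "frechet_derivative X (at (fst \<xi>)) 0 = 0" if "smooth_on \<Omega> X" for X
    using linear_0[OF has_derivative_linear[OF smooth_on_has_derivative[OF that assms]]] .
  show "dlift X1 \<xi> (E 0 \<xi>) = 0" "dlift X2 \<xi> (E 0 \<xi>) = 0" "dlift X3 \<xi> (E 0 \<xi>) = 0"
    "dlift X4 \<xi> (E 0 \<xi>) = 1" "dlift X5 \<xi> (E 0 \<xi>) = 0"
    using smooth_X1 smooth_X2 smooth_X3 smooth_X4 smooth_X5
    by (simp_all add: dlift_eq[OF _ assms] l coframe_X[OF assms])
qed

lemma E_W_numerator: "\<xi> \<in> N \<Longrightarrow> E k \<xi> \<in> W_numerator \<Omega> D \<xi>"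
proof (induction k arbitrary: \<xi>)
  case 0
  then show ?case using coframe_4_lifts[of \<xi>] by (simp add: W_numerator_eq tangent_N N_iff)
next
  case (Suc k)
  show ?case using bracket_tangent[OF vpoly_E Suc.IH Suc.prems] by simp
qed

lemma h_W_numerator: "\<xi> \<in> N \<Longrightarrow> h \<xi> \<in> W_numerator \<Omega> D \<xi>"
  using h_tangent by (simp add: W_numerator_eq fst_h inner_diff_right) (simp add: N_iff lift_function_def)

lemma dlift_euler:
  assumes "smooth_on \<Omega> X" "fst \<xi> \<in> \<Omega>"
  shows "dlift X \<xi> (euler_field \<xi>) = lift_function X \<xi>"
  using linear_0[OF has_derivative_linear[OF smooth_on_has_derivative[OF assms]]]
  by (simp add: dlift_eq[OF assms] euler_field_def lift_function_def)

lemma euler_W_numerator: "\<xi> \<in> N \<Longrightarrow> euler_field \<xi> \<in> W_numerator \<Omega> D \<xi>"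
  by (simp add: W_numerator_eq tangent_N N_iff dlift_euler smooth_X1 smooth_X2 smooth_X3) (simp add: euler_field_def)

lemma subspace_W_numerator:
  assumes "\<xi> \<in> N"
  shows "subspace (W_numerator \<Omega> D \<xi>)"
proof -
  have x: "fst \<xi> \<in> \<Omega>" using assms by (simp add: N_iff)
  note l = dlift_linear[OF smooth_X1 x] dlift_linear[OF smooth_X2 x] dlift_linear[OF smooth_X3 x]
  show ?thesis
    unfolding W_numerator_eq tangent_N[OF assms]
    by (rule subspaceI) (simp_all add: l[THEN linear_0] l[THEN linear_add] l[THEN linear_cmul] inner_add_right)
qed

lemma fst_lie_bracket_h:
  assumes x: "fst \<xi> \<in> \<Omega>" and Y: "vpoly \<Omega> Y" "((\<lambda>\<eta>. fst (Y \<eta>)) has_derivative G) (at \<xi>)"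
  shows "fst (lie_bracket h Y \<xi>) = G (h \<xi>) -
    (lift_function X4 \<xi> *\<^sub>R frechet_derivative X2 (at (fst \<xi>)) (fst (Y \<xi>)) + dlift X4 \<xi> (Y \<xi>) *\<^sub>R X2 (fst \<xi>) -
    (lift_function X5 \<xi> *\<^sub>R frechet_derivative X1 (at (fst \<xi>)) (fst (Y \<xi>)) + dlift X5 \<xi> (Y \<xi>) *\<^sub>R X1 (fst \<xi>)))"
proof -
  have S: "\<xi> \<in> \<Omega> \<times> UNIV" using x by (simp add: mem_Times_iff)
  have X: "((\<lambda>\<eta>. X (fst \<eta>)) has_derivative (\<lambda>w. frechet_derivative X (at (fst \<xi>)) (fst w))) (at \<xi>)"
    if "smooth_on \<Omega> X" for X :: "real^5 \<Rightarrow> real^5"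
    by (rule has_derivative_compose[OF bounded_linear_imp_has_derivative[OF bounded_linear_fst] smooth_on_has_derivative[OF that x]])
  have "((\<lambda>\<eta>. fst (h \<eta>)) has_derivative (\<lambda>w.
    (lift_function X4 \<xi> *\<^sub>R frechet_derivative X2 (at (fst \<xi>)) (fst w) + dlift X4 \<xi> w *\<^sub>R X2 (fst \<xi>)) -
    (lift_function X5 \<xi> *\<^sub>R frechet_derivative X1 (at (fst \<xi>)) (fst w) + dlift X5 \<xi> w *\<^sub>R X1 (fst \<xi>)))) (at \<xi>)"
    unfolding fst_h
    by (intro has_derivative_diff has_derivative_scaleR X lift_has_dlift[OF _ x] smooth_X1 smooth_X2 smooth_X4 smooth_X5)
  from fst_frechet[OF vpoly_h S this] fst_frechet[OF Y(1) S Y(2)]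
  show ?thesis by (simp add: lie_bracket_def)
qed

text \<open>Along \<open>E 0\<close> the base point rests, \<open>u_4\<close> grows at rate 1 and
  \<open>u_5\<close> is constant, so only the term \<open>u_4 X2\<close> of \<open>h\<close>
  contributes, with the sign reversed by the bracket.\<close>

lemma fst_E1:
  assumes x: "fst \<xi> \<in> \<Omega>"
  shows "fst (E (Suc 0) \<xi>) = - X2 (fst \<xi>)"
proof -
  have l: "frechet_derivative X (at (fst \<xi>)) 0 = 0" if "smooth_on \<Omega> X" for X
    using linear_0[OF has_derivative_linear[OF smooth_on_has_derivative[OF that x]]] .
  have "((\<lambda>\<eta>. fst (E 0 \<eta>)) has_derivative (\<lambda>w. 0)) (at \<xi>)" by simp
  from fst_lie_bracket_h[OF x vpoly_E this] show ?thesis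
    using coframe_4_lifts(4,5)[OF x] by (simp add: l[OF smooth_X1] l[OF smooth_X2])
qed

text \<open>Modulo the distribution the leading term is the bracket of \<open>- u_5 X1\<close> with
  \<open>- X2\<close>.\<close>

lemma fst_E2:
  assumes x: "fst \<xi> \<in> \<Omega>"
  shows "fst (E (Suc (Suc 0)) \<xi>) = lift_function X5 \<xi> *\<^sub>R X3 (fst \<xi>)
     + dlift X5 \<xi> (E (Suc 0) \<xi>) *\<^sub>R X1 (fst \<xi>) - dlift X4 \<xi> (E (Suc 0) \<xi>) *\<^sub>R X2 (fst \<xi>)"
proof -
  have S: "\<xi> \<in> \<Omega> \<times> UNIV" using x by (simp add: mem_Times_iff)
  have l: "linear (frechet_derivative X (at (fst \<xi>)))" if "smooth_on \<Omega> X" for X :: "real^5 \<Rightarrow> real^5"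
    using has_derivative_linear[OF smooth_on_has_derivative[OF that x]] .
  have "((\<lambda>\<eta>. - X2 (fst \<eta>)) has_derivative (\<lambda>w. - frechet_derivative X2 (at (fst \<xi>)) (fst w))) (at \<xi>)"
    by (rule has_derivative_minus[OF has_derivative_compose[OF bounded_linear_imp_has_derivative[OF bounded_linear_fst]
          smooth_on_has_derivative[OF smooth_X2 x]]])
  then have "((\<lambda>\<eta>. fst (E (Suc 0) \<eta>)) has_derivative (\<lambda>w. - frechet_derivative X2 (at (fst \<xi>)) (fst w))) (at \<xi>)"
    by (rule has_derivative_transform_within_open[OF _ open_times_UNIV[OF open_\<Omega>] S])
       (simp add: fst_E1 mem_Times_iff del: E.simps)
  from fst_lie_bracket_h[OF x vpoly_E this] show ?thesis
    unfolding E.simps(2)[of "Suc 0"] fst_E1[OF x] fst_h X3_def lie_bracket_def[of X1 X2]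
    by (simp add: linear_diff[OF l[OF smooth_X1]] linear_diff[OF l[OF smooth_X2]] linear_cmul[OF l[OF smooth_X1]]
        linear_cmul[OF l[OF smooth_X2]] linear_neg[OF l[OF smooth_X1]] linear_neg[OF l[OF smooth_X2]]
        algebra_simps del: E.simps)
qed

text \<open>The leading term is the bracket of \<open>u_4 X2 - u_5 X1\<close> with
  \<open>u_5 X3\<close>. With the two preceding lemmas this gives a triangular system as long as
  \<open>u_5 \<noteq> 0\<close>, whence the exceptional line and the powers of \<open>u_5\<close> as
  denominators.\<close>

lemma fst_E3:
  assumes x: "fst \<xi> \<in> \<Omega>"
  obtains c1 c2 c3 where "fst (E (Suc (Suc (Suc 0))) \<xi>) =
     (lift_function X4 \<xi> * lift_function X5 \<xi>) *\<^sub>R X5 (fst \<xi>) - (lift_function X5 \<xi>)\<^sup>2 *\<^sub>R X4 (fst \<xi>)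
     + c1 *\<^sub>R X1 (fst \<xi>) + c2 *\<^sub>R X2 (fst \<xi>) + c3 *\<^sub>R X3 (fst \<xi>)"
proof -
  have S: "\<xi> \<in> \<Omega> \<times> UNIV" using x by (simp add: mem_Times_iff)
  have l: "linear (frechet_derivative X (at (fst \<xi>)))" if "smooth_on \<Omega> X" for X :: "real^5 \<Rightarrow> real^5"
    using has_derivative_linear[OF smooth_on_has_derivative[OF that x]] .
  have X: "((\<lambda>\<eta>. X (fst \<eta>)) has_derivative (\<lambda>w. frechet_derivative X (at (fst \<xi>)) (fst w))) (at \<xi>)"
    if "smooth_on \<Omega> X" for X :: "real^5 \<Rightarrow> real^5"
    by (rule has_derivative_compose[OF bounded_linear_imp_has_derivative[OF bounded_linear_fst] smooth_on_has_derivative[OF that x]])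
  define \<alpha> where "\<alpha> \<eta> = dlift X5 \<eta> (E (Suc 0) \<eta>)" for \<eta>
  define \<beta> where "\<beta> \<eta> = dlift X4 \<eta> (E (Suc 0) \<eta>)" for \<eta>
  define \<alpha>' where "\<alpha>' = frechet_derivative \<alpha> (at \<xi>)"
  define \<beta>' where "\<beta>' = frechet_derivative \<beta> (at \<xi>)"
  have \<alpha>: "(\<alpha> has_derivative \<alpha>') (at \<xi>)" unfolding \<alpha>'_def
    by (rule fpoly_derivative(1)[OF open_\<Omega> _ S], unfold \<alpha>_def[abs_def])
       (intro fpoly_directional open_\<Omega> fpoly_lift smooth_X5 vpoly_E)
  have \<beta>: "(\<beta> has_derivative \<beta>') (at \<xi>)" unfolding \<beta>'_def
    by (rule fpoly_derivative(1)[OF open_\<Omega> _ S], unfold \<beta>_def[abs_def])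
       (intro fpoly_directional open_\<Omega> fpoly_lift smooth_X4 vpoly_E)
  have "((\<lambda>\<eta>. lift_function X5 \<eta> *\<^sub>R X3 (fst \<eta>) + \<alpha> \<eta> *\<^sub>R X1 (fst \<eta>) - \<beta> \<eta> *\<^sub>R X2 (fst \<eta>)) has_derivative
    (\<lambda>w. (lift_function X5 \<xi> *\<^sub>R frechet_derivative X3 (at (fst \<xi>)) (fst w) + dlift X5 \<xi> w *\<^sub>R X3 (fst \<xi>))
       + (\<alpha> \<xi> *\<^sub>R frechet_derivative X1 (at (fst \<xi>)) (fst w) + \<alpha>' w *\<^sub>R X1 (fst \<xi>))
       - (\<beta> \<xi> *\<^sub>R frechet_derivative X2 (at (fst \<xi>)) (fst w) + \<beta>' w *\<^sub>R X2 (fst \<xi>)))) (at \<xi>)"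
    by (intro has_derivative_diff has_derivative_add has_derivative_scaleR X \<alpha> \<beta> lift_has_dlift[OF _ x]
        smooth_X1 smooth_X2 smooth_X3 smooth_X5)
  then have "((\<lambda>\<eta>. fst (E (Suc (Suc 0)) \<eta>)) has_derivative
    (\<lambda>w. (lift_function X5 \<xi> *\<^sub>R frechet_derivative X3 (at (fst \<xi>)) (fst w) + dlift X5 \<xi> w *\<^sub>R X3 (fst \<xi>))
       + (\<alpha> \<xi> *\<^sub>R frechet_derivative X1 (at (fst \<xi>)) (fst w) + \<alpha>' w *\<^sub>R X1 (fst \<xi>))
       - (\<beta> \<xi> *\<^sub>R frechet_derivative X2 (at (fst \<xi>)) (fst w) + \<beta>' w *\<^sub>R X2 (fst \<xi>)))) (at \<xi>)"
    by (rule has_derivative_transform_within_open[OF _ open_times_UNIV[OF open_\<Omega>] S])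
       (simp add: fst_E2 mem_Times_iff \<alpha>_def \<beta>_def del: E.simps)
  note br = fst_lie_bracket_h[OF x vpoly_E this]
  have E2: "fst (E (Suc (Suc 0)) \<xi>) = lift_function X5 \<xi> *\<^sub>R X3 (fst \<xi>) + \<alpha> \<xi> *\<^sub>R X1 (fst \<xi>) - \<beta> \<xi> *\<^sub>R X2 (fst \<xi>)"
    by (simp add: fst_E2[OF x] \<alpha>_def \<beta>_def del: E.simps)
  have b: "X3 (fst \<xi>) = frechet_derivative X2 (at (fst \<xi>)) (X1 (fst \<xi>)) - frechet_derivative X1 (at (fst \<xi>)) (X2 (fst \<xi>))"
    "X4 (fst \<xi>) = frechet_derivative X3 (at (fst \<xi>)) (X1 (fst \<xi>)) - frechet_derivative X1 (at (fst \<xi>)) (X3 (fst \<xi>))"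
    "X5 (fst \<xi>) = frechet_derivative X3 (at (fst \<xi>)) (X2 (fst \<xi>)) - frechet_derivative X2 (at (fst \<xi>)) (X3 (fst \<xi>))"
    by (simp_all add: X4_def X5_def lie_bracket_def) (simp add: X3_def lie_bracket_def)
  have lin: "frechet_derivative X (at (fst \<xi>)) (a *\<^sub>R v + b *\<^sub>R w - c *\<^sub>R y) =
      a *\<^sub>R frechet_derivative X (at (fst \<xi>)) v + b *\<^sub>R frechet_derivative X (at (fst \<xi>)) w - c *\<^sub>R frechet_derivative X (at (fst \<xi>)) y"
    "frechet_derivative X (at (fst \<xi>)) (a *\<^sub>R v - c *\<^sub>R y) =
      a *\<^sub>R frechet_derivative X (at (fst \<xi>)) v - c *\<^sub>R frechet_derivative X (at (fst \<xi>)) y"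
    if "smooth_on \<Omega> X" for X :: "real^5 \<Rightarrow> real^5" and a b c v w y
    by (simp_all add: linear_diff[OF l[OF that]] linear_add[OF l[OF that]] linear_cmul[OF l[OF that]])
  define u4 where "u4 = lift_function X4 \<xi>"
  define u5 where "u5 = lift_function X5 \<xi>"
  define D1 where "D1 = frechet_derivative X1 (at (fst \<xi>))"
  define D2 where "D2 = frechet_derivative X2 (at (fst \<xi>))"
  define D3 where "D3 = frechet_derivative X3 (at (fst \<xi>))"
  define c3 where "c3 = dlift X5 \<xi> (h \<xi>) - \<alpha> \<xi> * u4 + \<beta> \<xi> * u5"
  define c1 where "c1 = \<alpha>' (h \<xi>) + dlift X5 \<xi> (E (Suc (Suc 0)) \<xi>)"
  define c2 where "c2 = - \<beta>' (h \<xi>) - dlift X4 \<xi> (E (Suc (Suc 0)) \<xi>)"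
  have "fst (E (Suc (Suc (Suc 0))) \<xi>) =
     (u5 *\<^sub>R (u4 *\<^sub>R D3 (X2 (fst \<xi>)) - u5 *\<^sub>R D3 (X1 (fst \<xi>))) + dlift X5 \<xi> (h \<xi>) *\<^sub>R X3 (fst \<xi>))
       + (\<alpha> \<xi> *\<^sub>R (u4 *\<^sub>R D1 (X2 (fst \<xi>)) - u5 *\<^sub>R D1 (X1 (fst \<xi>))) + \<alpha>' (h \<xi>) *\<^sub>R X1 (fst \<xi>))
       - (\<beta> \<xi> *\<^sub>R (u4 *\<^sub>R D2 (X2 (fst \<xi>)) - u5 *\<^sub>R D2 (X1 (fst \<xi>))) + \<beta>' (h \<xi>) *\<^sub>R X2 (fst \<xi>))
       - (u4 *\<^sub>R (u5 *\<^sub>R D2 (X3 (fst \<xi>)) + \<alpha> \<xi> *\<^sub>R D2 (X1 (fst \<xi>)) - \<beta> \<xi> *\<^sub>R D2 (X2 (fst \<xi>)))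
            + dlift X4 \<xi> (E (Suc (Suc 0)) \<xi>) *\<^sub>R X2 (fst \<xi>)
          - (u5 *\<^sub>R (u5 *\<^sub>R D1 (X3 (fst \<xi>)) + \<alpha> \<xi> *\<^sub>R D1 (X1 (fst \<xi>)) - \<beta> \<xi> *\<^sub>R D1 (X2 (fst \<xi>)))
            + dlift X5 \<xi> (E (Suc (Suc 0)) \<xi>) *\<^sub>R X1 (fst \<xi>)))"
    unfolding E.simps(2)[of "Suc (Suc 0)"] br unfolding E2 fst_h lin[OF smooth_X1] lin[OF smooth_X2] lin[OF smooth_X3]
      u4_def u5_def D1_def D2_def D3_def ..
  also have "\<dots> = (u4 * u5) *\<^sub>R (D3 (X2 (fst \<xi>)) - D2 (X3 (fst \<xi>))) - u5\<^sup>2 *\<^sub>R (D3 (X1 (fst \<xi>)) - D1 (X3 (fst \<xi>)))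
     + c1 *\<^sub>R X1 (fst \<xi>) + c2 *\<^sub>R X2 (fst \<xi>) + (dlift X5 \<xi> (h \<xi>) *\<^sub>R X3 (fst \<xi>) + (\<beta> \<xi> * u5 - \<alpha> \<xi> * u4) *\<^sub>R (D2 (X1 (fst \<xi>)) - D1 (X2 (fst \<xi>))))"
    by (simp add: c1_def c2_def algebra_simps power2_eq_square del: E.simps)
  also have "\<dots> = (u4 * u5) *\<^sub>R X5 (fst \<xi>) - u5\<^sup>2 *\<^sub>R X4 (fst \<xi>) + c1 *\<^sub>R X1 (fst \<xi>) + c2 *\<^sub>R X2 (fst \<xi>) + c3 *\<^sub>R X3 (fst \<xi>)"
    unfolding D1_def D2_def D3_def b(2,3)[symmetric] b(1)[symmetric]
    by (simp add: c3_def scaleR_add_left scaleR_diff_left)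
  finally show ?thesis using that unfolding u4_def u5_def by blast
qed

end

section \<open>Coordinates on the reduced space\<close>

context cartan_frame
begin

declare E.simps [simp del]

lemma fst_E:
  assumes "fst \<xi> \<in> \<Omega>"
  shows "fst (E 0 \<xi>) = 0" "fst (E (Suc 0) \<xi>) = - X2 (fst \<xi>)"
    "fst (E 2 \<xi>) = lift_function X5 \<xi> *\<^sub>R X3 (fst \<xi>)
       + dlift X5 \<xi> (E (Suc 0) \<xi>) *\<^sub>R X1 (fst \<xi>) - dlift X4 \<xi> (E (Suc 0) \<xi>) *\<^sub>R X2 (fst \<xi>)"
  using fst_E1[OF assms] fst_E2[OF assms] by (simp_all add: E.simps(1) numeral_2_eq_2)

lemma coframe_E3:
  assumes "fst \<xi> \<in> \<Omega>"
  shows "coframe 4 (fst \<xi>) \<bullet> fst (E 3 \<xi>) = - (lift_function X5 \<xi>)\<^sup>2"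
    and "coframe 5 (fst \<xi>) \<bullet> fst (E 3 \<xi>) = lift_function X4 \<xi> * lift_function X5 \<xi>"
proof -
  obtain c1 c2 c3 where "fst (E 3 \<xi>) =
     (lift_function X4 \<xi> * lift_function X5 \<xi>) *\<^sub>R X5 (fst \<xi>) - (lift_function X5 \<xi>)\<^sup>2 *\<^sub>R X4 (fst \<xi>)
     + c1 *\<^sub>R X1 (fst \<xi>) + c2 *\<^sub>R X2 (fst \<xi>) + c3 *\<^sub>R X3 (fst \<xi>)"
    using fst_E3[OF assms] unfolding numeral_3_eq_3 by blast
  then show "coframe 4 (fst \<xi>) \<bullet> fst (E 3 \<xi>) = - (lift_function X5 \<xi>)\<^sup>2"
    "coframe 5 (fst \<xi>) \<bullet> fst (E 3 \<xi>) = lift_function X4 \<xi> * lift_function X5 \<xi>"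
    using coframe_X[OF assms] by (simp_all add: inner_add_right inner_diff_right)
qed

text \<open>Coefficients \<open>k0, \<dots>, k3, kh, ke\<close> of \<open>w\<close> with respect to \<open>E\<^sub>0, \<dots>, E\<^sub>3, h\<close> and the Euler field, obtained by
  successive elimination; the denominators are powers of \<open>u\<^sub>5\<close>.\<close>

definition k3 where "k3 \<xi> w = - (coframe 4 (fst \<xi>) \<bullet> fst w) / (lift_function X5 \<xi>)\<^sup>2"

definition k2 where
  "k2 \<xi> w = (coframe 3 (fst \<xi>) \<bullet> fst w - k3 \<xi> w * (coframe 3 (fst \<xi>) \<bullet> fst (E 3 \<xi>))) / lift_function X5 \<xi>"

definition r1 where "r1 \<xi> w = w - k3 \<xi> w *\<^sub>R E 3 \<xi> - k2 \<xi> w *\<^sub>R E 2 \<xi>"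

definition kh where "kh \<xi> w = - (coframe 1 (fst \<xi>) \<bullet> fst (r1 \<xi> w)) / lift_function X5 \<xi>"

definition k1 where "k1 \<xi> w = kh \<xi> w * lift_function X4 \<xi> - coframe 2 (fst \<xi>) \<bullet> fst (r1 \<xi> w)"

definition r2 where "r2 \<xi> w = r1 \<xi> w - kh \<xi> w *\<^sub>R h \<xi> - k1 \<xi> w *\<^sub>R E (Suc 0) \<xi>"

definition ke where "ke \<xi> w = dlift X5 \<xi> (r2 \<xi> w) / lift_function X5 \<xi>"

definition k0 where "k0 \<xi> w = dlift X4 \<xi> (r2 \<xi> w) - ke \<xi> w * lift_function X4 \<xi>"

lemma linear_k3: "linear (k3 \<xi>)"
  by (rule linearI) (simp_all add: k3_def inner_add_right add_divide_distrib diff_divide_distrib)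

lemma linear_k2: "linear (k2 \<xi>)"
  by (rule linearI) (simp_all add: k2_def linear_add[OF linear_k3] linear_cmul[OF linear_k3] inner_add_right
      add_divide_distrib diff_divide_distrib algebra_simps)

lemma linear_r1: "linear (r1 \<xi>)"
  by (rule linearI) (simp_all add: r1_def linear_add[OF linear_k3] linear_cmul[OF linear_k3]
      linear_add[OF linear_k2] linear_cmul[OF linear_k2] algebra_simps)

lemma linear_kh: "linear (kh \<xi>)"
  by (rule linearI) (simp_all add: kh_def linear_add[OF linear_r1] linear_cmul[OF linear_r1] inner_add_right
      add_divide_distrib diff_divide_distrib)

lemma linear_k1: "linear (k1 \<xi>)"
  by (rule linearI) (simp_all add: k1_def linear_add[OF linear_r1] linear_cmul[OF linear_r1]
      linear_add[OF linear_kh] linear_cmul[OF linear_kh] inner_add_right algebra_simps)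

lemma linear_r2: "linear (r2 \<xi>)"
  by (rule linearI) (simp_all add: r2_def linear_add[OF linear_r1] linear_cmul[OF linear_r1]
      linear_add[OF linear_kh] linear_cmul[OF linear_kh] linear_add[OF linear_k1] linear_cmul[OF linear_k1] algebra_simps)

lemma linear_ke:
  assumes "fst \<xi> \<in> \<Omega>"
  shows "linear (ke \<xi>)"
  using dlift_linear[OF smooth_X5 assms]
  by (intro linearI) (simp_all add: ke_def linear_add[OF linear_r2] linear_cmul[OF linear_r2] linear_add linear_cmul
      add_divide_distrib)

lemma linear_k0:
  assumes "fst \<xi> \<in> \<Omega>"
  shows "linear (k0 \<xi>)"
  using dlift_linear[OF smooth_X4 assms] linear_ke[OF assms]
  by (intro linearI) (simp_all add: k0_def linear_add[OF linear_r2] linear_cmul[OF linear_r2] linear_add linear_cmul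
      algebra_simps)

lemma covector_in_N:
  assumes "\<xi> \<in> N"
  shows "snd \<xi> = lift_function X4 \<xi> *\<^sub>R coframe 4 (fst \<xi>) + lift_function X5 \<xi> *\<^sub>R coframe 5 (fst \<xi>)"
  using coframe_expansion[of "fst \<xi>" "snd \<xi>"] assms by (simp add: N_iff sum_5 lift_function_def)

text \<open>Removing \<open>E 3\<close> and \<open>E 2\<close> leaves a base part in the
  distribution; \<open>h\<close> and \<open>E 1\<close> then account for it, because the
  \<open>X1\<close> component of \<open>h\<close> is \<open>- u_5\<close>. The vertical rest lies in
  the plane of the two last coframe covectors, spanned by \<open>E 0\<close> and the Euler field
  when \<open>u_5 \<noteq> 0\<close>.\<close>

lemma decomposition:
  assumes \<xi>: "\<xi> \<in> N" and u5: "lift_function X5 \<xi> \<noteq> 0" and w: "w \<in> W_numerator \<Omega> D \<xi>"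
  shows "w = k0 \<xi> w *\<^sub>R E 0 \<xi> + k1 \<xi> w *\<^sub>R E (Suc 0) \<xi> + k2 \<xi> w *\<^sub>R E 2 \<xi> + k3 \<xi> w *\<^sub>R E 3 \<xi>
     + kh \<xi> w *\<^sub>R h \<xi> + ke \<xi> w *\<^sub>R euler_field \<xi>"
proof -
  have x: "fst \<xi> \<in> \<Omega>" using \<xi> by (simp add: N_iff)
  note F = fst_E[OF x] and C = coframe_X[OF x] and C3 = coframe_E3[OF x]
  have W: "r1 \<xi> w \<in> W_numerator \<Omega> D \<xi>" "r2 \<xi> w \<in> W_numerator \<Omega> D \<xi>"
  proof -
    show *: "r1 \<xi> w \<in> W_numerator \<Omega> D \<xi>" unfolding r1_def
      using w E_W_numerator[OF \<xi>] by (intro subspace_diff[OF subspace_W_numerator[OF \<xi>]] subspace_scale[OF subspace_W_numerator[OF \<xi>]])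
    show "r2 \<xi> w \<in> W_numerator \<Omega> D \<xi>" unfolding r2_def
      using * E_W_numerator[OF \<xi>] h_W_numerator[OF \<xi>] by (intro subspace_diff[OF subspace_W_numerator[OF \<xi>]] subspace_scale[OF subspace_W_numerator[OF \<xi>]])
  qed
  \<comment> \<open>The \<open>X5\<close> component has no basis field of its own: once the
    \<open>X4\<close> component is gone, the pairing with the covector forces it to vanish.\<close>
  have "snd \<xi> \<bullet> fst (r1 \<xi> w) = 0" using W(1) by (simp add: W_numerator_eq)
  then have s: "lift_function X4 \<xi> * (coframe 4 (fst \<xi>) \<bullet> fst (r1 \<xi> w)) + lift_function X5 \<xi> * (coframe 5 (fst \<xi>) \<bullet> fst (r1 \<xi> w)) = 0"
    by (subst (asm) covector_in_N[OF \<xi>]) (simp add: inner_add_left)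
  have r1_4: "coframe 4 (fst \<xi>) \<bullet> fst (r1 \<xi> w) = 0"
    using u5 by (simp add: r1_def inner_diff_right C3 F C k3_def inner_add_right)
  have r1_5: "coframe 5 (fst \<xi>) \<bullet> fst (r1 \<xi> w) = 0"
    using s u5 by (simp add: r1_4)
  have r1_3: "coframe 3 (fst \<xi>) \<bullet> fst (r1 \<xi> w) = 0"
    using u5 by (simp add: r1_def inner_diff_right F C k2_def inner_add_right)
  have "fst (r1 \<xi> w) = (coframe 1 (fst \<xi>) \<bullet> fst (r1 \<xi> w)) *\<^sub>R X1 (fst \<xi>) + (coframe 2 (fst \<xi>) \<bullet> fst (r1 \<xi> w)) *\<^sub>R X2 (fst \<xi>)"
    using frame_expansion[OF x, of "fst (r1 \<xi> w)"] by (simp add: sum_5 r1_3 r1_4 r1_5)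
  moreover have "coframe 1 (fst \<xi>) \<bullet> fst (r1 \<xi> w) = - (kh \<xi> w * lift_function X5 \<xi>)"
    using u5 by (simp add: kh_def)
  moreover have "coframe 2 (fst \<xi>) \<bullet> fst (r1 \<xi> w) = kh \<xi> w * lift_function X4 \<xi> - k1 \<xi> w" by (simp add: k1_def)
  ultimately have f0: "fst (r2 \<xi> w) = 0"
    by (simp add: r2_def F fst_h algebra_simps)
  have l0: "frechet_derivative X (at (fst \<xi>)) 0 = 0" if "smooth_on \<Omega> X" for X
    using linear_0[OF has_derivative_linear[OF smooth_on_has_derivative[OF that x]]] .
  have dl: "dlift (frame j) \<xi> (r2 \<xi> w) = snd (r2 \<xi> w) \<bullet> frame j (fst \<xi>)" for j
    by (simp add: dlift_eq[OF smooth_frame x] f0 l0[OF smooth_frame])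
  have "dlift X1 \<xi> (r2 \<xi> w) = 0" "dlift X2 \<xi> (r2 \<xi> w) = 0" "dlift X3 \<xi> (r2 \<xi> w) = 0"
    using W(2) by (simp_all add: W_numerator_eq tangent_N[OF \<xi>])
  then have "snd (r2 \<xi> w) = dlift X4 \<xi> (r2 \<xi> w) *\<^sub>R coframe 4 (fst \<xi>) + dlift X5 \<xi> (r2 \<xi> w) *\<^sub>R coframe 5 (fst \<xi>)"
    using coframe_expansion[OF x, of "snd (r2 \<xi> w)"] dl[of 1] dl[of 2] dl[of 3] dl[of 4] dl[of 5] by (simp add: sum_5)
  also have "dlift X5 \<xi> (r2 \<xi> w) = ke \<xi> w * lift_function X5 \<xi>" using u5 by (simp add: ke_def)
  also have "dlift X4 \<xi> (r2 \<xi> w) = k0 \<xi> w + ke \<xi> w * lift_function X4 \<xi>" by (simp add: k0_def)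
  finally have "snd (r2 \<xi> w) = k0 \<xi> w *\<^sub>R coframe 4 (fst \<xi>) + ke \<xi> w *\<^sub>R snd \<xi>"
    by (subst covector_in_N[OF \<xi>]) (simp add: algebra_simps)
  then have "r2 \<xi> w = k0 \<xi> w *\<^sub>R E 0 \<xi> + ke \<xi> w *\<^sub>R euler_field \<xi>"
    using f0 by (simp add: prod_eq_iff E.simps(1) euler_field_def)
  then show ?thesis by (simp add: r2_def r1_def algebra_simps)
qed

text \<open>Each block follows the order of elimination: the residuals \<open>r1\<close> and
  \<open>r2\<close> of a basis vector are either the vector itself or zero, and the remaining
  coefficients can be read off.\<close>

lemma coefficients_of_basis:
  assumes \<xi>: "\<xi> \<in> N" and u5: "lift_function X5 \<xi> \<noteq> 0"
  shows "k0 \<xi> (E 0 \<xi>) = 1" "k1 \<xi> (E 0 \<xi>) = 0" "k2 \<xi> (E 0 \<xi>) = 0" "k3 \<xi> (E 0 \<xi>) = 0"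
    and "k0 \<xi> (E (Suc 0) \<xi>) = 0" "k1 \<xi> (E (Suc 0) \<xi>) = 1" "k2 \<xi> (E (Suc 0) \<xi>) = 0" "k3 \<xi> (E (Suc 0) \<xi>) = 0"
    and "k0 \<xi> (E 2 \<xi>) = 0" "k1 \<xi> (E 2 \<xi>) = 0" "k2 \<xi> (E 2 \<xi>) = 1" "k3 \<xi> (E 2 \<xi>) = 0"
    and "k0 \<xi> (E 3 \<xi>) = 0" "k1 \<xi> (E 3 \<xi>) = 0" "k2 \<xi> (E 3 \<xi>) = 0" "k3 \<xi> (E 3 \<xi>) = 1"
    and "k0 \<xi> (h \<xi>) = 0" "k1 \<xi> (h \<xi>) = 0" "k2 \<xi> (h \<xi>) = 0" "k3 \<xi> (h \<xi>) = 0"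
    and "k0 \<xi> (euler_field \<xi>) = 0" "k1 \<xi> (euler_field \<xi>) = 0" "k2 \<xi> (euler_field \<xi>) = 0" "k3 \<xi> (euler_field \<xi>) = 0"
proof -
  have x: "fst \<xi> \<in> \<Omega>" using \<xi> by (simp add: N_iff)
  note F = fst_E[OF x] and C = coframe_X[OF x] and C3 = coframe_E3[OF x]
  note z4 = linear_0[OF dlift_linear[OF smooth_X4 x]] and z5 = linear_0[OF dlift_linear[OF smooth_X5 x]]
  show a: "k2 \<xi> (E 0 \<xi>) = 0" "k3 \<xi> (E 0 \<xi>) = 0" by (simp_all add: k2_def k3_def F)
  have r: "r1 \<xi> (E 0 \<xi>) = E 0 \<xi>" by (simp add: r1_def a)
  have k: "kh \<xi> (E 0 \<xi>) = 0" by (simp add: kh_def r F)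
  show b: "k1 \<xi> (E 0 \<xi>) = 0" by (simp add: k1_def r F k)
  have "r2 \<xi> (E 0 \<xi>) = E 0 \<xi>" by (simp add: r2_def r k b)
  then show "k0 \<xi> (E 0 \<xi>) = 1" by (simp add: k0_def ke_def coframe_4_lifts[OF x])
  show a: "k2 \<xi> (E (Suc 0) \<xi>) = 0" "k3 \<xi> (E (Suc 0) \<xi>) = 0" by (simp_all add: k2_def k3_def F C)
  have r: "r1 \<xi> (E (Suc 0) \<xi>) = E (Suc 0) \<xi>" by (simp add: r1_def a)
  have k: "kh \<xi> (E (Suc 0) \<xi>) = 0" by (simp add: kh_def r F C)
  show b: "k1 \<xi> (E (Suc 0) \<xi>) = 1" by (simp add: k1_def r F k C)
  have "r2 \<xi> (E (Suc 0) \<xi>) = 0" by (simp add: r2_def r k b)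
  then show "k0 \<xi> (E (Suc 0) \<xi>) = 0" by (simp add: k0_def ke_def z4 z5)
  show a: "k3 \<xi> (E 2 \<xi>) = 0" by (simp add: k3_def F C inner_add_right inner_diff_right)
  show b: "k2 \<xi> (E 2 \<xi>) = 1" using u5 by (simp add: k2_def a F C inner_add_right inner_diff_right)
  have r: "r1 \<xi> (E 2 \<xi>) = 0" by (simp add: r1_def a b)
  have k: "kh \<xi> (E 2 \<xi>) = 0" by (simp add: kh_def r)
  show b: "k1 \<xi> (E 2 \<xi>) = 0" by (simp add: k1_def r k)
  have "r2 \<xi> (E 2 \<xi>) = 0" by (simp add: r2_def r k b)
  then show "k0 \<xi> (E 2 \<xi>) = 0" by (simp add: k0_def ke_def z4 z5)
  show a: "k3 \<xi> (E 3 \<xi>) = 1" using u5 by (simp add: k3_def C3)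
  show b: "k2 \<xi> (E 3 \<xi>) = 0" by (simp add: k2_def a)
  have r: "r1 \<xi> (E 3 \<xi>) = 0" by (simp add: r1_def a b)
  have k: "kh \<xi> (E 3 \<xi>) = 0" by (simp add: kh_def r)
  show b: "k1 \<xi> (E 3 \<xi>) = 0" by (simp add: k1_def r k)
  have "r2 \<xi> (E 3 \<xi>) = 0" by (simp add: r2_def r k b)
  then show "k0 \<xi> (E 3 \<xi>) = 0" by (simp add: k0_def ke_def z4 z5)
  show a: "k2 \<xi> (h \<xi>) = 0" "k3 \<xi> (h \<xi>) = 0" by (simp_all add: k2_def k3_def fst_h C inner_diff_right)
  have r: "r1 \<xi> (h \<xi>) = h \<xi>" by (simp add: r1_def a)
  have k: "kh \<xi> (h \<xi>) = 1" using u5 by (simp add: kh_def r fst_h C inner_diff_right)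
  show b: "k1 \<xi> (h \<xi>) = 0" by (simp add: k1_def r fst_h k C inner_diff_right)
  have "r2 \<xi> (h \<xi>) = 0" by (simp add: r2_def r k b)
  then show "k0 \<xi> (h \<xi>) = 0" by (simp add: k0_def ke_def z4 z5)
  have f: "fst (euler_field \<xi>) = 0" by (simp add: euler_field_def)
  show a: "k2 \<xi> (euler_field \<xi>) = 0" "k3 \<xi> (euler_field \<xi>) = 0" by (simp_all add: k2_def k3_def f)
  have r: "r1 \<xi> (euler_field \<xi>) = euler_field \<xi>" by (simp add: r1_def a)
  have k: "kh \<xi> (euler_field \<xi>) = 0" by (simp add: kh_def r f)
  show b: "k1 \<xi> (euler_field \<xi>) = 0" by (simp add: k1_def r f k)
  have "r2 \<xi> (euler_field \<xi>) = euler_field \<xi>" by (simp add: r2_def r k b)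
  then show "k0 \<xi> (euler_field \<xi>) = 0"
    using u5 by (simp add: k0_def ke_def dlift_euler[OF smooth_X4 x] dlift_euler[OF smooth_X5 x])
qed

definition coords :: "(real^5) \<times> (real^5) \<Rightarrow> (real^5) \<times> (real^5) \<Rightarrow> (real^2) \<times> (real^2)" where
  "coords \<xi> w = vec4_inv (\<chi> j. if j = 1 then k0 \<xi> w else if j = 2 then k1 \<xi> w else if j = 3 then k2 \<xi> w else k3 \<xi> w)"

lemma vec4_coords:
  "vec4 (coords \<xi> w) $ 1 = k0 \<xi> w" "vec4 (coords \<xi> w) $ 2 = k1 \<xi> w"
  "vec4 (coords \<xi> w) $ 3 = k2 \<xi> w" "vec4 (coords \<xi> w) $ 4 = k3 \<xi> w"
  unfolding coords_def vec4_vec4_inv by simp_all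

lemma vec4_eqI: "vec4 v = vec4 w \<Longrightarrow> v = w"
  by (metis vec4_inv_vec4)

lemma linear_coords:
  assumes "fst \<xi> \<in> \<Omega>"
  shows "linear (coords \<xi>)"
proof -
  note l = linear_k0[OF assms] linear_k1 linear_k2 linear_k3
  have "linear (\<lambda>w. \<chi> j::4. if j = 1 then k0 \<xi> w else if j = 2 then k1 \<xi> w else if j = 3 then k2 \<xi> w else k3 \<xi> w)"
    by (rule linearI) (simp_all add: vec_eq_iff l[THEN linear_add] l[THEN linear_cmul])
  from linear_compose[OF this linear_vec4_inv] show ?thesis by (simp add: coords_def[abs_def] o_def)
qed

lemma W_denominator_eq:
  "\<xi> \<in> N \<Longrightarrow> W_denominator X1 X2 \<xi> = span {h \<xi>, euler_field \<xi>}"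
  by (simp add: W_denominator_def h_field_eq N_iff)

lemma coords_combination:
  assumes "\<xi> \<in> N" "lift_function X5 \<xi> \<noteq> 0"
  shows "vec4 (coords \<xi> (a *\<^sub>R E 0 \<xi> + b *\<^sub>R E (Suc 0) \<xi> + c *\<^sub>R E 2 \<xi> + d *\<^sub>R E 3 \<xi> + e *\<^sub>R h \<xi> + f *\<^sub>R euler_field \<xi>)) =
    (\<chi> j. if j = 1 then a else if j = 2 then b else if j = 3 then c else d)"
proof -
  have x: "fst \<xi> \<in> \<Omega>" using assms by (simp add: N_iff)
  note l = linear_k0[OF x] linear_k1 linear_k2 linear_k3
  show ?thesis
    unfolding coords_def vec4_vec4_inv vec_eq_iff forall_4
    by (simp add: l[THEN linear_add] l[THEN linear_cmul] coefficients_of_basis[OF assms])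
qed

lemma quotient_coordinates_coords:
  assumes \<xi>: "\<xi> \<in> N" and u5: "lift_function X5 \<xi> \<noteq> 0"
  shows "quotient_coordinates (W_numerator \<Omega> D \<xi>) (W_denominator X1 X2 \<xi>) (coords \<xi>)"
proof -
  have x: "fst \<xi> \<in> \<Omega>" using \<xi> by (simp add: N_iff)
  note W = subspace_W_numerator[OF \<xi>]
  have comb: "a *\<^sub>R E 0 \<xi> + b *\<^sub>R E (Suc 0) \<xi> + c *\<^sub>R E 2 \<xi> + d *\<^sub>R E 3 \<xi> + e *\<^sub>R h \<xi> + f *\<^sub>R euler_field \<xi> \<in> W_numerator \<Omega> D \<xi>"
    for a b c d e f
    by (intro subspace_add[OF W] subspace_scale[OF W] E_W_numerator[OF \<xi>] h_W_numerator[OF \<xi>] euler_W_numerator[OF \<xi>])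
  have "coords \<xi> ` W_numerator \<Omega> D \<xi> = UNIV"
  proof (intro equalityI subsetI UNIV_I)
    fix y
    let ?w = "vec4 y $ 1 *\<^sub>R E 0 \<xi> + vec4 y $ 2 *\<^sub>R E (Suc 0) \<xi> + vec4 y $ 3 *\<^sub>R E 2 \<xi> + vec4 y $ 4 *\<^sub>R E 3 \<xi> + 0 *\<^sub>R h \<xi> + 0 *\<^sub>R euler_field \<xi>"
    have "vec4 (coords \<xi> ?w) = vec4 y"
      unfolding coords_combination[OF assms] by (simp add: vec_eq_iff forall_4)
    then have "y = coords \<xi> ?w" by (intro vec4_eqI) simp
    then show "y \<in> coords \<xi> ` W_numerator \<Omega> D \<xi>" using comb by blast
  qed
  moreover have "{w \<in> W_numerator \<Omega> D \<xi>. coords \<xi> w = 0} = W_denominator X1 X2 \<xi>"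
    unfolding W_denominator_eq[OF \<xi>]
  proof (intro equalityI subsetI)
    fix w assume "w \<in> {w \<in> W_numerator \<Omega> D \<xi>. coords \<xi> w = 0}"
    then have w: "w \<in> W_numerator \<Omega> D \<xi>" "coords \<xi> w = 0" by auto
    have "vec4 (coords \<xi> w) = 0" using w(2) linear_0[OF linear_vec4] by simp
    then have "k0 \<xi> w = 0" "k1 \<xi> w = 0" "k2 \<xi> w = 0" "k3 \<xi> w = 0"
      using vec4_coords[of \<xi> w] by simp_all
    then have "w = kh \<xi> w *\<^sub>R h \<xi> + ke \<xi> w *\<^sub>R euler_field \<xi>" using decomposition[OF \<xi> u5 w(1)] by simp
    then show "w \<in> span {h \<xi>, euler_field \<xi>}" unfolding in_span_pair by blast
  next
    fix w assume "w \<in> span {h \<xi>, euler_field \<xi>}"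
    then obtain e f where w: "w = 0 *\<^sub>R E 0 \<xi> + 0 *\<^sub>R E (Suc 0) \<xi> + 0 *\<^sub>R E 2 \<xi> + 0 *\<^sub>R E 3 \<xi> + e *\<^sub>R h \<xi> + f *\<^sub>R euler_field \<xi>"
      unfolding in_span_pair by auto
    have "vec4 (coords \<xi> w) = vec4 0"
      unfolding w coords_combination[OF assms] using linear_0[OF linear_vec4] by (simp add: vec_eq_iff)
    then have "coords \<xi> w = 0" by (rule vec4_eqI)
    then show "w \<in> {w \<in> W_numerator \<Omega> D \<xi>. coords \<xi> w = 0}" using comb unfolding w by blast
  qed
  ultimately show ?thesis unfolding quotient_coordinates_def using linear_coords[OF x] by blast
qed

text \<open>Vanishing of the last three base components makes \<open>k3\<close> and then
  \<open>k2\<close> zero, so \<open>decomposition\<close> leaves just these four vectors.\<close>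

lemma jacobi_space_span:
  assumes \<xi>: "\<xi> \<in> N" and u5: "lift_function X5 \<xi> \<noteq> 0"
  shows "jacobi_space \<Omega> D \<xi> = {a *\<^sub>R E 0 \<xi> + b *\<^sub>R E (Suc 0) \<xi> + c *\<^sub>R h \<xi> + d *\<^sub>R euler_field \<xi> | a b c d. True}"
proof -
  have x: "fst \<xi> \<in> \<Omega>" using \<xi> by (simp add: N_iff)
  note F = fst_E[OF x] and C = coframe_X[OF x]
  show ?thesis
  proof (intro equalityI subsetI)
    fix w assume "w \<in> jacobi_space \<Omega> D \<xi>"
    then have w: "w \<in> tangent_space N \<xi>" "coframe 3 (fst \<xi>) \<bullet> fst w = 0" "coframe 4 (fst \<xi>) \<bullet> fst w = 0" "coframe 5 (fst \<xi>) \<bullet> fst w = 0"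
      unfolding jacobi_space_eq[OF \<xi>] by auto
    have "snd \<xi> \<bullet> fst w = 0" by (subst covector_in_N[OF \<xi>]) (simp add: inner_add_left w)
    then have W: "w \<in> W_numerator \<Omega> D \<xi>" using w(1) by (simp add: W_numerator_eq)
    have "k3 \<xi> w = 0" by (simp add: k3_def w)
    moreover then have "k2 \<xi> w = 0" by (simp add: k2_def w)
    ultimately have "w = k0 \<xi> w *\<^sub>R E 0 \<xi> + k1 \<xi> w *\<^sub>R E (Suc 0) \<xi> + kh \<xi> w *\<^sub>R h \<xi> + ke \<xi> w *\<^sub>R euler_field \<xi>"
      using decomposition[OF \<xi> u5 W] by simp
    then show "w \<in> {a *\<^sub>R E 0 \<xi> + b *\<^sub>R E (Suc 0) \<xi> + c *\<^sub>R h \<xi> + d *\<^sub>R euler_field \<xi> | a b c d. True}" by blast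
  next
    fix w assume "w \<in> {a *\<^sub>R E 0 \<xi> + b *\<^sub>R E (Suc 0) \<xi> + c *\<^sub>R h \<xi> + d *\<^sub>R euler_field \<xi> | a b c d. True}"
    then obtain a b c d where w: "w = a *\<^sub>R E 0 \<xi> + b *\<^sub>R E (Suc 0) \<xi> + c *\<^sub>R h \<xi> + d *\<^sub>R euler_field \<xi>" by blast
    have "w \<in> W_numerator \<Omega> D \<xi>" unfolding w
      by (intro subspace_add[OF subspace_W_numerator[OF \<xi>]] subspace_scale[OF subspace_W_numerator[OF \<xi>]]
          E_W_numerator[OF \<xi>] h_W_numerator[OF \<xi>] euler_W_numerator[OF \<xi>])
    then have "w \<in> tangent_space N \<xi>" by (simp add: W_numerator_eq)
    moreover have "\<forall>j\<in>{3, 4, 5}. coframe j (fst \<xi>) \<bullet> fst w = 0"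
      by (simp add: w F fst_h euler_field_def C inner_add_right inner_diff_right)
    ultimately show "w \<in> jacobi_space \<Omega> D \<xi>" unfolding jacobi_space_eq[OF \<xi>] by blast
  qed
qed

section \<open>Rational dependence on the covector\<close>

definition "rational f \<longleftrightarrow> (\<exists>g n. fpoly \<Omega> g \<and> (\<forall>\<xi>\<in>\<Omega> \<times> UNIV. lift_function X5 \<xi> \<noteq> 0 \<longrightarrow> f \<xi> = g \<xi> / lift_function X5 \<xi> ^ n))"

lemma fpoly_power_X5: "fpoly \<Omega> (\<lambda>\<xi>. lift_function X5 \<xi> ^ n)"
proof (induction n)
  case (Suc n)
  from fpoly_mult[OF fpoly_lift[OF open_\<Omega> smooth_X5] this] show ?case by simp
qed (simp add: fpoly_const open_\<Omega>)

lemma rational_fpoly: "fpoly \<Omega> g \<Longrightarrow> rational g"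
  unfolding rational_def by (rule exI[of _ g], rule exI[of _ 0]) simp

lemma rational_add:
  assumes "rational f" "rational g"
  shows "rational (\<lambda>\<xi>. f \<xi> + g \<xi>)"
proof -
  obtain f' n where f: "fpoly \<Omega> f'" "\<And>\<xi>. \<xi> \<in> \<Omega> \<times> UNIV \<Longrightarrow> lift_function X5 \<xi> \<noteq> 0 \<Longrightarrow> f \<xi> = f' \<xi> / lift_function X5 \<xi> ^ n"
    using assms(1) unfolding rational_def by blast
  obtain g' m where g: "fpoly \<Omega> g'" "\<And>\<xi>. \<xi> \<in> \<Omega> \<times> UNIV \<Longrightarrow> lift_function X5 \<xi> \<noteq> 0 \<Longrightarrow> g \<xi> = g' \<xi> / lift_function X5 \<xi> ^ m"
    using assms(2) unfolding rational_def by blast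
  show ?thesis unfolding rational_def
  proof (intro exI conjI ballI impI)
    show "fpoly \<Omega> (\<lambda>\<xi>. f' \<xi> * lift_function X5 \<xi> ^ m + g' \<xi> * lift_function X5 \<xi> ^ n)"
      by (intro fpoly_add fpoly_mult fpoly_power_X5 f g)
    show "f \<xi> + g \<xi> = (f' \<xi> * lift_function X5 \<xi> ^ m + g' \<xi> * lift_function X5 \<xi> ^ n) / lift_function X5 \<xi> ^ (n + m)"
      if "\<xi> \<in> \<Omega> \<times> UNIV" "lift_function X5 \<xi> \<noteq> 0" for \<xi>
      using that by (simp add: f(2) g(2) power_add add_divide_distrib)
  qed
qed

lemma rational_mult:
  assumes "rational f" "rational g"
  shows "rational (\<lambda>\<xi>. f \<xi> * g \<xi>)"
proof -
  obtain f' n where f: "fpoly \<Omega> f'" "\<And>\<xi>. \<xi> \<in> \<Omega> \<times> UNIV \<Longrightarrow> lift_function X5 \<xi> \<noteq> 0 \<Longrightarrow> f \<xi> = f' \<xi> / lift_function X5 \<xi> ^ n"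
    using assms(1) unfolding rational_def by blast
  obtain g' m where g: "fpoly \<Omega> g'" "\<And>\<xi>. \<xi> \<in> \<Omega> \<times> UNIV \<Longrightarrow> lift_function X5 \<xi> \<noteq> 0 \<Longrightarrow> g \<xi> = g' \<xi> / lift_function X5 \<xi> ^ m"
    using assms(2) unfolding rational_def by blast
  show ?thesis unfolding rational_def
  proof (intro exI conjI ballI impI)
    show "fpoly \<Omega> (\<lambda>\<xi>. f' \<xi> * g' \<xi>)" by (intro fpoly_mult f g)
    show "f \<xi> * g \<xi> = (f' \<xi> * g' \<xi>) / lift_function X5 \<xi> ^ (n + m)"
      if "\<xi> \<in> \<Omega> \<times> UNIV" "lift_function X5 \<xi> \<noteq> 0" for \<xi>
      using that by (simp add: f(2) g(2) power_add)
  qed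
qed

lemma rational_minus: "rational f \<Longrightarrow> rational (\<lambda>\<xi>. - f \<xi>)"
  using rational_mult[OF rational_fpoly[OF fpoly_const[OF open_\<Omega>, of "-1"]], of f] by simp

lemma rational_diff: "rational f \<Longrightarrow> rational g \<Longrightarrow> rational (\<lambda>\<xi>. f \<xi> - g \<xi>)"
  using rational_add[OF _ rational_minus, of f g] by simp

lemma rational_divide:
  assumes "rational f"
  shows "rational (\<lambda>\<xi>. f \<xi> / lift_function X5 \<xi>)"
proof -
  have "rational (\<lambda>\<xi>. 1 / lift_function X5 \<xi>)"
    unfolding rational_def by (rule exI[of _ "\<lambda>\<xi>. 1"], rule exI[of _ 1]) (simp add: fpoly_const open_\<Omega>)
  from rational_mult[OF assms this] show ?thesis by simp
qed

text \<open>Retraces the elimination: every coefficient arises from earlier ones by sums, products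
  and division by \<open>u_5\<close>.\<close>

lemma rational_coefficients:
  assumes F: "vpoly \<Omega> F"
  shows "rational (\<lambda>\<xi>. k0 \<xi> (F \<xi>))" "rational (\<lambda>\<xi>. k1 \<xi> (F \<xi>))" "rational (\<lambda>\<xi>. k2 \<xi> (F \<xi>))" "rational (\<lambda>\<xi>. k3 \<xi> (F \<xi>))"
proof -
  have c: "rational (\<lambda>\<xi>. coframe j (fst \<xi>) \<bullet> fst (G \<xi>))" if "vpoly \<Omega> G" for G j
    by (intro rational_fpoly fpoly_inner open_\<Omega> vpoly_base smooth_coframe vpoly_fst that)
  have u: "rational (lift_function X4)" "rational (lift_function X5)"
    by (intro rational_fpoly fpoly_lift open_\<Omega> smooth_X4 smooth_X5)+
  have dl: "rational (\<lambda>\<xi>. dlift X \<xi> (G \<xi>))" if "smooth_on \<Omega> X" "vpoly \<Omega> G" for G X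
    by (intro rational_fpoly fpoly_directional open_\<Omega> fpoly_lift that)
  show 3: "rational (\<lambda>\<xi>. k3 \<xi> (F \<xi>))"
    using rational_divide[OF rational_divide[OF rational_minus[OF c[OF F, of 4]]]]
    by (simp add: k3_def power2_eq_square)
  show 2: "rational (\<lambda>\<xi>. k2 \<xi> (F \<xi>))"
    unfolding k2_def by (intro rational_divide rational_diff rational_mult c F vpoly_E 3)
  have r1: "rational (\<lambda>\<xi>. coframe j (fst \<xi>) \<bullet> fst (r1 \<xi> (F \<xi>)))" for j
  proof -
    have "rational (\<lambda>\<xi>. coframe j (fst \<xi>) \<bullet> fst (F \<xi>) - k3 \<xi> (F \<xi>) * (coframe j (fst \<xi>) \<bullet> fst (E 3 \<xi>))
        - k2 \<xi> (F \<xi>) * (coframe j (fst \<xi>) \<bullet> fst (E 2 \<xi>)))"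
      by (intro rational_diff rational_mult c F vpoly_E 2 3)
    then show ?thesis by (simp add: r1_def inner_diff_right)
  qed
  have kh: "rational (\<lambda>\<xi>. kh \<xi> (F \<xi>))"
    unfolding kh_def by (intro rational_divide rational_minus r1)
  show 1: "rational (\<lambda>\<xi>. k1 \<xi> (F \<xi>))"
    unfolding k1_def by (intro rational_diff rational_mult kh u r1)
  have r2: "rational (\<lambda>\<xi>. dlift X \<xi> (r2 \<xi> (F \<xi>)))" if X: "smooth_on \<Omega> X" for X
  proof -
    have "rational (\<lambda>\<xi>. dlift X \<xi> (F \<xi>) - k3 \<xi> (F \<xi>) * dlift X \<xi> (E 3 \<xi>) - k2 \<xi> (F \<xi>) * dlift X \<xi> (E 2 \<xi>)
       - kh \<xi> (F \<xi>) * dlift X \<xi> (h \<xi>) - k1 \<xi> (F \<xi>) * dlift X \<xi> (E (Suc 0) \<xi>))"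
      by (intro rational_diff rational_mult dl X F vpoly_E vpoly_h 1 2 3 kh)
    moreover have "dlift X \<xi> (F \<xi>) - k3 \<xi> (F \<xi>) * dlift X \<xi> (E 3 \<xi>) - k2 \<xi> (F \<xi>) * dlift X \<xi> (E 2 \<xi>)
       - kh \<xi> (F \<xi>) * dlift X \<xi> (h \<xi>) - k1 \<xi> (F \<xi>) * dlift X \<xi> (E (Suc 0) \<xi>) = dlift X \<xi> (r2 \<xi> (F \<xi>))"
      if "\<xi> \<in> \<Omega> \<times> UNIV" for \<xi>
    proof -
      have l: "linear (dlift X \<xi>)" using dlift_linear[OF X] that by (auto simp: mem_Times_iff)
      show ?thesis by (simp add: r2_def r1_def linear_diff[OF l] linear_cmul[OF l])
    qed
    ultimately show ?thesis unfolding rational_def by metis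
  qed
  show "rational (\<lambda>\<xi>. k0 \<xi> (F \<xi>))"
    unfolding k0_def ke_def by (intro rational_diff rational_mult rational_divide r2 u smooth_X4 smooth_X5)
qed

text \<open>Provides the local bounds on coefficients that the Gronwall argument for transported
  fields requires.\<close>

lemma rational_isCont:
  assumes "rational f" "fst \<xi> \<in> \<Omega>" "lift_function X5 \<xi> \<noteq> 0"
  shows "isCont f \<xi>"
proof -
  obtain g n where g: "fpoly \<Omega> g" "\<And>\<eta>. \<eta> \<in> \<Omega> \<times> UNIV \<Longrightarrow> lift_function X5 \<eta> \<noteq> 0 \<Longrightarrow> f \<eta> = g \<eta> / lift_function X5 \<eta> ^ n"
    using assms(1) unfolding rational_def by blast
  have S: "\<xi> \<in> \<Omega> \<times> UNIV" using assms(2) by (simp add: mem_Times_iff)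
  have c: "isCont g \<xi>" "isCont (lift_function X5) \<xi>"
    using has_derivative_continuous[OF fpoly_derivative(1)[OF open_\<Omega> g(1) S]]
      has_derivative_continuous[OF lift_has_dlift[OF smooth_X5 assms(2)]] by blast+
  have "isCont (\<lambda>\<eta>. g \<eta> / lift_function X5 \<eta> ^ n) \<xi>" using c assms(3) by (intro continuous_intros) auto
  moreover have e: "\<forall>\<^sub>F \<eta> in nhds \<xi>. g \<eta> / lift_function X5 \<eta> ^ n = f \<eta>"
    using eventually_nhds_in_open[OF open_times_UNIV[OF open_\<Omega>] S] isCont_eventually_nonzero[OF c(2) assms(3)]
    by eventually_elim (simp add: g(2))
  ultimately show ?thesis using isCont_cong[OF e] by simp
qed

text \<open>On an affine line where \<open>u_5 = 1\<close> the denominators are 1, which turns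
  rational dependence into polynomial dependence.\<close>

lemma rational_poly_fun:
  assumes "rational f" "x \<in> \<Omega>" "\<And>z. (p + z *\<^sub>R r) \<bullet> X5 x = 1"
  shows "poly_fun (\<lambda>z. f (x, p + z *\<^sub>R r))"
proof -
  obtain g n where g: "fpoly \<Omega> g" "\<And>\<eta>. \<eta> \<in> \<Omega> \<times> UNIV \<Longrightarrow> lift_function X5 \<eta> \<noteq> 0 \<Longrightarrow> f \<eta> = g \<eta> / lift_function X5 \<eta> ^ n"
    using assms(1) unfolding rational_def by blast
  have "f (x, p + z *\<^sub>R r) = g (x, p + z *\<^sub>R r)" for z
    using g(2)[of "(x, p + z *\<^sub>R r)"] assms(2,3) by (simp add: lift_function_def)
  then show ?thesis using fpoly_restrict_line[OF g(1) assms(2), of p r] by simp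
qed

end

section \<open>The reduced Jacobi curve\<close>

lemma flow_cong:
  assumes "\<And>x. x \<in> V \<Longrightarrow> X x = Y x"
  shows "flow V X = flow V Y"
proof -
  have "(\<gamma> s \<in> V \<and> (\<gamma> has_vector_derivative X (\<gamma> s)) F) = (\<gamma> s \<in> V \<and> (\<gamma> has_vector_derivative Y (\<gamma> s)) F)"
    for \<gamma> :: "real \<Rightarrow> 'a" and s F
    using assms by metis
  then show ?thesis unfolding flow_def[abs_def] by simp
qed

lemma zero_derivative_constant:
  fixes f :: "real \<Rightarrow> 'b::real_normed_vector"
  assumes "\<And>t. \<bar>t\<bar> < T \<Longrightarrow> (f has_vector_derivative 0) (at t)" "\<bar>t\<bar> < T"
  shows "f t = f 0"
proof -
  have "norm (f t - f 0) \<le> 0 * \<bar>t - 0\<bar>"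
    by (rule vector_derivative_bound[where S="{-T<..<T}" and g'="\<lambda>_. 0"])
       (use assms in \<open>auto intro: has_vector_derivative_at_within\<close>)
  then show ?thesis by simp
qed

lemma abs_sum4_le:
  fixes a b c d :: real
  shows "\<bar>a\<bar> \<le> x \<Longrightarrow> \<bar>b\<bar> \<le> y \<Longrightarrow> \<bar>c\<bar> \<le> z \<Longrightarrow> \<bar>d\<bar> \<le> w \<Longrightarrow> \<bar>a + b + c + d\<bar> \<le> x + y + z + w"
  by linarith

context cartan_frame
begin

lemma lift_dilate: "lift_function X (dilate s \<xi>) = s * lift_function X \<xi>"
  by (simp add: lift_function_def dilate_def)

lemma h_dilate: "h (dilate s \<xi>) = s *\<^sub>R dilate s (h \<xi>)"
proof -
  have "ham_lift X (dilate s \<xi>) = dilate s (ham_lift X \<xi>)" for X :: "real^5 \<Rightarrow> real^5"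
    by (simp add: ham_lift_def dilate_def scaleR_sum_right)
  then show ?thesis
    by (simp add: h_def lift_dilate linear_diff[OF linear_dilate] linear_cmul[OF linear_dilate] scaleR_diff_right)
qed

text \<open>\<open>E 0\<close> is constant along the fibre, hence of degree -1 as a vertical field,
  and each bracket with \<open>h\<close> raises the degree by 1; \<open>s ^ k / s\<close> expresses
  the exponent \<open>k - 1\<close> also for \<open>k = 0\<close>.\<close>

lemma E_dilate:
  assumes "s \<noteq> 0" "\<xi> \<in> \<Omega> \<times> UNIV"
  shows "E k (dilate s \<xi>) = (s ^ k / s) *\<^sub>R dilate s (E k \<xi>)"
  using assms(2)
proof (induction k arbitrary: \<xi>)
  case 0
  then show ?case using assms(1) by (simp add: E.simps dilate_def)
next
  case (Suc k)
  show ?case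
    unfolding E.simps(2)
    using lie_bracket_homogeneous[of \<Omega> h s s "E k" "s ^ k / s", OF h_dilate Suc.IH open_\<Omega> vpoly_h vpoly_E Suc.prems]
    by simp
qed

text \<open>Euler's identity: the relation \<open>h_dilate\<close> differentiated at
  \<open>s = 1\<close>. It makes the flow of \<open>h\<close> preserve the span of \<open>h\<close>
  and the Euler field, by which the reduced space is divided.\<close>

lemma lie_bracket_h_euler:
  assumes "\<xi> \<in> \<Omega> \<times> UNIV"
  shows "lie_bracket h euler_field \<xi> = - h \<xi>"
proof -
  have "(euler_field has_derivative (\<lambda>w. (0, snd w))) (at \<xi>)"
    unfolding euler_field_def[abs_def] by (auto intro!: derivative_eq_intros)
  then have e: "frechet_derivative euler_field (at \<xi>) w = (0, snd w)" for w
    using frechet_derivative_at by metis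
  have "((\<lambda>s. dilate s \<xi>) has_derivative (\<lambda>r. (0, r *\<^sub>R snd \<xi>))) (at 1)"
    unfolding dilate_def by (auto intro!: derivative_eq_intros)
  moreover have "(h has_derivative frechet_derivative h (at \<xi>)) (at (dilate 1 \<xi>))"
    using vpoly_has_derivative[OF open_\<Omega> vpoly_h assms] by (simp add: dilate_def)
  ultimately have "((\<lambda>s. h (dilate s \<xi>)) has_derivative (\<lambda>r. frechet_derivative h (at \<xi>) (0, r *\<^sub>R snd \<xi>))) (at 1)"
    by (rule has_derivative_compose)
  moreover have "((\<lambda>s. h (dilate s \<xi>)) has_derivative (\<lambda>r. (r *\<^sub>R fst (h \<xi>), (2 * r) *\<^sub>R snd (h \<xi>)))) (at 1)"
    unfolding h_dilate unfolding dilate_def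
    by (auto intro!: derivative_eq_intros simp: algebra_simps)
  ultimately have "(\<lambda>r. frechet_derivative h (at \<xi>) (0, r *\<^sub>R snd \<xi>)) = (\<lambda>r. (r *\<^sub>R fst (h \<xi>), (2 * r) *\<^sub>R snd (h \<xi>)))"
    by (rule has_derivative_unique)
  from fun_cong[OF this, of 1] have "frechet_derivative h (at \<xi>) (0, snd \<xi>) = (fst (h \<xi>), 2 *\<^sub>R snd (h \<xi>))" by simp
  then show ?thesis by (simp add: lie_bracket_def e euler_field_def prod_eq_iff scaleR_2)
qed

lemma euler_differentiable: "euler_field differentiable (at \<xi>)"
proof -
  have "(euler_field has_derivative (\<lambda>w. (0, snd w))) (at \<xi>)"
    unfolding euler_field_def[abs_def] by (auto intro!: derivative_eq_intros)
  then show ?thesis by (rule differentiableI)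
qed

lemma jacobi_curve_h:
  "jacobi_curve \<Omega> D X1 X2 \<xi> t =
     frechet_derivative (flow (\<Omega> \<times> UNIV) h (- t)) (at (flow (\<Omega> \<times> UNIV) h t \<xi>)) ` jacobi_space \<Omega> D (flow (\<Omega> \<times> UNIV) h t \<xi>)"
proof -
  have "flow (\<Omega> \<times> UNIV) (h_field X1 X2) = flow (\<Omega> \<times> UNIV) h"
    by (rule flow_cong) (auto simp: h_field_eq)
  then show ?thesis by (simp add: jacobi_curve_def Let_def)
qed

text \<open>The function \<open>u_3\<close> is constant along \<open>h\<close> everywhere; once it
  is zero, the derivatives of \<open>u_1\<close> and \<open>u_2\<close>, being multiples of
  \<open>u_3\<close>, vanish too.\<close>

lemma solution_in_N:
  assumes g: "\<gamma> 0 \<in> N" "\<And>t. \<bar>t\<bar> < T \<Longrightarrow> \<gamma> t \<in> \<Omega> \<times> UNIV"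
    "\<And>t. \<bar>t\<bar> < T \<Longrightarrow> (\<gamma> has_vector_derivative h (\<gamma> t)) (at t)" and t: "\<bar>t\<bar> < T"
  shows "\<gamma> t \<in> N"
proof -
  have x: "fst (\<gamma> t) \<in> \<Omega>" if "\<bar>t\<bar> < T" for t using g(2)[OF that] by (simp add: mem_Times_iff)
  have d: "((\<lambda>t. lift_function X (\<gamma> t)) has_vector_derivative dlift X (\<gamma> t) (h (\<gamma> t))) (at t)"
    if "\<bar>t\<bar> < T" "smooth_on \<Omega> X" for X t
    using vector_derivative_diff_chain_within[OF g(3)[OF that(1)] has_derivative_at_withinI[OF lift_has_dlift[OF that(2) x[OF that(1)]]]]
    by (simp add: o_def)
  have 3: "lift_function X3 (\<gamma> t) = 0" if "\<bar>t\<bar> < T" for t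
    using zero_derivative_constant[of T "\<lambda>t. lift_function X3 (\<gamma> t)" t] d[OF _ smooth_X3] that g(1)
    by (simp add: dlift_X_h x N_iff)
  have "lift_function X1 (\<gamma> t) = 0" "lift_function X2 (\<gamma> t) = 0"
    using zero_derivative_constant[of T "\<lambda>t. lift_function X1 (\<gamma> t)" t] d[OF _ smooth_X1]
      zero_derivative_constant[of T "\<lambda>t. lift_function X2 (\<gamma> t)" t] d[OF _ smooth_X2] t g(1)
    by (simp_all add: dlift_X_h x 3 N_iff)
  then show ?thesis using 3 x t by (simp add: N_iff)
qed

lemma coords_kernel:
  assumes "\<xi> \<in> N" "quotient_coordinates (W_numerator \<Omega> D \<xi>) (W_denominator X1 X2 \<xi>) L"
  shows "L (h \<xi>) = 0" "L (euler_field \<xi>) = 0"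
proof -
  have "h \<xi> \<in> W_denominator X1 X2 \<xi>" "euler_field \<xi> \<in> W_denominator X1 X2 \<xi>"
    unfolding W_denominator_eq[OF assms(1)] by (auto intro: span_base)
  then show "L (h \<xi>) = 0" "L (euler_field \<xi>) = 0" using assms(2) unfolding quotient_coordinates_def by blast+
qed

text \<open>Coordinates on the same quotient differ by an isomorphism, but as maps on the ambient
  space they are related only inside the numerator. For this reason the reduced curve must be shown
  to stay there.\<close>

lemma coordinate_change:
  assumes \<xi>: "\<xi> \<in> N" and u5: "lift_function X5 \<xi> \<noteq> 0"
    and L: "quotient_coordinates (W_numerator \<Omega> D \<xi>) (W_denominator X1 X2 \<xi>) L"
  obtains M where "linear M" "surj M" "\<And>w. w \<in> W_numerator \<Omega> D \<xi> \<Longrightarrow> L w = M (coords \<xi> w)"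
proof -
  define M where "M u = L (vec4 u $ 1 *\<^sub>R E 0 \<xi> + vec4 u $ 2 *\<^sub>R E (Suc 0) \<xi> + vec4 u $ 3 *\<^sub>R E 2 \<xi> + vec4 u $ 4 *\<^sub>R E 3 \<xi>)" for u
  have lin: "linear L" using L by (simp add: quotient_coordinates_def)
  have "linear M"
    unfolding M_def
    by (rule linearI) (simp_all add: linear_add[OF linear_vec4] linear_cmul[OF linear_vec4] linear_add[OF lin] linear_cmul[OF lin]
        algebra_simps del: vec4_nth)
  moreover have eq: "L w = M (coords \<xi> w)" if "w \<in> W_numerator \<Omega> D \<xi>" for w
  proof -
    have "L w = L (k0 \<xi> w *\<^sub>R E 0 \<xi> + k1 \<xi> w *\<^sub>R E (Suc 0) \<xi> + k2 \<xi> w *\<^sub>R E 2 \<xi> + k3 \<xi> w *\<^sub>R E 3 \<xi>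
        + kh \<xi> w *\<^sub>R h \<xi> + ke \<xi> w *\<^sub>R euler_field \<xi>)"
      using decomposition[OF \<xi> u5 that] by simp
    also have "\<dots> = M (coords \<xi> w)"
      unfolding M_def vec4_coords using coords_kernel[OF \<xi> L] by (simp add: linear_add[OF lin] linear_cmul[OF lin])
    finally show ?thesis .
  qed
  moreover have "surj M"
  proof -
    have "y \<in> range M" for y
    proof -
      have "y \<in> L ` W_numerator \<Omega> D \<xi>" using L by (simp add: quotient_coordinates_def)
      then show ?thesis using eq by auto
    qed
    then show ?thesis by blast
  qed
  ultimately show ?thesis using that by blast
qed

text \<open>The fields transported to \<open>\<xi>\<close> satisfy a linear differential equation of order 4, so they stay
  in the reduced space by Gronwall's inequality.\<close>

lemma transported_in_W_numerator:
  fixes y :: "nat \<Rightarrow> real \<Rightarrow> (real^5) \<times> (real^5)"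
  assumes \<xi>: "\<xi> \<in> N" and T: "T > 0"
    and y: "\<And>k t. \<bar>t\<bar> < T \<Longrightarrow> (y k has_vector_derivative y (Suc k) t) (at t)"
    and y0: "\<And>k. y k 0 \<in> W_numerator \<Omega> D \<xi>"
    and y4: "\<And>t. \<bar>t\<bar> < T \<Longrightarrow> y 4 t - (c0 t *\<^sub>R y 0 t + c1 t *\<^sub>R y 1 t + c2 t *\<^sub>R y 2 t + c3 t *\<^sub>R y 3 t) \<in> W_numerator \<Omega> D \<xi>"
    and C: "\<And>t. \<bar>t\<bar> < T \<Longrightarrow> \<bar>c0 t\<bar> \<le> C \<and> \<bar>c1 t\<bar> \<le> C \<and> \<bar>c2 t\<bar> \<le> C \<and> \<bar>c3 t\<bar> \<le> C"
    and t: "\<bar>t\<bar> < T"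
  shows "y 0 t \<in> W_numerator \<Omega> D \<xi>" "y 1 t \<in> W_numerator \<Omega> D \<xi>"
proof -
  let ?W = "W_numerator \<Omega> D \<xi>"
  \<comment> \<open>Functionals vanishing on the numerator turn the relation for \<open>y 4\<close>
    into a scalar equation of order four with zero initial data.\<close>
  have key: "l \<bullet> y 0 t = 0 \<and> l \<bullet> y 1 t = 0" if l: "\<And>w. w \<in> ?W \<Longrightarrow> l \<bullet> w = 0" for l
  proof -
    define f where "f k s = l \<bullet> y k s" for k s
    define d where "d s = (f 0 s)\<^sup>2 + (f 1 s)\<^sup>2 + (f 2 s)\<^sup>2 + (f 3 s)\<^sup>2" for s
    have f: "(f k has_real_derivative f (Suc k) s) (at s)" if "\<bar>s\<bar> < T" for k s
      unfolding f_def[abs_def] has_real_derivative_iff_has_vector_derivative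
      using bounded_linear.has_vector_derivative[OF bounded_linear_inner_right y[OF that], of l k] .
    have f4: "f 4 s = c0 s * f 0 s + c1 s * f 1 s + c2 s * f 2 s + c3 s * f 3 s" if "\<bar>s\<bar> < T" for s
      using l[OF y4[OF that]] unfolding f_def inner_diff_right inner_add_right inner_scaleR_right
      by (rule eq_iff_diff_eq_0[THEN iffD2])
    have C0: "C \<ge> 0" using C[OF t] by linarith
    \<comment> \<open>The derivative of \<open>d\<close> is twice the sum of three products and a
      term that expands into four products with coefficients at most \<open>C\<close>; each product
      is at most \<open>d\<close>, so the rate is \<open>2 (3 + 4 C)\<close>.\<close>
    have "d t \<le> d 0 * exp ((6 + 8 * C) * \<bar>t - 0\<bar>)"
    proof (rule Gronwall[where S="{-T<..<T}"])
      fix s assume "s \<in> {-T<..<T}"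
      then have s: "\<bar>s\<bar> < T" by auto
      have "(d has_real_derivative 2 * (f 0 s * f 1 s + f 1 s * f 2 s + f 2 s * f 3 s + f 3 s * f 4 s)) (at s)"
        unfolding d_def
        by (rule derivative_eq_intros f[OF s] refl)+ (simp add: numeral_eq_Suc algebra_simps)
      then show "(d has_vector_derivative 2 * (f 0 s * f 1 s + f 1 s * f 2 s + f 2 s * f 3 s + f 3 s * f 4 s)) (at s within {-T<..<T})"
        by (auto simp: has_real_derivative_iff_has_vector_derivative intro: has_vector_derivative_at_within)
      have sq: "\<bar>a * b\<bar> \<le> d s" if "a\<^sup>2 + b\<^sup>2 \<le> 2 * d s" for a b :: real
      proof -
        have "0 \<le> (\<bar>a\<bar> - \<bar>b\<bar>)\<^sup>2" by simp
        then have "2 * \<bar>a * b\<bar> \<le> a\<^sup>2 + b\<^sup>2" by (simp add: power2_diff abs_mult)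
        then show ?thesis using that by linarith
      qed
      have nn: "(f k s)\<^sup>2 \<ge> 0" for k by simp
      have p: "\<bar>f 0 s * f 1 s\<bar> \<le> d s" "\<bar>f 1 s * f 2 s\<bar> \<le> d s" "\<bar>f 2 s * f 3 s\<bar> \<le> d s"
        "\<bar>f 3 s * f 0 s\<bar> \<le> d s" "\<bar>f 3 s * f 1 s\<bar> \<le> d s" "\<bar>f 3 s * f 2 s\<bar> \<le> d s" "\<bar>f 3 s * f 3 s\<bar> \<le> d s"
        using nn[of 0] nn[of 1] nn[of 2] nn[of 3] by (intro sq; simp add: d_def)+
      have cp: "\<bar>c * x\<bar> \<le> C * d s" if "\<bar>c\<bar> \<le> C" "\<bar>x\<bar> \<le> d s" for c x
        unfolding abs_mult using that C0 by (intro mult_mono) auto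
      have "f 3 s * f 4 s = c0 s * (f 3 s * f 0 s) + c1 s * (f 3 s * f 1 s) + c2 s * (f 3 s * f 2 s) + c3 s * (f 3 s * f 3 s)"
        unfolding f4[OF s] by (simp add: algebra_simps)
      then have "\<bar>f 3 s * f 4 s\<bar> \<le> C * d s + C * d s + C * d s + C * d s"
        using C[OF s] p by (simp only:) (intro abs_sum4_le cp; blast)
      with p(1-3) have "\<bar>f 0 s * f 1 s + f 1 s * f 2 s + f 2 s * f 3 s + f 3 s * f 4 s\<bar>
          \<le> d s + d s + d s + (C * d s + C * d s + C * d s + C * d s)"
        by (rule abs_sum4_le)
      then have "2 * \<bar>f 0 s * f 1 s + f 1 s * f 2 s + f 2 s * f 3 s + f 3 s * f 4 s\<bar> \<le> 2 * (d s + d s + d s + (C * d s + C * d s + C * d s + C * d s))"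
        by (rule mult_left_mono) simp
      also have "\<dots> = (6 + 8 * C) * d s" by (simp add: algebra_simps)
      finally show "\<bar>2 * (f 0 s * f 1 s + f 1 s * f 2 s + f 2 s * f 3 s + f 3 s * f 4 s)\<bar> \<le> (6 + 8 * C) * d s"
        unfolding abs_mult abs_numeral .
    qed (use t T in auto)
    moreover have "d 0 = 0" using l[OF y0] by (simp add: d_def f_def)
    ultimately have "d t \<le> 0" by simp
    then have "(f 0 t)\<^sup>2 = 0 \<and> (f 1 t)\<^sup>2 = 0" unfolding d_def
      using zero_le_power2[of "f 0 t"] zero_le_power2[of "f 1 t"] zero_le_power2[of "f 2 t"] zero_le_power2[of "f 3 t"] by linarith
    then show ?thesis by (simp add: f_def)
  qed
  have "y k t \<in> orthogonal_comp (orthogonal_comp ?W)" if "k = 0 \<or> k = 1" for k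
    unfolding orthogonal_comp_def orthogonal_def
  proof (intro CollectI ballI)
    fix l assume "l \<in> {x. \<forall>w\<in>?W. w \<bullet> x = 0}"
    then have "l \<bullet> w = 0" if "w \<in> ?W" for w by (subst inner_commute) (use that in blast)
    from key[OF this] that show "l \<bullet> y k t = 0" by blast
  qed
  then show "y 0 t \<in> ?W" "y 1 t \<in> ?W"
    using orthogonal_comp_self[OF subspace_W_numerator[OF \<xi>]] by auto
qed

text \<open>\<open>y k\<close> is \<open>E k\<close> pulled back along the flow, so its derivative
  is \<open>y (Suc k)\<close> and its value at time 0 is a bracket at \<open>\<xi>\<close>. The
  pullback fixes \<open>h\<close> and moves the Euler field by a multiple of \<open>h\<close>. Hence
  the Jacobi spaces, spanned by \<open>E 0\<close>, \<open>E 1\<close>, \<open>h\<close> and the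
  Euler field, project to the planes of \<open>v 0\<close> and \<open>v 1\<close>.\<close>

lemma reduced_curve:
  assumes \<xi>: "\<xi> \<in> N" and u5: "lift_function X5 \<xi> \<noteq> 0"
  obtains v e where "tower v" "\<And>k. v k 0 = coords \<xi> (E k \<xi>)" "e > 0"
    "\<And>t. \<bar>t\<bar> < e \<Longrightarrow> jacobi_curve \<Omega> D X1 X2 \<xi> t \<subseteq> W_numerator \<Omega> D \<xi>"
    "\<And>t. \<bar>t\<bar> < e \<Longrightarrow> coords \<xi> ` jacobi_curve \<Omega> D X1 X2 \<xi> t = span {v 0 t, v 1 t}"
proof -
  let ?V = "\<Omega> \<times> (UNIV :: (real^5) set)"
  let ?W = "W_numerator \<Omega> D \<xi>"
  have x: "fst \<xi> \<in> \<Omega>" and S: "\<xi> \<in> ?V" using \<xi> by (auto simp: N_iff mem_Times_iff)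
  have oV: "open ?V" by (rule open_times_UNIV[OF open_\<Omega>])
  have "Ck_on 2 ?V h" using vpoly_smooth_on[OF open_\<Omega> vpoly_h] by (simp add: smooth_on_def)
  from flow_and_derivative[OF oV this S] obtain T \<gamma> A where T: "T > 0" and \<gamma>0: "\<gamma> 0 = \<xi>" and A0: "A 0 = id_blinfun"
    and \<gamma>V: "\<And>t. \<bar>t\<bar> < T \<Longrightarrow> \<gamma> t \<in> ?V"
    and \<gamma>': "\<And>t. \<bar>t\<bar> < T \<Longrightarrow> (\<gamma> has_vector_derivative h (\<gamma> t)) (at t)"
    and A': "\<And>t. \<bar>t\<bar> < T \<Longrightarrow> (A has_vector_derivative - (A t o\<^sub>L Blinfun (frechet_derivative h (at (\<gamma> t))))) (at t)"
    and fl: "\<And>t. \<bar>t\<bar> < T \<Longrightarrow> flow ?V h t \<xi> = \<gamma> t"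
    and fA: "\<And>t. \<bar>t\<bar> < T \<Longrightarrow> frechet_derivative (flow ?V h (- t)) (at (\<gamma> t)) = blinfun_apply (A t)"
    by blast
  have \<gamma>N: "\<gamma> t \<in> N" if "\<bar>t\<bar> < T" for t
    by (rule solution_in_N[OF _ \<gamma>V \<gamma>' that]) (simp_all add: \<gamma>0 \<xi>)
  have pull: "((\<lambda>t. blinfun_apply (A t) (Y (\<gamma> t))) has_vector_derivative blinfun_apply (A t) (lie_bracket h Y (\<gamma> t))) (at t)"
    if "\<bar>t\<bar> < T" "Y differentiable (at (\<gamma> t))" for t Y
    by (rule pullback_has_derivative_lie_bracket[OF \<gamma>'[OF that(1)] A'[OF that(1)] _ that(2)])
       (rule differentiableI[OF vpoly_has_derivative[OF open_\<Omega> vpoly_h \<gamma>V[OF that(1)]]])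
  define y where "y k t = blinfun_apply (A t) (E k (\<gamma> t))" for k t
  have y': "(y k has_vector_derivative y (Suc k) t) (at t)" if "\<bar>t\<bar> < T" for k t
    unfolding y_def E.simps(2)
    by (rule pull[OF that]) (rule differentiableI[OF vpoly_has_derivative[OF open_\<Omega> vpoly_E \<gamma>V[OF that]]])
  have y0: "y k 0 = E k \<xi>" for k by (simp add: y_def A0 \<gamma>0)
  have Ah: "blinfun_apply (A t) (h (\<gamma> t)) = h \<xi>" if "\<bar>t\<bar> < T" for t
  proof -
    have "((\<lambda>t. blinfun_apply (A t) (h (\<gamma> t))) has_vector_derivative 0) (at s)" if "\<bar>s\<bar> < T" for s
      using pull[OF that differentiableI[OF vpoly_has_derivative[OF open_\<Omega> vpoly_h \<gamma>V[OF that]]]]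
      by (simp add: lie_bracket_self blinfun.zero_right)
    from zero_derivative_constant[OF this that] show ?thesis by (simp add: A0 \<gamma>0)
  qed
  \<comment> \<open>As the bracket of \<open>h\<close> with the Euler field is \<open>- h\<close>,
    the pulled back Euler field is affine in time with slope \<open>- h\<close>.\<close>
  have Ae: "blinfun_apply (A t) (euler_field (\<gamma> t)) = euler_field \<xi> - t *\<^sub>R h \<xi>" if "\<bar>t\<bar> < T" for t
  proof -
    have "((\<lambda>t. blinfun_apply (A t) (euler_field (\<gamma> t)) + t *\<^sub>R h \<xi>) has_vector_derivative 0) (at s)" if s: "\<bar>s\<bar> < T" for s
    proof -
      have "((\<lambda>t. blinfun_apply (A t) (euler_field (\<gamma> t))) has_vector_derivative - h \<xi>) (at s)"
        using pull[OF s euler_differentiable] by (simp add: lie_bracket_h_euler[OF \<gamma>V[OF s]] blinfun.minus_right Ah[OF s])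
      moreover have "((\<lambda>t. t *\<^sub>R h \<xi>) has_vector_derivative h \<xi>) (at s)"
        using bounded_linear.has_vector_derivative[OF bounded_linear_scaleR_left has_vector_derivative_id] by simp
      ultimately show ?thesis using has_vector_derivative_add by fastforce
    qed
    from zero_derivative_constant[OF this that]
    have "blinfun_apply (A t) (euler_field (\<gamma> t)) + t *\<^sub>R h \<xi> = euler_field \<xi>" by (simp add: A0 \<gamma>0)
    then show ?thesis by (simp add: algebra_simps)
  qed
  have hW: "h \<xi> \<in> ?W" and eW: "euler_field \<xi> \<in> ?W" by (rule h_W_numerator[OF \<xi>], rule euler_W_numerator[OF \<xi>])
  note W = subspace_W_numerator[OF \<xi>]
  \<comment> \<open>The coefficients of \<open>E 4\<close> along the orbit are those of the fourth
    order equation for the transported fields; continuity at time 0 bounds them.\<close>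
  define c where "c j t = vec4 (coords (\<gamma> t) (E 4 (\<gamma> t))) $ j" for j t
  have cont\<gamma>: "isCont \<gamma> 0" using \<gamma>'[of 0] T has_vector_derivative_continuous by force
  have "isCont (\<lambda>t. c j t) 0" for j
  proof -
    have "\<forall>j. isCont (\<lambda>\<eta>. vec4 (coords \<eta> (E 4 \<eta>)) $ j) \<xi>"
      unfolding forall_4 vec4_coords using rational_coefficients[OF vpoly_E] rational_isCont[OF _ x u5] by blast
    then have "isCont (\<lambda>\<eta>. vec4 (coords \<eta> (E 4 \<eta>)) $ j) (\<gamma> 0)" using \<gamma>0 by simp
    from isCont_o2[OF cont\<gamma> this] show ?thesis by (simp add: c_def)
  qed
  then have "\<forall>\<^sub>F t in nhds 0. \<bar>c j t\<bar> < \<bar>c j 0\<bar> + 1" for j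
    by (intro order_tendstoD(2)[where y="\<bar>c j 0\<bar>"] tendsto_rabs) (simp_all add: isCont_def tendsto_at_iff_tendsto_nhds)
  moreover have "\<forall>\<^sub>F t in nhds 0. lift_function X5 (\<gamma> t) \<noteq> 0"
  proof (rule isCont_eventually_nonzero)
    have "isCont (lift_function X5) (\<gamma> 0)"
      using has_derivative_continuous[OF lift_has_dlift[OF smooth_X5 x]] \<gamma>0 by simp
    from isCont_o2[OF cont\<gamma> this] show "isCont (\<lambda>t. lift_function X5 (\<gamma> t)) 0" .
  qed (simp add: \<gamma>0 u5)
  ultimately have "\<forall>\<^sub>F t in nhds 0. lift_function X5 (\<gamma> t) \<noteq> 0 \<and> \<bar>c 1 t\<bar> < \<bar>c 1 0\<bar> + 1 \<and> \<bar>c 2 t\<bar> < \<bar>c 2 0\<bar> + 1 \<and>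
      \<bar>c 3 t\<bar> < \<bar>c 3 0\<bar> + 1 \<and> \<bar>c 4 t\<bar> < \<bar>c 4 0\<bar> + 1"
    by (intro eventually_conj)
  then obtain e1 where e1: "e1 > 0" "\<And>t. \<bar>t\<bar> < e1 \<Longrightarrow> lift_function X5 (\<gamma> t) \<noteq> 0 \<and> \<bar>c 1 t\<bar> < \<bar>c 1 0\<bar> + 1 \<and> \<bar>c 2 t\<bar> < \<bar>c 2 0\<bar> + 1 \<and>
      \<bar>c 3 t\<bar> < \<bar>c 3 0\<bar> + 1 \<and> \<bar>c 4 t\<bar> < \<bar>c 4 0\<bar> + 1"
    unfolding eventually_nhds_0_abs by blast
  define e where "e = min T e1"
  have e: "e > 0" "\<And>t. \<bar>t\<bar> < e \<Longrightarrow> \<bar>t\<bar> < T" "\<And>t. \<bar>t\<bar> < e \<Longrightarrow> \<bar>t\<bar> < e1" using T e1(1) by (auto simp: e_def)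
  define C where "C = \<bar>c 1 0\<bar> + \<bar>c 2 0\<bar> + \<bar>c 3 0\<bar> + \<bar>c 4 0\<bar> + 1"
  have yW: "y 0 t \<in> ?W" "y 1 t \<in> ?W" if t: "\<bar>t\<bar> < e" for t
  proof -
    have a: "y 4 t - (c 1 t *\<^sub>R y 0 t + c 2 t *\<^sub>R y 1 t + c 3 t *\<^sub>R y 2 t + c 4 t *\<^sub>R y 3 t) \<in> ?W" if t: "\<bar>t\<bar> < e" for t
    proof -
      note tT = e(2)[OF t]
      let ?\<mu> = "\<gamma> t"
      have "E 4 ?\<mu> = k0 ?\<mu> (E 4 ?\<mu>) *\<^sub>R E 0 ?\<mu> + k1 ?\<mu> (E 4 ?\<mu>) *\<^sub>R E (Suc 0) ?\<mu> + k2 ?\<mu> (E 4 ?\<mu>) *\<^sub>R E 2 ?\<mu> + k3 ?\<mu> (E 4 ?\<mu>) *\<^sub>R E 3 ?\<mu>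
         + kh ?\<mu> (E 4 ?\<mu>) *\<^sub>R h ?\<mu> + ke ?\<mu> (E 4 ?\<mu>) *\<^sub>R euler_field ?\<mu>"
        using decomposition[OF \<gamma>N[OF tT] _ E_W_numerator[OF \<gamma>N[OF tT]]] e1(2)[OF e(3)[OF t]] by blast
      then have "y 4 t = blinfun_apply (A t) (k0 ?\<mu> (E 4 ?\<mu>) *\<^sub>R E 0 ?\<mu> + k1 ?\<mu> (E 4 ?\<mu>) *\<^sub>R E (Suc 0) ?\<mu> + k2 ?\<mu> (E 4 ?\<mu>) *\<^sub>R E 2 ?\<mu> + k3 ?\<mu> (E 4 ?\<mu>) *\<^sub>R E 3 ?\<mu>
         + kh ?\<mu> (E 4 ?\<mu>) *\<^sub>R h ?\<mu> + ke ?\<mu> (E 4 ?\<mu>) *\<^sub>R euler_field ?\<mu>)"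
        unfolding y_def by simp
      then have "y 4 t - (c 1 t *\<^sub>R y 0 t + c 2 t *\<^sub>R y 1 t + c 3 t *\<^sub>R y 2 t + c 4 t *\<^sub>R y 3 t)
         = kh ?\<mu> (E 4 ?\<mu>) *\<^sub>R h \<xi> + ke ?\<mu> (E 4 ?\<mu>) *\<^sub>R (euler_field \<xi> - t *\<^sub>R h \<xi>)"
        by (simp add: c_def vec4_coords y_def blinfun.add_right blinfun.scaleR_right Ah[OF tT] Ae[OF tT] del: vec4_nth)
      also have "\<dots> \<in> ?W"
        by (intro subspace_add[OF W] subspace_diff[OF W] subspace_scale[OF W] hW eW)
      finally show ?thesis .
    qed
    have b: "\<bar>c 1 t\<bar> \<le> C \<and> \<bar>c 2 t\<bar> \<le> C \<and> \<bar>c 3 t\<bar> \<le> C \<and> \<bar>c 4 t\<bar> \<le> C" if "\<bar>t\<bar> < e" for t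
    proof -
      have "\<bar>c 1 0\<bar> + 1 \<le> C" "\<bar>c 2 0\<bar> + 1 \<le> C" "\<bar>c 3 0\<bar> + 1 \<le> C" "\<bar>c 4 0\<bar> + 1 \<le> C"
        by (simp_all add: C_def)
      with e1(2)[OF e(3)[OF that]] show ?thesis by (meson less_imp_le less_le_trans)
    qed
    have y0W: "y k 0 \<in> ?W" for k by (simp add: y0 E_W_numerator[OF \<xi>])
    show "y 0 t \<in> ?W" "y 1 t \<in> ?W"
      by (rule transported_in_W_numerator[of \<xi> e y "c 1" "c 2" "c 3" "c 4" C t, OF \<xi> e(1) y'[OF e(2)] y0W a b t], assumption+)+
  qed
  define v where "v k t = coords \<xi> (y k t)" for k t
  note lin = linear_coords[OF x]
  have v': "(v k has_vector_derivative v (Suc k) t) (at t)" if "\<bar>t\<bar> < T" for k t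
    unfolding v_def[abs_def]
    using bounded_linear.has_vector_derivative[OF linear_conv_bounded_linear[THEN iffD1, OF lin] y'[OF that]] .
  have tower: "tower v" unfolding tower_def using T v' by (intro exI[of _ T] conjI allI impI)
  have v0: "v k 0 = coords \<xi> (E k \<xi>)" for k by (simp add: v_def y0)
  have jc: "jacobi_curve \<Omega> D X1 X2 \<xi> t =
      {a *\<^sub>R y 0 t + b *\<^sub>R y 1 t + c *\<^sub>R h \<xi> + d *\<^sub>R (euler_field \<xi> - t *\<^sub>R h \<xi>) | a b c d. True}" if t: "\<bar>t\<bar> < e" for t
  proof -
    note tT = e(2)[OF t]
    have "jacobi_curve \<Omega> D X1 X2 \<xi> t = blinfun_apply (A t) ` jacobi_space \<Omega> D (\<gamma> t)"
      unfolding jacobi_curve_h fl[OF tT] fA[OF tT] ..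
    also have "jacobi_space \<Omega> D (\<gamma> t) = {a *\<^sub>R E 0 (\<gamma> t) + b *\<^sub>R E (Suc 0) (\<gamma> t) + c *\<^sub>R h (\<gamma> t) + d *\<^sub>R euler_field (\<gamma> t) | a b c d. True}"
      using e1(2)[OF e(3)[OF t]] by (intro jacobi_space_span[OF \<gamma>N[OF tT]]) blast
    also have "blinfun_apply (A t) ` \<dots> = {blinfun_apply (A t) (a *\<^sub>R E 0 (\<gamma> t) + b *\<^sub>R E (Suc 0) (\<gamma> t) + c *\<^sub>R h (\<gamma> t) + d *\<^sub>R euler_field (\<gamma> t)) | a b c d. True}"
      by blast
    finally show ?thesis
      by (simp add: blinfun.add_right blinfun.scaleR_right Ah[OF tT] Ae[OF tT] y_def)
  qed
  have sub: "jacobi_curve \<Omega> D X1 X2 \<xi> t \<subseteq> ?W" if t: "\<bar>t\<bar> < e" for t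
    unfolding jc[OF t] using yW[OF t]
    by (auto intro!: subspace_add[OF W] subspace_diff[OF W] subspace_scale[OF W] hW eW)
  have sp: "coords \<xi> ` jacobi_curve \<Omega> D X1 X2 \<xi> t = span {v 0 t, v 1 t}" if t: "\<bar>t\<bar> < e" for t
  proof -
    note k = coords_kernel[OF \<xi> quotient_coordinates_coords[OF \<xi> u5]]
    have c: "coords \<xi> (a *\<^sub>R y 0 t + b *\<^sub>R y 1 t + c *\<^sub>R h \<xi> + d *\<^sub>R (euler_field \<xi> - t *\<^sub>R h \<xi>)) = a *\<^sub>R v 0 t + b *\<^sub>R v 1 t" for a b c d
      by (simp add: linear_add[OF lin] linear_cmul[OF lin] linear_diff[OF lin] k v_def)
    have "coords \<xi> ` jacobi_curve \<Omega> D X1 X2 \<xi> t =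
        {coords \<xi> (a *\<^sub>R y 0 t + b *\<^sub>R y 1 t + c *\<^sub>R h \<xi> + d *\<^sub>R (euler_field \<xi> - t *\<^sub>R h \<xi>)) | a b c d. True}"
      unfolding jc[OF t] by blast
    also have "\<dots> = {a *\<^sub>R v 0 t + b *\<^sub>R v 1 t | a b. True}" unfolding c by simp
    also have "\<dots> = span {v 0 t, v 1 t}" by (rule set_eqI) (simp add: in_span_pair)
    finally show ?thesis .
  qed
  show ?thesis by (rule that[OF tower v0 e(1) sub sp])
qed

end

section \<open>The density on a fibre\<close>

context cartan_frame
begin

text \<open>In these coordinates the first four vectors are the standard basis, so the volume is 1.
  A value independent of the point is what allows inversion within polynomials in
  \<open>z\<close>.\<close>

lemma curve_det_coords:
  assumes "\<xi> \<in> N" "lift_function X5 \<xi> \<noteq> 0" "\<And>k. v k 0 = coords \<xi> (E k \<xi>)"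
  shows "curve_det v (0, 0) = 1 / 12" and "area (fst (v 0 0)) (fst (v 1 0)) = 1"
proof -
  have 1: "v 1 0 = coords \<xi> (E (Suc 0) \<xi>)" using assms(3)[of 1] by simp
  note c = coefficients_of_basis[OF assms(1,2)]
  show "curve_det v (0, 0) = 1 / 12"
    unfolding curve_det_origin vol_expand unfolding 1 assms(3)[of 0] assms(3)[of 2] assms(3)[of 3] vec4_coords c by simp
  have a: "area x y = vec4 (x, x') $ 1 * vec4 (y, y') $ 2 - vec4 (x, x') $ 2 * vec4 (y, y') $ 1" for x y x' y' :: "real^2"
    by (simp add: area_def)
  show "area (fst (v 0 0)) (fst (v 1 0)) = 1"
    unfolding a[of _ _ "snd (v 0 0)" "snd (v 1 0)"] prod.collapse unfolding 1 assms(3)[of 0] vec4_coords c by simp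
qed

text \<open>Existence comes from representing the curve in the coordinates \<open>coords\<close>.
  For uniqueness, any other admissible choice factors through them by a linear map \<open>M\<close>,
  and the right-hand side contains neither \<open>M\<close> nor the matrices.\<close>

lemma fundamental_density_eq:
  assumes \<xi>: "\<xi> \<in> N" and u5: "lift_function X5 \<xi> \<noteq> 0"
    and v: "tower v" and v0: "\<And>k. v k 0 = coords \<xi> (E k \<xi>)" and e: "e > 0"
    and sub: "\<And>t. \<bar>t\<bar> < e \<Longrightarrow> jacobi_curve \<Omega> D X1 X2 \<xi> t \<subseteq> W_numerator \<Omega> D \<xi>"
    and sp: "\<And>t. \<bar>t\<bar> < e \<Longrightarrow> coords \<xi> ` jacobi_curve \<Omega> D X1 X2 \<xi> t = span {v 0 t, v 1 t}"
    and G: "has_partials (curve_det v) G0 G1"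
    and H: "has_partials (\<lambda>x. G1 x * inverse (curve_det v x)) \<Phi> H1"
    and \<Phi>: "has_partials \<Phi> \<Phi>0 \<Phi>1" "has_partials \<Phi>0 \<Phi>00 \<Phi>01" "has_partials \<Phi>1 \<Phi>10 \<Phi>11"
  shows "fundamental_density \<Omega> D X1 X2 \<xi> = 1 / 2 * \<Phi>00 (0, 0) - 3 / 20 * (\<Phi> (0, 0))\<^sup>2
           - 3 / 20 * (\<Phi>00 (0, 0) + \<Phi>01 (0, 0) + (\<Phi>10 (0, 0) + \<Phi>11 (0, 0)))"
proof -
  have nz: "curve_det v (0, 0) \<noteq> 0" and ar: "area (fst (v 0 0)) (fst (v 1 0)) \<noteq> 0"
    using curve_det_coords[where v=v, OF \<xi> u5 v0] by simp_all
  have ev: "\<forall>\<^sub>F t in nhds 0. jacobi_curve \<Omega> D X1 X2 \<xi> t \<subseteq> W_numerator \<Omega> D \<xi> \<and>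
      coords \<xi> ` jacobi_curve \<Omega> D X1 X2 \<xi> t = span {v 0 t, v 1 t}"
    unfolding eventually_nhds_0_abs using e sub sp by (intro exI[of _ e]) simp
  show ?thesis
    unfolding fundamental_density_def
  proof (rule the_equality)
    obtain S where S: "represents S id v" using represents_exists[OF v ar] by blast
    have w: "\<forall>\<^sub>F \<tau> in nhds 0. has_weight S \<tau> 4"
      by (rule has_weight_represents[OF v nz G linear_id surj_id S])
    have "\<forall>\<^sub>F t in nhds 0. coords \<xi> ` jacobi_curve \<Omega> D X1 X2 \<xi> t = graph_of (S t)"
      using ev S[unfolded represents_def] by eventually_elim simp
    with w density_of_curve_represents[OF v nz linear_id surj_id S w G H \<Phi>] quotient_coordinates_coords[OF \<xi> u5]
    show "\<exists>(L :: (real^5) \<times> (real^5) \<Rightarrow> (real^2) \<times> (real^2)) S k. quotient_coordinates (W_numerator \<Omega> D \<xi>) (W_denominator X1 X2 \<xi>) L \<and>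
        (\<forall>\<^sub>F t in nhds 0. L ` jacobi_curve \<Omega> D X1 X2 \<xi> t = graph_of (S t)) \<and>
        (\<forall>\<^sub>F \<tau> in nhds 0. has_weight S \<tau> k) \<and>
        1 / 2 * \<Phi>00 (0, 0) - 3 / 20 * (\<Phi> (0, 0))\<^sup>2
           - 3 / 20 * (\<Phi>00 (0, 0) + \<Phi>01 (0, 0) + (\<Phi>10 (0, 0) + \<Phi>11 (0, 0))) = density_of_curve k S 0"
      by (intro exI[of _ "coords \<xi>"] exI[of _ S] exI[of _ 4] conjI) simp_all
  next
    fix a
    assume "\<exists>(L :: (real^5) \<times> (real^5) \<Rightarrow> (real^2) \<times> (real^2)) S k. quotient_coordinates (W_numerator \<Omega> D \<xi>) (W_denominator X1 X2 \<xi>) L \<and>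
        (\<forall>\<^sub>F t in nhds 0. L ` jacobi_curve \<Omega> D X1 X2 \<xi> t = graph_of (S t)) \<and>
        (\<forall>\<^sub>F \<tau> in nhds 0. has_weight S \<tau> k) \<and> a = density_of_curve k S 0"
    then obtain L :: "(real^5) \<times> (real^5) \<Rightarrow> (real^2) \<times> (real^2)" and S k
      where L: "quotient_coordinates (W_numerator \<Omega> D \<xi>) (W_denominator X1 X2 \<xi>) L"
        and S: "\<forall>\<^sub>F t in nhds 0. L ` jacobi_curve \<Omega> D X1 X2 \<xi> t = graph_of (S t)"
        and w: "\<forall>\<^sub>F \<tau> in nhds 0. has_weight S \<tau> k" and a: "a = density_of_curve k S 0"
      by (elim exE conjE)
    obtain M where M: "linear M" "surj M" "\<And>w. w \<in> W_numerator \<Omega> D \<xi> \<Longrightarrow> L w = M (coords \<xi> w)"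
      by (rule coordinate_change[OF \<xi> u5 L]) (rule that)
    have "represents S M v"
      unfolding represents_def using ev S
    proof eventually_elim
      case (elim t)
      have "graph_of (S t) = M ` coords \<xi> ` jacobi_curve \<Omega> D X1 X2 \<xi> t"
        unfolding elim(2)[symmetric] image_image by (rule image_cong[OF refl M(3)]) (use elim(1) in blast)
      then show ?case using elim(1) by simp
    qed
    from density_of_curve_represents[OF v nz M(1,2) this w G H \<Phi>]
    show "a = 1 / 2 * \<Phi>00 (0, 0) - 3 / 20 * (\<Phi> (0, 0))\<^sup>2
           - 3 / 20 * (\<Phi>00 (0, 0) + \<Phi>01 (0, 0) + (\<Phi>10 (0, 0) + \<Phi>11 (0, 0)))" unfolding a .
  qed
qed

text \<open>Both the vector and the basis are rescaled, \<open>E i\<close> by the power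
  \<open>i - 1\<close>, so a coordinate scales by the difference of the two indices. The powers for
  \<open>h\<close> and the Euler field differ, but these directions are divided out.\<close>

lemma coords_dilate:
  assumes \<eta>: "\<eta> \<in> N" and u5: "lift_function X5 \<eta> \<noteq> 0" and s: "s \<noteq> 0"
  shows "vec4 (coords (dilate s \<eta>) (E k (dilate s \<eta>))) $ j
           = s powi (int k - weight4 j) * vec4 (coords \<eta> (E k \<eta>)) $ j"
proof -
  let ?\<mu> = "dilate s \<eta>" and ?w = "E k \<eta>"
  have S: "\<eta> \<in> \<Omega> \<times> UNIV" using \<eta> by (simp add: N_iff mem_Times_iff)
  have \<mu>: "?\<mu> \<in> N" "lift_function X5 ?\<mu> \<noteq> 0"
    using \<eta> u5 s by (simp_all add: N_iff lift_dilate) (simp add: dilate_def)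
  have dE: "dilate s (E i \<eta>) = (s / s ^ i) *\<^sub>R E i ?\<mu>" for i
    using s by (simp add: E_dilate[OF s S])
  have dh: "dilate s (h \<eta>) = (1 / s) *\<^sub>R h ?\<mu>" using s by (simp add: h_dilate)
  have de: "dilate s (euler_field \<eta>) = 1 *\<^sub>R euler_field ?\<mu>" by (simp add: dilate_def euler_field_def)
  note l = linear_dilate[of s]
  have "?w = k0 \<eta> ?w *\<^sub>R E 0 \<eta> + k1 \<eta> ?w *\<^sub>R E (Suc 0) \<eta> + k2 \<eta> ?w *\<^sub>R E 2 \<eta> + k3 \<eta> ?w *\<^sub>R E 3 \<eta>
     + kh \<eta> ?w *\<^sub>R h \<eta> + ke \<eta> ?w *\<^sub>R euler_field \<eta>"
    by (rule decomposition[OF \<eta> u5 E_W_numerator[OF \<eta>]])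
  then have "E k ?\<mu> = (s ^ k / s) *\<^sub>R dilate s (k0 \<eta> ?w *\<^sub>R E 0 \<eta> + k1 \<eta> ?w *\<^sub>R E (Suc 0) \<eta> + k2 \<eta> ?w *\<^sub>R E 2 \<eta> + k3 \<eta> ?w *\<^sub>R E 3 \<eta>
     + kh \<eta> ?w *\<^sub>R h \<eta> + ke \<eta> ?w *\<^sub>R euler_field \<eta>)"
    using E_dilate[OF s S, of k] by simp
  also have "\<dots> = (s ^ k / s * (k0 \<eta> ?w * (s / s ^ 0))) *\<^sub>R E 0 ?\<mu> + (s ^ k / s * (k1 \<eta> ?w * (s / s ^ Suc 0))) *\<^sub>R E (Suc 0) ?\<mu>
     + (s ^ k / s * (k2 \<eta> ?w * (s / s ^ 2))) *\<^sub>R E 2 ?\<mu> + (s ^ k / s * (k3 \<eta> ?w * (s / s ^ 3))) *\<^sub>R E 3 ?\<mu>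
     + (s ^ k / s * (kh \<eta> ?w * (1 / s))) *\<^sub>R h ?\<mu> + (s ^ k / s * (ke \<eta> ?w * 1)) *\<^sub>R euler_field ?\<mu>"
    unfolding linear_add[OF l] linear_cmul[OF l] dE dh de scaleR_add_right scaleR_scaleR ..
  finally have "vec4 (coords ?\<mu> (E k ?\<mu>)) = vec4 (coords ?\<mu> \<dots>)" by (rule arg_cong)
  then have E: "vec4 (coords ?\<mu> (E k ?\<mu>)) = (\<chi> j. if j = 1 then s ^ k / s * (k0 \<eta> ?w * (s / s ^ 0))
      else if j = 2 then s ^ k / s * (k1 \<eta> ?w * (s / s ^ Suc 0)) else if j = 3 then s ^ k / s * (k2 \<eta> ?w * (s / s ^ 2))
      else s ^ k / s * (k3 \<eta> ?w * (s / s ^ 3)))"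
    unfolding coords_combination[OF \<mu>] .
  have p: "s ^ k / s * (a * (s / s ^ i)) = s powi (int k - int i) * a" for a i
    using s by (simp add: power_int_diff)
  show ?thesis
    unfolding E using exhaust_4[of j] p[of _ 0] p[of _ "Suc 0"] p[of _ 2] p[of _ 3]
    by (elim disjE) (simp_all add: weight4_def vec4_coords del: vec4_nth)
qed

text \<open>The points used have \<open>u_5 = s\<close> and \<open>u_4 = s z\<close>. Polynomial
  dependence on \<open>z\<close> comes from the line \<open>s = 1\<close>, and the power of
  \<open>s\<close> from dilation.\<close>

lemma density_graded:
  assumes q: "q \<in> \<Omega>"
  shows "graded 4 (\<lambda>(s, z). fundamental_density \<Omega> D X1 X2 (dilate s (q, coframe 5 q + z *\<^sub>R coframe 4 q)))"
proof -
  define \<eta> where "\<eta> z = (q, coframe 5 q + z *\<^sub>R coframe 4 q)" for z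
  define \<xi> where "\<xi> i = dilate (fst i) (\<eta> (snd i))" for i :: "real \<times> real"
  have \<eta>: "\<eta> z \<in> N" "lift_function X5 (\<eta> z) = 1" for z
    by (simp_all add: N_iff \<eta>_def q lift_function_def inner_add_left coframe_X[OF q])
  have \<xi>: "\<xi> i \<in> N" "lift_function X5 (\<xi> i) \<noteq> 0" if "fst i \<noteq> 0" for i
    using \<eta>[of "snd i"] that by (simp_all add: \<xi>_def N_iff lift_dilate) (simp add: dilate_def)
  \<comment> \<open>A curve is chosen for each parameter without reference to the others; at
    \<open>s = 0\<close> the condition is vacuous, so the choice is a total function.\<close>
  have "\<exists>v. fst i \<noteq> 0 \<longrightarrow> tower v \<and> (\<forall>k. v k 0 = coords (\<xi> i) (E k (\<xi> i))) \<and>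
      (\<exists>e>0. \<forall>t. \<bar>t\<bar> < e \<longrightarrow> jacobi_curve \<Omega> D X1 X2 (\<xi> i) t \<subseteq> W_numerator \<Omega> D (\<xi> i) \<and>
         coords (\<xi> i) ` jacobi_curve \<Omega> D X1 X2 (\<xi> i) t = span {v 0 t, v 1 t})" for i
  proof (cases "fst i = 0")
    case False
    obtain v e where "tower v" "\<And>k. v k 0 = coords (\<xi> i) (E k (\<xi> i))" "e > 0"
      "\<And>t. \<bar>t\<bar> < e \<Longrightarrow> jacobi_curve \<Omega> D X1 X2 (\<xi> i) t \<subseteq> W_numerator \<Omega> D (\<xi> i)"
      "\<And>t. \<bar>t\<bar> < e \<Longrightarrow> coords (\<xi> i) ` jacobi_curve \<Omega> D X1 X2 (\<xi> i) t = span {v 0 t, v 1 t}"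
      by (rule reduced_curve[OF \<xi>[OF False]]) (rule that)
    then show ?thesis by (intro exI[of _ v] impI conjI allI exI[of _ e])
  qed blast
  then have "\<exists>V. \<forall>i. fst i \<noteq> 0 \<longrightarrow> tower (V i) \<and> (\<forall>k. V i k 0 = coords (\<xi> i) (E k (\<xi> i))) \<and>
      (\<exists>e>0. \<forall>t. \<bar>t\<bar> < e \<longrightarrow> jacobi_curve \<Omega> D X1 X2 (\<xi> i) t \<subseteq> W_numerator \<Omega> D (\<xi> i) \<and>
         coords (\<xi> i) ` jacobi_curve \<Omega> D X1 X2 (\<xi> i) t = span {V i 0 t, V i 1 t})"
    by (intro choice allI)
  then obtain V where V: "\<And>i. fst i \<noteq> 0 \<Longrightarrow> tower (V i)" "\<And>i k. fst i \<noteq> 0 \<Longrightarrow> V i k 0 = coords (\<xi> i) (E k (\<xi> i))"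
    "\<And>i. fst i \<noteq> 0 \<Longrightarrow> \<exists>e>0. \<forall>t. \<bar>t\<bar> < e \<longrightarrow> jacobi_curve \<Omega> D X1 X2 (\<xi> i) t \<subseteq> W_numerator \<Omega> D (\<xi> i) \<and>
         coords (\<xi> i) ` jacobi_curve \<Omega> D X1 X2 (\<xi> i) t = span {V i 0 t, V i 1 t}"
    by (elim exE) blast
  have gr: "graded (int k - weight4 j) (\<lambda>i. vec4 (V i k 0) $ j)" for k j
  proof -
    have "\<forall>j. rational (\<lambda>\<xi>. vec4 (coords \<xi> (E k \<xi>)) $ j)"
      unfolding forall_4 vec4_coords using rational_coefficients[OF vpoly_E] by blast
    moreover have "(coframe 5 q + z *\<^sub>R coframe 4 q) \<bullet> X5 q = 1" for z
      by (simp add: inner_add_left coframe_X[OF q])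
    ultimately have "poly_fun (\<lambda>z. vec4 (coords (\<eta> z) (E k (\<eta> z))) $ j)"
      unfolding \<eta>_def using rational_poly_fun[OF _ q, of "\<lambda>\<xi>. vec4 (coords \<xi> (E k \<xi>)) $ j" "coframe 5 q" "coframe 4 q"] by blast
    then obtain P where "\<And>z. vec4 (coords (\<eta> z) (E k (\<eta> z))) $ j = poly P z" unfolding poly_fun_def by blast
    then have "vec4 (V (s, z) k 0) $ j = s powi (int k - weight4 j) * poly P z" if "s \<noteq> 0" for s z
      using coords_dilate[OF \<eta>(1), of z s k j] \<eta>(2) that by (simp add: V(2) \<xi>_def del: vec4_nth)
    then show ?thesis unfolding graded_def by blast
  qed
  let ?F = "\<lambda>i. curve_det (V i)"
  have F: "jet n 0 ?F" for n by (rule jet_curve_det[OF V(1) gr]) simp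
  have F0: "curve_det (V (s, z)) (0, 0) = 1 / 12" if "s \<noteq> 0" for s z
    using that by (intro curve_det_coords(1)[where v="V (s, z)", OF \<xi> V(2)]) simp_all
  \<comment> \<open>Of the four orders one is spent on \<open>G1\<close>, a second on
    \<open>\<Phi>\<close>, which is the function \<open>g\<close> of the density, and two on its
    second derivatives; so these have degrees 2 and 4.\<close>
  obtain G0 G1 where G: "\<And>s z. s \<noteq> 0 \<Longrightarrow> has_partials (curve_det (V (s, z))) (G0 (s, z)) (G1 (s, z))"
    and G1: "jet (Suc (Suc (Suc 0))) (0 + 1) G1"
    by (rule jet_SucE[OF F[of "Suc (Suc (Suc (Suc 0)))"]]) (rule that)
  have "jet (Suc (Suc (Suc 0))) (- 0) (\<lambda>i x. inverse (curve_det (V i) x))"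
  proof (rule jet_inverse[OF _ _ F])
    \<comment> \<open>The value at the origin is always 1/12, so its reciprocal is the constant
      polynomial 12.\<close>
    show "graded (- 0) (\<lambda>i. inverse (curve_det (V i) (0, 0)))"
      unfolding graded_def by (rule exI[of _ "[:12:]"]) (simp add: F0)
  qed (simp add: F0)
  note GF = jet_mult[OF G1 this]
  obtain \<Phi> H1 where H: "\<And>s z. s \<noteq> 0 \<Longrightarrow>
       has_partials (\<lambda>x. G1 (s, z) x * inverse (curve_det (V (s, z)) x)) (\<Phi> (s, z)) (H1 (s, z))"
    and \<Phi>: "jet (Suc (Suc 0)) (0 + 1 + - 0 + 1) \<Phi>"
    by (rule jet_SucE[OF GF]) (rule that)
  obtain \<Phi>0 \<Phi>1 where \<Phi>': "\<And>s z. s \<noteq> 0 \<Longrightarrow> has_partials (\<Phi> (s, z)) (\<Phi>0 (s, z)) (\<Phi>1 (s, z))"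
    and \<Phi>0: "jet (Suc 0) (0 + 1 + - 0 + 1 + 1) \<Phi>0" and \<Phi>1: "jet (Suc 0) (0 + 1 + - 0 + 1 + 1) \<Phi>1"
    by (rule jet_SucE[OF \<Phi>]) (rule that)
  obtain \<Phi>00 \<Phi>01 where \<Phi>0': "\<And>s z. s \<noteq> 0 \<Longrightarrow> has_partials (\<Phi>0 (s, z)) (\<Phi>00 (s, z)) (\<Phi>01 (s, z))"
    and \<Phi>00: "jet 0 (0 + 1 + - 0 + 1 + 1 + 1) \<Phi>00" and \<Phi>01: "jet 0 (0 + 1 + - 0 + 1 + 1 + 1) \<Phi>01"
    by (rule jet_SucE[OF \<Phi>0]) (rule that)
  obtain \<Phi>10 \<Phi>11 where \<Phi>1': "\<And>s z. s \<noteq> 0 \<Longrightarrow> has_partials (\<Phi>1 (s, z)) (\<Phi>10 (s, z)) (\<Phi>11 (s, z))"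
    and \<Phi>10: "jet 0 (0 + 1 + - 0 + 1 + 1 + 1) \<Phi>10" and \<Phi>11: "jet 0 (0 + 1 + - 0 + 1 + 1 + 1) \<Phi>11"
    by (rule jet_SucE[OF \<Phi>1]) (rule that)
  have g: "graded 2 (\<lambda>i. \<Phi> i (0, 0))" "graded 4 (\<lambda>i. \<Phi>00 i (0, 0))" "graded 4 (\<lambda>i. \<Phi>01 i (0, 0))"
      "graded 4 (\<lambda>i. \<Phi>10 i (0, 0))" "graded 4 (\<lambda>i. \<Phi>11 i (0, 0))"
    using jet_value[OF \<Phi>] jet_value[OF \<Phi>00] jet_value[OF \<Phi>01] jet_value[OF \<Phi>10] jet_value[OF \<Phi>11] by simp_all
  have "graded (2 + 2) (\<lambda>i. \<Phi> i (0, 0) * \<Phi> i (0, 0))" by (rule graded_mult[OF g(1) g(1)])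
  then have "graded 4 (\<lambda>i. (\<Phi> i (0, 0))\<^sup>2)" by (simp add: power2_eq_square)
  then have "graded 4 (\<lambda>i. 1 / 2 * \<Phi>00 i (0, 0) - 3 / 20 * (\<Phi> i (0, 0))\<^sup>2
           - 3 / 20 * (\<Phi>00 i (0, 0) + \<Phi>01 i (0, 0) + (\<Phi>10 i (0, 0) + \<Phi>11 i (0, 0))))"
    by (intro graded_diff graded_add graded_cmult g)
  then obtain P where P: "\<And>s z. s \<noteq> 0 \<Longrightarrow> 1 / 2 * \<Phi>00 (s, z) (0, 0) - 3 / 20 * (\<Phi> (s, z) (0, 0))\<^sup>2
           - 3 / 20 * (\<Phi>00 (s, z) (0, 0) + \<Phi>01 (s, z) (0, 0) + (\<Phi>10 (s, z) (0, 0) + \<Phi>11 (s, z) (0, 0))) = s powi 4 * poly P z"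
    unfolding graded_def by blast
  have "fundamental_density \<Omega> D X1 X2 (\<xi> (s, z)) = s powi 4 * poly P z" if s: "s \<noteq> 0" for s z
  proof -
    have f: "fst (s, z) \<noteq> 0" using s by simp
    obtain e where e: "e > 0" "\<And>t. \<bar>t\<bar> < e \<Longrightarrow> jacobi_curve \<Omega> D X1 X2 (\<xi> (s, z)) t \<subseteq> W_numerator \<Omega> D (\<xi> (s, z))"
       "\<And>t. \<bar>t\<bar> < e \<Longrightarrow> coords (\<xi> (s, z)) ` jacobi_curve \<Omega> D X1 X2 (\<xi> (s, z)) t = span {V (s, z) 0 t, V (s, z) 1 t}"
      using V(3)[OF f] by blast
    show ?thesis
      using fundamental_density_eq[where v="V (s, z)", OF \<xi>[OF f] V(1)[OF f] V(2)[OF f] e G[OF s] H[OF s] \<Phi>'[OF s] \<Phi>0'[OF s] \<Phi>1'[OF s]]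
      unfolding P[OF s] .
  qed
  then show ?thesis unfolding graded_def by (intro exI[of _ P]) (simp add: \<xi>_def \<eta>_def)
qed

text \<open>The preceding result read with \<open>s = u_5\<close> and
  \<open>z = u_4 / u_5\<close>.\<close>

lemma density_half:
  assumes q: "q \<in> \<Omega>"
  obtains P where "\<And>p. p \<bullet> X1 q = 0 \<Longrightarrow> p \<bullet> X2 q = 0 \<Longrightarrow> p \<bullet> X3 q = 0 \<Longrightarrow> p \<bullet> X5 q \<noteq> 0 \<Longrightarrow>
    fundamental_density \<Omega> D X1 X2 (q, p) = (p \<bullet> X5 q) ^ 4 * poly P ((p \<bullet> X4 q) / (p \<bullet> X5 q))"
proof -
  obtain P where P: "\<And>s z. s \<noteq> 0 \<Longrightarrow>
      fundamental_density \<Omega> D X1 X2 (dilate s (q, coframe 5 q + z *\<^sub>R coframe 4 q)) = s powi 4 * poly P z"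
    using density_graded[OF q] unfolding graded_def by auto
  show ?thesis
  proof (rule that)
    fix p assume p: "p \<bullet> X1 q = 0" "p \<bullet> X2 q = 0" "p \<bullet> X3 q = 0" and nz: "p \<bullet> X5 q \<noteq> 0"
    have "(q, p) \<in> N" using p q by (simp add: N_iff lift_function_def)
    from covector_in_N[OF this] have "p = (p \<bullet> X4 q) *\<^sub>R coframe 4 q + (p \<bullet> X5 q) *\<^sub>R coframe 5 q"
      by (simp add: lift_function_def)
    also have "\<dots> = (p \<bullet> X5 q) *\<^sub>R (coframe 5 q + ((p \<bullet> X4 q) / (p \<bullet> X5 q)) *\<^sub>R coframe 4 q)"
      using nz by (simp add: scaleR_add_right)
    finally have "(q, p) = dilate (p \<bullet> X5 q) (q, coframe 5 q + ((p \<bullet> X4 q) / (p \<bullet> X5 q)) *\<^sub>R coframe 4 q)"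
      by (simp add: dilate_def)
    with P[OF nz, of "(p \<bullet> X4 q) / (p \<bullet> X5 q)"]
    show "fundamental_density \<Omega> D X1 X2 (q, p) = (p \<bullet> X5 q) ^ 4 * poly P ((p \<bullet> X4 q) / (p \<bullet> X5 q))"
      by (simp only: power_int_numeral)
  qed
qed

end

section \<open>Quartic forms on the plane\<close>

text \<open>Comparison on \<open>b = 1\<close> gives \<open>P a = a ^ 4 Q (1 / a)\<close> for
  \<open>a \<noteq> 0\<close>. The right-hand side grows at most like \<open>a ^ 4\<close>, which is
  made exact by comparing coefficients.\<close>

lemma quartic_of_halves:
  fixes f :: "real \<Rightarrow> real \<Rightarrow> real"
  assumes P: "\<And>a b. b \<noteq> 0 \<Longrightarrow> f a b = b ^ 4 * poly P (a / b)"
    and Q: "\<And>a b. a \<noteq> 0 \<Longrightarrow> f a b = a ^ 4 * poly Q (b / a)"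
  obtains c where "\<And>a b. a \<noteq> 0 \<or> b \<noteq> 0 \<Longrightarrow> f a b = (\<Sum>i\<le>4. c i * a ^ i * b ^ (4 - i))"
proof -
  let ?n = "degree Q"
  \<comment> \<open>Multiplication by \<open>a\<close> to the degree of \<open>Q\<close> clears the
    negative powers and turns \<open>Q (1 / a)\<close> into the reflected polynomial.\<close>
  have "poly (monom 1 ?n * P) a = poly (monom 1 4 * reflect_poly Q) a" if "a \<in> - {0}" for a
  proof -
    have "poly P a = a ^ 4 * poly Q (inverse a)"
      using P[of 1 a] Q[of a 1] that by (simp add: inverse_eq_divide)
    then show ?thesis using that by (simp add: poly_monom poly_reflect_poly_nz)
  qed
  then have "- {0} \<subseteq> {a. poly (monom 1 ?n * P - monom 1 4 * reflect_poly Q) a = 0}" by auto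
  moreover have "infinite (- {0::real})" by (simp add: infinite_UNIV_char_0)
  ultimately have eq: "monom 1 ?n * P = monom 1 4 * reflect_poly Q"
    using poly_roots_finite finite_subset by (metis eq_iff_diff_eq_0)
  have c: "coeff P i = (if ?n + i < 4 then 0 else coeff (reflect_poly Q) (?n + i - 4))" for i
    using arg_cong[OF eq, of "\<lambda>p. coeff p (?n + i)"] by (simp add: coeff_monom_mult)
  have z: "coeff P i = 0" if "i > 4" for i
    unfolding c using that degree_reflect_poly_le[of Q] by (auto intro!: coeff_eq_0)
  have P4: "degree P \<le> 4" by (rule degree_le) (use z in blast)
  \<comment> \<open>Serves the line \<open>b = 0\<close>, where only the second expression speaks:
    its constant term is the coefficient of \<open>P\<close> at degree 4.\<close>
  have Q0: "coeff P 4 = coeff Q 0" unfolding c by (simp add: coeff_reflect_poly)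
  show ?thesis
  proof (rule that)
    fix a b :: real assume ab: "a \<noteq> 0 \<or> b \<noteq> 0"
    show "f a b = (\<Sum>i\<le>4. coeff P i * a ^ i * b ^ (4 - i))"
    proof (cases "b = 0")
      case True
      then show ?thesis using Q[of a b] ab Q0 by (simp add: poly_0_coeff_0 numeral_eq_Suc)
    next
      case False
      have "f a b = (\<Sum>i\<le>4. coeff P i * (a / b) ^ i * b ^ 4)"
        unfolding P[OF False] by (subst poly_as_sum_of_monoms'[OF P4, symmetric])
          (simp add: poly_sum poly_monom sum_distrib_left mult_ac)
      also have "\<dots> = (\<Sum>i\<le>4. coeff P i * a ^ i * b ^ (4 - i))"
      proof (rule sum.cong[OF refl])
        fix i :: nat assume "i \<in> {..4}"
        then have "b ^ 4 = b ^ i * b ^ (4 - i)" by (simp flip: power_add)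
        then show "coeff P i * (a / b) ^ i * b ^ 4 = coeff P i * a ^ i * b ^ (4 - i)"
          using False by (simp add: power_divide)
      qed
      finally show ?thesis .
    qed
  qed
qed

lemma homogeneous_polynomial_on_plane:
  fixes b b' :: "'a::euclidean_space"
  assumes ind: "independent {b, b'}" and ne: "b \<noteq> b'" and F: "F = span {b, b'}"
    and f: "\<And>x y. f (x *\<^sub>R b + y *\<^sub>R b') = (\<Sum>i\<le>d. c i * x ^ i * y ^ (d - i))"
  shows "homogeneous_polynomial_on F d f"
  unfolding homogeneous_polynomial_on_def
proof (intro exI[of _ "{b, b'}"] exI[of _ "\<lambda>\<alpha>. c (\<alpha> b)"] conjI ballI)
  fix p assume "p \<in> F"
  then obtain x y where p: "p = x *\<^sub>R b + y *\<^sub>R b'" unfolding F in_span_pair by blast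
  have s: "b \<in> span {b, b'}" "b' \<in> span {b, b'}" by (auto intro: span_base)
  have r: "representation {b, b'} p b = x" "representation {b, b'} p b' = y"
    unfolding p using ne by (simp_all add: representation_add[OF ind] representation_scale[OF ind]
        representation_basis[OF ind] span_scale s)
  let ?A = "{\<alpha> \<in> {b, b'} \<rightarrow>\<^sub>E {..d}. sum \<alpha> {b, b'} = d}"
  \<comment> \<open>Inverse to reading off the exponent of \<open>b\<close>; \<open>restrict\<close>
    appears because the multi-indices are extensional functions on the basis.\<close>
  let ?g = "\<lambda>i. restrict (\<lambda>w. if w = b then i else d - i) {b, b'}"
  have "(\<Sum>\<alpha>\<in>?A. c (\<alpha> b) * (\<Prod>w\<in>{b, b'}. representation {b, b'} p w ^ \<alpha> w)) = (\<Sum>i\<le>d. c i * x ^ i * y ^ (d - i))"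
  proof (rule sum.reindex_bij_witness[where i = ?g and j = "\<lambda>\<alpha>. \<alpha> b"])
    fix \<alpha> assume \<alpha>: "\<alpha> \<in> ?A"
    then have e: "\<alpha> b + \<alpha> b' = d" using ne by simp
    then have e': "\<alpha> b' = d - \<alpha> b" by simp
    show "?g (\<alpha> b) = \<alpha>"
    proof
      fix w show "?g (\<alpha> b) w = \<alpha> w"
        using \<alpha> e' ne by (cases "w \<in> {b, b'}") (auto simp: PiE_def extensional_def)
    qed
    show "\<alpha> b \<in> {..d}" using e by simp
    show "c (\<alpha> b) * x ^ \<alpha> b * y ^ (d - \<alpha> b) = c (\<alpha> b) * (\<Prod>w\<in>{b, b'}. representation {b, b'} p w ^ \<alpha> w)"
      using ne e' by (simp add: r)
  next
    fix i assume i: "i \<in> {..d}"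
    show "?g i b = i" by simp
    show "?g i \<in> ?A" using i ne by (auto simp: PiE_def extensional_def)
  qed
  then show "f p = (\<Sum>\<alpha> | \<alpha> \<in> {b, b'} \<rightarrow>\<^sub>E {..d} \<and> sum \<alpha> {b, b'} = d.
       c (\<alpha> b) * (\<Prod>w\<in>{b, b'}. representation {b, b'} p w ^ \<alpha> w))"
    unfolding p f by simp
qed (use ind F in simp_all)

section \<open>Exchanging the two fields\<close>

context cartan_frame
begin

lemma cartan_frame_swap: "cartan_frame \<Omega> X2 X1 D"
  by unfold_locales (simp_all add: open_\<Omega> smooth_X1 smooth_X2 D_eq growth insert_commute)

lemma swapped_brackets:
  assumes x: "x \<in> \<Omega>"
  shows "lie_bracket X2 X1 x = - X3 x"
    and "lie_bracket X2 (lie_bracket X2 X1) x = - X5 x" "lie_bracket X1 (lie_bracket X2 X1) x = - X4 x"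
proof -
  have e: "lie_bracket X2 X1 = (\<lambda>x. - X3 x)" unfolding X3_def by (rule ext) (rule lie_bracket_swap)
  then show "lie_bracket X2 X1 x = - X3 x" by simp
  have d: "(X3 has_derivative frechet_derivative X3 (at x)) (at x)"
    by (rule smooth_on_has_derivative[OF smooth_X3 x])
  have f: "frechet_derivative (\<lambda>x. - X3 x) (at x) v = - frechet_derivative X3 (at x) v" for v
    using frechet_derivative_at[OF has_derivative_minus[OF d]] by metis
  have l: "linear (frechet_derivative X (at x))" if "smooth_on \<Omega> X" for X
    using has_derivative_linear[OF smooth_on_has_derivative[OF that x]] .
  have "lie_bracket Y (\<lambda>x. - X3 x) x = - lie_bracket Y X3 x" if "smooth_on \<Omega> Y" for Y
    by (simp add: lie_bracket_def f linear_neg[OF l[OF that]])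
  from this[OF smooth_X1] this[OF smooth_X2]
  show "lie_bracket X2 (lie_bracket X2 X1) x = - X5 x" "lie_bracket X1 (lie_bracket X2 X1) x = - X4 x"
    by (simp_all add: e X4_def X5_def)
qed

text \<open>The exchange sends the pair \<open>u_4, u_5\<close> to \<open>- u_5, - u_4\<close>, and
  the two terms of \<open>h\<close> change places, their signs included.\<close>

lemma h_field_swap:
  assumes "fst \<xi> \<in> \<Omega>"
  shows "h_field X2 X1 \<xi> = h_field X1 X2 \<xi>"
  using swapped_brackets[OF assms]
  by (simp add: h_field_def Let_def lift_function_def X3_def[symmetric] X4_def[symmetric] X5_def[symmetric])

lemma fundamental_density_swap:
  assumes "q \<in> \<Omega>"
  shows "fundamental_density \<Omega> D X2 X1 (q, p) = fundamental_density \<Omega> D X1 X2 (q, p)"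
proof -
  have "flow (\<Omega> \<times> UNIV) (h_field X2 X1) = flow (\<Omega> \<times> UNIV) (h_field X1 X2)"
    by (rule flow_cong) (auto simp: h_field_swap)
  then have "jacobi_curve \<Omega> D X2 X1 (q, p) = jacobi_curve \<Omega> D X1 X2 (q, p)"
    by (simp add: jacobi_curve_def[abs_def])
  moreover have "W_denominator X2 X1 (q, p) = W_denominator X1 X2 (q, p)"
    using assms by (simp add: W_denominator_def h_field_swap)
  ultimately show ?thesis unfolding fundamental_density_def by simp
qed

lemma annihilator_D2_at:
  assumes q: "q \<in> \<Omega>"
  shows "annihilator_at (dist_power D 2) q = span {coframe 4 q, coframe 5 q}"
proof (intro equalityI subsetI)
  fix p assume "p \<in> annihilator_at (dist_power D 2) q"
  then have "(q, p) \<in> N"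
    using q by (simp add: annihilator_at_def dist_power_2 annihilator_span N_iff lift_function_def)
  from covector_in_N[OF this] show "p \<in> span {coframe 4 q, coframe 5 q}"
    unfolding in_span_pair by auto
next
  fix p assume "p \<in> span {coframe 4 q, coframe 5 q}"
  then show "p \<in> annihilator_at (dist_power D 2) q"
    unfolding in_span_pair using q
    by (auto simp: annihilator_at_def dist_power_2 annihilator_span inner_add_left coframe_X)
qed

lemma independent_coframe:
  assumes q: "q \<in> \<Omega>"
  shows "independent {coframe 4 q, coframe 5 q}" "coframe 4 q \<noteq> coframe 5 q"
proof -
  show ne: "coframe 4 q \<noteq> coframe 5 q"
    using coframe_X(4)[OF q, of 4] coframe_X(4)[OF q, of 5] by auto
  have "coframe 4 q \<notin> span {coframe 5 q}"
  proof
    assume "coframe 4 q \<in> span {coframe 5 q}"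
    then obtain k where "coframe 4 q = k *\<^sub>R coframe 5 q" unfolding span_singleton by blast
    then have "coframe 4 q \<bullet> X4 q = k * (coframe 5 q \<bullet> X4 q)" by simp
    then show False by (simp add: coframe_X[OF q])
  qed
  moreover have "coframe 5 q \<noteq> 0" using coframe_X(5)[OF q, of 5] by auto
  ultimately show "independent {coframe 4 q, coframe 5 q}"
    by (simp add: independent_insert ne)
qed

text \<open>The claim is for nonzero covectors, the Jacobi curve being defined off the zero section;
  the quartic itself extends to the whole fibre.\<close>

theorem fundamental_density_quartic:
  assumes q: "q \<in> \<Omega>"
  shows "\<exists>P. homogeneous_polynomial_on (annihilator_at (dist_power D 2) q) 4 P \<and>
    (\<forall>p \<in> annihilator_at (dist_power D 2) q - {0}. fundamental_density \<Omega> D X1 X2 (q, p) = P p)"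
proof -
  interpret sw: cartan_frame \<Omega> X2 X1 D by (rule cartan_frame_swap)
  have sw: "sw.X3 q = - X3 q" "sw.X4 q = - X5 q" "sw.X5 q = - X4 q"
    using swapped_brackets[OF q] by (simp_all add: sw.X3_def sw.X4_def sw.X5_def)
  define f where "f a b = fundamental_density \<Omega> D X1 X2 (q, a *\<^sub>R coframe 4 q + b *\<^sub>R coframe 5 q)" for a b
  note c = coframe_X[OF q] inner_add_left
  obtain P where P: "\<And>p. p \<bullet> X1 q = 0 \<Longrightarrow> p \<bullet> X2 q = 0 \<Longrightarrow> p \<bullet> X3 q = 0 \<Longrightarrow> p \<bullet> X5 q \<noteq> 0 \<Longrightarrow>
    fundamental_density \<Omega> D X1 X2 (q, p) = (p \<bullet> X5 q) ^ 4 * poly P ((p \<bullet> X4 q) / (p \<bullet> X5 q))"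
    by (rule density_half[OF q]) (rule that)
  obtain Q where Q: "\<And>p. p \<bullet> X2 q = 0 \<Longrightarrow> p \<bullet> X1 q = 0 \<Longrightarrow> p \<bullet> sw.X3 q = 0 \<Longrightarrow> p \<bullet> sw.X5 q \<noteq> 0 \<Longrightarrow>
    fundamental_density \<Omega> D X2 X1 (q, p) = (p \<bullet> sw.X5 q) ^ 4 * poly Q ((p \<bullet> sw.X4 q) / (p \<bullet> sw.X5 q))"
    by (rule sw.density_half[OF q]) (rule that)
  have 1: "f a b = b ^ 4 * poly P (a / b)" if "b \<noteq> 0" for a b
    using P[of "a *\<^sub>R coframe 4 q + b *\<^sub>R coframe 5 q"] that by (simp add: f_def c)
  \<comment> \<open>In the exchanged frame \<open>u_5\<close> is \<open>- a\<close> and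
    \<open>u_4\<close> is \<open>- b\<close>: the even power absorbs one sign and the quotient
    cancels both.\<close>
  have 2: "f a b = a ^ 4 * poly Q (b / a)" if "a \<noteq> 0" for a b
    using Q[of "a *\<^sub>R coframe 4 q + b *\<^sub>R coframe 5 q"] that
    unfolding fundamental_density_swap[OF q] by (simp add: f_def c sw)
  obtain k where k: "\<And>a b. a \<noteq> 0 \<or> b \<noteq> 0 \<Longrightarrow> f a b = (\<Sum>i\<le>4. k i * a ^ i * b ^ (4 - i))"
    by (rule quartic_of_halves[of f P Q, OF 1 2]) (assumption+, rule that)
  define R where "R p = (\<Sum>i\<le>4. k i * (p \<bullet> X4 q) ^ i * (p \<bullet> X5 q) ^ (4 - i))" for p
  show ?thesis
    unfolding annihilator_D2_at[OF q]
  proof (intro exI[of _ R] conjI ballI)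
    show "homogeneous_polynomial_on (span {coframe 4 q, coframe 5 q}) 4 R"
      by (rule homogeneous_polynomial_on_plane[OF independent_coframe[OF q] refl]) (simp add: R_def c)
  next
    fix p assume p: "p \<in> span {coframe 4 q, coframe 5 q} - {0}"
    then obtain a b where ab: "p = a *\<^sub>R coframe 4 q + b *\<^sub>R coframe 5 q" by (auto simp: in_span_pair)
    with p have "a \<noteq> 0 \<or> b \<noteq> 0" by auto
    from k[OF this] show "fundamental_density \<Omega> D X1 X2 (q, p) = R p"
      unfolding ab by (simp add: f_def R_def c)
  qed
qed

end

theorem theorem3:
  fixes T :: "'m topology"
    and \<A> :: "('m, real^5) chart set"
    and D :: "('m, real^5) chart \<Rightarrow> real^5 \<Rightarrow> (real^5) set"
    and X1 X2 :: "('m, real^5) chart \<Rightarrow> real^5 \<Rightarrow> real^5"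
    and U :: "'m set" and q :: 'm and c :: "('m, real^5) chart"
  assumes "smooth_manifold T \<A>"
    and "distribution \<A> 2 D"
    and "\<And>c' y. c' \<in> \<A> \<Longrightarrow> y \<in> snd c' ` fst c' \<Longrightarrow> has_small_growth_vector (D c') y [2, 3, 5]"
    and "local_basis2 T \<A> D U X1 X2"
    and "q \<in> U"
    and "c \<in> \<A>" and "q \<in> fst c"
  shows "\<exists>P. homogeneous_polynomial_on (annihilator_at (dist_power (D c) 2) (snd c q)) 4 P \<and>
             (\<forall>p \<in> annihilator_at (dist_power (D c) 2) (snd c q) - {0}.
                fundamental_density (snd c ` (fst c \<inter> U)) (D c) (X1 c) (X2 c) (snd c q, p) = P p)"
proof -
  let ?\<Omega> = "snd c ` (fst c \<inter> U)"
  have vf: "vector_field_on T \<A> U X1" "vector_field_on T \<A> U X2"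
    and span: "\<And>y. y \<in> ?\<Omega> \<Longrightarrow> D c y = span {X1 c y, X2 c y}"
    using assms(4,6) unfolding local_basis2_def by blast+
  \<comment> \<open>The coordinate map is a homeomorphism onto an open set, so the image of the part
    of its domain inside \<open>U\<close> is open, as the locale requires.\<close>
  have "is_chart T c" using assms(1,6) unfolding smooth_manifold_def by blast
  then have c: "openin T (fst c)" "open (snd c ` fst c)"
    "homeomorphic_map (subtopology T (fst c)) (top_of_set (snd c ` fst c)) (snd c)"
    unfolding is_chart_def by blast+
  have "openin T U" using vf(1) unfolding vector_field_on_def by blast
  then have "openin (subtopology T (fst c)) (fst c \<inter> U)"
    by (metis inf_commute openin_subtopology_Int)
  then have "openin (top_of_set (snd c ` fst c)) ?\<Omega>"
    using homeomorphic_imp_open_map[OF c(3)] unfolding open_map_def by blast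
  then have "open ?\<Omega>" using c(2) openin_open_trans by blast
  moreover have "smooth_on ?\<Omega> (X1 c)" "smooth_on ?\<Omega> (X2 c)"
    using vf assms(6) unfolding vector_field_on_def by blast+
  ultimately interpret cartan_frame ?\<Omega> "X1 c" "X2 c" "D c"
    using span assms(3)[OF assms(6)] by unfold_locales auto
  show ?thesis by (rule fundamental_density_quartic) (use assms(5,7) in blast)
qed

end
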